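(* Let $k$ be an algebraically closed field of characteristic zero and let $\mathfrak{g}$ be a nonabelian, unimodular, coregular finite dimensional Lie algebra over $k$ such that $\mathrm{trdeg}_k Y(\mathfrak{g})=i(\mathfrak{g})$. If $\mathfrak{g}$ admits a commutative polarization $\mathfrak{h}$, then, for any $\xi\in\mathfrak{g}^*_{\mathrm{reg}}$, the Mishchenko-Fomenko subalgebra $Y_\xi(\mathfrak{g})$ is not a maximal Poisson commutative subalgebra of $S(\mathfrak{g})$. If in addition $\mathfrak{g}$ is algebraic, then $\mathrm{codim}\,\mathfrak{g}^*_{\mathrm{sing}}\le 2$.
   Context: For $\xi\in\mathfrak{g}^*$ let $\mathfrak{g}(\xi)=\{x\in\mathfrak{g}\mid \xi([x,y])=0\ \forall y\in\mathfrak{g}\}$. The index is $i(\mathfrak{g})=\min_{\xi}\dim\mathfrak{g}(\xi)$, and $c(\mathfrak{g})=(\dim\mathfrak{g}+i(\mathfrak{g}))/2$. $\mathfrak{g}^*_{\mathrm{reg}}$ is the set of $\xi\in\mathfrak{g}^*$ with $\dim\mathfrak{g}(\xi)=i(\mathfrak{g})$, and $\mathfrak{g}^*_{\mathrm{sing}}=\mathfrak{g}^*\setminus\mathfrak{g}^*_{\mathrm{reg}}$. $S(\mathfrak{g})=k[x_1,\dots,x_n]$ (with $x_1,\dots,x_n$ a basis of $\mathfrak{g}$) carries the Poisson bracket $\{f,g\}=\sum_{i,j}[x_i,x_j]\frac{\partial f}{\partial x_i}\frac{\partial g}{\partial x_j}$; its Poisson center is $Y(\mathfrak{g})=S(\mathfrak{g})^{\mathfrak{g}}$.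 A subalgebra is Poisson commutative if the bracket vanishes on it identically. $\mathfrak{g}$ is coregular if $Y(\mathfrak{g})$ is a polynomial algebra over $k$; unimodular if $\mathrm{tr}(\mathrm{ad}\,x)=0$ for all $x\in\mathfrak{g}$; algebraic if it is the Lie algebra of an affine algebraic group over $k$. A commutative polarization (CP) of $\mathfrak{g}$ is a commutative Lie subalgebra $\mathfrak{h}$ with $\dim\mathfrak{h}=c(\mathfrak{g})$. Mishchenko-Fomenko subalgebra: for $f\in S(\mathfrak{g})$ of degree $d$ and $\xi\in\mathfrak{g}^*$ with $a_i=\xi(x_i)$, expand $f(x_1+a_1t,\dots,x_n+a_nt)=\sum_{j=0}^d f_\xi^j(x_1,\dots,x_n)t^j$; the polynomials $f_\xi^j$, $j=0,\dots,d-1$, are the $\xi$-shifts of $f$. $Y_\xi(\mathfrak{g})$ is the subalgebra of $S(\mathfrak{g})$ generated by the $\xi$-shifts of all $f\in Y(\mathfrak{g})$; it is Poisson commutative. *)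

theory Defs
  imports
    "HOL-Library.Poly_Mapping"
    "HOL-Library.Extended_Nat"
    "HOL-Computational_Algebra.Polynomial"
    "HOL-Algebra.Group"
begin

section \<open>Multivariate polynomials\<close>

text \<open>A monomial is a finitely supported exponent function. For a set \<open>B\<close> of variables,
  \<open>polys B\<close> is the polynomial ring \<open>k[B]\<close>.\<close>

type_synonym ('x, 'k) mpoly = "('x \<Rightarrow>\<^sub>0 nat) \<Rightarrow>\<^sub>0 'k"

definition Const :: "'k::comm_ring_1 \<Rightarrow> ('x, 'k) mpoly" where
  "Const c = Poly_Mapping.single 0 c"

definition Var :: "'x \<Rightarrow> ('x, 'k::comm_ring_1) mpoly" where
  "Var x = Poly_Mapping.single (Poly_Mapping.single x 1) 1"

definition polys :: "'x set \<Rightarrow> ('x, 'k::comm_ring_1) mpoly set" where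
  "polys B = {p. \<forall>m \<in> Poly_Mapping.keys p. Poly_Mapping.keys m \<subseteq> B}"

definition total_degree :: "('x, 'k::comm_ring_1) mpoly \<Rightarrow> nat" where
  "total_degree p =
     Max (insert 0 ((\<lambda>m. \<Sum>x \<in> Poly_Mapping.keys m. Poly_Mapping.lookup m x) ` Poly_Mapping.keys p))"

definition partial_deriv :: "'x \<Rightarrow> ('x, 'k::comm_ring_1) mpoly \<Rightarrow> ('x, 'k) mpoly" where
  "partial_deriv x p = (\<Sum>m \<in> Poly_Mapping.keys p.
     Poly_Mapping.single (m - Poly_Mapping.single x 1)
       (of_nat (Poly_Mapping.lookup m x) * Poly_Mapping.lookup p m))"

text \<open>Substitution of \<open>a x\<close> for the variable \<open>x\<close> in an algebra whose structure map is \<open>h\<close>.\<close>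

definition eval_in :: "('k \<Rightarrow> 'r) \<Rightarrow> ('x \<Rightarrow> 'r) \<Rightarrow> ('x, 'k::comm_ring_1) mpoly \<Rightarrow> 'r::comm_ring_1" where
  "eval_in h a p = (\<Sum>m \<in> Poly_Mapping.keys p. h (Poly_Mapping.lookup p m) *
     (\<Prod>x \<in> Poly_Mapping.keys m. a x ^ Poly_Mapping.lookup m x))"

abbreviation eval_at :: "('x \<Rightarrow> 'k) \<Rightarrow> ('x, 'k::comm_ring_1) mpoly \<Rightarrow> 'k" where
  "eval_at \<equiv> eval_in (\<lambda>c. c)"

definition subalgebra :: "('x, 'k::comm_ring_1) mpoly set \<Rightarrow> bool" where
  "subalgebra A \<longleftrightarrow> (\<forall>c. Const c \<in> A) \<and> (\<forall>p \<in> A. \<forall>q \<in> A. p + q \<in> A \<and> p * q \<in> A)"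

text \<open>Here the polynomials in \<open>F\<close> themselves serve as names of the variables of \<open>P\<close>.\<close>

definition alg_independent :: "('x, 'k::comm_ring_1) mpoly set \<Rightarrow> bool" where
  "alg_independent F \<longleftrightarrow> (\<forall>P \<in> polys F. eval_in Const (\<lambda>f. f) P = 0 \<longrightarrow> P = 0)"

definition polynomial_algebra :: "('x, 'k::comm_ring_1) mpoly set \<Rightarrow> bool" where
  "polynomial_algebra A \<longleftrightarrow> (\<exists>F. alg_independent F \<and> subalgebra hull F = A)"

definition trdeg :: "('x, 'k::comm_ring_1) mpoly set \<Rightarrow> enat" where
  "trdeg A = (SUP F \<in> {F. F \<subseteq> A \<and> finite F \<and> alg_independent F}. enat (card F))"


section \<open>Zariski topology\<close>

text \<open>\<open>R\<close> is the ring of polynomials used as equations. With \<open>Z\<close> an arbitrary set of points,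
  the sets \<open>K\<close> below are the closed sets of the subspace topology on \<open>Z\<close>.\<close>

definition zariski_closed_in ::
  "('x, 'k::comm_ring_1) mpoly set \<Rightarrow> ('x \<Rightarrow> 'k) set \<Rightarrow> ('x \<Rightarrow> 'k) set \<Rightarrow> bool" where
  "zariski_closed_in R Z K \<longleftrightarrow> (\<exists>F \<subseteq> R. K = {a \<in> Z. \<forall>f \<in> F. eval_at a f = 0})"

definition irreducible_closed_in ::
  "('x, 'k::comm_ring_1) mpoly set \<Rightarrow> ('x \<Rightarrow> 'k) set \<Rightarrow> ('x \<Rightarrow> 'k) set \<Rightarrow> bool" where
  "irreducible_closed_in R Z K \<longleftrightarrow> zariski_closed_in R Z K \<and> K \<noteq> {} \<and>
     (\<forall>K1 K2. zariski_closed_in R Z K1 \<and> zariski_closed_in R Z K2 \<and> K = K1 \<union> K2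
        \<longrightarrow> K = K1 \<or> K = K2)"

text \<open>Krull dimension, as the supremum of the lengths of chains of irreducible closed sets.\<close>

definition zariski_dim :: "('x, 'k::comm_ring_1) mpoly set \<Rightarrow> ('x \<Rightarrow> 'k) set \<Rightarrow> enat" where
  "zariski_dim R Z = (SUP n \<in> {n. \<exists>K :: nat \<Rightarrow> ('x \<Rightarrow> 'k) set.
     (\<forall>i \<le> n. irreducible_closed_in R Z (K i)) \<and> (\<forall>i < n. K i \<subset> K (Suc i))}. enat n)"


section \<open>Affine algebraic groups and their Lie algebras\<close>

text \<open>Affine \<open>N\<close>-space is realised as the functions on \<open>nat\<close> that vanish from \<open>N\<close> on.
  In the polynomials for the multiplication, \<open>Inl i\<close> and \<open>Inr i\<close> are the \<open>i\<close>-th coordinates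
  of the left and of the right factor.\<close>

definition affine_space :: "nat \<Rightarrow> (nat \<Rightarrow> 'k::zero) set" where
  "affine_space N = {a. \<forall>i \<ge> N. a i = 0}"

definition affine_algebraic_group :: "nat \<Rightarrow> (nat \<Rightarrow> 'k::field) monoid \<Rightarrow> bool" where
  "affine_algebraic_group N G \<longleftrightarrow>
     group G \<and>
     zariski_closed_in (polys {..<N}) (affine_space N) (carrier G) \<and>
     (\<exists>M :: nat \<Rightarrow> (nat + nat, 'k) mpoly.
        \<forall>i < N. M i \<in> polys ({..<N} <+> {..<N}) \<and>
          (\<forall>a \<in> carrier G. \<forall>b \<in> carrier G. (a \<otimes>\<^bsub>G\<^esub> b) i = eval_at (case_sum a b) (M i))) \<and>
     (\<exists>I :: nat \<Rightarrow> (nat, 'k) mpoly.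
        \<forall>i < N. I i \<in> polys {..<N} \<and>
          (\<forall>a \<in> carrier G. (inv\<^bsub>G\<^esub> a) i = eval_at a (I i)))"

text \<open>Regular functions are extended by \<open>0\<close> outside the group, and derivations by \<open>0\<close> outside
  the coordinate ring, so that equality of functions is equality on the group,
  respectively on the coordinate ring.\<close>

definition coordinate_ring :: "nat \<Rightarrow> (nat \<Rightarrow> 'k::field) monoid \<Rightarrow> ((nat \<Rightarrow> 'k) \<Rightarrow> 'k) set" where
  "coordinate_ring N G =
     {f. \<exists>p \<in> polys {..<N}. f = (\<lambda>a. if a \<in> carrier G then eval_at a p else 0)}"

definition left_translate ::
  "(nat \<Rightarrow> 'k::field) monoid \<Rightarrow> (nat \<Rightarrow> 'k) \<Rightarrow> ((nat \<Rightarrow> 'k) \<Rightarrow> 'k) \<Rightarrow> ((nat \<Rightarrow> 'k) \<Rightarrow> 'k)" where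
  "left_translate G g f = (\<lambda>a. if a \<in> carrier G then f (inv\<^bsub>G\<^esub> g \<otimes>\<^bsub>G\<^esub> a) else 0)"

definition group_lie_algebra ::
  "nat \<Rightarrow> (nat \<Rightarrow> 'k::field) monoid \<Rightarrow> (((nat \<Rightarrow> 'k) \<Rightarrow> 'k) \<Rightarrow> ((nat \<Rightarrow> 'k) \<Rightarrow> 'k)) set" where
  "group_lie_algebra N G = {D.
     (\<forall>f. f \<notin> coordinate_ring N G \<longrightarrow> D f = (\<lambda>a. 0)) \<and>
     (\<forall>f \<in> coordinate_ring N G. D f \<in> coordinate_ring N G) \<and>
     (\<forall>f \<in> coordinate_ring N G. \<forall>g \<in> coordinate_ring N G.
        D (\<lambda>a. f a + g a) = (\<lambda>a. D f a + D g a) \<and>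
        D (\<lambda>a. f a * g a) = (\<lambda>a. f a * D g a + D f a * g a)) \<and>
     (\<forall>c. \<forall>f \<in> coordinate_ring N G. D (\<lambda>a. c * f a) = (\<lambda>a. c * D f a)) \<and>
     (\<forall>g \<in> carrier G. \<forall>f \<in> coordinate_ring N G.
        D (left_translate G g f) = left_translate G g (D f))}"


section \<open>Finite-dimensional Lie algebras and their Poisson algebras\<close>

locale lie_algebra = finite_dimensional_vector_space scale Basis
  for scale :: "'k::field \<Rightarrow> 'g::ab_group_add \<Rightarrow> 'g" and Basis :: "'g set" +
  fixes bracket :: "'g \<Rightarrow> 'g \<Rightarrow> 'g"
  assumes linear_right: "Vector_Spaces.linear scale scale (bracket x)"
    and linear_left: "Vector_Spaces.linear scale scale (\<lambda>y. bracket y x)"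
    and alternating: "bracket x x = 0"
    and jacobi: "bracket x (bracket y z) + bracket y (bracket z x) + bracket z (bracket x y) = 0"
begin

definition abelian :: bool where
  "abelian \<longleftrightarrow> (\<forall>x y. bracket x y = 0)"

definition dual :: "('g \<Rightarrow> 'k) set" where
  "dual = {\<xi>. Vector_Spaces.linear scale (*) \<xi>}"

definition stabilizer :: "('g \<Rightarrow> 'k) \<Rightarrow> 'g set" where
  "stabilizer \<xi> = {x. \<forall>y. \<xi> (bracket x y) = 0}"

definition index :: nat where
  "index = (INF \<xi> \<in> dual. dim (stabilizer \<xi>))"

definition c_number :: rat where
  "c_number = (of_nat dimension + of_nat index) / 2"

definition dual_reg :: "('g \<Rightarrow> 'k) set" where
  "dual_reg = {\<xi> \<in> dual. dim (stabilizer \<xi>) = index}"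

definition dual_sing :: "('g \<Rightarrow> 'k) set" where
  "dual_sing = dual - dual_reg"

definition unimodular :: bool where
  "unimodular \<longleftrightarrow> (\<forall>x. (\<Sum>b \<in> Basis. representation Basis (bracket x b) b) = 0)"

definition commutative_polarization :: "'g set \<Rightarrow> bool" where
  "commutative_polarization \<h> \<longleftrightarrow> subspace \<h> \<and>
     (\<forall>x \<in> \<h>. \<forall>y \<in> \<h>. bracket x y = 0) \<and> of_nat (dim \<h>) = c_number"

definition algebraic :: bool where
  "algebraic \<longleftrightarrow> (\<exists>N. \<exists>G :: (nat \<Rightarrow> 'k) monoid. affine_algebraic_group N G \<and>
     (\<exists>\<phi>. bij_betw \<phi> UNIV (group_lie_algebra N G) \<and>
        (\<forall>x y. \<phi> (x + y) = (\<lambda>f a. \<phi> x f a + \<phi> y f a)) \<and>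
        (\<forall>c x. \<phi> (scale c x) = (\<lambda>f a. c * \<phi> x f a)) \<and>
        (\<forall>x y. \<phi> (bracket x y) = (\<lambda>f a. \<phi> x (\<phi> y f) a - \<phi> y (\<phi> x f) a))))"

text \<open>The symmetric algebra is the polynomial ring in the elements of the fixed basis;
  its elements are also the polynomial functions on the dual space, a linear form \<open>\<xi>\<close>
  being evaluated through its values \<open>\<xi> b\<close> at the basis elements.\<close>

definition sym_algebra :: "('g, 'k) mpoly set" where
  "sym_algebra = polys Basis"

definition embed :: "'g \<Rightarrow> ('g, 'k) mpoly" where
  "embed v = (\<Sum>b \<in> Basis. Const (representation Basis v b) * Var b)"

definition poisson :: "('g, 'k) mpoly \<Rightarrow> ('g, 'k) mpoly \<Rightarrow> ('g, 'k) mpoly" where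
  "poisson f g = (\<Sum>x \<in> Basis. \<Sum>y \<in> Basis.
     embed (bracket x y) * partial_deriv x f * partial_deriv y g)"

definition poisson_center :: "('g, 'k) mpoly set" where
  "poisson_center = {f \<in> sym_algebra. \<forall>g \<in> sym_algebra. poisson f g = 0}"

definition coregular :: bool where
  "coregular \<longleftrightarrow> polynomial_algebra poisson_center"

definition poisson_commutative_subalgebra :: "('g, 'k) mpoly set \<Rightarrow> bool" where
  "poisson_commutative_subalgebra A \<longleftrightarrow>
     subalgebra A \<and> A \<subseteq> sym_algebra \<and> (\<forall>f \<in> A. \<forall>g \<in> A. poisson f g = 0)"

definition maximal_poisson_commutative_subalgebra :: "('g, 'k) mpoly set \<Rightarrow> bool" where
  "maximal_poisson_commutative_subalgebra A \<longleftrightarrow> poisson_commutative_subalgebra A \<and>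
     (\<forall>A'. poisson_commutative_subalgebra A' \<and> A \<subseteq> A' \<longrightarrow> A' = A)"

text \<open>\<open>f(x + \<xi>(x) t)\<close> as a polynomial in \<open>t\<close> with coefficients in the symmetric algebra.\<close>

definition shift_expansion :: "('g \<Rightarrow> 'k) \<Rightarrow> ('g, 'k) mpoly \<Rightarrow> ('g, 'k) mpoly poly" where
  "shift_expansion \<xi> f = eval_in (\<lambda>c. [:Const c:]) (\<lambda>x. [:Var x, Const (\<xi> x):]) f"

definition shifts :: "('g \<Rightarrow> 'k) \<Rightarrow> ('g, 'k) mpoly \<Rightarrow> ('g, 'k) mpoly set" where
  "shifts \<xi> f = {coeff (shift_expansion \<xi> f) j | j. j < total_degree f}"

definition mishchenko_fomenko :: "('g \<Rightarrow> 'k) \<Rightarrow> ('g, 'k) mpoly set" where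
  "mishchenko_fomenko \<xi> = subalgebra hull (\<Union>f \<in> poisson_center. shifts \<xi> f)"

text \<open>Codimension in the dual space. The empty set has codimension \<open>\<infinity>\<close>; for nonempty \<open>Z\<close>
  one has \<open>zariski_dim sym_algebra Z \<le> dimension\<close>, so the subtraction does not truncate.\<close>

definition dual_codim :: "('g \<Rightarrow> 'k) set \<Rightarrow> enat" where
  "dual_codim Z = (if Z = {} then \<infinity> else enat dimension - zariski_dim sym_algebra Z)"

end

end

theory Submission
  imports
    Defs
    "Jordan_Normal_Form.Determinant"
    "HOL-Algebra.Algebraic_Closure_Type"
    "HOL-Computational_Algebra.Fraction_Field"
    "HOL-Computational_Algebra.Polynomial_Factorial"
begin

hide_const (open) up_ring.coeff up_ring.monom module.smult Coset.order
  Polynomials.lead_coeff Polynomials.degree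
no_notation Polynomials.var (\<open>X\<index>\<close>)
no_notation fps_nth (infixl \<open>$\<close> 75)
hide_const (open) Embedded_Algebras.subalgebra

text \<open>
  Let \<open>M\<close> be the matrix of brackets between \<open>\<h>\<close> and a complement of \<open>\<h>\<close>. It is injective at regular
  points, so every invariant has its gradients in \<open>\<h>\<close>. The polynomials whose gradients all lie
  in \<open>\<h>\<close> form a Poisson commutative subalgebra containing \<open>\<h>\<close> and the shifts of invariants. The
  elements of the Mishchenko-Fomenko subalgebra of \<open>\<xi>\<close> have their gradient at \<open>0\<close> in the stabilizer
  of \<open>\<xi>\<close>, so maximality would put \<open>\<h>\<close> inside that stabilizer, which is too small.

  For the codimension, let \<open>Z\<close> be the closed cone of linear forms where \<open>M\<close> is not injective; it consists
  of singular forms. If no three vectors are in general position with respect to \<open>Z\<close>, then every linear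
  form is the sum of an element of \<open>Z\<close> and a combination of at most two fixed vectors, and chains of
  linear subspaces lift to chains of irreducible closed subsets of \<open>Z\<close>. Otherwise let \<open>F\<close> be the matrix
  of gradients of the generators of the Poisson center. Its maximal minors are proportional to the
  complementary minors of \<open>M\<close>; the factor is a polynomial because \<open>Z\<close> has codimension at least two, an
  invariant because of unimodularity, and then a constant because a common factor of the Jacobian minors
  of the generators that is itself invariant cannot involve any of them. So the complex formed
  by \<open>F\<close> and the transpose of \<open>M\<close>, restricted to a three-dimensional linear space meeting \<open>Z\<close> only
  in \<open>0\<close>, is exact off the origin. The cokernel of the transpose of \<open>M\<close> then has finite length and a free
  resolution of length two over a polynomial ring in three variables, hence is zero, although the
  entries of \<open>M\<close> vanish at \<open>0\<close>.
\<close>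

section \<open>Polynomials and evaluation\<close>

text \<open>The bound two comes from a comparison of lengths. Three vectors in general position make
  a power of each of the three coordinates annihilate the homology, which is a regular sequence of
  length three, while a nonzero module with a free resolution of length two has positive depth over
  a polynomial ring in three variables. Two vectors already make the factor between the minors a
  polynomial.

  Points over \<open>k\<close> and generic points over a larger field are both produced by one
  lemma, which extends a homomorphism, modulo a prime ideal, to finitely many further elements with
  values in an algebraically closed field; it plays the role of the Nullstellensatz. In the Jacobian
  argument a prime ideal that contains the common factor and meets the algebra of all but one
  generator only in zero takes the place of an irreducible divisor.

  Lower bounds for dimensions come from chains alone: projections of cones along vectors outside
  them are finite, so images stay closed, and a minimal closed set lying over a linear subspace is
  irreducible.\<close>

abbreviation (input) mlookup where "mlookup \<equiv> Poly_Mapping.lookup"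
abbreviation (input) mkeys where "mkeys \<equiv> Poly_Mapping.keys"

definition monom_val :: "('x \<Rightarrow> 'r) \<Rightarrow> ('x \<Rightarrow>\<^sub>0 nat) \<Rightarrow> 'r::comm_ring_1" where
  "monom_val a m = (\<Prod>x \<in> mkeys m. a x ^ mlookup m x)"

lemma monom_val_superset:
  assumes "finite A" "mkeys m \<subseteq> A"
  shows "monom_val a m = (\<Prod>x \<in> A. a x ^ mlookup m x)"
  unfolding monom_val_def
  by (rule prod.mono_neutral_left[OF assms]) (auto simp: in_keys_iff)

lemma monom_val_zero [simp]: "monom_val a 0 = 1"
  by (simp add: monom_val_def)

lemma monom_val_add: "monom_val a (m + n) = monom_val a m * monom_val a n"
proof -
  let ?A = "mkeys m \<union> mkeys n"
  have "monom_val a (m + n) = (\<Prod>x \<in> ?A. a x ^ mlookup (m + n) x)"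
    by (rule monom_val_superset) (auto dest: subsetD[OF Poly_Mapping.keys_add])
  also have "\<dots> = (\<Prod>x \<in> ?A. a x ^ mlookup m x) * (\<Prod>x \<in> ?A. a x ^ mlookup n x)"
    by (simp add: lookup_add power_add prod.distrib)
  also have "\<dots> = monom_val a m * monom_val a n"
    by (simp add: monom_val_superset[of ?A])
  finally show ?thesis .
qed

lemma monom_val_single [simp]: "monom_val a (Poly_Mapping.single x n) = a x ^ n"
  by (cases "n = 0") (simp_all add: monom_val_def)

lemma mpoly_sum_singles:
  "p = (\<Sum>m \<in> mkeys p. Poly_Mapping.single m (mlookup p m))"
  by (rule poly_mapping_eqI) (auto simp: lookup_sum lookup_single when_def in_keys_iff)

lemma mpoly_induct_add [case_names single add]:
  assumes "\<And>m c. P (Poly_Mapping.single m c)" "\<And>p q. P p \<Longrightarrow> P q \<Longrightarrow> P (p + q)"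
  shows "P (p :: 'a::zero \<Rightarrow>\<^sub>0 'b::comm_monoid_add)"
proof -
  have "P (\<Sum>m \<in> A. Poly_Mapping.single m (mlookup p m))" if "finite A" for A
    using that
  proof induction
    case empty
    show ?case using assms(1)[of 0 0] by simp
  qed (auto intro: assms)
  from this[of "mkeys p"] show ?thesis using mpoly_sum_singles[of p] by simp
qed

context
  fixes h :: "'k::comm_ring_1 \<Rightarrow> 'r::comm_ring_1"
  assumes h: "comm_ring_hom h"
begin

interpretation comm_ring_hom h by (rule h)

lemma eval_in_superset:
  assumes "finite A" "mkeys p \<subseteq> A"
  shows "eval_in h a p = (\<Sum>m \<in> A. h (mlookup p m) * monom_val a m)"
  unfolding eval_in_def monom_val_def
  by (rule sum.mono_neutral_left[OF assms]) (auto simp: in_keys_iff)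

lemma eval_in_single: "eval_in h a (Poly_Mapping.single m c) = h c * monom_val a m"
  by (subst eval_in_superset[of "{m}"]) auto

lemma eval_in_add: "eval_in h a (p + q) = eval_in h a p + eval_in h a q"
proof -
  let ?A = "mkeys p \<union> mkeys q"
  have "eval_in h a (p + q) = (\<Sum>m \<in> ?A. h (mlookup (p + q) m) * monom_val a m)"
    by (rule eval_in_superset) (auto dest: subsetD[OF Poly_Mapping.keys_add])
  also have "\<dots> = eval_in h a p + eval_in h a q"
    by (simp add: eval_in_superset[of ?A] lookup_add hom_add distrib_right sum.distrib)
  finally show ?thesis .
qed

lemma eval_in_zero: "eval_in h a 0 = 0"
  by (simp add: eval_in_def)

lemma eval_in_mult: "eval_in h a (p * q) = eval_in h a p * eval_in h a q"
proof (induction p rule: mpoly_induct_add)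
  case (single m c)
  show ?case
  proof (induction q rule: mpoly_induct_add)
    case (single n d)
    then show ?case by (simp add: mult_single eval_in_single hom_mult monom_val_add)
  qed (simp add: eval_in_add distrib_left)
qed (simp add: eval_in_add distrib_right)

lemma eval_in_one: "eval_in h a 1 = 1"
  using eval_in_single[of a 0 1] by simp

lemma eval_in_Const: "eval_in h a (Const c) = h c"
  by (simp add: Const_def eval_in_single)

lemma eval_in_Var: "eval_in h a (Var x) = a x"
  by (simp add: Var_def eval_in_single)

lemma comm_ring_hom_eval_in: "comm_ring_hom (eval_in h a)"
  using eval_in_Const[of a 1]
  by unfold_locales (simp_all add: eval_in_add eval_in_mult Const_def eval_in_zero)

end

lemma comm_ring_hom_id: "comm_ring_hom (\<lambda>c. c)"
  by unfold_locales auto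

lemma comm_ring_hom_compose:
  assumes "comm_ring_hom f" "comm_ring_hom g"
  shows "comm_ring_hom (\<lambda>x. f (g x))"
proof -
  interpret f: comm_ring_hom f by fact
  interpret g: comm_ring_hom g by fact
  show ?thesis by unfold_locales (simp_all add: f.hom_add g.hom_add f.hom_mult g.hom_mult)
qed

lemma Const_add: "Const (c + d) = Const c + Const d"
  and Const_mult: "Const (c * d) = Const c * Const d"
  and Const_zero [simp]: "Const 0 = 0"
  and Const_one [simp]: "Const 1 = 1"
  by (simp_all add: Const_def single_add mult_single)

lemma comm_ring_hom_Const: "comm_ring_hom (Const :: 'k::comm_ring_1 \<Rightarrow> ('x, 'k) mpoly)"
  by unfold_locales (simp_all add: Const_add Const_mult)

lemma Const_eq_iff [simp]: "Const c = Const d \<longleftrightarrow> c = d"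
  by (metis Const_def lookup_single_eq)

lemma Const_eq_0_iff [simp]: "Const c = 0 \<longleftrightarrow> c = 0"
  by (metis Const_eq_iff Const_zero)

interpretation Const_hom: comm_ring_hom "Const :: 'k::comm_ring_1 \<Rightarrow> ('x, 'k) mpoly"
  by (rule comm_ring_hom_Const)

interpretation eval_at: comm_ring_hom "eval_at a" for a
  by (rule comm_ring_hom_eval_in[OF comm_ring_hom_id])

declare eval_at.hom_add [simp] eval_at.hom_mult [simp] eval_at.hom_minus [simp]
  eval_at.hom_uminus [simp] eval_at.hom_power [simp]

lemmas eval_at_Const [simp] = eval_in_Const[OF comm_ring_hom_id]
lemmas eval_at_Var [simp] = eval_in_Var[OF comm_ring_hom_id]

lemma polysI: "(\<And>m. m \<in> mkeys p \<Longrightarrow> mkeys m \<subseteq> B) \<Longrightarrow> p \<in> polys B"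
  by (simp add: polys_def)

lemma polys_Const [simp]: "Const c \<in> polys B"
  by (rule polysI) (auto simp: Const_def split: if_splits)

lemma polys_zero [simp]: "0 \<in> polys B"
  by (simp add: polys_def)

lemma polys_one [simp]: "1 \<in> polys B"
  using polys_Const[of 1] by simp

lemma polys_Var [simp]: "x \<in> B \<Longrightarrow> Var x \<in> polys B"
  by (rule polysI) (auto simp: Var_def split: if_splits)

lemma polys_add [simp]: "p \<in> polys B \<Longrightarrow> q \<in> polys B \<Longrightarrow> p + q \<in> polys B"
  unfolding polys_def using Poly_Mapping.keys_add[of p q] by blast

lemma polys_mult [simp]: "p \<in> polys B \<Longrightarrow> q \<in> polys B \<Longrightarrow> p * q \<in> polys B"
proof (rule polysI)
  fix m assume pq: "p \<in> polys B" "q \<in> polys B" and m: "m \<in> mkeys (p * q)"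
  then obtain a b where "m = a + b" "a \<in> mkeys p" "b \<in> mkeys q"
    using Poly_Mapping.keys_mult[of p q] by auto
  then show "mkeys m \<subseteq> B"
    using pq Poly_Mapping.keys_add[of a b] unfolding polys_def by blast
qed

lemma polys_uminus [simp]: "p \<in> polys B \<Longrightarrow> - p \<in> polys B"
  by (simp add: polys_def in_keys_iff)

lemma polys_minus [simp]: "p \<in> polys B \<Longrightarrow> q \<in> polys B \<Longrightarrow> p - q \<in> polys B"
  using polys_add[of p B "- q"] by simp

lemma polys_sum [intro]: "(\<And>i. i \<in> A \<Longrightarrow> f i \<in> polys B) \<Longrightarrow> sum f A \<in> polys B"
  by (induction A rule: infinite_finite_induct) auto

lemma polys_prod [intro]: "(\<And>i. i \<in> A \<Longrightarrow> f i \<in> polys B) \<Longrightarrow> prod f A \<in> polys B"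
  by (induction A rule: infinite_finite_induct) auto

lemma polys_power [simp]: "p \<in> polys B \<Longrightarrow> p ^ n \<in> polys B"
  by (induction n) auto

lemma polys_mono: "A \<subseteq> B \<Longrightarrow> p \<in> polys A \<Longrightarrow> p \<in> polys B"
  unfolding polys_def by auto

lemma Var_power: "(Var x :: ('x, 'k::comm_ring_1) mpoly) ^ n = Poly_Mapping.single (Poly_Mapping.single x n) 1"
  by (induction n) (simp_all add: Var_def mult_single single_add[symmetric])

lemma single_eq_Const_mult:
  "Poly_Mapping.single m c = Const c * (\<Prod>x \<in> mkeys m. (Var x :: ('x, 'k::comm_ring_1) mpoly) ^ mlookup m x)"
proof -
  have "(\<Prod>x \<in> A. (Var x :: ('x, 'k) mpoly) ^ mlookup m x)
      = Poly_Mapping.single (\<Sum>x \<in> A. Poly_Mapping.single x (mlookup m x)) 1" if "finite A" for A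
    using that by induction (simp_all add: Var_power mult_single)
  from this[of "mkeys m"] show ?thesis
    using mpoly_sum_singles[of m] by (simp add: Const_def mult_single)
qed

lemma polys_induct [consumes 1, case_names Const Var add mult]:
  assumes "p \<in> polys B" "\<And>c. P (Const c)" "\<And>x. x \<in> B \<Longrightarrow> P (Var x)"
    "\<And>p q. p \<in> polys B \<Longrightarrow> q \<in> polys B \<Longrightarrow> P p \<Longrightarrow> P q \<Longrightarrow> P (p + q)"
    "\<And>p q. p \<in> polys B \<Longrightarrow> q \<in> polys B \<Longrightarrow> P p \<Longrightarrow> P q \<Longrightarrow> P (p * q)"
  shows "P (p :: ('x, 'k::comm_ring_1) mpoly)"
proof -
  let ?Q = "\<lambda>p. p \<in> polys B \<and> P p"
  have one: "?Q 1" using assms(2)[of 1] by simp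
  have pow: "?Q (Var x ^ n)" if "x \<in> B" for x n
    by (induction n) (use one that assms(3,5) in auto)
  have prd: "?Q (\<Prod>x \<in> A. Var x ^ n x)" if "finite A" "A \<subseteq> B" for A n
    using that by induction (use one pow assms(5) in auto)
  have sgl: "?Q (Poly_Mapping.single m c)" if "mkeys m \<subseteq> B" for m c
    unfolding single_eq_Const_mult using prd[OF _ that, of "mlookup m"] assms(2,5) by auto
  have "?Q (\<Sum>m \<in> A. Poly_Mapping.single m (mlookup p m))" if "finite A" "A \<subseteq> mkeys p" for A
    using that
  proof induction
    case empty
    then show ?case using assms(2)[of 0] by simp
  next
    case (insert m A)
    moreover have "?Q (Poly_Mapping.single m (mlookup p m))"
      using sgl insert.prems assms(1) by (auto simp: polys_def)
    ultimately show ?case using assms(4) by auto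
  qed
  from this[of "mkeys p"] show ?thesis using mpoly_sum_singles[of p] by simp
qed

lemma polys_UNIV: "p \<in> polys UNIV"
  by (simp add: polys_def)

text \<open>Uniqueness in the universal property of a polynomial ring. Composite substitutions are
  identified through it below, without computing with monomials.\<close>

lemma eval_in_polys_eqI:
  assumes "comm_ring_hom f" "comm_ring_hom g" "p \<in> polys B"
    "\<And>c. f (Const c) = g (Const c)" "\<And>x. x \<in> B \<Longrightarrow> f (Var x) = g (Var x)"
  shows "f p = g (p :: ('x, 'k::comm_ring_1) mpoly)"
proof -
  interpret f: comm_ring_hom f by fact
  interpret g: comm_ring_hom g by fact
  show ?thesis
    using assms(3) by (induction p rule: polys_induct)
      (auto simp: assms f.hom_add g.hom_add f.hom_mult g.hom_mult)
qed

lemma hom_eq_eval_in: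
  assumes "comm_ring_hom f" "p \<in> polys B"
  shows "f p = eval_in (\<lambda>c. f (Const c)) (\<lambda>x. f (Var x)) (p :: ('x, 'k::comm_ring_1) mpoly)"
proof -
  have c: "comm_ring_hom (\<lambda>c. f (Const c))"
    by (rule comm_ring_hom_compose[OF assms(1) comm_ring_hom_Const])
  show ?thesis
    by (rule eval_in_polys_eqI[OF assms(1) comm_ring_hom_eval_in[OF c] assms(2)])
      (simp_all add: eval_in_Const[OF c] eval_in_Var[OF c])
qed

lemma eval_in_cong_polys:
  assumes "p \<in> polys B" "\<And>x. x \<in> B \<Longrightarrow> a x = b x"
  shows "eval_in h a p = eval_in h b p"
  unfolding eval_in_def using assms
  by (intro sum.cong prod.cong refl arg_cong2[where f="(*)"] arg_cong2[where f="(^)"])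
    (auto simp: polys_def)

lemma eval_in_polys_mem:
  assumes "comm_ring_hom h" "p \<in> polys B" "\<And>c. h c \<in> R" "\<And>x. x \<in> B \<Longrightarrow> a x \<in> R"
    "\<And>u v. u \<in> R \<Longrightarrow> v \<in> R \<Longrightarrow> u + v \<in> R" "\<And>u v. u \<in> R \<Longrightarrow> v \<in> R \<Longrightarrow> u * v \<in> R"
  shows "eval_in h a p \<in> R"
  using assms(2)
  by (induction p rule: polys_induct)
    (simp_all add: assms eval_in_Const[OF assms(1)] eval_in_Var[OF assms(1)]
       eval_in_add[OF assms(1)] eval_in_mult[OF assms(1)])

subsection \<open>Partial derivatives\<close>

lemma partial_deriv_superset:
  assumes "finite A" "mkeys p \<subseteq> A"
  shows "partial_deriv x p = (\<Sum>m \<in> A. Poly_Mapping.single (m - Poly_Mapping.single x 1)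
       (of_nat (mlookup m x) * mlookup p m))"
  unfolding partial_deriv_def
  by (rule sum.mono_neutral_left[OF assms]) (auto simp: in_keys_iff)

lemma partial_deriv_single:
  "partial_deriv x (Poly_Mapping.single m c)
     = Poly_Mapping.single (m - Poly_Mapping.single x 1) (of_nat (mlookup m x) * c)"
  by (subst partial_deriv_superset[of "{m}"]) auto

lemma partial_deriv_add [simp]: "partial_deriv x (p + q) = partial_deriv x p + partial_deriv x q"
proof -
  let ?A = "mkeys p \<union> mkeys q"
  have "mkeys (p + q) \<subseteq> ?A" by (rule Poly_Mapping.keys_add)
  then show ?thesis
    by (simp add: partial_deriv_superset[of ?A] lookup_add distrib_left single_add sum.distrib)
qed

lemma partial_deriv_mult:
  "partial_deriv x (p * q) = p * partial_deriv x q + partial_deriv x p * q"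
proof (induction p rule: mpoly_induct_add)
  case (single m c)
  show ?case
  proof (induction q rule: mpoly_induct_add)
    case (single n d)
    let ?s = "Poly_Mapping.single x 1 :: 'a \<Rightarrow>\<^sub>0 nat"
    \<comment> \<open>Subtraction of exponents is truncated, so the two monomials may differ when
      \<open>x\<close> does not occur in \<open>m\<close>; the coefficient is then zero.\<close>
    have 1: "Poly_Mapping.single (m + n - ?s) (of_nat (mlookup m x) * (c * d))
        = Poly_Mapping.single (m - ?s + n) (of_nat (mlookup m x) * (c * d))"
    proof (cases "mlookup m x = 0")
      case False
      then have "m + n - ?s = m - ?s + n"
        by (intro poly_mapping_eqI) (auto simp: lookup_add lookup_minus lookup_single when_def)
      then show ?thesis by simp
    qed simp
    have 2: "Poly_Mapping.single (m + n - ?s) (of_nat (mlookup n x) * (c * d))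
        = Poly_Mapping.single (m + (n - ?s)) (of_nat (mlookup n x) * (c * d))"
    proof (cases "mlookup n x = 0")
      case False
      then have "m + n - ?s = m + (n - ?s)"
        by (intro poly_mapping_eqI) (auto simp: lookup_add lookup_minus lookup_single when_def)
      then show ?thesis by simp
    qed simp
    show ?case
      using 1 2
      by (simp add: mult_single partial_deriv_single lookup_add distrib_left distrib_right single_add
          mult_ac add_ac)
  qed (simp add: distrib_left algebra_simps)
qed (simp add: algebra_simps)

lemma partial_deriv_Const [simp]: "partial_deriv x (Const c) = 0"
  by (simp add: Const_def partial_deriv_single)

lemma partial_deriv_Var: "partial_deriv x (Var y) = (if x = y then 1 else 0)"
  by (auto simp: Var_def partial_deriv_single lookup_single)

lemma partial_deriv_sum: "partial_deriv x (sum f A) = (\<Sum>i \<in> A. partial_deriv x (f i))"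
  by (induction A rule: infinite_finite_induct)
    (auto simp: partial_deriv_Const[of x 0, simplified])

lemma partial_deriv_polys [simp]: "p \<in> polys B \<Longrightarrow> partial_deriv x p \<in> polys B"
  by (induction p rule: polys_induct) (auto simp: partial_deriv_Var partial_deriv_mult)

text \<open>Subrings are sets inside one ambient ring, so that adjoining elements one by one, as the
  extension arguments do, never changes the type.\<close>

definition ring_subset :: "'r::comm_ring_1 set \<Rightarrow> bool" where
  "ring_subset R \<longleftrightarrow> 1 \<in> R \<and> (\<forall>a \<in> R. \<forall>b \<in> R. a - b \<in> R \<and> a * b \<in> R)"

lemma ring_subsetD:
  assumes "ring_subset R"
  shows "0 \<in> R" "1 \<in> R" "a \<in> R \<Longrightarrow> - a \<in> R" "a \<in> R \<Longrightarrow> b \<in> R \<Longrightarrow> a + b \<in> R"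
    "a \<in> R \<Longrightarrow> b \<in> R \<Longrightarrow> a - b \<in> R" "a \<in> R \<Longrightarrow> b \<in> R \<Longrightarrow> a * b \<in> R" "a \<in> R \<Longrightarrow> a ^ n \<in> R"
proof -
  show 1: "1 \<in> R" and m: "\<And>a b. a \<in> R \<Longrightarrow> b \<in> R \<Longrightarrow> a - b \<in> R"
    and t: "\<And>a b. a \<in> R \<Longrightarrow> b \<in> R \<Longrightarrow> a * b \<in> R"
    using assms by (auto simp: ring_subset_def)
  show 0: "0 \<in> R" using m[OF 1 1] by simp
  show u: "- a \<in> R" if "a \<in> R" for a using m[OF 0 that] by simp
  show "a + b \<in> R" if "a \<in> R" "b \<in> R" using m[OF that(1) u[OF that(2)]] by simp
  show "a ^ n \<in> R" if "a \<in> R" by (induction n) (auto simp: 1 t that)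
qed

lemma ring_subset_sum: "ring_subset R \<Longrightarrow> (\<And>i. i \<in> A \<Longrightarrow> f i \<in> R) \<Longrightarrow> sum f A \<in> R"
  by (induction A rule: infinite_finite_induct) (auto intro: ring_subsetD)

lemma ring_subset_polys: "ring_subset (polys B)"
  by (simp add: ring_subset_def)

definition derivation_on :: "'r::comm_ring_1 set \<Rightarrow> ('r \<Rightarrow> 'r) \<Rightarrow> bool" where
  "derivation_on R D \<longleftrightarrow> (\<forall>a \<in> R. \<forall>b \<in> R. D (a + b) = D a + D b \<and> D (a * b) = a * D b + D a * b)"

text \<open>The chain rule for a derivation that is controlled on a subring only; hence the
  conditions that constants and substituted values stay in \<open>R\<close>.\<close>

lemma derivation_eval_in:
  assumes h: "comm_ring_hom h" and R: "ring_subset R" and D: "derivation_on R D"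
    and hR: "\<And>c. h c \<in> R" "\<And>c. D (h c) = 0" and aR: "\<And>x. x \<in> B \<Longrightarrow> a x \<in> R"
    and B: "finite B" and p: "p \<in> polys B"
  shows "D (eval_in h a p) = (\<Sum>x \<in> B. eval_in h a (partial_deriv x p) * D (a x))"
  using p
proof (induction p rule: polys_induct)
  case (Const c)
  then show ?case by (simp add: eval_in_Const[OF h] hR eval_in_zero[OF h])
next
  case (Var x)
  have "(\<Sum>y \<in> B. eval_in h a (partial_deriv y (Var x)) * D (a y))
      = (\<Sum>y \<in> B. if y = x then D (a x) else 0)"
    by (rule sum.cong) (auto simp: partial_deriv_Var eval_in_zero[OF h]
        eval_in_one[OF h])
  then show ?case using Var B by (simp add: eval_in_Var[OF h])
next
  case (add p q)
  have "eval_in h a p \<in> R" "eval_in h a q \<in> R"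
    using add.hyps by (auto intro!: eval_in_polys_mem[OF h] hR aR ring_subsetD[OF R])
  then have "D (eval_in h a (p + q)) = D (eval_in h a p) + D (eval_in h a q)"
    using D by (simp add: eval_in_add[OF h] derivation_on_def)
  then show ?case
    by (simp add: add.IH eval_in_add[OF h] distrib_right sum.distrib)
next
  case (mult p q)
  have "eval_in h a p \<in> R" "eval_in h a q \<in> R"
    using mult.hyps by (auto intro!: eval_in_polys_mem[OF h] hR aR ring_subsetD[OF R])
  then have "D (eval_in h a (p * q)) = eval_in h a p * D (eval_in h a q) + D (eval_in h a p) * eval_in h a q"
    using D by (simp add: eval_in_mult[OF h] derivation_on_def)
  then show ?case
    by (simp add: mult.IH eval_in_add[OF h] eval_in_mult[OF h] partial_deriv_mult
        distrib_left distrib_right sum.distrib sum_distrib_left mult_ac)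
qed

section \<open>Extension of derivations and of homomorphisms\<close>

definition poly_over :: "'r::comm_ring_1 set \<Rightarrow> 'r poly set" where
  "poly_over R = {H. \<forall>n. coeff H n \<in> R}"

lemma poly_over_coeff: "H \<in> poly_over R \<Longrightarrow> coeff H n \<in> R"
  by (simp add: poly_over_def)

context
  fixes R :: "'r::comm_ring_1 set"
  assumes R: "ring_subset R"
begin

lemma poly_over_closed:
  shows "0 \<in> poly_over R" "1 \<in> poly_over R" "a \<in> R \<Longrightarrow> monom a n \<in> poly_over R"
    "a \<in> R \<Longrightarrow> [:a:] \<in> poly_over R"
    "H \<in> poly_over R \<Longrightarrow> K \<in> poly_over R \<Longrightarrow> H + K \<in> poly_over R"
    "H \<in> poly_over R \<Longrightarrow> K \<in> poly_over R \<Longrightarrow> H - K \<in> poly_over R"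
    "H \<in> poly_over R \<Longrightarrow> K \<in> poly_over R \<Longrightarrow> H * K \<in> poly_over R"
    "a \<in> R \<Longrightarrow> H \<in> poly_over R \<Longrightarrow> smult a H \<in> poly_over R"
  using ring_subsetD[OF R]
  by (auto simp: poly_over_def coeff_mult coeff_pCons coeff_1 intro!: ring_subset_sum[OF R] split: nat.splits)

lemma poly_over_X: "[:0, 1:] \<in> poly_over R"
  using ring_subsetD(1,2)[OF R] by (auto simp: poly_over_def coeff_pCons split: nat.splits)

lemma ring_subset_poly_over: "ring_subset {poly H x |H. H \<in> poly_over R}"
  unfolding ring_subset_def
proof (intro conjI ballI)
  show "1 \<in> {poly H x |H. H \<in> poly_over R}"
    using poly_over_closed(2) by force
next
  fix a b assume "a \<in> {poly H x |H. H \<in> poly_over R}" "b \<in> {poly H x |H. H \<in> poly_over R}"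
  then obtain H K where 1: "H \<in> poly_over R" "K \<in> poly_over R" "a = poly H x" "b = poly K x"
    by auto
  show "a - b \<in> {poly H x |H. H \<in> poly_over R}"
    using 1 poly_over_closed(6)[of H K] by force
  show "a * b \<in> {poly H x |H. H \<in> poly_over R}"
    using 1 poly_over_closed(7)[of H K] by force
qed

lemma subset_poly_over: "R \<subseteq> {poly H x |H. H \<in> poly_over R}"
proof
  fix a assume "a \<in> R"
  then show "a \<in> {poly H x |H. H \<in> poly_over R}"
    using poly_over_closed(4)[of a] by (auto intro!: exI[of _ "[:a:]"])
qed

lemma mem_poly_over: "x \<in> {poly H x |H. H \<in> poly_over R}"
  using poly_over_X by (auto intro!: exI[of _ "[:0, 1:]"])

end

lemma pderiv_poly_over:
  fixes R :: "'r::idom set"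
  assumes R: "ring_subset R" and H: "H \<in> poly_over R"
  shows "pderiv H \<in> poly_over R"
proof -
  have "of_nat n \<in> R" for n
    by (induction n) (auto intro: ring_subsetD[OF R])
  then show ?thesis
    using H by (auto simp: poly_over_def coeff_pderiv intro!: ring_subsetD(6)[OF R] simp del: of_nat_Suc)
qed

text \<open>One step of division by \<open>G\<close>: cancelling the leading term after scaling by the leading
  coefficient of \<open>G\<close>.\<close>

definition cancel_lead :: "'r::comm_ring_1 poly \<Rightarrow> 'r poly \<Rightarrow> 'r poly" where
  "cancel_lead G H = smult (lead_coeff G) H - monom (lead_coeff H) (degree H - degree G) * G"

lemma cancel_lead_degree:
  assumes "degree G \<le> degree H"
  shows "cancel_lead G H = 0 \<or> degree (cancel_lead G H) < degree H"
proof (rule eq_zero_or_degree_less)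
  show "degree (cancel_lead G H) \<le> degree H"
    unfolding cancel_lead_def using assms
    by (intro degree_diff_le degree_smult_le order_trans[OF degree_mult_le]
        order_trans[OF add_right_mono[OF degree_monom_le]]) auto
  show "coeff (cancel_lead G H) (degree H) = 0"
    using assms by (simp add: cancel_lead_def coeff_monom_mult)
qed

lemma poly_over_cancel_lead:
  assumes "ring_subset R" "G \<in> poly_over R" "H \<in> poly_over R"
  shows "cancel_lead G H \<in> poly_over R"
  unfolding cancel_lead_def
  by (intro poly_over_closed[OF assms(1)] assms poly_over_coeff[OF assms(2)] poly_over_coeff[OF assms(3)])

lemma derivation_on_zero: "ring_subset R \<Longrightarrow> derivation_on R D \<Longrightarrow> D 0 = 0"
  using ring_subsetD(1)[of R] unfolding derivation_on_def
  by (metis add_cancel_right_left)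

lemma derivation_on_sum:
  assumes "ring_subset R" "derivation_on R D" "\<And>i. i \<in> A \<Longrightarrow> f i \<in> R"
  shows "D (sum f A) = (\<Sum>i \<in> A. D (f i))"
  using assms(3)
proof (induction A rule: infinite_finite_induct)
  case (insert i A)
  then show ?case
    using assms(2) ring_subset_sum[OF assms(1), of A f] by (auto simp: derivation_on_def)
qed (auto simp: derivation_on_zero[OF assms(1,2)])

context
  fixes R :: "'r::comm_ring_1 set" and D
  assumes R: "ring_subset R" and D: "derivation_on R D"
begin

lemma map_poly_derivation_add:
  assumes "H \<in> poly_over R" "K \<in> poly_over R"
  shows "map_poly D (H + K) = map_poly D H + map_poly D K"
  using assms D
  by (intro poly_eqI) (simp add: coeff_map_poly derivation_on_zero[OF R D] poly_over_def derivation_on_def)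

lemma map_poly_derivation_mult:
  assumes "H \<in> poly_over R" "K \<in> poly_over R"
  shows "map_poly D (H * K) = H * map_poly D K + map_poly D H * K"
proof (rule poly_eqI)
  fix n
  have "coeff (map_poly D (H * K)) n = D (\<Sum>i\<le>n. coeff H i * coeff K (n - i))"
    by (simp add: coeff_map_poly derivation_on_zero[OF R D] coeff_mult)
  also have "\<dots> = (\<Sum>i\<le>n. D (coeff H i * coeff K (n - i)))"
    using assms by (intro derivation_on_sum[OF R D] ring_subsetD(6)[OF R]) (auto simp: poly_over_def)
  also have "\<dots> = (\<Sum>i\<le>n. coeff H i * D (coeff K (n - i)) + D (coeff H i) * coeff K (n - i))"
    using assms D by (intro sum.cong) (auto simp: poly_over_def derivation_on_def)
  also have "\<dots> = coeff (H * map_poly D K + map_poly D H * K) n"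
    by (simp add: coeff_map_poly derivation_on_zero[OF R D] coeff_mult sum.distrib)
  finally show "coeff (map_poly D (H * K)) n = coeff (H * map_poly D K + map_poly D H * K) n" .
qed

lemma derivation_on_map_poly: "derivation_on (poly_over R) (map_poly D)"
  by (simp add: derivation_on_def map_poly_derivation_add map_poly_derivation_mult)

end

text \<open>The value at \<open>x\<close> is forced by an algebraic equation and free otherwise. For
  a nonzero \<open>G\<close> over \<open>R\<close> of least degree with root \<open>x\<close>, it
  must be minus the value at \<open>x\<close> of \<open>G\<close> with differentiated coefficients,
  divided by the derivative of \<open>G\<close> at \<open>x\<close>. The divisor is nonzero because
  in characteristic zero the derivative of \<open>G\<close> is a nonzero polynomial of smaller
  degree. If \<open>x\<close> satisfies no equation, the value 0 is chosen.\<close>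

lemma derivation_extend_step:
  fixes x :: "'f::field_char_0"
  assumes R: "ring_subset R" and D: "derivation_on R D"
  shows "\<exists>R' D'. ring_subset R' \<and> R \<subseteq> R' \<and> x \<in> R' \<and> derivation_on R' D' \<and> (\<forall>r \<in> R. D' r = D r)"
proof -
  define V where "V = {G \<in> poly_over R. G \<noteq> 0 \<and> poly G x = 0}"
  define G where "G = arg_min degree (\<lambda>G. G \<in> V)"
  define u where "u = (if V = {} then 0 else - poly (map_poly D G) x / poly (pderiv G) x)"
  define E where "E H = poly (map_poly D H) x + poly (pderiv H) x * u" for H
  note cl = poly_over_closed[OF R]
  note D0 = derivation_on_zero[OF R D]
  have Eadd: "E (H + K) = E H + E K" if "H \<in> poly_over R" "K \<in> poly_over R" for H K
    by (simp add: E_def map_poly_derivation_add[OF R D that] pderiv_add algebra_simps)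
  have Emult: "E (H * K) = poly H x * E K + E H * poly K x"
    if "H \<in> poly_over R" "K \<in> poly_over R" for H K
    by (simp add: E_def map_poly_derivation_mult[OF R D that] pderiv_mult algebra_simps)
  have E0: "E 0 = 0" by (simp add: E_def)
  have Ediff: "E (H - K) = E H - E K" if "H \<in> poly_over R" "K \<in> poly_over R" for H K
    using Eadd[of "H - K" K] cl(6)[OF that] that by simp
  \<comment> \<open>This makes the extension well defined: polynomials with the same value at
    \<open>x\<close> get the same image. Cancelling leading terms against \<open>G\<close> lowers
    the degree, and \<open>E\<close> kills \<open>G\<close> by the choice of
    \<open>u\<close>.\<close>
  have EV: "E H = 0" if "H \<in> poly_over R" "poly H x = 0" for H
  proof (cases "V = {}")
    case True
    then show ?thesis using that E0 by (auto simp: V_def)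
  next
    case False
    have GV: "G \<in> V" and Gmin: "\<And>K. K \<in> V \<Longrightarrow> degree G \<le> degree K"
      using False arg_min_nat_lemma[of "\<lambda>G. G \<in> V" _ degree] unfolding G_def by auto
    have G: "G \<in> poly_over R" "G \<noteq> 0" "poly G x = 0" using GV by (auto simp: V_def)
    have dG: "degree G \<noteq> 0"
      using G by (metis degree_eq_zeroE poly_const_conv pCons_eq_0_iff)
    have "poly (pderiv G) x \<noteq> 0"
    proof
      assume "poly (pderiv G) x = 0"
      then have "pderiv G \<in> V"
        using G dG pderiv_poly_over[OF R] by (auto simp: V_def pderiv_eq_0_iff)
      from Gmin[OF this] show False using dG by (simp add: degree_pderiv)
    qed
    then have EG: "E G = 0" using False by (simp add: E_def u_def)
    show ?thesis using that
    proof (induction "degree H" arbitrary: H rule: less_induct)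
      case less
      show ?case
      proof (cases "H = 0")
        case True
        then show ?thesis by (simp add: E0)
      next
        case H0: False
        then have "H \<in> V" using less.prems by (simp add: V_def)
        from Gmin[OF this] have le: "degree G \<le> degree H" .
        let ?H' = "cancel_lead G H"
        have mem: "?H' \<in> poly_over R"
          by (rule poly_over_cancel_lead[OF R G(1) less.prems(1)])
        have ev: "poly ?H' x = 0"
          using less.prems G by (simp add: cancel_lead_def)
        have "E ?H' = 0"
          using cancel_lead_degree[OF le] less.hyps[OF _ mem ev] E0 by auto
        moreover have "E ?H' = lead_coeff G * E H"
        proof -
          have m: "monom (lead_coeff H) (degree H - degree G) \<in> poly_over R"
            and c: "[:lead_coeff G:] \<in> poly_over R"
            using less.prems G by (auto intro!: cl poly_over_coeff)
          have "?H' = [:lead_coeff G:] * H - monom (lead_coeff H) (degree H - degree G) * G"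
            by (simp add: cancel_lead_def)
          then show ?thesis
            using Ediff[OF cl(7)[OF c less.prems(1)] cl(7)[OF m G(1)]]
              Emult[OF c less.prems(1)] Emult[OF m G(1)] less.prems G EG by simp
        qed
        ultimately show ?thesis using G(2) by simp
      qed
    qed
  qed
  define R' where "R' = {poly H x |H. H \<in> poly_over R}"
  define D' where "D' z = E (SOME H. H \<in> poly_over R \<and> poly H x = z)" for z
  have D': "D' (poly H x) = E H" if "H \<in> poly_over R" for H
  proof -
    let ?K = "SOME K. K \<in> poly_over R \<and> poly K x = poly H x"
    have K: "?K \<in> poly_over R \<and> poly ?K x = poly H x" using that by (metis (mono_tags, lifting) someI)
    then have "E (?K - H) = 0" using that by (intro EV cl(6)) auto
    then show ?thesis using Ediff[of ?K H] K that by (simp add: D'_def)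
  qed
  have "derivation_on R' D'"
    unfolding derivation_on_def
  proof (intro ballI)
    fix a b assume "a \<in> R'" "b \<in> R'"
    then obtain H K where HK: "H \<in> poly_over R" "K \<in> poly_over R" "a = poly H x" "b = poly K x"
      by (auto simp: R'_def)
    show "D' (a + b) = D' a + D' b \<and> D' (a * b) = a * D' b + D' a * b"
      using D'[OF cl(5)[OF HK(1,2)]] D'[OF cl(7)[OF HK(1,2)]] HK D'
      by (simp add: Eadd Emult)
  qed
  moreover have "D' r = D r" if "r \<in> R" for r
    using D'[OF cl(4)[OF that]] by (simp add: E_def map_poly_pCons D0 pderiv_pCons)
  ultimately show ?thesis
    using ring_subset_poly_over[OF R] subset_poly_over[OF R] mem_poly_over[OF R]
    by (intro exI[of _ R'] exI[of _ D']) (auto simp: R'_def)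
qed

lemma derivation_extend:
  fixes X :: "'f::field_char_0 set"
  assumes "finite X" and R: "ring_subset R" and D: "derivation_on R D"
  shows "\<exists>R' D'. ring_subset R' \<and> R \<subseteq> R' \<and> X \<subseteq> R' \<and> derivation_on R' D' \<and> (\<forall>r \<in> R. D' r = D r)"
  using assms(1)
proof induction
  case empty
  show ?case using R D by blast
next
  case (insert x X)
  then obtain R1 D1 where 1: "ring_subset R1" "R \<subseteq> R1" "X \<subseteq> R1" "derivation_on R1 D1"
    "\<forall>r \<in> R. D1 r = D r" by blast
  obtain R2 D2 where "ring_subset R2" "R1 \<subseteq> R2" "x \<in> R2" "derivation_on R2 D2"
    "\<forall>r \<in> R1. D2 r = D1 r" using derivation_extend_step[OF 1(1,4)] by blast
  then show ?case using 1 by (intro exI[of _ R2] exI[of _ D2]) auto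
qed

section \<open>Prime ideals avoiding a multiplicative set\<close>

definition prime_ideal_set :: "'s::comm_ring_1 set \<Rightarrow> bool" where
  "prime_ideal_set J \<longleftrightarrow> 0 \<in> J \<and> 1 \<notin> J \<and> (\<forall>a \<in> J. \<forall>b \<in> J. a + b \<in> J) \<and> (\<forall>a \<in> J. \<forall>s. s * a \<in> J)
     \<and> (\<forall>a b. a * b \<in> J \<longrightarrow> a \<in> J \<or> b \<in> J)"

text \<open>An ideal maximal among those that contain \<open>I\<close> and miss \<open>M\<close> is
  prime. It is used with \<open>M\<close> the nonzero elements of a subalgebra and with
  \<open>M\<close> the powers of one variable.\<close>

lemma exists_prime_ideal_avoiding:
  fixes I M :: "'s::comm_ring_1 set"
  assumes I: "0 \<in> I" "\<And>a b. a \<in> I \<Longrightarrow> b \<in> I \<Longrightarrow> a + b \<in> I" "\<And>a s. a \<in> I \<Longrightarrow> s * a \<in> I"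
    and M: "1 \<in> M" "\<And>a b. a \<in> M \<Longrightarrow> b \<in> M \<Longrightarrow> a * b \<in> M" and IM: "I \<inter> M = {}"
  shows "\<exists>J. prime_ideal_set J \<and> I \<subseteq> J \<and> J \<inter> M = {}"
proof -
  define ideals where "ideals = {J. I \<subseteq> J \<and> J \<inter> M = {} \<and> (\<forall>a \<in> J. \<forall>b \<in> J. a + b \<in> J) \<and> (\<forall>a \<in> J. \<forall>s::'s. s * a \<in> J)}"
  have ne: "ideals \<noteq> {}"
    using I IM unfolding ideals_def by blast
  have chain: "\<Union>C \<in> ideals" if C: "C \<noteq> {}" "subset.chain ideals C" for C
  proof -
    have sub: "C \<subseteq> ideals" and lin: "\<And>K L. K \<in> C \<Longrightarrow> L \<in> C \<Longrightarrow> K \<subseteq> L \<or> L \<subseteq> K"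
      using C(2) by (auto simp: subset.chain_def)
    have "a + b \<in> \<Union>C" if "a \<in> \<Union>C" "b \<in> \<Union>C" for a b
    proof -
      from that obtain K L where "K \<in> C" "L \<in> C" "a \<in> K" "b \<in> L" by auto
      then obtain N where "N \<in> C" "a \<in> N" "b \<in> N" using lin by blast
      then have "a + b \<in> N" using sub unfolding ideals_def by blast
      then show ?thesis using \<open>N \<in> C\<close> by blast
    qed
    moreover have "s * a \<in> \<Union>C" if "a \<in> \<Union>C" for a s :: 's
      using that sub unfolding ideals_def by blast
    moreover have "I \<subseteq> \<Union>C" "\<Union>C \<inter> M = {}"
      using C(1) sub unfolding ideals_def by blast+
    ultimately show "\<Union>C \<in> ideals"
      unfolding ideals_def by blast
  qed
  obtain J where J: "J \<in> ideals" and max: "\<And>K. K \<in> ideals \<Longrightarrow> J \<subseteq> K \<Longrightarrow> K = J"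
    using subset_Zorn_nonempty[OF ne chain] by metis
  have Ja: "a + b \<in> J" if "a \<in> J" "b \<in> J" for a b using J that by (auto simp: ideals_def)
  have Jm: "s * a \<in> J" if "a \<in> J" for a s using J that by (auto simp: ideals_def)
  have J0: "0 \<in> J" using J I(1) by (auto simp: ideals_def)
  \<comment> \<open>By maximality, the ideal generated by \<open>J\<close> and \<open>a\<close>
    meets \<open>M\<close>.\<close>
  have key: "\<exists>j s. j \<in> J \<and> j + s * a \<in> M" if "a \<notin> J" for a
  proof (rule ccontr)
    assume no: "\<not> ?thesis"
    define K where "K = {j + s * a |j s. j \<in> J}"
    have JK: "J \<subseteq> K"
    proof
      fix j assume "j \<in> J"
      then have "j = j + 0 * a \<and> j \<in> J" by simp
      then show "j \<in> K" unfolding K_def by blast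
    qed
    have "u + v \<in> K" if uv: "u \<in> K" "v \<in> K" for u v
    proof -
      obtain j s j' s' where "j \<in> J" "j' \<in> J" "u = j + s * a" "v = j' + s' * a"
        using uv unfolding K_def by auto
      then have "u + v = (j + j') + (s + s') * a" "j + j' \<in> J"
        using Ja by (auto simp: algebra_simps)
      then show ?thesis unfolding K_def by blast
    qed
    moreover have "t * u \<in> K" if u: "u \<in> K" for u t
    proof -
      obtain j s where "j \<in> J" "u = j + s * a" using u unfolding K_def by auto
      then have "t * u = t * j + (t * s) * a" "t * j \<in> J" using Jm by (auto simp: algebra_simps)
      then show ?thesis unfolding K_def by blast
    qed
    moreover have "K \<inter> M = {}" using no unfolding K_def by auto
    ultimately have "K \<in> ideals" using J JK unfolding ideals_def by blast
    then have "K = J" using max JK by blast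
    moreover have "a \<in> K"
    proof -
      have "a = 0 + 1 * a \<and> 0 \<in> J" using J0 by simp
      then show ?thesis unfolding K_def by blast
    qed
    ultimately show False using that by simp
  qed
  have "prime_ideal_set J"
    unfolding prime_ideal_set_def
  proof (intro conjI allI impI ballI)
    show "1 \<notin> J" using J M(1) by (auto simp: ideals_def)
    fix a b assume ab: "a * b \<in> J"
    show "a \<in> J \<or> b \<in> J"
    proof (rule ccontr)
      assume "\<not> (a \<in> J \<or> b \<in> J)"
      then obtain j s j' s' where 1: "j \<in> J" "j + s * a \<in> M" "j' \<in> J" "j' + s' * b \<in> M"
        using key by meson
      have "(j + s * a) * (j' + s' * b) = (j' + s' * b) * j + (s * a) * j' + (s * s') * (a * b)"
        by (simp add: algebra_simps)
      also have "\<dots> \<in> J"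
        using Ja[OF Ja[OF Jm[OF 1(1)] Jm[OF 1(3)]] Jm[OF ab]] by blast
      finally show False using M(2)[OF 1(2,4)] J by (auto simp: ideals_def)
    qed
  qed (use Ja Jm J0 in blast)+
  then show ?thesis using J unfolding ideals_def by blast
qed

section \<open>Extension of homomorphisms to an algebraically closed field\<close>

definition hom_on :: "'s::comm_ring_1 set \<Rightarrow> ('s \<Rightarrow> 'f::comm_ring_1) \<Rightarrow> bool" where
  "hom_on A \<theta> \<longleftrightarrow> \<theta> 1 = 1 \<and> (\<forall>a \<in> A. \<forall>b \<in> A. \<theta> (a + b) = \<theta> a + \<theta> b \<and> \<theta> (a * b) = \<theta> a * \<theta> b)"

lemma hom_onD:
  assumes "ring_subset A" "hom_on A \<theta>"
  shows "\<theta> 0 = 0" "\<theta> 1 = 1" "a \<in> A \<Longrightarrow> b \<in> A \<Longrightarrow> \<theta> (a + b) = \<theta> a + \<theta> b"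
    "a \<in> A \<Longrightarrow> b \<in> A \<Longrightarrow> \<theta> (a * b) = \<theta> a * \<theta> b"
    "a \<in> A \<Longrightarrow> b \<in> A \<Longrightarrow> \<theta> (a - b) = \<theta> a - \<theta> b"
proof -
  show z: "\<theta> 0 = 0"
    using ring_subsetD(1)[OF assms(1)] assms(2) unfolding hom_on_def by (metis add_cancel_right_left)
  show "\<theta> 1 = 1" and p: "\<And>a b. a \<in> A \<Longrightarrow> b \<in> A \<Longrightarrow> \<theta> (a + b) = \<theta> a + \<theta> b"
    and "a \<in> A \<Longrightarrow> b \<in> A \<Longrightarrow> \<theta> (a * b) = \<theta> a * \<theta> b"
    using assms(2) by (auto simp: hom_on_def)
  show "\<theta> (a - b) = \<theta> a - \<theta> b" if "a \<in> A" "b \<in> A"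
    using p[OF ring_subsetD(5)[OF assms(1) that] that(2)] by simp
qed

lemma hom_on_sum:
  assumes "ring_subset A" "hom_on A \<theta>" "\<And>i. i \<in> I \<Longrightarrow> f i \<in> A"
  shows "\<theta> (sum f I) = (\<Sum>i \<in> I. \<theta> (f i))"
  using assms(3)
proof (induction I rule: infinite_finite_induct)
  case (insert i I)
  then show ?case
    using hom_onD(3)[OF assms(1,2)] ring_subset_sum[OF assms(1), of I f] by auto
qed (auto simp: hom_onD[OF assms(1,2)])

lemma ring_subset_poly_over_set: "ring_subset A \<Longrightarrow> ring_subset (poly_over A)"
  using poly_over_closed[of A] by (auto simp: ring_subset_def)

context
  fixes A :: "'s::comm_ring_1 set" and \<theta> :: "'s \<Rightarrow> 'f::idom"
  assumes A: "ring_subset A" and \<theta>: "hom_on A \<theta>"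
begin

lemma hom_on_map_poly:
  shows "hom_on (poly_over A) (map_poly \<theta>)"
  unfolding hom_on_def
proof (intro conjI ballI)
  note h = hom_onD[OF A \<theta>]
  show "map_poly \<theta> 1 = 1" using h by (simp add: map_poly_1')
  fix H K assume HK: "H \<in> poly_over A" "K \<in> poly_over A"
  show "map_poly \<theta> (H + K) = map_poly \<theta> H + map_poly \<theta> K"
    using HK h by (intro poly_eqI) (simp add: coeff_map_poly poly_over_def)
  show "map_poly \<theta> (H * K) = map_poly \<theta> H * map_poly \<theta> K"
  proof (rule poly_eqI)
    fix n
    have "coeff (map_poly \<theta> (H * K)) n = \<theta> (\<Sum>i\<le>n. coeff H i * coeff K (n - i))"
      by (simp add: coeff_map_poly h coeff_mult)
    also have "\<dots> = (\<Sum>i\<le>n. \<theta> (coeff H i * coeff K (n - i)))"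
      using HK by (intro hom_on_sum[OF A \<theta>] ring_subsetD(6)[OF A]) (auto simp: poly_over_def)
    also have "\<dots> = coeff (map_poly \<theta> H * map_poly \<theta> K) n"
      using HK h by (simp add: coeff_map_poly coeff_mult poly_over_def)
    finally show "coeff (map_poly \<theta> (H * K)) n = coeff (map_poly \<theta> H * map_poly \<theta> K) n" .
  qed
qed

lemma eval_map_poly_hom_on:
  shows "H \<in> poly_over A \<Longrightarrow> K \<in> poly_over A \<Longrightarrow>
      poly (map_poly \<theta> (H + K)) t = poly (map_poly \<theta> H) t + poly (map_poly \<theta> K) t"
    and "H \<in> poly_over A \<Longrightarrow> K \<in> poly_over A \<Longrightarrow>
      poly (map_poly \<theta> (H - K)) t = poly (map_poly \<theta> H) t - poly (map_poly \<theta> K) t"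
    and "H \<in> poly_over A \<Longrightarrow> K \<in> poly_over A \<Longrightarrow>
      poly (map_poly \<theta> (H * K)) t = poly (map_poly \<theta> H) t * poly (map_poly \<theta> K) t"
  using hom_onD(3-5)[OF ring_subset_poly_over_set[OF A] hom_on_map_poly, of H K] by auto

end

text \<open>Polynomials over \<open>A\<close> are considered modulo those with all coefficients in the prime ideal
  \<open>J\<close>; \<open>strip\<close> provides representatives whose leading coefficient is nonzero modulo \<open>J\<close>.\<close>

lemma strip:
  assumes "ring_subset A" "0 \<in> J" "H \<in> poly_over A" "H \<notin> poly_over J"
  shows "\<exists>H' \<in> poly_over A. H - H' \<in> poly_over J \<and> H - H' \<in> poly_over A \<and> lead_coeff H' \<notin> J \<and> degree H' \<le> degree H"
  using assms(3,4)
proof (induction "degree H" arbitrary: H rule: less_induct)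
  case less
  show ?case
  proof (cases "lead_coeff H \<in> J")
    case False
    then show ?thesis using less.prems assms by (intro bexI[of _ H]) (auto simp: poly_over_def ring_subsetD)
  next
    case True
    let ?m = "monom (lead_coeff H) (degree H)"
    let ?K = "H - ?m"
    have m: "?m \<in> poly_over A" "?m \<in> poly_over J"
      using True assms(2) less.prems
      by (auto simp: poly_over_def ring_subsetD[OF assms(1)] coeff_monom)
    have K: "?K \<in> poly_over A" by (intro poly_over_closed[OF assms(1)] m less.prems)
    have cK: "coeff ?K n = (if n = degree H then 0 else coeff H n)" for n
      by (simp add: coeff_monom)
    have KJ: "?K \<notin> poly_over J"
    proof
      assume "?K \<in> poly_over J"
      then have "coeff H n \<in> J" for n
        using cK[of n] True unfolding poly_over_def by (cases "n = degree H") (auto dest!: spec[of _ n])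
      then show False using less.prems by (simp add: poly_over_def)
    qed
    moreover have "0 \<in> poly_over J" using assms(2) by (simp add: poly_over_def)
    ultimately have "?K \<noteq> 0" by metis
    moreover have "degree ?K \<le> degree H" using cK by (intro degree_le) (auto simp: coeff_eq_0)
    moreover have "coeff ?K (degree H) = 0" using cK by simp
    ultimately have lt: "degree ?K < degree H" using eq_zero_or_degree_less by blast
    obtain H' where H': "H' \<in> poly_over A" "?K - H' \<in> poly_over J" "?K - H' \<in> poly_over A"
      "lead_coeff H' \<notin> J" "degree H' \<le> degree ?K"
      using less.hyps[OF lt K KJ] by blast
    have "H' \<noteq> 0" using H'(4) assms(2) by auto
    have "H - H' = (?K - H') + ?m" by simp
    then have "H - H' \<in> poly_over A" using poly_over_closed(5)[OF assms(1) H'(3) m(1)] by metis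
    moreover have "H - H' \<in> poly_over J"
    proof -
      have "coeff (H - H') n \<in> J" for n
      proof (cases "n = degree H")
        case True
        then have "coeff H' n = 0" using H'(5) lt by (intro coeff_eq_0) simp
        then show ?thesis using True \<open>lead_coeff H \<in> J\<close> by simp
      next
        case False
        then have "coeff (H - H') n = coeff (?K - H') n" by (simp add: coeff_monom)
        then show ?thesis using H'(2) by (metis poly_over_coeff)
      qed
      then show ?thesis by (simp add: poly_over_def)
    qed
    ultimately show ?thesis using H' lt by (intro bexI[of _ H']) auto
  qed
qed

lemma pseudo_division_over:
  assumes A: "ring_subset A" and G: "G \<in> poly_over A" and H: "H \<in> poly_over A"
  shows "\<exists>s. \<exists>Q \<in> poly_over A. \<exists>K \<in> poly_over A.
    smult (lead_coeff G ^ s) H = Q * G + K \<and> (K = 0 \<or> degree K < degree G)"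
  using H
proof (induction "degree H" arbitrary: H rule: less_induct)
  case less
  note cl = poly_over_closed[OF A]
  show ?case
  proof (cases "degree H < degree G")
    case True
    then show ?thesis
      using less.prems by (intro exI[of _ 0] bexI[of _ 0] bexI[of _ H]) (auto intro: cl)
  next
    case False
    let ?H' = "cancel_lead G H" and ?m = "monom (lead_coeff H) (degree H - degree G)"
    have H': "?H' \<in> poly_over A" by (rule poly_over_cancel_lead[OF A G less.prems])
    have m: "?m \<in> poly_over A" using less.prems by (intro cl poly_over_coeff)
    have eq: "smult (lead_coeff G) H = ?H' + ?m * G" by (simp add: cancel_lead_def)
    have "degree G \<le> degree H" using False by simp
    from cancel_lead_degree[OF this] show ?thesis
    proof
      assume "?H' = 0"
      then show ?thesis
        using eq m by (intro exI[of _ 1] bexI[of _ ?m] bexI[of _ 0]) (auto intro: cl)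
    next
      assume "degree ?H' < degree H"
      from less.hyps[OF this H'] obtain s Q K where
        QK: "Q \<in> poly_over A" "K \<in> poly_over A" "smult (lead_coeff G ^ s) ?H' = Q * G + K"
          "K = 0 \<or> degree K < degree G" by blast
      have "smult (lead_coeff G ^ Suc s) H = smult (lead_coeff G ^ s) (smult (lead_coeff G) H)"
        by (simp add: mult.commute)
      also have "\<dots> = smult (lead_coeff G ^ s) ?H' + smult (lead_coeff G ^ s) ?m * G"
        unfolding eq by (simp add: smult_add_right)
      also have "\<dots> = (Q + smult (lead_coeff G ^ s) ?m) * G + K"
        unfolding QK(3) by (simp add: algebra_simps)
      finally show ?thesis
        using QK m G by (intro exI[of _ "Suc s"] bexI[of _ "Q + smult (lead_coeff G ^ s) ?m"] bexI[of _ K])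
          (auto intro!: cl ring_subsetD(7)[OF A] poly_over_coeff)
    qed
  qed
qed

text \<open>Modulo \<open>J\<close> the ring \<open>A'\<close> is a domain generated by
  \<open>x\<close> over the image of \<open>A\<close>. If \<open>x\<close> is transcendental there,
  all but finitely many values are admissible for \<open>x\<close>; if it is algebraic, the roots of
  a minimal equation are. The single element \<open>l'\<close> guards against what can go wrong, the
  loss of a leading coefficient and the vanishing of the image of \<open>l\<close>. It depends on
  \<open>l\<close> but not on \<open>\<theta>\<close>.\<close>

lemma hom_extend_step:
  fixes A J :: "'s::comm_ring_1 set" and x :: 's
  assumes A: "ring_subset A" and J: "prime_ideal_set J"
  defines "A' \<equiv> {poly H x |H. H \<in> poly_over A}"
  assumes l: "l \<in> A'" "l \<notin> J"
  shows "\<exists>l' \<in> A - J. \<forall>\<theta> :: 's \<Rightarrow> 'f::{alg_closed_field, field_char_0}.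
    hom_on A \<theta> \<and> (\<forall>a \<in> A \<inter> J. \<theta> a = 0) \<and> \<theta> l' \<noteq> 0 \<longrightarrow>
    (\<exists>\<theta>'. hom_on A' \<theta>' \<and> (\<forall>a \<in> A' \<inter> J. \<theta>' a = 0) \<and> (\<forall>a \<in> A. \<theta>' a = \<theta> a) \<and> \<theta>' l \<noteq> 0)"
proof -
  have J0: "0 \<in> J" and J1: "1 \<notin> J" and Jadd: "\<And>a b. a \<in> J \<Longrightarrow> b \<in> J \<Longrightarrow> a + b \<in> J"
    and Jm: "\<And>a s. a \<in> J \<Longrightarrow> s * a \<in> J" and Jp: "\<And>a b. a * b \<in> J \<Longrightarrow> a \<in> J \<or> b \<in> J"
    using J unfolding prime_ideal_set_def by blast+
  have Jm': "a * s \<in> J" if "a \<in> J" for a s using Jm[OF that, of s] by (simp add: mult.commute)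
  have Jneg: "- a \<in> J" if "a \<in> J" for a using Jm[OF that, of "-1"] by simp
  have Jdiff: "a - b \<in> J" if "a \<in> J" "b \<in> J" for a b using Jadd[OF that(1) Jneg[OF that(2)]] by simp
  have Jsum: "sum f I \<in> J" if "\<And>i. i \<in> I \<Longrightarrow> f i \<in> J" for f :: "nat \<Rightarrow> 's" and I
    using that by (induction I rule: infinite_finite_induct) (auto simp: J0 intro: Jadd)
  have Jpow: "a ^ n \<notin> J" if "a \<notin> J" for a n
    using that by (induction n) (auto simp: J1 dest: Jp)
  have J_poly: "poly H x \<in> J" if "H \<in> poly_over J" for H
    using that unfolding poly_altdef by (intro Jsum) (auto simp: poly_over_def intro: Jm')
  have zero_J: "0 \<in> poly_over J" using J0 by (simp add: poly_over_def)
  note cl = poly_over_closed[OF A]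
  obtain \<Lambda> where \<Lambda>: "\<Lambda> \<in> poly_over A" "poly \<Lambda> x = l" using l unfolding A'_def by auto
  have \<Lambda>J: "\<Lambda> \<notin> poly_over J" using J_poly \<Lambda> l by auto
  define N where "N = {H \<in> poly_over A. poly H x \<in> J}"
  \<comment> \<open>Sending \<open>x\<close> to \<open>t\<close> is consistent as soon as every
    relation of \<open>x\<close> modulo \<open>J\<close> holds at \<open>t\<close>.\<close>
  have extend: "\<exists>\<theta>'. hom_on A' \<theta>' \<and> (\<forall>a \<in> A' \<inter> J. \<theta>' a = 0) \<and> (\<forall>a \<in> A. \<theta>' a = \<theta> a) \<and>
      (\<forall>H \<in> poly_over A. \<theta>' (poly H x) = poly (map_poly \<theta> H) t)"
    if \<theta>: "hom_on A \<theta>" and N0: "\<And>H. H \<in> N \<Longrightarrow> poly (map_poly \<theta> H) t = 0"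
    for \<theta> :: "'s \<Rightarrow> 'f" and t
  proof -
    define \<theta>' where "\<theta>' z = poly (map_poly \<theta> (SOME H. H \<in> poly_over A \<and> poly H x = z)) t" for z
    note ev = eval_map_poly_hom_on[OF A \<theta>]
    have \<theta>': "\<theta>' (poly H x) = poly (map_poly \<theta> H) t" if "H \<in> poly_over A" for H
    proof -
      let ?K = "SOME K. K \<in> poly_over A \<and> poly K x = poly H x"
      have K: "?K \<in> poly_over A \<and> poly ?K x = poly H x"
        using that by (metis (mono_tags, lifting) someI)
      then have "?K - H \<in> N" using that J0 cl(6) by (simp add: N_def)
      from N0[OF this] show ?thesis using ev(2)[of ?K H t] K that by (simp add: \<theta>'_def)
    qed
    have "hom_on A' \<theta>'"
      unfolding hom_on_def
    proof (intro conjI ballI)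
      show "\<theta>' 1 = 1" using \<theta>'[OF cl(2)] hom_onD[OF A \<theta>] by (simp add: map_poly_1')
      fix a b assume "a \<in> A'" "b \<in> A'"
      then obtain H K where HK: "H \<in> poly_over A" "K \<in> poly_over A" "a = poly H x" "b = poly K x"
        by (auto simp: A'_def)
      show "\<theta>' (a + b) = \<theta>' a + \<theta>' b"
        using \<theta>'[OF cl(5)[OF HK(1,2)]] \<theta>'[OF HK(1)] \<theta>'[OF HK(2)] HK ev(1)[of H K t] by simp
      show "\<theta>' (a * b) = \<theta>' a * \<theta>' b"
        using \<theta>'[OF cl(7)[OF HK(1,2)]] \<theta>'[OF HK(1)] \<theta>'[OF HK(2)] HK ev(3)[of H K t] by simp
    qed
    moreover have "\<theta>' a = 0" if "a \<in> A' \<inter> J" for a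
      using that \<theta>' N0 by (auto simp: A'_def N_def)
    moreover have "\<theta>' a = \<theta> a" if "a \<in> A" for a
      using \<theta>'[OF cl(4)[OF that]] by (simp add: map_poly_pCons hom_onD(1)[OF A \<theta>])
    ultimately show ?thesis using \<theta>' by blast
  qed
  have map0: "map_poly \<theta> H = 0"
    if "hom_on A \<theta>" "\<forall>a \<in> A \<inter> J. \<theta> a = 0" "H \<in> poly_over A" "H \<in> poly_over J"
    for \<theta> :: "'s \<Rightarrow> 'f" and H
    using that hom_onD(1)[OF A that(1)] by (intro poly_eqI) (auto simp: coeff_map_poly poly_over_def)
  show ?thesis
  proof (cases "N \<subseteq> poly_over J")
    \<comment> \<open>Transcendental case: a relation has all coefficients in \<open>J\<close> and
      imposes no condition on \<open>t\<close>. A coefficient of \<open>\<Lambda>\<close> outside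
      \<open>J\<close> keeps the polynomial representing \<open>l\<close> nonzero.\<close>
    case True
    obtain k where k: "coeff \<Lambda> k \<notin> J" using \<Lambda>J by (auto simp: poly_over_def)
    show ?thesis
    proof (rule bexI[of _ "coeff \<Lambda> k"], intro allI impI, elim conjE)
      fix \<theta> :: "'s \<Rightarrow> 'f"
      assume \<theta>: "hom_on A \<theta>" "\<forall>a \<in> A \<inter> J. \<theta> a = 0" "\<theta> (coeff \<Lambda> k) \<noteq> 0"
      have "coeff (map_poly \<theta> \<Lambda>) k \<noteq> 0"
        using \<theta> hom_onD(1)[OF A \<theta>(1)] by (simp add: coeff_map_poly)
      then have "map_poly \<theta> \<Lambda> \<noteq> 0" by auto
      then have "finite {t. poly (map_poly \<theta> \<Lambda>) t = 0}" by (rule poly_roots_finite)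
      then obtain t where t: "poly (map_poly \<theta> \<Lambda>) t \<noteq> 0"
        using ex_new_if_finite[OF infinite_UNIV_char_0] by blast
      have "poly (map_poly \<theta> H) t = 0" if "H \<in> N" for H
        using map0[OF \<theta>(1,2), of H] that True by (auto simp: N_def)
      from extend[OF \<theta>(1) this] show "\<exists>\<theta>'. hom_on A' \<theta>' \<and> (\<forall>a \<in> A' \<inter> J. \<theta>' a = 0) \<and> (\<forall>a \<in> A. \<theta>' a = \<theta> a) \<and> \<theta>' l \<noteq> 0"
        using t \<Lambda> by metis
    qed (use k \<Lambda> in \<open>auto intro: poly_over_coeff\<close>)
  next
    case False
    define G0 where "G0 = arg_min degree (\<lambda>G. G \<in> N - poly_over J)"
    have G0: "G0 \<in> N - poly_over J" and Gmin0: "\<And>K. K \<in> N - poly_over J \<Longrightarrow> degree G0 \<le> degree K"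
      using False arg_min_nat_lemma[of "\<lambda>G. G \<in> N - poly_over J" _ degree] unfolding G0_def by auto
    \<comment> \<open>Algebraic case: a relation of least degree modulo \<open>J\<close>, with
      leading terms in \<open>J\<close> removed, so that its leading coefficient can be required to
      survive under \<open>\<theta>\<close>.\<close>
    obtain G where G: "G \<in> poly_over A" "G0 - G \<in> poly_over J" "lead_coeff G \<notin> J" "degree G \<le> degree G0"
      using strip[OF A J0, of G0] G0 by (auto simp: N_def)
    have "poly G x \<in> J" using Jdiff[of "poly G0 x" "poly (G0 - G) x"] J_poly[OF G(2)] G0 by (simp add: N_def)
    then have GN: "G \<in> N" using G by (simp add: N_def)
    have GJ: "G \<notin> poly_over J" using G(3) by (auto simp: poly_over_def)
    have Gmin: "degree G \<le> degree K" if "K \<in> N" "K \<notin> poly_over J" for K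
      using Gmin0[of K] G(4) that by simp
    have dG: "degree G > 0"
    proof (rule ccontr)
      assume "\<not> ?thesis"
      then obtain g where "G = [:g:]" by (metis degree_eq_zeroE gr0I)
      then show False using GN G(3) by (simp add: N_def)
    qed
    \<comment> \<open>The polynomials whose value at \<open>x\<close> is a multiple of
      \<open>l\<close> modulo \<open>J\<close>.\<close>
    define I where "I = {H \<in> poly_over A. \<exists>U \<in> poly_over A. H - U * \<Lambda> \<in> N}"
    have I_N: "H \<in> I" if "H \<in> N" for H
      using that cl(1) by (auto simp: I_def N_def intro!: bexI[of _ 0])
    have N_comb: "H - U * K \<in> N" if "H \<in> N" "K \<in> N" "U \<in> poly_over A" for H K U
      using that by (auto simp: N_def intro!: cl Jdiff Jm)
    have N_smult: "smult a H \<in> N" if "H \<in> N" "a \<in> A" for a H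
      using that by (auto simp: N_def intro!: cl Jm)
    have I_comb: "smult a H - Q * K \<in> I" if HK: "H \<in> I" "K \<in> I" "Q \<in> poly_over A" "a \<in> A" for H K Q a
    proof -
      obtain U W where UW: "U \<in> poly_over A" "W \<in> poly_over A" "H - U * \<Lambda> \<in> N" "K - W * \<Lambda> \<in> N"
        using HK unfolding I_def by blast
      have "(smult a H - Q * K) - (smult a U - Q * W) * \<Lambda> = smult a (H - U * \<Lambda>) - Q * (K - W * \<Lambda>)"
        by (simp add: algebra_simps smult_diff_right)
      moreover have "smult a (H - U * \<Lambda>) - Q * (K - W * \<Lambda>) \<in> N"
        by (intro N_comb N_smult UW HK)
      ultimately show ?thesis
        using HK UW unfolding I_def by (auto intro!: cl bexI[of _ "smult a U - Q * W"])
    qed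
    have \<Lambda>I: "\<Lambda> \<in> I" using \<Lambda> cl(2) J0 by (auto simp: I_def N_def cl(1) intro!: bexI[of _ 1])
    define \<rho>0 where "\<rho>0 = arg_min degree (\<lambda>G. G \<in> I - poly_over J)"
    have \<rho>0: "\<rho>0 \<in> I - poly_over J" and \<rho>min0: "\<And>K. K \<in> I - poly_over J \<Longrightarrow> degree \<rho>0 \<le> degree K"
      using \<Lambda>I \<Lambda>J arg_min_nat_lemma[of "\<lambda>G. G \<in> I - poly_over J" _ degree] unfolding \<rho>0_def by auto
    obtain \<rho> where \<rho>: "\<rho> \<in> poly_over A" "\<rho>0 - \<rho> \<in> poly_over J" "\<rho>0 - \<rho> \<in> poly_over A" "lead_coeff \<rho> \<notin> J"
      "degree \<rho> \<le> degree \<rho>0"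
      using strip[OF A J0, of \<rho>0] \<rho>0 by (auto simp: I_def)
    have \<rho>N: "\<rho>0 - \<rho> \<in> N" using \<rho>(3) J_poly[OF \<rho>(2)] by (simp add: N_def)
    from I_comb[of \<rho>0 "\<rho>0 - \<rho>" 1 1] have \<rho>I: "\<rho> \<in> I"
      using \<rho>0 I_N[OF \<rho>N] cl(2) ring_subsetD(2)[OF A] by simp
    have \<rho>min: "degree \<rho> \<le> degree K" if "K \<in> I" "K \<notin> poly_over J" for K
      using \<rho>min0[of K] \<rho>(5) that by simp
    have div: "\<exists>s. \<exists>Q \<in> poly_over A. \<exists>K \<in> poly_over A.
        smult (lead_coeff \<rho> ^ s) H = Q * \<rho> + K \<and> K \<in> poly_over J" if H: "H \<in> I" for H
    proof -
      have HA: "H \<in> poly_over A" using H by (simp add: I_def)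
      obtain s Q K where QK: "Q \<in> poly_over A" "K \<in> poly_over A"
        "smult (lead_coeff \<rho> ^ s) H = Q * \<rho> + K" "K = 0 \<or> degree K < degree \<rho>"
        using pseudo_division_over[OF A \<rho>(1) HA] by blast
      have "K = smult (lead_coeff \<rho> ^ s) H - Q * \<rho>" using QK(3) by simp
      then have "K \<in> I"
        using I_comb[OF H \<rho>I QK(1)] ring_subsetD(7)[OF A poly_over_coeff[OF \<rho>(1)]] by simp
      then have "K \<in> poly_over J"
        using QK(4) \<rho>min[of K] zero_J by fastforce
      then show ?thesis using QK by blast
    qed
    \<comment> \<open>Modulo \<open>J\<close>, and up to powers of its leading coefficient,
      \<open>\<rho>\<close> divides both \<open>\<Lambda>\<close> and \<open>G\<close>. Its value at
      \<open>x\<close> lies outside \<open>J\<close> because \<open>l\<close> does, so the cofactor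
      in \<open>G\<close> is itself a relation of \<open>x\<close>. By minimality of
      \<open>G\<close> the cofactor has no smaller degree, which makes \<open>\<rho>\<close>
      constant.\<close>
    have "degree \<rho> = 0"
    proof (rule ccontr)
      assume pos: "degree \<rho> \<noteq> 0"
      obtain s Q K where 1: "Q \<in> poly_over A" "K \<in> poly_over A" "K \<in> poly_over J"
        "smult (lead_coeff \<rho> ^ s) \<Lambda> = Q * \<rho> + K" using div[OF \<Lambda>I] by blast
      obtain s' Q' K' where 2: "Q' \<in> poly_over A" "K' \<in> poly_over A" "K' \<in> poly_over J"
        "smult (lead_coeff \<rho> ^ s') G = Q' * \<rho> + K'" using div[OF I_N[OF GN]] by blast
      have "poly \<rho> x \<notin> J"
      proof
        assume "poly \<rho> x \<in> J"
        then have "poly (Q * \<rho> + K) x \<in> J" using J_poly[OF 1(3)] by (auto intro: Jadd Jm)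
        then have "lead_coeff \<rho> ^ s * l \<in> J" using 1(4) \<Lambda>(2) by (metis poly_smult)
        then show False using Jp Jpow[OF \<rho>(4)] l(2) by blast
      qed
      moreover have "poly Q' x * poly \<rho> x \<in> J"
      proof -
        have "poly (Q' * \<rho>) x = lead_coeff \<rho> ^ s' * poly G x - poly K' x"
          using arg_cong[OF 2(4), of "\<lambda>p. poly p x"] by simp
        then show ?thesis using GN J_poly[OF 2(3)] by (auto simp: N_def intro: Jdiff Jm)
      qed
      ultimately have Q'N: "Q' \<in> N" using Jp 2(1) by (auto simp: N_def)
      have lG: "lead_coeff \<rho> ^ s' * lead_coeff G \<notin> J" using Jp Jpow[OF \<rho>(4)] G(3) by blast
      have Q'J: "Q' \<notin> poly_over J"
      proof
        assume "Q' \<in> poly_over J"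
        then have "coeff (Q' * \<rho> + K') (degree G) \<in> J"
          using 2(3) by (auto simp: coeff_mult poly_over_def intro!: Jadd Jsum Jm')
        then show False using lG 2(4) by (metis coeff_smult)
      qed
      obtain Q where Q: "Q \<in> poly_over A" "Q' - Q \<in> poly_over J" "lead_coeff Q \<notin> J"
        using strip[OF A J0 2(1) Q'J] by blast
      have "poly Q x \<in> J" using Jdiff[of "poly Q' x" "poly (Q' - Q) x"] J_poly[OF Q(2)] Q'N by (simp add: N_def)
      then have QN: "Q \<in> N" using Q by (simp add: N_def)
      have "Q \<notin> poly_over J" using Q(3) by (auto simp: poly_over_def)
      from Gmin[OF QN this] have "degree G \<le> degree Q" .
      moreover have "degree Q + degree \<rho> \<le> degree G"
      proof (rule ccontr)
        assume "\<not> ?thesis"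
        then have "coeff G (degree Q + degree \<rho>) = 0" by (intro coeff_eq_0) simp
        then have "coeff (Q' * \<rho> + K') (degree Q + degree \<rho>) = 0" using 2(4) by (metis coeff_smult mult_zero_right)
        moreover have "Q' * \<rho> + K' = Q * \<rho> + ((Q' - Q) * \<rho> + K')" by (simp add: algebra_simps)
        ultimately have "coeff (Q * \<rho> + ((Q' - Q) * \<rho> + K')) (degree Q + degree \<rho>) = 0"
          by simp
        then have "lead_coeff Q * lead_coeff \<rho> + coeff ((Q' - Q) * \<rho> + K') (degree Q + degree \<rho>) = 0"
          by (simp only: coeff_add coeff_mult_degree_sum)
        then have "lead_coeff Q * lead_coeff \<rho> = - coeff ((Q' - Q) * \<rho> + K') (degree Q + degree \<rho>)"
          by (simp only: eq_neg_iff_add_eq_0)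
        moreover have "coeff ((Q' - Q) * \<rho> + K') (degree Q + degree \<rho>) \<in> J"
          unfolding coeff_add coeff_mult[of "Q' - Q"]
          using poly_over_coeff[OF Q(2)] poly_over_coeff[OF 2(3)] by (intro Jadd Jsum Jm')
        ultimately show False using Jneg Jp Q(3) \<rho>(4) by metis
      qed
      ultimately show False using pos by simp
    qed
    then obtain r where r: "\<rho> = [:r:]" by (metis degree_eq_zeroE)
    have rA: "r \<in> A" "r \<notin> J" using \<rho>(1,4) poly_over_coeff[of \<rho> A 0] r by auto
    obtain U where U: "U \<in> poly_over A" "\<rho> - U * \<Lambda> \<in> N" using \<rho>I by (auto simp: I_def)
    \<comment> \<open>The factor \<open>r\<close> lies in \<open>A\<close> and is a multiple of
      \<open>l\<close> modulo \<open>J\<close>, so the extension cannot kill \<open>l\<close> when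
      \<open>\<theta>\<close> does not kill \<open>r\<close>. The other factor preserves the degree
      of \<open>G\<close>, hence the existence of a root.\<close>
    let ?l = "lead_coeff G * r"
    show ?thesis
    proof (rule bexI[of _ ?l], intro allI impI, elim conjE)
      fix \<theta> :: "'s \<Rightarrow> 'f"
      assume \<theta>: "hom_on A \<theta>" "\<forall>a \<in> A \<inter> J. \<theta> a = 0" "\<theta> ?l \<noteq> 0"
      note h = hom_onD[OF A \<theta>(1)] and ev = eval_map_poly_hom_on[OF A \<theta>(1)]
      have ne: "\<theta> (lead_coeff G) \<noteq> 0" "\<theta> r \<noteq> 0"
        using \<theta>(3) h(4)[OF poly_over_coeff[OF G(1)] rA(1)] by auto
      have "degree (map_poly \<theta> G) = degree G" 
        using ne map_poly_degree_leq[of \<theta> G] le_degree[of "map_poly \<theta> G" "degree G"]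
        by (simp add: coeff_map_poly h(1))
      then obtain t where t: "poly (map_poly \<theta> G) t = 0"
        using alg_closed_imp_poly_has_root[of "map_poly \<theta> G"] dG by auto
      have N0: "poly (map_poly \<theta> H) t = 0" if "H \<in> N" for H
      proof (cases "H \<in> poly_over J")
        case True
        then show ?thesis using map0[OF \<theta>(1,2)] that by (simp add: N_def)
      next
        case False
        have HA: "H \<in> poly_over A" using that by (simp add: N_def)
        obtain s Q K where QK: "Q \<in> poly_over A" "K \<in> poly_over A"
          "smult (lead_coeff G ^ s) H = Q * G + K" "K = 0 \<or> degree K < degree G"
          using pseudo_division_over[OF A G(1) HA] by blast
        have lA: "lead_coeff G ^ s \<in> A" by (intro ring_subsetD(7)[OF A] poly_over_coeff[OF G(1)])
        have "K = smult (lead_coeff G ^ s) H - Q * G" using QK(3) by simp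
        then have "K \<in> N" using N_comb[OF N_smult[OF that lA] GN QK(1)] by simp
        then have KJ: "K \<in> poly_over J" using QK(4) Gmin[of K] zero_J by fastforce
        have "poly (map_poly \<theta> ([:lead_coeff G ^ s:] * H)) t = poly (map_poly \<theta> (Q * G + K)) t"
          using QK(3) by simp
        then have "\<theta> (lead_coeff G ^ s) * poly (map_poly \<theta> H) t = 0"
          using ev(3)[OF cl(4)[OF lA] HA] ev(1)[OF cl(7)[OF QK(1) G(1)] QK(2)] ev(3)[OF QK(1) G(1)]
            t map0[OF \<theta>(1,2) QK(2) KJ] by (simp add: map_poly_pCons h(1))
        moreover have "\<theta> (lead_coeff G ^ s) = \<theta> (lead_coeff G) ^ s"
          using poly_over_coeff[OF G(1), of "degree G"]
          by (induction s) (simp_all add: h ring_subsetD[OF A])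
        ultimately show ?thesis using ne(1) by simp
      qed
      obtain \<theta>' where \<theta>': "hom_on A' \<theta>'" "\<forall>a \<in> A' \<inter> J. \<theta>' a = 0" "\<forall>a \<in> A. \<theta>' a = \<theta> a"
        "\<forall>H \<in> poly_over A. \<theta>' (poly H x) = poly (map_poly \<theta> H) t"
        using extend[OF \<theta>(1) N0] by blast
      have "poly (map_poly \<theta> \<rho>) t = poly (map_poly \<theta> U) t * poly (map_poly \<theta> \<Lambda>) t"
        using N0[OF U(2)] ev(2)[OF \<rho>(1) cl(7)[OF U(1) \<Lambda>(1)]] ev(3)[OF U(1) \<Lambda>(1)] by simp
      then have "\<theta>' l \<noteq> 0" using \<theta>'(4) \<Lambda> ne(2) r by (auto simp: map_poly_pCons h(1))
      then show "\<exists>\<theta>'. hom_on A' \<theta>' \<and> (\<forall>a \<in> A' \<inter> J. \<theta>' a = 0) \<and> (\<forall>a \<in> A. \<theta>' a = \<theta> a) \<and> \<theta>' l \<noteq> 0"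
        using \<theta>' by blast
    qed (use G(3) rA Jp in \<open>auto intro!: ring_subsetD(6)[OF A] poly_over_coeff[OF G(1)]\<close>)
  qed
qed

lemma hom_extend:
  fixes A J V :: "'s::comm_ring_1 set"
  assumes "finite V" and A: "ring_subset A" and J: "prime_ideal_set J"
  shows "\<exists>A'. ring_subset A' \<and> A \<subseteq> A' \<and> V \<subseteq> A' \<and> (\<forall>l \<in> A' - J. \<exists>l' \<in> A - J.
    \<forall>\<theta> :: 's \<Rightarrow> 'f::{alg_closed_field, field_char_0}.
    hom_on A \<theta> \<and> (\<forall>a \<in> A \<inter> J. \<theta> a = 0) \<and> \<theta> l' \<noteq> 0 \<longrightarrow>
    (\<exists>\<theta>'. hom_on A' \<theta>' \<and> (\<forall>a \<in> A' \<inter> J. \<theta>' a = 0) \<and> (\<forall>a \<in> A. \<theta>' a = \<theta> a) \<and> \<theta>' l \<noteq> 0))"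
  using assms(1)
proof induction
  case empty
  then show ?case using A by (intro exI[of _ A]) blast
next
  case (insert x V)
  then obtain B where B: "ring_subset B" "A \<subseteq> B" "V \<subseteq> B" and ext: "\<forall>l \<in> B - J. \<exists>l' \<in> A - J.
    \<forall>\<theta> :: 's \<Rightarrow> 'f::{alg_closed_field, field_char_0}.
    hom_on A \<theta> \<and> (\<forall>a \<in> A \<inter> J. \<theta> a = 0) \<and> \<theta> l' \<noteq> 0 \<longrightarrow>
    (\<exists>\<theta>'. hom_on B \<theta>' \<and> (\<forall>a \<in> B \<inter> J. \<theta>' a = 0) \<and> (\<forall>a \<in> A. \<theta>' a = \<theta> a) \<and> \<theta>' l \<noteq> 0)"
    by blast
  let ?C = "{poly H x |H. H \<in> poly_over B}"
  have BC: "B \<subseteq> ?C" by (rule subset_poly_over[OF B(1)])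
  show ?case
  proof (intro exI[of _ ?C] conjI ballI)
    show "ring_subset ?C" by (rule ring_subset_poly_over[OF B(1)])
    show "A \<subseteq> ?C" using B(2) BC by blast
    show "insert x V \<subseteq> ?C" using BC B(3) mem_poly_over[OF B(1), of x] by blast
    fix l assume l: "l \<in> ?C - J"
    then obtain \<mu> where \<mu>: "\<mu> \<in> B - J" and 1: "\<forall>\<theta> :: 's \<Rightarrow> 'f.
      hom_on B \<theta> \<and> (\<forall>a \<in> B \<inter> J. \<theta> a = 0) \<and> \<theta> \<mu> \<noteq> 0 \<longrightarrow>
      (\<exists>\<theta>'. hom_on ?C \<theta>' \<and> (\<forall>a \<in> ?C \<inter> J. \<theta>' a = 0) \<and> (\<forall>a \<in> B. \<theta>' a = \<theta> a) \<and> \<theta>' l \<noteq> 0)"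
      using hom_extend_step[OF B(1) J, of l x, where 'f='f] by blast
    obtain \<nu> where \<nu>: "\<nu> \<in> A - J" and 2: "\<forall>\<theta> :: 's \<Rightarrow> 'f.
      hom_on A \<theta> \<and> (\<forall>a \<in> A \<inter> J. \<theta> a = 0) \<and> \<theta> \<nu> \<noteq> 0 \<longrightarrow>
      (\<exists>\<theta>'. hom_on B \<theta>' \<and> (\<forall>a \<in> B \<inter> J. \<theta>' a = 0) \<and> (\<forall>a \<in> A. \<theta>' a = \<theta> a) \<and> \<theta>' \<mu> \<noteq> 0)"
      using ext \<mu> by blast
    show "\<exists>l' \<in> A - J. \<forall>\<theta> :: 's \<Rightarrow> 'f. hom_on A \<theta> \<and> (\<forall>a \<in> A \<inter> J. \<theta> a = 0) \<and> \<theta> l' \<noteq> 0 \<longrightarrow>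
      (\<exists>\<theta>'. hom_on ?C \<theta>' \<and> (\<forall>a \<in> ?C \<inter> J. \<theta>' a = 0) \<and> (\<forall>a \<in> A. \<theta>' a = \<theta> a) \<and> \<theta>' l \<noteq> 0)"
    proof (rule bexI[OF _ \<nu>], intro allI impI)
      fix \<theta> :: "'s \<Rightarrow> 'f"
      assume "hom_on A \<theta> \<and> (\<forall>a \<in> A \<inter> J. \<theta> a = 0) \<and> \<theta> \<nu> \<noteq> 0"
      then obtain \<theta>1 where 3: "hom_on B \<theta>1" "\<forall>a \<in> B \<inter> J. \<theta>1 a = 0" "\<forall>a \<in> A. \<theta>1 a = \<theta> a" "\<theta>1 \<mu> \<noteq> 0"
        using 2 by blast
      then obtain \<theta>2 where "hom_on ?C \<theta>2" "\<forall>a \<in> ?C \<inter> J. \<theta>2 a = 0" "\<forall>a \<in> B. \<theta>2 a = \<theta>1 a" "\<theta>2 l \<noteq> 0"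
        using 1 by blast
      then show "\<exists>\<theta>'. hom_on ?C \<theta>' \<and> (\<forall>a \<in> ?C \<inter> J. \<theta>' a = 0) \<and> (\<forall>a \<in> A. \<theta>' a = \<theta> a) \<and> \<theta>' l \<noteq> 0"
        using 3 B(2) by (intro exI[of _ \<theta>2]) auto
    qed
  qed
qed

section \<open>The Jacobian criterion\<close>

text \<open>The Cauchy-Binet formula before terms are collected: the sum runs over all maps from the
  rows to \<open>B\<close>, repetitions included, so that no ordering of \<open>B\<close> is
  involved.\<close>

lemma det_sum_prod_expand:
  fixes C :: "nat \<Rightarrow> 'b \<Rightarrow> 'a::comm_ring_1"
  assumes B: "finite B"
  shows "det (mat i i (\<lambda>(r, j). \<Sum>b \<in> B. C r b * F b j))
    = (\<Sum>\<beta> \<in> {0..<i} \<rightarrow>\<^sub>E B. (\<Prod>r = 0..<i. C r (\<beta> r)) * det (mat i i (\<lambda>(r, j). F (\<beta> r) j)))"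
proof -
  let ?P = "{p. p permutes {0..<i}}"
  have "det (mat i i (\<lambda>(r, j). \<Sum>b \<in> B. C r b * F b j))
    = (\<Sum>p \<in> ?P. signof p * (\<Prod>r = 0..<i. \<Sum>b \<in> B. C r b * F b (p r)))"
    by (subst det_def'[of _ i]) (auto intro!: sum.cong prod.cong arg_cong2[where f="(*)"] simp: permutes_in_image)
  also have "\<dots> = (\<Sum>p \<in> ?P. signof p * (\<Sum>\<beta> \<in> {0..<i} \<rightarrow>\<^sub>E B. \<Prod>r = 0..<i. C r (\<beta> r) * F (\<beta> r) (p r)))"
    by (intro sum.cong arg_cong2[where f="(*)"] refl prod_sum_PiE) (auto simp: B)
  also have "\<dots> = (\<Sum>\<beta> \<in> {0..<i} \<rightarrow>\<^sub>E B. \<Sum>p \<in> ?P. signof p * ((\<Prod>r = 0..<i. C r (\<beta> r)) * (\<Prod>r = 0..<i. F (\<beta> r) (p r))))"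
    by (subst sum.swap) (simp add: sum_distrib_left prod.distrib)
  also have "\<dots> = (\<Sum>\<beta> \<in> {0..<i} \<rightarrow>\<^sub>E B. (\<Prod>r = 0..<i. C r (\<beta> r)) * (\<Sum>p \<in> ?P. signof p * (\<Prod>r = 0..<i. F (\<beta> r) (p r))))"
    by (simp add: sum_distrib_left mult_ac)
  also have "\<dots> = (\<Sum>\<beta> \<in> {0..<i} \<rightarrow>\<^sub>E B. (\<Prod>r = 0..<i. C r (\<beta> r)) * det (mat i i (\<lambda>(r, j). F (\<beta> r) j)))"
    by (intro sum.cong refl arg_cong2[where f="(*)"], subst det_def'[of _ i])
      (auto intro!: sum.cong prod.cong arg_cong2[where f="(*)"] simp: permutes_in_image)
  finally show ?thesis .
qed

lemma det_replace_col_smult: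
  assumes N: "N \<in> carrier_mat n n" and w: "w \<in> carrier_vec n" and k: "k < n"
  shows "det (replace_col N (a \<cdot>\<^sub>v w) k) = a * det (replace_col N w k)"
proof -
  have c: "cofactor (replace_col N (a \<cdot>\<^sub>v w) k) r k = cofactor (replace_col N w k) r k" for r
    unfolding cofactor_def
    by (intro arg_cong2[where f="(*)"] refl arg_cong[where f=det])
      (auto simp: mat_delete_def replace_col_def intro!: eq_matI)
  have d: "replace_col N v k \<in> carrier_mat n n" for v
    using N by (auto simp: replace_col_def)
  show ?thesis
    using N w k by (simp add: laplace_expansion_column[OF d k] c sum_distrib_left mult.assoc)
      (auto simp: replace_col_def intro!: sum.cong)
qed

lemma det_unit_rows_except:
  fixes K :: "'a::field mat"
  assumes K: "K \<in> carrier_mat n n" and k: "k < n"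
    and rows: "\<And>r j. r < n \<Longrightarrow> j < n \<Longrightarrow> r \<noteq> k \<Longrightarrow> K $$ (r, j) = (if r = j then 1 else 0)"
    and nz: "K $$ (k, k) \<noteq> 0"
  shows "det K \<noteq> 0"
proof
  assume "det K = 0"
  then obtain v where v: "v \<in> carrier_vec n" "v \<noteq> 0\<^sub>v n" "K *\<^sub>v v = 0\<^sub>v n"
    using det_0_iff_vec_prod_zero_field[OF K] by auto
  have e: "(\<Sum>j = 0..<n. K $$ (r, j) * v $ j) = 0" if "r < n" for r
    using arg_cong[OF v(3), of "\<lambda>w. w $ r"] K v(1) that by (simp add: scalar_prod_def)
  have z: "v $ r = 0" if "r < n" "r \<noteq> k" for r
  proof -
    have "(\<Sum>j = 0..<n. K $$ (r, j) * v $ j) = (\<Sum>j = 0..<n. if r = j then v $ j else 0)"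
      using rows that by (intro sum.cong) auto
    then show ?thesis using e[OF that(1)] that by simp
  qed
  have "(\<Sum>j = 0..<n. K $$ (k, j) * v $ j) = (\<Sum>j = 0..<n. if k = j then K $$ (k, k) * v $ k else 0)"
    using z by (intro sum.cong) auto
  then have "v $ k = 0" using e[OF k] k nz by simp
  then have "v $ r = 0" if "r < n" for r using z that by blast
  then have "v = 0\<^sub>v n" using v(1) by (intro eq_vecI) auto
  then show False using v(2) by simp
qed

section \<open>A large algebraically closed field\<close>

instance fract :: ("{idom, ring_char_0}") field_char_0
proof
  show "inj (of_nat :: nat \<Rightarrow> 'a fract)"
  proof (rule injI)
    fix m n assume "of_nat m = (of_nat n :: 'a fract)"
    then have "to_fract (of_nat m :: 'a) = to_fract (of_nat n)"
      by (simp add: to_fract_def Fract_of_nat_eq[symmetric])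
    then show "m = n" by (simp add: to_fract_def eq_fract)
  qed
qed

text \<open>Countably many variables leave room for every finite set of variables, so the field does
  not depend on the polynomial ring to be embedded.\<close>

type_synonym 'k generic_field = "(nat, 'k) mpoly fract alg_closure"

lemma exists_embedding:
  assumes B: "finite (B :: 'x set)"
  shows "\<exists>\<iota> :: ('x, 'k::field_char_0) mpoly \<Rightarrow> 'k generic_field.
    comm_ring_hom \<iota> \<and> (\<forall>p \<in> polys B. \<iota> p = 0 \<longrightarrow> p = 0)"
proof -
  obtain idx :: "'x \<Rightarrow> nat" where idx: "inj_on idx B"
    using finite_imp_inj_to_nat_seg[OF B] by auto
  define \<phi> where "\<phi> = eval_in (Const :: 'k \<Rightarrow> (nat, 'k) mpoly) (\<lambda>x. Var (idx x))"
  define \<psi> where "\<psi> = eval_in (Const :: 'k \<Rightarrow> ('x, 'k) mpoly) (\<lambda>n. Var (inv_into B idx n))"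
  define e where "e = (\<lambda>q :: (nat, 'k) mpoly. to_ac (to_fract q))"
  have \<phi>: "comm_ring_hom \<phi>" and \<psi>: "comm_ring_hom \<psi>"
    unfolding \<phi>_def \<psi>_def by (intro comm_ring_hom_eval_in comm_ring_hom_Const)+
  have e: "comm_ring_hom e" by unfold_locales (simp_all add: e_def)
  interpret \<psi>: comm_ring_hom \<psi> by (rule \<psi>)
  have "p = 0" if p: "p \<in> polys B" "e (\<phi> p) = 0" for p
  proof -
    have "\<phi> p = 0" using p(2) by (simp add: e_def)
    moreover have "\<psi> (\<phi> p) = p"
      by (rule eval_in_polys_eqI[OF comm_ring_hom_compose[OF \<psi> \<phi>] comm_ring_hom_id p(1)])
        (simp_all add: \<phi>_def \<psi>_def eval_in_Const[OF comm_ring_hom_Const] eval_in_Var[OF comm_ring_hom_Const] idx)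
    ultimately show ?thesis by simp
  qed
  then show ?thesis
    using comm_ring_hom_compose[OF e \<phi>] by (intro exI[of _ "\<lambda>p. e (\<phi> p)"]) auto
qed

text \<open>Independence makes the algebra generated by the \<open>f j\<close> a polynomial ring in
  them, on which differentiation with respect to the generator with number \<open>r\<close> is well
  defined. It is carried over to a field by \<open>\<iota>\<close> so that it can be extended to the
  variables.\<close>

lemma subalgebra_derivation:
  fixes \<iota> :: "('x, 'k::comm_ring_1) mpoly \<Rightarrow> 'f::comm_ring_1"
  assumes \<iota>: "comm_ring_hom \<iota>" and inj: "\<And>p. p \<in> polys B \<Longrightarrow> \<iota> p = 0 \<Longrightarrow> p = 0"
    and f: "\<And>j. j \<in> T \<Longrightarrow> f j \<in> polys B"
    and ind: "\<And>P. P \<in> polys T \<Longrightarrow> eval_in Const f P = 0 \<Longrightarrow> P = (0 :: (nat, 'k) mpoly)"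
  shows "\<exists>R D. ring_subset R \<and> derivation_on R D \<and> (\<forall>c. \<iota> (Const c) \<in> R \<and> D (\<iota> (Const c)) = 0) \<and>
    (\<forall>j \<in> T. \<iota> (f j) \<in> R \<and> D (\<iota> (f j)) = (if j = r then 1 else 0))"
proof -
  interpret comm_ring_hom \<iota> by (rule \<iota>)
  note C = comm_ring_hom_Const
  define g where "g P = \<iota> (eval_in Const f P)" for P :: "(nat, 'k) mpoly"
  have g: "comm_ring_hom g"
    unfolding g_def by (intro comm_ring_hom_compose[OF \<iota>] comm_ring_hom_eval_in C)
  interpret g: comm_ring_hom g by (rule g)
  have mem: "eval_in Const f P \<in> polys B" if "P \<in> polys T" for P
    by (rule eval_in_polys_mem[OF C that]) (auto intro: f)
  have g0: "P = 0" if "P \<in> polys T" "g P = 0" for P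
    using inj[OF mem[OF that(1)]] ind[OF that(1)] that(2) unfolding g_def by blast
  define R where "R = g ` polys T"
  define D where "D z = g (partial_deriv r (SOME P. P \<in> polys T \<and> g P = z))" for z
  have D: "D (g P) = g (partial_deriv r P)" if "P \<in> polys T" for P
  proof -
    let ?Q = "SOME Q. Q \<in> polys T \<and> g Q = g P"
    have "?Q \<in> polys T \<and> g ?Q = g P" using that by (metis (mono_tags, lifting) someI)
    then have "?Q = P" using g0[of "?Q - P"] that by (simp add: g.hom_minus)
    then show ?thesis by (simp add: D_def)
  qed
  have gC: "g (Const c) = \<iota> (Const c)" for c by (simp add: g_def eval_in_Const[OF C])
  have gV: "g (Var j) = \<iota> (f j)" for j by (simp add: g_def eval_in_Var[OF C])
  show ?thesis
  proof (intro exI[of _ R] exI[of _ D] conjI allI ballI)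
    have gm: "g P \<in> R" if "P \<in> polys T" for P
      using that by (simp add: R_def)
    show "ring_subset R"
      unfolding ring_subset_def
    proof (intro conjI ballI)
      show "1 \<in> R" using gm[of 1] by simp
      fix a b assume "a \<in> R" "b \<in> R"
      then obtain P Q where PQ: "P \<in> polys T" "Q \<in> polys T" "a = g P" "b = g Q" by (auto simp: R_def)
      show "a - b \<in> R" using gm[of "P - Q"] PQ by (simp add: g.hom_minus)
      show "a * b \<in> R" using gm[of "P * Q"] PQ by (simp add: g.hom_mult)
    qed
    show "derivation_on R D"
      unfolding derivation_on_def
    proof (intro ballI)
      fix a b assume "a \<in> R" "b \<in> R"
      then obtain P Q where PQ: "P \<in> polys T" "Q \<in> polys T" "a = g P" "b = g Q" by (auto simp: R_def)
      show "D (a + b) = D a + D b \<and> D (a * b) = a * D b + D a * b"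
        using D[of P] D[of Q] D[of "P + Q"] D[of "P * Q"] PQ
        by (simp add: partial_deriv_mult g.hom_add g.hom_mult)
    qed
    show "\<iota> (Const c) \<in> R" for c using gm[of "Const c"] by (simp add: gC)
    show "D (\<iota> (Const c)) = 0" for c using D[of "Const c"] by (simp add: gC)
    show "\<iota> (f j) \<in> R" if "j \<in> T" for j using gm[of "Var j"] that by (simp add: gV)
    show "D (\<iota> (f j)) = (if j = r then 1 else 0)" if "j \<in> T" for j
      using D[of "Var j"] that by (auto simp: gV partial_deriv_Var)
  qed
qed

text \<open>Differentiation with respect to each \<open>f r\<close>, extended to the variables,
  takes values there that form a left inverse of the Jacobian matrix over the large field. When the
  determinant of the resulting identity matrix is expanded by Cauchy-Binet, some maximal minor must
  survive.\<close>

theorem jacobian_minor_nonzero: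
  fixes f :: "nat \<Rightarrow> ('x, 'k::field_char_0) mpoly"
  assumes B: "finite B" and f: "\<And>j. j < i \<Longrightarrow> f j \<in> polys B"
    and ind: "\<And>P. P \<in> polys {..<i} \<Longrightarrow> eval_in Const f P = 0 \<Longrightarrow> P = 0"
  shows "\<exists>\<beta> \<in> {0..<i} \<rightarrow>\<^sub>E B. det (mat i i (\<lambda>(r, j). partial_deriv (\<beta> r) (f j))) \<noteq> 0"
proof -
  obtain \<iota> :: "('x, 'k) mpoly \<Rightarrow> 'k generic_field" where \<iota>: "comm_ring_hom \<iota>"
    and inj: "\<And>p. p \<in> polys B \<Longrightarrow> \<iota> p = 0 \<Longrightarrow> p = 0"
    using exists_embedding[OF B, where 'k='k] by blast
  interpret \<iota>: comm_ring_hom \<iota> by (rule \<iota>)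
  have c: "comm_ring_hom (\<lambda>c. \<iota> (Const c))"
    by (rule comm_ring_hom_compose[OF \<iota> comm_ring_hom_Const])
  have ev: "\<iota> p = eval_in (\<lambda>c. \<iota> (Const c)) (\<lambda>x. \<iota> (Var x)) p" if "p \<in> polys B" for p
    by (rule hom_eq_eval_in[OF \<iota> that])
  have "\<exists>C. \<forall>j < i. (\<Sum>x \<in> B. C x * \<iota> (partial_deriv x (f j))) = (if j = r then 1 else 0)" for r
  proof -
    have "\<exists>R D. ring_subset R \<and> derivation_on R D \<and> (\<forall>c. \<iota> (Const c) \<in> R \<and> D (\<iota> (Const c)) = 0) \<and>
        (\<forall>j \<in> {..<i}. \<iota> (f j) \<in> R \<and> D (\<iota> (f j)) = (if j = r then 1 else 0))"
      by (rule subalgebra_derivation[OF \<iota>]) (use inj f ind in auto)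
    then obtain R D where RD: "ring_subset R" "derivation_on R D"
      "\<forall>c. \<iota> (Const c) \<in> R \<and> D (\<iota> (Const c)) = 0"
      "\<forall>j \<in> {..<i}. \<iota> (f j) \<in> R \<and> D (\<iota> (f j)) = (if j = r then 1 else 0)"
      by blast
    obtain R' D' where RD': "ring_subset R'" "R \<subseteq> R'" "(\<lambda>x. \<iota> (Var x)) ` B \<subseteq> R'" "derivation_on R' D'"
      "\<forall>r \<in> R. D' r = D r"
      using derivation_extend[OF finite_imageI[OF B] RD(1,2), of "\<lambda>x. \<iota> (Var x)"] by blast
    have "(\<Sum>x \<in> B. D' (\<iota> (Var x)) * \<iota> (partial_deriv x (f j))) = (if j = r then 1 else 0)" if "j < i" for j
    proof -
      have "D' (\<iota> (f j)) = (\<Sum>x \<in> B. \<iota> (partial_deriv x (f j)) * D' (\<iota> (Var x)))"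
        unfolding ev[OF f[OF that]]
        by (subst derivation_eval_in[OF c RD'(1,4) _ _ _ B f[OF that]])
          (use RD RD' f[OF that] in \<open>auto simp: ev[OF partial_deriv_polys]\<close>)
      then show ?thesis using RD(4) RD'(5) that by (simp add: mult.commute)
    qed
    then show ?thesis by (intro exI[of _ "\<lambda>x. D' (\<iota> (Var x))"]) blast
  qed
  then have "\<exists>C. \<forall>r. \<forall>j < i. (\<Sum>x \<in> B. C r x * \<iota> (partial_deriv x (f j))) = (if j = r then 1 else 0)"
    by (intro choice allI)
  then obtain C where C: "\<And>r j. j < i \<Longrightarrow> (\<Sum>x \<in> B. C r x * \<iota> (partial_deriv x (f j))) = (if j = r then 1 else 0)"
    by blast
  have "mat i i (\<lambda>(r, j). \<Sum>x \<in> B. C r x * \<iota> (partial_deriv x (f j))) = 1\<^sub>m i"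
    by (intro eq_matI) (auto simp: C)
  then have "(\<Sum>\<beta> \<in> {0..<i} \<rightarrow>\<^sub>E B. (\<Prod>r = 0..<i. C r (\<beta> r)) *
      det (mat i i (\<lambda>(r, j). \<iota> (partial_deriv (\<beta> r) (f j))))) = 1"
    using det_sum_prod_expand[OF B, of i C "\<lambda>x j. \<iota> (partial_deriv x (f j))"] by simp
  then obtain \<beta> where \<beta>: "\<beta> \<in> {0..<i} \<rightarrow>\<^sub>E B" "det (mat i i (\<lambda>(r, j). \<iota> (partial_deriv (\<beta> r) (f j)))) \<noteq> 0"
    by (metis (no_types, lifting) mult_zero_right sum.neutral zero_neq_one)
  have "mat i i (\<lambda>(r, j). \<iota> (partial_deriv (\<beta> r) (f j))) = map_mat \<iota> (mat i i (\<lambda>(r, j). partial_deriv (\<beta> r) (f j)))"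
    by (intro eq_matI) auto
  then show ?thesis using \<beta> by (metis \<iota>.hom_det \<iota>.hom_zero)
qed

text \<open>The degree in one variable is additive over a domain, so a factor of a polynomial
  without that variable lacks it as well.\<close>

lemma factor_in_polys:
  fixes P Q :: "(nat, 'k::field_char_0) mpoly"
  assumes "P * Q \<in> polys (T - {j})" "P \<in> polys T" "Q \<in> polys T" "Q \<noteq> 0"
  shows "P \<in> polys (T - {j})"
proof -
  define \<psi> where "\<psi> = eval_in (\<lambda>c. [:Const c:]) (\<lambda>x. if x = j then [:0, 1:] else [:Var x :: (nat, 'k) mpoly:])"
  have C: "comm_ring_hom (\<lambda>c. [:Const c :: (nat, 'k) mpoly:])"
    by unfold_locales (simp_all add: Const_add Const_mult one_pCons)
  have \<psi>: "comm_ring_hom \<psi>" unfolding \<psi>_def by (rule comm_ring_hom_eval_in[OF C])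
  interpret \<psi>: comm_ring_hom \<psi> by (rule \<psi>)
  have ev: "comm_ring_hom (\<lambda>p. poly p (Var j :: (nat, 'k) mpoly))" by unfold_locales auto
  have bk: "poly (\<psi> p) (Var j) = p" for p
    by (rule eval_in_polys_eqI[OF comm_ring_hom_compose[OF ev \<psi>] comm_ring_hom_id polys_UNIV])
      (auto simp: \<psi>_def eval_in_Const[OF C] eval_in_Var[OF C])
  have deg0: "\<exists>c \<in> polys (T - {j}). \<psi> p = [:c:]" if "p \<in> polys (T - {j})" for p
  proof -
    have "\<psi> p \<in> {[:c:] |c. c \<in> polys (T - {j})}"
      unfolding \<psi>_def by (rule eval_in_polys_mem[OF C that]) (auto intro!: polys_Const polys_Var polys_add polys_mult)
    then show ?thesis by blast
  qed
  have over: "\<psi> p \<in> poly_over (polys (T - {j}))" if "p \<in> polys T" for p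
    unfolding \<psi>_def
    by (rule eval_in_polys_mem[OF C that])
      (auto intro!: poly_over_closed[OF ring_subset_polys] poly_over_X[OF ring_subset_polys] polys_Var)
  have "\<psi> Q \<noteq> 0" using bk[of Q] assms(4) by auto
  have "degree (\<psi> P) = 0"
  proof (cases "\<psi> P = 0")
    case False
    obtain c where "\<psi> (P * Q) = [:c:]" using deg0[OF assms(1)] by blast
    then have "degree (\<psi> P * \<psi> Q) = 0" by (simp add: \<psi>.hom_mult)
    then show ?thesis using degree_mult_eq[OF False \<open>\<psi> Q \<noteq> 0\<close>] by simp
  qed simp
  then obtain c where c: "\<psi> P = [:c:]" by (metis degree_eq_zeroE)
  then have "P = c" using bk[of P] by simp
  moreover have "c \<in> polys (T - {j})" using poly_over_coeff[OF over[OF assms(2)], of 0] c by simp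
  ultimately show ?thesis by simp
qed

lemma polys_retraction:
  "\<exists>\<rho> :: ('x, 'k::comm_ring_1) mpoly \<Rightarrow> ('x, 'k) mpoly. comm_ring_hom \<rho> \<and> (\<forall>p \<in> polys B. \<rho> p = p) \<and> (\<forall>p. \<rho> p \<in> polys B)"
  for B :: "'x set"
proof -
  let ?\<rho> = "eval_in (Const :: 'k \<Rightarrow> ('x, 'k) mpoly) (\<lambda>x. if x \<in> B then Var x else 0)"
  note C = comm_ring_hom_Const
  have 1: "comm_ring_hom ?\<rho>" by (rule comm_ring_hom_eval_in[OF C])
  have "?\<rho> p = p" if "p \<in> polys B" for p
    by (rule eval_in_polys_eqI[OF 1 comm_ring_hom_id that]) (auto simp: eval_in_Const[OF C] eval_in_Var[OF C])
  moreover have "?\<rho> p \<in> polys B" for p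
    by (rule eval_in_polys_mem[OF C polys_UNIV]) auto
  ultimately show ?thesis using 1 by blast
qed

lemma hom_on_eval_in:
  assumes A: "ring_subset A" and \<theta>: "hom_on A \<theta>" and CA: "\<And>c. Const c \<in> A" and VA: "\<And>x. x \<in> B \<Longrightarrow> Var x \<in> A"
    and p: "p \<in> polys B"
  shows "p \<in> A \<and> \<theta> p = eval_in (\<lambda>c. \<theta> (Const c)) (\<lambda>x. \<theta> (Var x)) p"
proof -
  note h = hom_onD[OF A \<theta>]
  have C: "comm_ring_hom (\<lambda>c. \<theta> (Const c))"
    by unfold_locales (simp_all add: Const_add Const_mult h CA)
  show ?thesis
    using p
    by (induction p rule: polys_induct)
      (auto simp: CA VA h ring_subsetD[OF A] eval_in_Const[OF C] eval_in_Var[OF C] eval_in_add[OF C] eval_in_mult[OF C])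
qed

text \<open>An injective \<open>\<theta>\<close> cannot kill the guarding element of the extension
  lemma, which is nonzero because it lies outside \<open>J\<close>. As \<open>A'\<close> is produced
  by the lemma, \<open>l\<close> may lie outside it; the last conclusion is conditional for that
  reason.\<close>

corollary hom_extend_injective:
  fixes A J V :: "'s::comm_ring_1 set" and \<theta> :: "'s \<Rightarrow> 'f::{alg_closed_field, field_char_0}"
  assumes V: "finite V" and A: "ring_subset A" and J: "prime_ideal_set J" and AJ: "A \<inter> J \<subseteq> {0}"
    and \<theta>: "hom_on A \<theta>" and inj: "\<And>a. a \<in> A \<Longrightarrow> \<theta> a = 0 \<Longrightarrow> a = 0" and l: "l \<notin> J"
  obtains A' \<theta>' where "ring_subset A'" "A \<subseteq> A'" "V \<subseteq> A'" "hom_on A' \<theta>'" "\<forall>a \<in> A' \<inter> J. \<theta>' a = 0"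
    "\<forall>a \<in> A. \<theta>' a = \<theta> a" "l \<in> A' \<longrightarrow> \<theta>' l \<noteq> 0"
proof -
  have J01: "0 \<in> J" "1 \<notin> J" using J by (auto simp: prime_ideal_set_def)
  from hom_extend[OF V A J, where 'f = 'f] obtain A' where A': "ring_subset A'" "A \<subseteq> A'" "V \<subseteq> A'" and
    ext: "\<forall>l \<in> A' - J. \<exists>l' \<in> A - J. \<forall>\<theta> :: 's \<Rightarrow> 'f.
    hom_on A \<theta> \<and> (\<forall>a \<in> A \<inter> J. \<theta> a = 0) \<and> \<theta> l' \<noteq> 0 \<longrightarrow>
    (\<exists>\<theta>'. hom_on A' \<theta>' \<and> (\<forall>a \<in> A' \<inter> J. \<theta>' a = 0) \<and> (\<forall>a \<in> A. \<theta>' a = \<theta> a) \<and> \<theta>' l \<noteq> 0)"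
    by (elim exE conjE)
  define l0 where "l0 = (if l \<in> A' then l else 1)"
  have l0: "l0 \<in> A' - J" using l J01 ring_subsetD(2)[OF A'(1)] by (auto simp: l0_def)
  obtain l' where l': "l' \<in> A - J" and ext':
    "hom_on A \<theta> \<and> (\<forall>a \<in> A \<inter> J. \<theta> a = 0) \<and> \<theta> l' \<noteq> 0 \<longrightarrow>
    (\<exists>\<theta>'. hom_on A' \<theta>' \<and> (\<forall>a \<in> A' \<inter> J. \<theta>' a = 0) \<and> (\<forall>a \<in> A. \<theta>' a = \<theta> a) \<and> \<theta>' l0 \<noteq> 0)"
    using bspec[OF ext l0] by (elim bexE allE[of _ \<theta>])
  have "\<theta> 0 = 0" by (rule hom_onD(1)[OF A \<theta>])
  then have "\<forall>a \<in> A \<inter> J. \<theta> a = 0" using AJ by auto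
  moreover have "\<theta> l' \<noteq> 0" using l' inj[of l'] J01(1) by auto
  ultimately obtain \<theta>' where "hom_on A' \<theta>'" "\<forall>a \<in> A' \<inter> J. \<theta>' a = 0" "\<forall>a \<in> A. \<theta>' a = \<theta> a" "\<theta>' l0 \<noteq> 0"
    using ext' \<theta> by (elim impE exE conjE) auto
  then show ?thesis using A' by (intro that[of A' \<theta>']) (auto simp: l0_def)
qed

text \<open>A ramification argument. If \<open>P\<close> involves the variable \<open>j0\<close>,
  the hypersurface \<open>p = 0\<close> has a point at which the other \<open>f j\<close> take
  generic values. Along the line from it to a generic point of the whole space, \<open>p\<close>
  vanishes at the start to some order \<open>e > 0\<close>. Differentiating \<open>p = P(f)\<close>
  along the line leaves order exactly \<open>e - 1\<close>, while the divisibility of the Jacobian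
  minors by \<open>p\<close> and Cramer's rule force a higher order.\<close>

theorem jacobian_minors_common_factor:
  fixes f :: "nat \<Rightarrow> ('x, 'k::field_char_0) mpoly"
  assumes B: "finite B" and f: "\<And>j. j < i \<Longrightarrow> f j \<in> polys B"
    and ind: "\<And>P. P \<in> polys {..<i} \<Longrightarrow> eval_in Const f P = 0 \<Longrightarrow> P = 0"
    and P: "P \<in> polys {..<i}" and p: "p = eval_in Const f P"
    and closed: "\<And>s. s \<in> polys B \<Longrightarrow> p * s \<in> eval_in Const f ` polys {..<i} \<Longrightarrow> s \<in> eval_in Const f ` polys {..<i}"
    and minors: "\<And>\<beta>. \<beta> \<in> {0..<i} \<rightarrow>\<^sub>E B \<Longrightarrow> p dvd det (mat i i (\<lambda>(r, j). partial_deriv (\<beta> r) (f j)))"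
    and p0: "p \<noteq> 0"
  shows "\<exists>c. P = Const c"
proof (rule ccontr)
  assume nc: "\<not> ?thesis"
  note C = comm_ring_hom_Const
  have "\<exists>m \<in> mkeys P. m \<noteq> 0"
  proof (rule ccontr)
    assume "\<not> ?thesis"
    then have "P = Const (mlookup P 0)"
      by (intro poly_mapping_eqI) (auto simp: Const_def lookup_single when_def in_keys_iff)
    then show False using nc by blast
  qed
  then obtain m where m: "m \<in> mkeys P" "m \<noteq> 0" by blast
  then obtain j0 where j0: "j0 \<in> mkeys m" by (metis ex_in_conv keys_eq_empty)
  define T where "T = {..<i} - {j0}"
  have j0i: "j0 < i" using m j0 P by (auto simp: polys_def)
  have PT: "P \<notin> polys T" using m j0 by (auto simp: polys_def T_def)
  have Ti: "T \<subseteq> {..<i}" by (auto simp: T_def)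
  interpret ev: comm_ring_hom "eval_in Const f" by (rule comm_ring_hom_eval_in[OF C])
  have evB: "eval_in Const f Q \<in> polys B" if "Q \<in> polys {..<i}" for Q
    by (rule eval_in_polys_mem[OF C that]) (auto intro: f)
  have pB: "p \<in> polys B" using P p evB by simp
  obtain \<iota> :: "('x, 'k) mpoly \<Rightarrow> 'k generic_field" where \<iota>: "comm_ring_hom \<iota>"
    and inj: "\<And>p. p \<in> polys B \<Longrightarrow> \<iota> p = 0 \<Longrightarrow> p = 0"
    using exists_embedding[OF B, where 'k='k] by blast
  interpret \<iota>: comm_ring_hom \<iota> by (rule \<iota>)
  have dom: "a * b \<noteq> 0" if "a \<in> polys B" "b \<in> polys B" "a \<noteq> 0" "b \<noteq> 0" for a b :: "('x, 'k) mpoly"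
    using inj[of a] inj[of b] that by (metis \<iota>.hom_mult \<iota>.hom_zero mult_eq_0_iff)
  define A0 where "A0 = eval_in Const f ` polys T"
  have A0: "ring_subset A0"
    unfolding ring_subset_def A0_def
  proof (intro conjI ballI)
    show "1 \<in> eval_in Const f ` polys T" using ev.hom_one by (metis image_eqI polys_one)
    fix a b assume "a \<in> eval_in Const f ` polys T" "b \<in> eval_in Const f ` polys T"
    then show "a - b \<in> eval_in Const f ` polys T" "a * b \<in> eval_in Const f ` polys T"
      by (auto simp: ev.hom_minus[symmetric] ev.hom_mult[symmetric])
  qed
  have A0B: "A0 \<subseteq> polys B" using evB polys_mono[OF Ti] by (auto simp: A0_def)
  have Const_A0: "Const c \<in> A0" for c
    unfolding A0_def using eval_in_Const[OF C, of f c] by (metis image_eqI polys_Const)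
  have f_A0: "f j \<in> A0" if "j \<in> T" for j
    unfolding A0_def using eval_in_Var[OF C, of f j] that by (metis image_eqI polys_Var)
  define I where "I = {p * s |s. True}"
  \<comment> \<open>If a multiple of \<open>p\<close> were a nonzero polynomial in the
    \<open>f j\<close> with \<open>j\<close> in \<open>T\<close>, then by \<open>closed\<close> the
    cofactor would be a polynomial in all \<open>f j\<close>, and \<open>P\<close> would divide a
    nonzero polynomial without the variable \<open>j0\<close>.\<close>
  have "I \<inter> (A0 - {0}) = {}"
  proof (rule ccontr)
    assume "\<not> ?thesis"
    then obtain z where "z \<in> I" "z \<in> A0" "z \<noteq> 0" by blast
    obtain s where s: "z = p * s" using \<open>z \<in> I\<close> by (auto simp: I_def)
    obtain Q where "Q \<in> polys T" "z = eval_in Const f Q" using \<open>z \<in> A0\<close> by (auto simp: A0_def)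
    then have Q: "Q \<in> polys T" "eval_in Const f Q = p * s" "eval_in Const f Q \<noteq> 0"
      using s \<open>z \<noteq> 0\<close> by simp_all
    \<comment> \<open>The cofactor \<open>s\<close> is an arbitrary polynomial, possibly with
      variables outside \<open>B\<close>; the retraction brings it into the ring where
      \<open>closed\<close> applies.\<close>
    obtain \<rho> :: "('x, 'k) mpoly \<Rightarrow> ('x, 'k) mpoly" where \<rho>: "comm_ring_hom \<rho>" "\<And>q. q \<in> polys B \<Longrightarrow> \<rho> q = q" "\<And>q. \<rho> q \<in> polys B"
      using polys_retraction[of B, where 'k='k] by blast
    interpret \<rho>: comm_ring_hom \<rho> by (rule \<rho>)
    have Qi: "Q \<in> polys {..<i}" using polys_mono[OF Ti Q(1)] .
    have "p * \<rho> s = \<rho> (p * s)" using \<rho>(2)[OF pB] by (simp add: \<rho>.hom_mult)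
    also have "\<dots> = eval_in Const f Q" using \<rho>(2)[OF evB[OF Qi]] Q(2) by simp
    finally have eq: "p * \<rho> s = eval_in Const f Q" .
    then obtain Q' where Q': "Q' \<in> polys {..<i}" "\<rho> s = eval_in Const f Q'"
      using closed[OF \<rho>(3), of s] Qi by auto
    have "eval_in Const f (P * Q' - Q) = 0" using eq Q' p by (simp add: ev.hom_minus ev.hom_mult)
    then have "P * Q' = Q" using ind[of "P * Q' - Q"] P Q'(1) Qi by simp
    moreover have "Q' \<noteq> 0" using Q(3) eq Q'(2) by (auto simp: ev.hom_zero)
    ultimately have "P \<in> polys T" using factor_in_polys[of P Q' "{..<i}" j0] Q(1) P Q'(1) by (simp add: T_def)
    then show False using PT by simp
  qed
  moreover have "0 \<in> I" by (auto simp: I_def intro!: exI[of _ 0])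
  moreover have "a + b \<in> I" if "a \<in> I" "b \<in> I" for a b
    using that by (auto simp: I_def distrib_left[symmetric])
  moreover have "s * a \<in> I" if "a \<in> I" for a s
    using that by (auto simp: I_def mult.left_commute)
  moreover have "1 \<in> A0 - {0}" using ring_subsetD(2)[OF A0] by simp
  moreover have "a * b \<in> A0 - {0}" if "a \<in> A0 - {0}" "b \<in> A0 - {0}" for a b
    using that dom[of a b] A0B ring_subsetD(6)[OF A0, of a b] by auto
  ultimately obtain J where J: "prime_ideal_set J" "I \<subseteq> J" "J \<inter> (A0 - {0}) = {}"
    using exists_prime_ideal_avoiding[of I "A0 - {0}"] by blast
  have J01: "0 \<in> J" "1 \<notin> J" using J(1) by (auto simp: prime_ideal_set_def)
  have pJ: "p \<in> J" using J(2) by (auto simp: I_def intro!: subsetD[OF J(2)] exI[of _ 1])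
  have h1: "hom_on A0 \<iota>" by (simp add: hom_on_def \<iota>.hom_add \<iota>.hom_mult)
  have h2: "A0 \<inter> J \<subseteq> {0}" using J(3) by auto
  have h3: "\<And>a. a \<in> A0 \<Longrightarrow> \<iota> a = 0 \<Longrightarrow> a = 0" using inj A0B by auto
  \<comment> \<open>This is a point of \<open>p = 0\<close> with coordinates in the large field. Its
    agreement with \<open>\<iota>\<close> on \<open>A0\<close> says that the \<open>f j\<close> with
    \<open>j\<close> in \<open>T\<close> take generic values at it. The element to be kept nonzero
    is just 1.\<close>
  obtain A' \<theta> where A': "ring_subset A'" "A0 \<subseteq> A'" "Var ` B \<subseteq> A'"
    and \<theta>: "hom_on A' \<theta>" "\<forall>a \<in> A' \<inter> J. \<theta> a = 0" "\<forall>a \<in> A0. \<theta> a = \<iota> a"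
      "1 \<in> A' \<longrightarrow> \<theta> 1 \<noteq> 0"
    by (rule hom_extend_injective[OF finite_imageI[OF B, of Var] A0 J(1) h2 h1 h3 J01(2)])
  define \<kappa> where "\<kappa> c = \<iota> (Const c)" for c
  have \<kappa>: "comm_ring_hom \<kappa>" unfolding \<kappa>_def by (rule comm_ring_hom_compose[OF \<iota> C])
  have \<kappa>_eq: "\<kappa> = (\<lambda>c. \<iota> (Const c))" by (simp add: \<kappa>_def fun_eq_iff)
  interpret \<kappa>: comm_ring_hom \<kappa> by (rule \<kappa>)
  have \<theta>C: "\<theta> (Const c) = \<kappa> c" for c using \<theta>(3) Const_A0 by (simp add: \<kappa>_def)
  have \<theta>ev: "q \<in> A'" "\<theta> q = eval_in \<kappa> (\<lambda>x. \<theta> (Var x)) q" if "q \<in> polys B" for q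
    using hom_on_eval_in[OF A'(1) \<theta>(1) _ _ that] A'(2,3) Const_A0 by (auto simp: \<theta>C)
  have \<iota>ev: "\<iota> q = eval_in \<kappa> (\<lambda>x. \<iota> (Var x)) q" if "q \<in> polys B" for q
    using hom_eq_eval_in[OF \<iota> that] unfolding \<kappa>_eq .
  \<comment> \<open>The line from the point \<open>\<theta>\<close> at parameter 0 to the generic
    point \<open>\<iota>\<close> at parameter 1.\<close>
  define xs where "xs x = [:\<theta> (Var x), \<iota> (Var x) - \<theta> (Var x):]" for x
  define K where "K c = [:\<kappa> c:]" for c
  have K: "comm_ring_hom K"
    by unfold_locales (simp_all add: K_def \<kappa>.hom_add \<kappa>.hom_mult one_pCons)
  define \<Theta> where "\<Theta> = eval_in K xs"
  have \<Theta>: "comm_ring_hom \<Theta>" unfolding \<Theta>_def by (rule comm_ring_hom_eval_in[OF K])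
  interpret \<Theta>: comm_ring_hom \<Theta> by (rule \<Theta>)
  have \<Theta>V: "\<Theta> (Var x) = xs x" for x by (simp add: \<Theta>_def eval_in_Var[OF K])
  have \<Theta>C: "\<Theta> (Const c) = K c" for c by (simp add: \<Theta>_def eval_in_Const[OF K])
  have pe: "comm_ring_hom (\<lambda>q :: 'k generic_field poly. poly q t)" for t by unfold_locales auto
  have \<Theta>0: "poly (\<Theta> q) 0 = \<theta> q" if "q \<in> polys B" for q
    unfolding \<theta>ev(2)[OF that]
    by (rule eval_in_polys_eqI[OF comm_ring_hom_compose[OF pe \<Theta>] comm_ring_hom_eval_in[OF \<kappa>] that])
      (simp_all add: \<Theta>V \<Theta>C K_def xs_def eval_in_Const[OF \<kappa>] eval_in_Var[OF \<kappa>])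
  have \<Theta>1: "poly (\<Theta> q) 1 = \<iota> q" if "q \<in> polys B" for q
    unfolding \<iota>ev[OF that]
    by (rule eval_in_polys_eqI[OF comm_ring_hom_compose[OF pe \<Theta>] comm_ring_hom_eval_in[OF \<kappa>] that])
      (simp_all add: \<Theta>V \<Theta>C K_def xs_def eval_in_Const[OF \<kappa>] eval_in_Var[OF \<kappa>])
  \<comment> \<open>Derivations dual to the \<open>f j\<close> with \<open>j\<close> in
    \<open>T\<close>, defined on the coordinates of both end points of the line.\<close>
  have "\<exists>R D. ring_subset R \<and> derivation_on R D \<and> (\<forall>c. \<kappa> c \<in> R \<and> D (\<kappa> c) = 0) \<and>
      (\<forall>j \<in> T. D (\<iota> (f j)) = (if j = r then 1 else 0)) \<and> (\<forall>x \<in> B. \<theta> (Var x) \<in> R \<and> \<iota> (Var x) \<in> R)" for r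
  proof -
    have ind': "Q = 0" if "Q \<in> polys T" "eval_in Const f Q = 0" for Q
      using ind[OF polys_mono[OF Ti that(1)] that(2)] .
    have "\<exists>R D. ring_subset R \<and> derivation_on R D \<and> (\<forall>c. \<iota> (Const c) \<in> R \<and> D (\<iota> (Const c)) = 0) \<and>
        (\<forall>j \<in> T. \<iota> (f j) \<in> R \<and> D (\<iota> (f j)) = (if j = r then 1 else 0))"
      by (rule subalgebra_derivation[OF \<iota>]) (use inj f ind' Ti in auto)
    then obtain R D where RD: "ring_subset R" "derivation_on R D"
      "\<forall>c. \<iota> (Const c) \<in> R \<and> D (\<iota> (Const c)) = 0"
      "\<forall>j \<in> T. \<iota> (f j) \<in> R \<and> D (\<iota> (f j)) = (if j = r then 1 else 0)"
      by blast
    obtain R' D' where "ring_subset R'" "R \<subseteq> R'" "(\<lambda>x. \<theta> (Var x)) ` B \<union> (\<lambda>x. \<iota> (Var x)) ` B \<subseteq> R'" "derivation_on R' D'"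
      "\<forall>r \<in> R. D' r = D r"
      using derivation_extend[OF _ RD(1,2), of "(\<lambda>x. \<theta> (Var x)) ` B \<union> (\<lambda>x. \<iota> (Var x)) ` B"] B by blast
    then show ?thesis using RD unfolding \<kappa>_def by (intro exI[of _ R'] exI[of _ D']) auto
  qed
  then have "\<exists>R D. \<forall>r. ring_subset (R r) \<and> derivation_on (R r) (D r) \<and> (\<forall>c. \<kappa> c \<in> R r \<and> D r (\<kappa> c) = 0) \<and>
      (\<forall>j \<in> T. D r (\<iota> (f j)) = (if j = r then 1 else 0)) \<and> (\<forall>x \<in> B. \<theta> (Var x) \<in> R r \<and> \<iota> (Var x) \<in> R r)"
    by (subst choice_iff[symmetric], subst choice_iff[symmetric], intro allI)
  then obtain R D where RDprop: "\<forall>r. ring_subset (R r) \<and> derivation_on (R r) (D r) \<and> (\<forall>c. \<kappa> c \<in> R r \<and> D r (\<kappa> c) = 0) \<and>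
      (\<forall>j \<in> T. D r (\<iota> (f j)) = (if j = r then 1 else 0)) \<and> (\<forall>x \<in> B. \<theta> (Var x) \<in> R r \<and> \<iota> (Var x) \<in> R r)"
    by blast
  then have R: "\<And>r. ring_subset (R r)" and D: "\<And>r. derivation_on (R r) (D r)"
    and \<kappa>R: "\<And>r c. \<kappa> c \<in> R r" "\<And>r c. D r (\<kappa> c) = 0"
    and Df: "\<And>r j. j \<in> T \<Longrightarrow> D r (\<iota> (f j)) = (if j = r then 1 else 0)"
    and VR: "\<And>r x. x \<in> B \<Longrightarrow> \<theta> (Var x) \<in> R r" "\<And>r x. x \<in> B \<Longrightarrow> \<iota> (Var x) \<in> R r"
    using RDprop by blast+
  have D0: "D r 0 = 0" for r using derivation_on_zero[OF R D] .
  \<comment> \<open>For the index \<open>j0\<close>, where no dual derivation is available,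
    differentiation along the line is used; the other derivations act on coefficients.\<close>
  define E where "E r = (if r = j0 then pderiv else map_poly (D r))" for r
  have E: "derivation_on (poly_over (R r)) (E r)" for r
    using derivation_on_map_poly[OF R D, of r]
    by (auto simp: E_def derivation_on_def pderiv_add pderiv_mult algebra_simps)
  have EK: "K c \<in> poly_over (R r)" "E r (K c) = 0" for r c
    using poly_over_closed(4)[OF R \<kappa>R(1), of c r]
    by (auto simp: E_def K_def map_poly_pCons D0 \<kappa>R pderiv_pCons)
  have xsR: "xs x \<in> poly_over (R r)" if "x \<in> B" for x r
    using VR[OF that, of r] ring_subsetD(1,5)[OF R[of r]]
    by (auto simp: xs_def poly_over_def coeff_pCons split: nat.splits)
  note RP = ring_subset_poly_over_set[OF R]
  have \<Theta>R: "\<Theta> q \<in> poly_over (R r)" if "q \<in> polys B" for q r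
    unfolding \<Theta>_def
    by (rule eval_in_polys_mem[OF K that]) (auto intro: EK xsR ring_subsetD[OF RP])
  have E\<Theta>: "E r (\<Theta> q) = (\<Sum>x \<in> B. E r (xs x) * \<Theta> (partial_deriv x q))" if "q \<in> polys B" for q r
    using derivation_eval_in[OF K RP E[of r] EK xsR B that] by (simp add: \<Theta>_def mult.commute)
  define N where "N = mat i i (\<lambda>(r, j). E r (\<Theta> (f j)))"
  have N: "N \<in> carrier_mat i i" by (simp add: N_def)
  have "N = mat i i (\<lambda>(r, j). \<Sum>x \<in> B. E r (xs x) * \<Theta> (partial_deriv x (f j)))"
    unfolding N_def by (intro eq_matI) (auto simp: E\<Theta> f)
  then have detN: "det N = (\<Sum>\<beta> \<in> {0..<i} \<rightarrow>\<^sub>E B. (\<Prod>r = 0..<i. E r (xs (\<beta> r))) *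
      det (mat i i (\<lambda>(r, j). \<Theta> (partial_deriv (\<beta> r) (f j)))))"
    using det_sum_prod_expand[OF B] by simp
  have dvdN: "\<Theta> p dvd det N"
    unfolding detN
  proof (intro dvd_sum dvd_mult)
    fix \<beta> assume "\<beta> \<in> {0..<i} \<rightarrow>\<^sub>E B"
    then have "\<Theta> p dvd \<Theta> (det (mat i i (\<lambda>(r, j). partial_deriv (\<beta> r) (f j))))"
      using minors by (intro \<Theta>.hom_dvd) auto
    also have "\<dots> = det (map_mat \<Theta> (mat i i (\<lambda>(r, j). partial_deriv (\<beta> r) (f j))))" by simp
    also have "map_mat \<Theta> (mat i i (\<lambda>(r, j). partial_deriv (\<beta> r) (f j))) = mat i i (\<lambda>(r, j). \<Theta> (partial_deriv (\<beta> r) (f j)))"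
      by (intro eq_matI) auto
    finally show "\<Theta> p dvd det (mat i i (\<lambda>(r, j). \<Theta> (partial_deriv (\<beta> r) (f j))))" .
  qed
  define y where "y = vec i (\<lambda>j. eval_in K (\<lambda>j. \<Theta> (f j)) (partial_deriv j P))"
  define w where "w = vec i (\<lambda>r. E r (\<Theta> p))"
  have \<Theta>p: "\<Theta> p = eval_in K (\<lambda>j. \<Theta> (f j)) P"
    unfolding p
    by (rule eval_in_polys_eqI[OF comm_ring_hom_compose[OF \<Theta> ev.comm_ring_hom_axioms] comm_ring_hom_eval_in[OF K] P])
      (simp_all add: eval_in_Const[OF C] eval_in_Var[OF C] \<Theta>C eval_in_Const[OF K] eval_in_Var[OF K])
  have Ny: "N *\<^sub>v y = w"
  proof (rule eq_vecI)
    fix r assume "r < dim_vec w"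
    then have r: "r < i" by (simp add: w_def)
    have "E r (\<Theta> p) = (\<Sum>j < i. eval_in K (\<lambda>j. \<Theta> (f j)) (partial_deriv j P) * E r (\<Theta> (f j)))"
      unfolding \<Theta>p by (rule derivation_eval_in[OF K RP E[of r] EK _ finite_lessThan P]) (auto intro: \<Theta>R f)
    then show "(N *\<^sub>v y) $ r = w $ r"
      using r by (simp add: N_def y_def w_def scalar_prod_def lessThan_atLeast0 mult.commute)
  qed (simp add: N_def w_def)
  have "\<Theta> p \<noteq> 0" using \<Theta>1[OF pB] inj[OF pB] p0 by auto
  then obtain g where g: "\<Theta> p = [:0, 1:] ^ order 0 (\<Theta> p) * g" "\<not> [:0, 1:] dvd g"
    using order_decomp[of "\<Theta> p" 0] by auto
  define e where "e = order 0 (\<Theta> p)"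
  have "poly (\<Theta> p) 0 = 0" using \<Theta>0[OF pB] \<theta>(2) pJ \<theta>ev(1)[OF pB] by auto
  then have "e > 0" using \<open>\<Theta> p \<noteq> 0\<close> by (simp add: e_def order_gt_0_iff)
  then obtain e' where e': "e = Suc e'" by (cases e) auto
  let ?t = "[:0, 1:] :: 'k generic_field poly"
  have te: "?t ^ n = monom 1 n" for n by (simp add: monom_altdef)
  have gp: "\<Theta> p = ?t ^ e * g" using g(1) by (simp add: e_def)
  have g0: "poly g 0 \<noteq> 0" using g(2) by (simp add: poly_eq_0_iff_dvd)
  have gR: "g \<in> poly_over (R r)" for r
  proof -
    have "coeff g n = coeff (\<Theta> p) (n + e)" for n by (simp add: gp te coeff_monom_mult)
    then show ?thesis using \<Theta>R[OF pB, of r] by (simp add: poly_over_def)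
  qed
  \<comment> \<open>Only the row \<open>j0\<close> of \<open>w\<close> loses one order at the start
    of the line. After division by the power of the parameter with exponent \<open>e - 1\<close>,
    its value at 0 is \<open>e\<close> times that of \<open>g\<close>, nonzero in characteristic
    zero, and the other rows vanish there.\<close>
  define v where "v = vec i (\<lambda>r. if r = j0 then of_nat e * g + ?t * pderiv g else ?t * map_poly (D r) g)"
  have w_eq: "w = ?t ^ e' \<cdot>\<^sub>v v"
  proof (rule eq_vecI)
    fix r assume "r < dim_vec (?t ^ e' \<cdot>\<^sub>v v)"
    then have r: "r < i" by (simp add: v_def)
    show "w $ r = (?t ^ e' \<cdot>\<^sub>v v) $ r"
    proof (cases "r = j0")
      case True
      have sm: "smult (of_nat k) q = of_nat k * q" for k and q :: "'k generic_field poly"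
        by (simp add: of_nat_poly)
      have dt: "pderiv ?t = 1" by (simp add: pderiv_pCons)
      have "pderiv (?t ^ e * g) = ?t ^ e * pderiv g + g * (of_nat e * ?t ^ e')"
        unfolding e' pderiv_mult pderiv_power_Suc dt sm by (simp only: mult_1_right)
      also have "\<dots> = ?t ^ e' * (of_nat e * g + ?t * pderiv g)"
        unfolding e' power_Suc by (simp only: distrib_left distrib_right mult_ac add_ac)
      finally have "pderiv (?t ^ e * g) = ?t ^ e' * (of_nat e * g + ?t * pderiv g)" .
      then show ?thesis using r True by (simp add: w_def v_def E_def gp)
    next
      case False
      have "map_poly (D r) (?t ^ e * g) = ?t ^ e * map_poly (D r) g"
        by (intro poly_eqI) (simp add: te coeff_map_poly D0 coeff_monom_mult)
      then show ?thesis using r False by (simp add: w_def v_def E_def gp e' mult_ac)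
    qed
  qed (simp add: w_def v_def)
  have vc: "v \<in> carrier_vec i" by (simp add: v_def)
  have yc: "y \<in> carrier_vec i" by (simp add: y_def)
  \<comment> \<open>Cramer's rule for \<open>N *\<^sub>v y = w\<close>. The right-hand side is
    divisible by the full power \<open>?t ^ e\<close>, since \<open>\<Theta> p\<close> divides
    \<open>det N\<close>.\<close>
  have "?t ^ e' * det (replace_col N v j0) = y $ j0 * det N"
    using cramer_lemma_mat[OF N yc j0i] det_replace_col_smult[OF N vc j0i, of "?t ^ e'"] Ny w_eq by simp
  moreover have "?t ^ e dvd y $ j0 * det N" using dvdN gp by (metis dvd_mult dvd_mult_left)
  ultimately have "?t ^ e' * ?t dvd ?t ^ e' * det (replace_col N v j0)" by (simp add: e' mult.commute)
  moreover have "?t ^ e' \<noteq> 0" by (simp only: power_eq_0_iff) simp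
  ultimately have "?t dvd det (replace_col N v j0)" by (simp only: dvd_mult_cancel_left) simp
  then have 0: "poly (det (replace_col N v j0)) 0 = 0" by (simp add: poly_eq_0_iff_dvd)
  define L where "L = map_mat (\<lambda>q. poly q 0) (replace_col N v j0)"
  interpret pe: comm_ring_hom "\<lambda>q :: 'k generic_field poly. poly q 0" by (rule pe)
  have Lc: "L \<in> carrier_mat i i" by (simp add: L_def replace_col_def N_def)
  \<comment> \<open>At the start of the line the rows other than \<open>j0\<close> are unit rows:
    the \<open>f j\<close> with \<open>j\<close> in \<open>T\<close> have their generic values
    there, and the derivations are dual to these.\<close>
  have "det L \<noteq> 0"
  proof (rule det_unit_rows_except[OF Lc j0i])
    show "L $$ (j0, j0) \<noteq> 0"
      using j0i g0 \<open>e > 0\<close> by (simp add: L_def replace_col_def N_def v_def)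
    fix r j assume rj: "r < i" "j < i" "r \<noteq> j0"
    show "L $$ (r, j) = (if r = j then 1 else 0)"
    proof (cases "j = j0")
      case True
      then show ?thesis using rj by (simp add: L_def replace_col_def N_def v_def)
    next
      case False
      have jT: "j \<in> T" using False rj by (simp add: T_def)
      have "poly (map_poly (D r) (\<Theta> (f j))) 0 = D r (poly (\<Theta> (f j)) 0)"
        by (simp add: poly_0_coeff_0 coeff_map_poly D0)
      also have "\<dots> = D r (\<iota> (f j))" using \<Theta>0[OF f[OF rj(2)]] \<theta>(3) f_A0[OF jT] by simp
      finally show ?thesis using rj False Df[OF jT, of r] by (auto simp: L_def replace_col_def N_def E_def)
    qed
  qed
  moreover have "det L = 0" using 0 unfolding L_def by simp
  ultimately show False by simp
qed

lemma comm_ring_hom_const_poly: "comm_ring_hom (\<lambda>c. [:c:] :: 'k::comm_ring_1 poly)"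
  by unfold_locales (simp_all add: one_pCons)

lemma comm_ring_hom_poly_eval: "comm_ring_hom (\<lambda>q. poly q (t :: 'k::comm_ring_1))"
  by unfold_locales auto

lemma comm_ring_hom_map_poly:
  assumes "comm_ring_hom h"
  shows "comm_ring_hom (map_poly h)"
proof -
  interpret comm_ring_hom h by fact
  show ?thesis
    by unfold_locales
      (auto intro!: poly_eqI simp: coeff_map_poly coeff_mult hom_add hom_mult hom_sum coeff_1)
qed

subsection \<open>One variable singled out\<close>

definition as_poly :: "'x \<Rightarrow> ('x, 'k::comm_ring_1) mpoly \<Rightarrow> ('x, 'k) mpoly poly" where
  "as_poly j = eval_in (\<lambda>c. [:Const c:]) (\<lambda>x. if x = j then [:0, 1:] else [:Var x:])"

lemma comm_ring_hom_pConst: "comm_ring_hom (\<lambda>c. [:Const c :: ('x, 'k::comm_ring_1) mpoly:])"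
  by (rule comm_ring_hom_compose[OF comm_ring_hom_const_poly comm_ring_hom_Const])

lemma comm_ring_hom_as_poly: "comm_ring_hom (as_poly j)"
  unfolding as_poly_def by (rule comm_ring_hom_eval_in[OF comm_ring_hom_pConst])

lemma poly_as_poly [simp]: "poly (as_poly j p) (Var j) = p"
  by (rule eval_in_polys_eqI[OF comm_ring_hom_compose[OF comm_ring_hom_poly_eval comm_ring_hom_as_poly]
        comm_ring_hom_id polys_UNIV])
    (auto simp: as_poly_def eval_in_Const[OF comm_ring_hom_pConst] eval_in_Var[OF comm_ring_hom_pConst])

lemma as_poly_over: "p \<in> polys T \<Longrightarrow> as_poly j p \<in> poly_over (polys (T - {j}))"
  unfolding as_poly_def
  by (rule eval_in_polys_mem[OF comm_ring_hom_pConst])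
    (auto intro!: poly_over_closed[OF ring_subset_polys] poly_over_X[OF ring_subset_polys] polys_Var)

lemma eval_as_poly:
  "poly (map_poly (eval_at a) (as_poly j p)) t = eval_at (a(j := t)) (p :: ('x, 'k::comm_ring_1) mpoly)"
proof -
  have 1: "comm_ring_hom (map_poly (eval_at a) :: ('x, 'k) mpoly poly \<Rightarrow> 'k poly)"
    by (rule comm_ring_hom_map_poly[OF eval_at.comm_ring_hom_axioms])
  show ?thesis
    by (rule eval_in_polys_eqI[OF comm_ring_hom_compose[OF comm_ring_hom_poly_eval
          comm_ring_hom_compose[OF 1 comm_ring_hom_as_poly]] eval_at.comm_ring_hom_axioms polys_UNIV])
      (auto simp: as_poly_def eval_in_Const[OF comm_ring_hom_pConst] eval_in_Var[OF comm_ring_hom_pConst]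
         map_poly_pCons)
qed

lemma mpoly_eq_0_if_vanishing:
  fixes p :: "('x, 'k::field_char_0) mpoly"
  assumes "finite B" "p \<in> polys B" "\<And>a. eval_at a p = 0"
  shows "p = 0"
  using assms
proof (induction B arbitrary: p rule: finite_induct)
  case empty
  have "p = Const (mlookup p 0)"
    using empty.prems(1)
    by (intro poly_mapping_eqI) (auto simp: Const_def lookup_single when_def polys_def in_keys_iff)
  then show ?case using empty.prems(2) by (metis eval_at_Const Const_zero)
next
  case (insert x B)
  have "coeff (as_poly x p) n = 0" for n
  proof (rule insert.IH)
    have "as_poly x p \<in> poly_over (polys (insert x B - {x}))" by (rule as_poly_over[OF insert.prems(1)])
    then show "coeff (as_poly x p) n \<in> polys B" using insert.hyps by (simp add: poly_over_def)
    fix a :: "'x \<Rightarrow> 'k"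
    have "poly (map_poly (eval_at a) (as_poly x p)) t = 0" for t
      by (simp add: eval_as_poly insert.prems)
    then have "map_poly (eval_at a) (as_poly x p) = 0" by (simp add: poly_all_0_iff_0[symmetric])
    then show "eval_at a (coeff (as_poly x p) n) = 0"
      using arg_cong[of _ _ "\<lambda>q. coeff q n"] by (metis coeff_0 coeff_map_poly eval_at.hom_zero)
  qed
  then have "as_poly x p = 0" by (intro poly_eqI) simp
  then show ?case using poly_as_poly[of x p] by simp
qed

definition line_poly :: "('x \<Rightarrow> 'k) \<Rightarrow> ('x \<Rightarrow> 'k) \<Rightarrow> ('x, 'k::comm_ring_1) mpoly \<Rightarrow> 'k poly" where
  "line_poly a b = eval_in (\<lambda>c. [:c:]) (\<lambda>x. [:a x, b x:])"

lemma comm_ring_hom_line_poly: "comm_ring_hom (line_poly a b)"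
  unfolding line_poly_def by (rule comm_ring_hom_eval_in[OF comm_ring_hom_const_poly])

lemma poly_line_poly: "poly (line_poly a b p) t = eval_at (\<lambda>x. a x + t * b x) p"
  by (rule eval_in_polys_eqI[OF comm_ring_hom_compose[OF comm_ring_hom_poly_eval
        comm_ring_hom_line_poly] eval_at.comm_ring_hom_axioms polys_UNIV])
    (auto simp: line_poly_def eval_in_Const[OF comm_ring_hom_const_poly] eval_in_Var[OF comm_ring_hom_const_poly])

section \<open>Gradients on the dual of a Lie algebra\<close>

context lie_algebra
begin

interpretation bracket_right: Vector_Spaces.linear scale scale "bracket x" for x by (rule linear_right)
interpretation bracket_left: Vector_Spaces.linear scale scale "\<lambda>y. bracket y x" for x by (rule linear_left)

lemmas bracket_simps = bracket_right.add bracket_right.scale bracket_right.sum bracket_right.zero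
  bracket_left.add bracket_left.scale bracket_left.sum bracket_left.zero bracket_right.neg bracket_left.neg
  bracket_right.diff bracket_left.diff

lemma bracket_antisym: "bracket x y = - bracket y x"
proof -
  have "bracket (x + y) (x + y) = bracket x x + bracket x y + (bracket y x + bracket y y)"
    by (simp only: bracket_right.add bracket_left.add add_ac)
  then have "bracket x y + bracket y x = 0" by (simp add: alternating)
  then show ?thesis by (simp add: eq_neg_iff_add_eq_0)
qed

lemma dual_iff: "\<xi> \<in> dual \<longleftrightarrow> (\<forall>x y. \<xi> (x + y) = \<xi> x + \<xi> y) \<and> (\<forall>c x. \<xi> (scale c x) = c * \<xi> x)"
proof
  assume "\<xi> \<in> dual"
  then interpret Vector_Spaces.linear scale "(*)" \<xi> by (simp add: dual_def)
  show "(\<forall>x y. \<xi> (x + y) = \<xi> x + \<xi> y) \<and> (\<forall>c x. \<xi> (scale c x) = c * \<xi> x)"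
    by (simp add: add scale)
next
  assume "(\<forall>x y. \<xi> (x + y) = \<xi> x + \<xi> y) \<and> (\<forall>c x. \<xi> (scale c x) = c * \<xi> x)"
  then have "Vector_Spaces.linear scale (*) \<xi>"
    by unfold_locales (auto simp: algebra_simps)
  then show "\<xi> \<in> dual" by (simp add: dual_def)
qed

lemma dualD:
  assumes "\<xi> \<in> dual"
  shows "\<xi> (x + y) = \<xi> x + \<xi> y" "\<xi> (scale c x) = c * \<xi> x" "\<xi> 0 = 0" "\<xi> (- x) = - \<xi> x" "\<xi> (x - y) = \<xi> x - \<xi> y"
    "\<xi> (sum f A) = (\<Sum>i \<in> A. \<xi> (f i))"
proof -
  interpret Vector_Spaces.linear scale "(*)" \<xi> using assms by (simp add: dual_def)
  show "\<xi> (x + y) = \<xi> x + \<xi> y" "\<xi> (scale c x) = c * \<xi> x" "\<xi> 0 = 0" "\<xi> (- x) = - \<xi> x" "\<xi> (x - y) = \<xi> x - \<xi> y"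
    "\<xi> (sum f A) = (\<Sum>i \<in> A. \<xi> (f i))"
    by (simp_all add: add scale zero neg diff sum)
qed

lemma dual_closed [simp]:
  shows "(\<lambda>x. 0) \<in> dual" "\<xi> \<in> dual \<Longrightarrow> \<eta> \<in> dual \<Longrightarrow> (\<lambda>x. \<xi> x + \<eta> x) \<in> dual"
    "\<xi> \<in> dual \<Longrightarrow> (\<lambda>x. c * \<xi> x) \<in> dual" "\<xi> \<in> dual \<Longrightarrow> (\<lambda>x. - \<xi> x) \<in> dual"
    "\<xi> \<in> dual \<Longrightarrow> \<eta> \<in> dual \<Longrightarrow> (\<lambda>x. \<xi> x - \<eta> x) \<in> dual"
  by (auto simp: dual_iff algebra_simps)

lemma dual_representation:
  assumes "independent E" "span E = UNIV"
  shows "(\<lambda>x. representation E x b) \<in> dual"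
  using representation_add[OF assms(1)] representation_scale[OF assms(1)] assms(2)
  by (auto simp: dual_iff)

lemma dual_sum: "finite A \<Longrightarrow> (\<And>i. i \<in> A \<Longrightarrow> f i \<in> dual) \<Longrightarrow> (\<lambda>x. \<Sum>i \<in> A. f i x) \<in> dual"
  by (induction A rule: finite_induct) auto

lemma dual_extend: "\<exists>\<xi> \<in> dual. \<forall>b \<in> Basis. \<xi> b = a b"
proof (intro bexI[of _ "\<lambda>x. \<Sum>b \<in> Basis. a b * representation Basis x b"] ballI)
  show "(\<lambda>x. \<Sum>b \<in> Basis. a b * representation Basis x b) \<in> dual"
    by (intro dual_sum finite_Basis dual_closed dual_representation independent_Basis span_Basis)
  fix c assume "c \<in> Basis"
  then have "(\<Sum>b \<in> Basis. a b * representation Basis c b) = (\<Sum>b \<in> Basis. if b = c then a c else 0)"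
    by (intro sum.cong) (auto simp: representation_basis[OF independent_Basis])
  then show "(\<Sum>b \<in> Basis. a b * representation Basis c b) = a c"
    using \<open>c \<in> Basis\<close> finite_Basis by simp
qed

lemma sum_Basis_representation: "(\<Sum>b \<in> Basis. scale (representation Basis v b) b) = v"
  by (rule sum_representation_eq[OF independent_Basis]) (auto simp: span_Basis finite_Basis)

lemma eval_embed [simp]: "\<xi> \<in> dual \<Longrightarrow> eval_at \<xi> (embed v) = \<xi> v"
proof -
  assume \<xi>: "\<xi> \<in> dual"
  have "eval_at \<xi> (embed v) = \<xi> (\<Sum>b \<in> Basis. scale (representation Basis v b) b)"
    by (simp add: embed_def eval_at.hom_sum dualD[OF \<xi>])
  then show ?thesis by (simp add: sum_Basis_representation)
qed

lemma embed_sym [simp]: "embed v \<in> sym_algebra"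
  unfolding embed_def sym_algebra_def by (intro polys_sum polys_mult polys_Const polys_Var)

text \<open>The differential of \<open>f\<close> at \<open>\<xi>\<close>: a linear form on the dual
  space, hence an element of the Lie algebra. The value at \<open>\<xi>\<close> of a Poisson bracket
  thereby becomes \<open>\<xi>\<close> of a Lie bracket.\<close>

definition grad :: "('g \<Rightarrow> 'k) \<Rightarrow> ('g, 'k) mpoly \<Rightarrow> 'g" where
  "grad \<xi> f = (\<Sum>b \<in> Basis. scale (eval_at \<xi> (partial_deriv b f)) b)"

lemma grad_Const [simp]: "grad \<xi> (Const c) = 0"
  by (simp add: grad_def)

lemma grad_add [simp]: "grad \<xi> (f + g) = grad \<xi> f + grad \<xi> g"
  by (simp add: grad_def scale_left_distrib sum.distrib)

lemma grad_mult: "grad \<xi> (f * g) = scale (eval_at \<xi> f) (grad \<xi> g) + scale (eval_at \<xi> g) (grad \<xi> f)"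
  by (simp add: grad_def partial_deriv_mult scale_left_distrib sum.distrib scale_sum_right mult.commute)

lemma grad_embed [simp]: "grad \<xi> (embed v) = v"
proof -
  have "partial_deriv b (embed v) = Const (representation Basis v b)" if "b \<in> Basis" for b
  proof -
    have "partial_deriv b (embed v) = (\<Sum>c \<in> Basis. if c = b then Const (representation Basis v b) else 0)"
      unfolding embed_def partial_deriv_sum
      by (rule sum.cong) (auto simp: partial_deriv_mult partial_deriv_Var)
    then show ?thesis using that finite_Basis by simp
  qed
  then show ?thesis by (simp add: grad_def sum_Basis_representation)
qed

lemma eval_poisson:
  assumes "\<xi> \<in> dual"
  shows "eval_at \<xi> (poisson f g) = \<xi> (bracket (grad \<xi> f) (grad \<xi> g))"
  unfolding poisson_def grad_def
  by (simp add: eval_at.hom_sum assms dualD[OF assms] bracket_simps sum_distrib_left sum_distrib_right mult_ac)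
    (subst sum.swap, simp add: mult_ac)

lemma poisson_sym: "f \<in> sym_algebra \<Longrightarrow> g \<in> sym_algebra \<Longrightarrow> poisson f g \<in> sym_algebra"
  unfolding poisson_def using embed_sym unfolding sym_algebra_def
  by (intro polys_sum polys_mult partial_deriv_polys) auto

lemma grad_center:
  assumes "f \<in> poisson_center" "\<xi> \<in> dual"
  shows "grad \<xi> f \<in> stabilizer \<xi>"
  unfolding stabilizer_def
proof (intro CollectI allI)
  fix y
  have "poisson f (embed y) = 0" using assms(1) by (simp add: poisson_center_def)
  then show "\<xi> (bracket (grad \<xi> f) y) = 0"
    using eval_poisson[OF assms(2), of f "embed y"] by simp
qed

lemma subspace_stabilizer: "\<xi> \<in> dual \<Longrightarrow> subspace (stabilizer \<xi>)"
  unfolding subspace_def stabilizer_def by (auto simp: bracket_simps dualD)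

lemma dim_kernel_ge:
  assumes "subspace W" "\<phi> \<in> dual"
  shows "dim W \<le> Suc (dim {x \<in> W. \<phi> x = 0})"
proof (cases "\<exists>w \<in> W. \<phi> w \<noteq> 0")
  case True
  then obtain w where w: "w \<in> W" "\<phi> w \<noteq> 0" by blast
  let ?K = "{x \<in> W. \<phi> x = 0}"
  have "W \<subseteq> span (insert w ?K)"
  proof
    fix x assume x: "x \<in> W"
    let ?y = "x - scale (\<phi> x / \<phi> w) w"
    have "?y \<in> ?K"
      using x w subspace_diff[OF assms(1) x subspace_scale[OF assms(1) w(1)]] by (simp add: dualD[OF assms(2)])
    then have "?y + scale (\<phi> x / \<phi> w) w \<in> span (insert w ?K)"
      by (intro span_add span_scale) (auto intro: span_base)
    then show "x \<in> span (insert w ?K)" by simp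
  qed
  then have "dim W \<le> dim (insert w ?K)" by (metis dim_span dim_subset)
  also have "\<dots> \<le> Suc (dim ?K)" by (simp add: dim_insert)
  finally show ?thesis .
next
  case False
  then have "{x \<in> W. \<phi> x = 0} = W" by auto
  then show ?thesis by simp
qed

lemma subspace_kernel: "subspace W \<Longrightarrow> \<phi> \<in> dual \<Longrightarrow> subspace {x \<in> W. \<phi> x = 0}"
  unfolding subspace_def by (auto simp: dualD)

lemma dim_kernels_ge:
  assumes "finite I" "subspace W" "\<And>i. i \<in> I \<Longrightarrow> \<phi> i \<in> dual"
  shows "subspace {x \<in> W. \<forall>i \<in> I. \<phi> i x = 0} \<and> dim W \<le> card I + dim {x \<in> W. \<forall>i \<in> I. \<phi> i x = 0}"
  using assms(1,3)
proof (induction I rule: finite_induct)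
  case empty
  then show ?case using assms(2) by simp
next
  case (insert j I)
  let ?K = "{x \<in> W. \<forall>i \<in> I. \<phi> i x = 0}"
  have eq: "{x \<in> W. \<forall>i \<in> insert j I. \<phi> i x = 0} = {x \<in> ?K. \<phi> j x = 0}" by auto
  show ?case
    unfolding eq using insert dim_kernel_ge[of ?K "\<phi> j"] subspace_kernel[of ?K "\<phi> j"] by force
qed

lemma index_le: "\<xi> \<in> dual \<Longrightarrow> index \<le> dim (stabilizer \<xi>)"
  unfolding index_def by (rule cINF_lower) auto

lemma dual_reg_nonempty: "dual_reg \<noteq> {}"
proof -
  have "Inf ((\<lambda>\<xi>. dim (stabilizer \<xi>)) ` dual) \<in> (\<lambda>\<xi>. dim (stabilizer \<xi>)) ` dual"
    by (rule Inf_nat_def1) (use dual_closed(1) in blast)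
  then show ?thesis unfolding dual_reg_def index_def by force
qed

end

section \<open>Commutative polarizations\<close>

lemma mult_mat_vec_sum:
  assumes "A \<in> carrier_mat n m" "v \<in> carrier_vec m" "a < n"
  shows "(A *\<^sub>v v) $ a = (\<Sum>j<m. A $$ (a, j) * v $ j)"
  using assms by (auto simp: scalar_prod_def lessThan_atLeast0 intro!: sum.cong)

context lie_algebra
begin

lemma shift_hom: "comm_ring_hom (shift_expansion \<xi>)"
  unfolding shift_expansion_def by (rule comm_ring_hom_eval_in[OF comm_ring_hom_pConst])

lemma shift_Const: "shift_expansion \<xi> (Const c) = [:Const c:]"
  by (simp add: shift_expansion_def eval_in_Const[OF comm_ring_hom_pConst])

lemma shift_Var: "shift_expansion \<xi> (Var x) = [:Var x, Const (\<xi> x):]"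
  by (simp add: shift_expansion_def eval_in_Var[OF comm_ring_hom_pConst])

lemma shift_over: "f \<in> polys B \<Longrightarrow> shift_expansion \<xi> f \<in> poly_over (polys B)"
  unfolding shift_expansion_def
proof (rule eval_in_polys_mem[OF comm_ring_hom_pConst])
  note cl = poly_over_closed[OF ring_subset_polys[of B]]
  show "[:Const c:] \<in> poly_over (polys B)" for c by (intro cl polys_Const)
  show "[:Var x, Const (\<xi> x):] \<in> poly_over (polys B)" if "x \<in> B" for x
    using that by (auto simp: poly_over_def coeff_pCons split: nat.splits)
  show "p + q \<in> poly_over (polys B)" "p * q \<in> poly_over (polys B)"
    if "p \<in> poly_over (polys B)" "q \<in> poly_over (polys B)" for p q
    by (rule cl that)+
qed

lemma eval_shift:
  "poly (map_poly (eval_at \<eta>) (shift_expansion \<xi> f)) t = eval_at (\<lambda>x. \<eta> x + t * \<xi> x) f"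
  by (rule eval_in_polys_eqI[OF comm_ring_hom_compose[OF comm_ring_hom_poly_eval
        comm_ring_hom_compose[OF comm_ring_hom_map_poly[OF eval_at.comm_ring_hom_axioms] shift_hom]]
        eval_at.comm_ring_hom_axioms polys_UNIV])
    (auto simp: shift_Const shift_Var map_poly_pCons)

lemma derivation_on_partial_deriv: "derivation_on UNIV (partial_deriv b)"
  by (simp add: derivation_on_def partial_deriv_mult)

lemma partial_deriv_zero [simp]: "partial_deriv b 0 = 0"
  using partial_deriv_Const[of b 0] by simp

lemma partial_deriv_shift:
  "map_poly (partial_deriv b) (shift_expansion \<xi> f) = shift_expansion \<xi> (partial_deriv b f)"
proof -
  interpret shift: comm_ring_hom "shift_expansion \<xi>" by (rule shift_hom)
  have U: "ring_subset (UNIV :: ('g, 'k) mpoly set)" by (simp add: ring_subset_def)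
  have mem: "H \<in> poly_over UNIV" for H :: "('g, 'k) mpoly poly" by (simp add: poly_over_def)
  show ?thesis
    using polys_UNIV[of f]
  proof (induction f rule: polys_induct)
    case (Const c)
    then show ?case by (simp add: shift_Const map_poly_pCons)
  next
    case (Var x)
    then show ?case by (auto simp: shift_Var map_poly_pCons partial_deriv_Var)
  next
    case (add p q)
    then show ?case
      by (simp add: shift.hom_add map_poly_derivation_add[OF U derivation_on_partial_deriv mem mem])
  next
    case (mult p q)
    then show ?case
      by (simp add: shift.hom_add shift.hom_mult partial_deriv_mult
          map_poly_derivation_mult[OF U derivation_on_partial_deriv mem mem])
  qed
qed

text \<open>Shifting commutes with partial differentiation, so one polynomial in \<open>t\<close>
  has gradients of \<open>f\<close> along the line as its values and gradients of the shifts as its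
  coefficients. A linear condition on the former thus passes to the latter.\<close>

lemma grad_shift_poly:
  assumes "\<phi> \<in> dual"
  shows "\<exists>R. (\<forall>t. poly R t = \<phi> (grad (\<lambda>x. \<eta> x + t * \<xi> x) f)) \<and>
    (\<forall>j. coeff R j = \<phi> (grad \<eta> (coeff (shift_expansion \<xi> f) j)))"
proof -
  define R where "R = (\<Sum>b \<in> Basis. smult (\<phi> b) (map_poly (eval_at \<eta>) (shift_expansion \<xi> (partial_deriv b f))))"
  have "poly R t = \<phi> (grad (\<lambda>x. \<eta> x + t * \<xi> x) f)" for t
    by (simp add: R_def poly_sum eval_shift grad_def dualD[OF assms] mult.commute)
  moreover have "coeff R j = \<phi> (grad \<eta> (coeff (shift_expansion \<xi> f) j))" for j
    by (simp add: R_def coeff_sum coeff_map_poly grad_def dualD[OF assms] mult.commute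
        partial_deriv_shift[symmetric])
  ultimately show ?thesis by blast
qed

end

locale cp_setting = lie_algebra scale Basis bracket
  for scale :: "'k::{alg_closed_field, field_char_0} \<Rightarrow> 'g::ab_group_add \<Rightarrow> 'g"
    and Basis :: "'g set" and bracket :: "'g \<Rightarrow> 'g \<Rightarrow> 'g" +
  fixes \<h> :: "'g set"
  assumes cp: "commutative_polarization \<h>" and nonabelian: "\<not> abelian"
begin

interpretation bracket_right: Vector_Spaces.linear scale scale "bracket x" for x by (rule linear_right)
interpretation bracket_left: Vector_Spaces.linear scale scale "\<lambda>y. bracket y x" for x by (rule linear_left)

definition nh :: nat where "nh = dim \<h>"
definition nv :: nat where "nv = dimension - nh"

lemma subspace_h: "subspace \<h>" and bracket_h: "x \<in> \<h> \<Longrightarrow> y \<in> \<h> \<Longrightarrow> bracket x y = 0"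
  using cp by (auto simp: commutative_polarization_def)

lemma two_nh: "2 * nh = dimension + index"
proof -
  have "(of_nat (2 * nh) :: rat) = of_nat (dimension + index)"
    using cp by (simp add: commutative_polarization_def c_number_def nh_def)
  then show ?thesis by (simp only: of_nat_eq_iff)
qed

lemma nh_le: "nh \<le> dimension"
  unfolding nh_def by (metis dim_subset_UNIV dimension_def dim_UNIV)

lemma nh_nv: "nh + nv = dimension" and nh_eq: "nh = nv + index"
  using nh_le two_nh by (auto simp: nv_def)

lemma adapted_basis_exists:
  "\<exists>u :: nat \<Rightarrow> 'g. inj_on u {..<dimension} \<and> independent (u ` {..<dimension}) \<and>
     span (u ` {..<dimension}) = UNIV \<and> \<h> = span (u ` {..<nh})"
proof -
  obtain E where E: "E \<subseteq> \<h>" "independent E" "\<h> \<subseteq> span E" "card E = dim \<h>"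
    using basis_exists by blast
  have spE: "span E = \<h>" using E subspace_h by (metis span_minimal subset_antisym)
  let ?F = "extend_basis E"
  have F: "E \<subseteq> ?F" "independent ?F" "span ?F = UNIV"
    using extend_basis_superset[OF E(2)] independent_extend_basis[OF E(2)] span_extend_basis[OF E(2)] by auto
  have fin: "finite ?F" "finite E" using F(2) E(2) finiteI_independent by auto
  have cF: "card ?F = dimension"
    using dim_eq_card_independent[OF F(2)] dim_span[of ?F] F(3) by (simp add: dimension_def)
  obtain e1 where e1: "bij_betw e1 {..<nh} E"
    using ex_bij_betw_nat_finite[OF fin(2)] E(4) by (auto simp: nh_def atLeast0LessThan)
  have "card (?F - E) = nv"
    using card_Diff_subset[OF fin(2) F(1)] cF E(4) by (simp add: nv_def nh_def)
  then obtain e2 where e2: "bij_betw e2 {..<nv} (?F - E)"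
    using ex_bij_betw_nat_finite[of "?F - E"] fin by (auto simp: atLeast0LessThan)
  define u where "u a = (if a < nh then e1 a else e2 (a - nh))" for a
  have b1: "bij_betw u {..<nh} E"
    using e1 by (rule bij_betw_cong[THEN iffD1, rotated]) (simp add: u_def)
  have "bij_betw (\<lambda>a. e2 (a - nh)) {nh..<dimension} (?F - E)"
  proof (rule bij_betw_trans[OF _ e2, of "\<lambda>a. a - nh", unfolded comp_def])
    show "bij_betw (\<lambda>a. a - nh) {nh..<dimension} {..<nv}"
      by (rule bij_betwI[of _ _ _ "\<lambda>a. a + nh"]) (auto simp: nv_def)
  qed
  then have b2: "bij_betw u {nh..<dimension} (?F - E)"
    by (rule bij_betw_cong[THEN iffD1, rotated]) (simp add: u_def)
  have un: "{..<nh} \<union> {nh..<dimension} = {..<dimension}" using nh_le by auto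
  have "bij_betw u {..<dimension} ?F"
    using bij_betw_combine[OF b1 b2] F(1) unfolding un by (simp add: Un_absorb1)
  then show ?thesis
    using F b1 spE by (intro exI[of _ u]) (auto simp: bij_betw_def)
qed

definition u :: "nat \<Rightarrow> 'g" where
  "u = (SOME u. inj_on u {..<dimension} \<and> independent (u ` {..<dimension}) \<and>
     span (u ` {..<dimension}) = UNIV \<and> \<h> = span (u ` {..<nh}))"

lemma u_props: "inj_on u {..<dimension}" "independent (u ` {..<dimension})"
    "span (u ` {..<dimension}) = UNIV" "\<h> = span (u ` {..<nh})"
  using someI_ex[OF adapted_basis_exists] unfolding u_def by blast+

definition co :: "nat \<Rightarrow> 'g \<Rightarrow> 'k" where
  "co a x = representation (u ` {..<dimension}) x (u a)"

lemma co_dual: "co a \<in> dual"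
  unfolding co_def by (rule dual_representation[OF u_props(2,3)])

lemmas co_simps = dualD[OF co_dual]

lemma co_u: "a < dimension \<Longrightarrow> b < dimension \<Longrightarrow> co a (u b) = (if a = b then 1 else 0)"
  unfolding co_def using u_props(1)
  by (subst representation_basis[OF u_props(2)]) (auto dest: inj_onD)

lemma expand_u: "(\<Sum>a<dimension. scale (co a x) (u a)) = x"
proof -
  let ?E = "u ` {..<dimension}"
  have "x \<in> span ?E" by (simp only: u_props(3) UNIV_I)
  then have "(\<Sum>b \<in> ?E. scale (representation ?E x b) b) = x"
    by (intro sum_representation_eq[OF u_props(2)]) auto
  moreover have "(\<Sum>b \<in> ?E. scale (representation ?E x b) b) = (\<Sum>a<dimension. scale (co a x) (u a))"
    by (subst sum.reindex[OF u_props(1)]) (simp only: comp_def co_def)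
  ultimately show ?thesis by (simp only:)
qed

lemma u_in_h: "a < nh \<Longrightarrow> u a \<in> \<h>"
  using u_props(4) span_base by auto

lemma h_iff: "x \<in> \<h> \<longleftrightarrow> (\<forall>a \<in> {nh..<dimension}. co a x = 0)"
proof
  assume "x \<in> \<h>"
  then have x: "x \<in> span (u ` {..<nh})" using u_props(4) by simp
  have sub: "u ` {..<nh} \<subseteq> u ` {..<dimension}" using nh_le by auto
  have "representation (u ` {..<dimension}) x = representation (u ` {..<nh}) x"
    by (rule representation_extend[OF u_props(2) x sub])
  moreover have "u a \<notin> u ` {..<nh}" if "a \<in> {nh..<dimension}" for a
    using that u_props(1) nh_le by (auto dest!: inj_onD)
  ultimately show "\<forall>a \<in> {nh..<dimension}. co a x = 0"
    unfolding co_def using representation_ne_zero by metis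
next
  assume 0: "\<forall>a \<in> {nh..<dimension}. co a x = 0"
  have "x = (\<Sum>a<dimension. scale (co a x) (u a))" by (simp add: expand_u)
  also have "\<dots> = (\<Sum>a<nh. scale (co a x) (u a))"
    using 0 nh_le by (intro sum.mono_neutral_right) auto
  also have "\<dots> \<in> \<h>" by (intro subspace_sum subspace_scale subspace_h u_in_h) auto
  finally show "x \<in> \<h>" .
qed

lemma expand_h: "x \<in> \<h> \<Longrightarrow> (\<Sum>a<nh. scale (co a x) (u a)) = x"
proof -
  assume "x \<in> \<h>"
  then have 0: "\<forall>a \<in> {nh..<dimension}. co a x = 0" by (simp only: h_iff)
  have "(\<Sum>a<nh. scale (co a x) (u a)) = (\<Sum>a<dimension. scale (co a x) (u a))"
    using nh_le by (intro sum.mono_neutral_left) (auto simp: 0)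
  then show ?thesis by (simp add: expand_u)
qed

lemma bracket_u_h: "y \<in> \<h> \<Longrightarrow> bracket y x = (\<Sum>b<nv. scale (co (nh + b) x) (bracket y (u (nh + b))))"
proof -
  assume y: "y \<in> \<h>"
  have "bracket y x = bracket y (\<Sum>a<dimension. scale (co a x) (u a))" by (simp only: expand_u)
  also have "\<dots> = (\<Sum>a<dimension. scale (co a x) (bracket y (u a)))"
    by (simp add: bracket_right.sum bracket_right.scale)
  also have "\<dots> = (\<Sum>a \<in> {nh..<dimension}. scale (co a x) (bracket y (u a)))"
    using y u_in_h bracket_h by (intro sum.mono_neutral_right) auto
  also have "\<dots> = (\<Sum>b<nv. scale (co (nh + b) x) (bracket y (u (nh + b))))"
    by (rule sum.reindex_bij_witness[of _ "\<lambda>b. nh + b" "\<lambda>a. a - nh"]) (auto simp: nv_def)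
  finally show ?thesis .
qed

text \<open>For a constant matrix \<open>C\<close> with \<open>nh\<close> rows and \<open>index\<close> columns, \<open>\<delta> C\<close> is the determinant
  of the block matrix \<open>[M | C]\<close>, where \<open>M\<close> is the matrix of brackets between \<open>\<h>\<close> and a complement.
  The common zeros of all \<open>\<delta> C\<close> are the points where \<open>M\<close> is not injective.\<close>

definition dmat :: "(nat \<Rightarrow> nat \<Rightarrow> 'k) \<Rightarrow> ('g, 'k) mpoly mat" where
  "dmat C = mat nh nh (\<lambda>(a, j). if j < nv then embed (bracket (u a) (u (nh + j))) else Const (C a (j - nv)))"

definition dmat_at :: "('g \<Rightarrow> 'k) \<Rightarrow> (nat \<Rightarrow> nat \<Rightarrow> 'k) \<Rightarrow> 'k mat" where
  "dmat_at \<xi> C = mat nh nh (\<lambda>(a, j). if j < nv then \<xi> (bracket (u a) (u (nh + j))) else C a (j - nv))"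

definition \<delta> :: "(nat \<Rightarrow> nat \<Rightarrow> 'k) \<Rightarrow> ('g, 'k) mpoly" where
  "\<delta> C = det (dmat C)"

lemma dmat_carrier [simp]: "dmat C \<in> carrier_mat nh nh" "dmat_at \<xi> C \<in> carrier_mat nh nh"
  by (simp_all add: dmat_def dmat_at_def)

lemma det_polys:
  assumes "A \<in> carrier_mat n n" "\<And>i j. i < n \<Longrightarrow> j < n \<Longrightarrow> A $$ (i, j) \<in> polys B"
  shows "det A \<in> polys B"
proof -
  have s: "signof p \<in> polys B" for p :: "nat \<Rightarrow> nat" by (simp add: sign_def)
  show ?thesis
    unfolding det_def'[OF assms(1)]
    by (intro polys_sum polys_mult polys_prod s assms(2)) (auto simp: permutes_in_image)
qed

lemma \<delta>_sym: "\<delta> C \<in> polys Basis"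
  unfolding \<delta>_def
  by (rule det_polys[of _ nh]) (use embed_sym in \<open>auto simp: dmat_def sym_algebra_def\<close>)

lemma eval_\<delta>: "\<xi> \<in> dual \<Longrightarrow> eval_at \<xi> (\<delta> C) = det (dmat_at \<xi> C)"
proof -
  assume \<xi>: "\<xi> \<in> dual"
  have "map_mat (eval_at \<xi>) (dmat C) = dmat_at \<xi> C"
    by (intro eq_matI) (auto simp: dmat_def dmat_at_def \<xi>)
  then show ?thesis unfolding \<delta>_def by (metis eval_at.hom_det)
qed

text \<open>The complement coordinates of \<open>x\<close> solve the homogeneous system with the
  bracket matrix. Where this matrix is injective, \<open>\<h>\<close> is therefore its own
  orthogonal space for the form that \<open>\<xi>\<close> induces on the Lie algebra.\<close>

lemma nondeg_perp:
  assumes \<xi>: "\<xi> \<in> dual" "eval_at \<xi> (\<delta> C) \<noteq> 0" and x: "\<And>y. y \<in> \<h> \<Longrightarrow> \<xi> (bracket x y) = 0"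
  shows "x \<in> \<h>"
proof -
  \<comment> \<open>The padding by zeros keeps the constant columns \<open>C\<close> out of the
    product.\<close>
  define w where "w = vec nh (\<lambda>j. if j < nv then co (nh + j) x else 0)"
  have w: "w \<in> carrier_vec nh" by (simp add: w_def)
  have nvh: "nv \<le> nh" using nh_eq by simp
  have "dmat_at \<xi> C *\<^sub>v w = 0\<^sub>v nh"
  proof (rule eq_vecI)
    fix a assume "a < dim_vec (0\<^sub>v nh)"
    then have a: "a < nh" by simp
    have "(dmat_at \<xi> C *\<^sub>v w) $ a = (\<Sum>j<nh. dmat_at \<xi> C $$ (a, j) * w $ j)"
      by (rule mult_mat_vec_sum[OF dmat_carrier(2) w a])
    also have "\<dots> = (\<Sum>j<nh. if j < nv then \<xi> (bracket (u a) (u (nh + j))) * co (nh + j) x else 0)"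
      using a by (intro sum.cong) (auto simp: dmat_at_def w_def)
    also have "\<dots> = (\<Sum>j<nv. \<xi> (bracket (u a) (u (nh + j))) * co (nh + j) x)"
      using nvh by (intro sum.mono_neutral_cong_right) auto
    also have "\<dots> = \<xi> (bracket (u a) x)"
      by (simp add: bracket_u_h[OF u_in_h[OF a], of x] dualD[OF \<xi>(1)] mult.commute)
    also have "\<dots> = - \<xi> (bracket x (u a))"
      by (subst bracket_antisym) (simp add: dualD[OF \<xi>(1)])
    finally show "(dmat_at \<xi> C *\<^sub>v w) $ a = 0\<^sub>v nh $ a" using a x[OF u_in_h[OF a]] by simp
  qed (simp add: dmat_at_def)
  then have "w = 0\<^sub>v nh"
    using det_0_iff_vec_prod_zero_field[OF dmat_carrier(2)] w \<xi> eval_\<delta> by metis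
  have "co (nh + j) x = 0" if "j < nv" for j
    using arg_cong[OF \<open>w = 0\<^sub>v nh\<close>, of "\<lambda>w. w $ j"] that nvh by (simp add: w_def)
  then have "co a x = 0" if "a \<in> {nh..<dimension}" for a
    using that nh_nv by (metis atLeastLessThan_iff le_Suc_ex nat_add_left_cancel_less)
  then show ?thesis using h_iff by blast
qed

text \<open>An element of \<open>\<h>\<close> annihilated by all columns of the bracket matrix lies
  in the stabilizer, because brackets inside \<open>\<h>\<close> vanish anyway. At a regular point
  the stabilizer has dimension \<open>index\<close>, which is exactly the number of columns left for
  \<open>C\<close> to detect it.\<close>

lemma reg_\<delta>_nonzero:
  assumes "\<xi> \<in> dual_reg"
  shows "\<exists>C. eval_at \<xi> (\<delta> C) \<noteq> 0"
proof -
  have \<xi>: "\<xi> \<in> dual" "dim (stabilizer \<xi>) = index" using assms by (auto simp: dual_reg_def)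
  obtain E where E: "E \<subseteq> stabilizer \<xi>" "independent E" "stabilizer \<xi> \<subseteq> span E" "card E = index"
    using basis_exists[of "stabilizer \<xi>"] \<xi>(2) by metis
  let ?F = "extend_basis E"
  have F: "E \<subseteq> ?F" "independent ?F" "span ?F = UNIV"
    using extend_basis_superset[OF E(2)] independent_extend_basis[OF E(2)] span_extend_basis[OF E(2)] by auto
  have fin: "finite ?F" "finite E" using F(2) E(2) finiteI_independent by auto
  obtain \<kappa> where \<kappa>: "bij_betw \<kappa> {..<index} E"
    using ex_bij_betw_nat_finite[OF fin(2)] E(4) by (auto simp: atLeast0LessThan)
  \<comment> \<open>The extra columns are coordinate forms for a basis of the stabilizer, extended
    to the whole algebra; they separate the vectors of the stabilizer.\<close>
  define C where "C a j = representation ?F (u a) (\<kappa> j)" for a j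
  have rd: "(\<lambda>x. representation ?F x b) \<in> dual" for b by (rule dual_representation[OF F(2,3)])
  have "det (transpose_mat (dmat_at \<xi> C)) \<noteq> 0"
  proof
    assume "det (transpose_mat (dmat_at \<xi> C)) = 0"
    then obtain v where v: "v \<in> carrier_vec nh" "v \<noteq> 0\<^sub>v nh" "transpose_mat (dmat_at \<xi> C) *\<^sub>v v = 0\<^sub>v nh"
      using det_0_iff_vec_prod_zero_field[of "transpose_mat (dmat_at \<xi> C)" nh] by auto
    define y where "y = (\<Sum>a<nh. scale (v $ a) (u a))"
    have yh: "y \<in> \<h>" unfolding y_def by (intro subspace_sum subspace_scale subspace_h u_in_h) auto
    have 0: "(\<Sum>a<nh. dmat_at \<xi> C $$ (a, j) * v $ a) = 0" if "j < nh" for j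
    proof -
      have tc: "transpose_mat (dmat_at \<xi> C) \<in> carrier_mat nh nh" by simp
      have "(\<Sum>a<nh. transpose_mat (dmat_at \<xi> C) $$ (j, a) * v $ a) = 0"
        using mult_mat_vec_sum[OF tc v(1) that] that by (simp add: v(3))
      moreover have "transpose_mat (dmat_at \<xi> C) $$ (j, a) = dmat_at \<xi> C $$ (a, j)" if "a < nh" for a
        using that \<open>j < nh\<close> by (simp add: dmat_at_def)
      ultimately show ?thesis by simp
    qed
    have nvh: "nv \<le> nh" using nh_eq by simp
    have "\<xi> (bracket y (u (nh + j))) = 0" if "j < nv" for j
    proof -
      have "\<xi> (bracket y (u (nh + j))) = (\<Sum>a<nh. dmat_at \<xi> C $$ (a, j) * v $ a)"
        using that nvh
        by (simp add: y_def bracket_left.sum bracket_left.scale dualD[OF \<xi>(1)] dmat_at_def mult.commute)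
      then show ?thesis using 0[of j] that nvh by simp
    qed
    then have "\<xi> (bracket y z) = 0" for z
      by (subst bracket_u_h[OF yh]) (simp add: dualD[OF \<xi>(1)])
    then have ys: "y \<in> stabilizer \<xi>" by (simp add: stabilizer_def)
    have rep0: "representation ?F y (\<kappa> j) = 0" if "j < index" for j
    proof -
      have "representation ?F y (\<kappa> j) = (\<Sum>a<nh. dmat_at \<xi> C $$ (a, nv + j) * v $ a)"
        using that nh_eq by (simp add: y_def dualD[OF rd] dmat_at_def C_def mult.commute)
      then show ?thesis using 0[of "nv + j"] that nh_eq by simp
    qed
    have "representation ?F y b = 0" if "b \<in> ?F" for b
    proof (cases "b \<in> E")
      case True
      then obtain j where "j < index" "b = \<kappa> j" using \<kappa> by (auto simp: bij_betw_def)
      then show ?thesis using rep0 by simp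
    next
      case False
      have "representation ?F y = representation E y"
        by (rule representation_extend[OF F(2) _ F(1)]) (use ys E(3) in auto)
      then show ?thesis using False representation_ne_zero by metis
    qed
    then have "y = 0"
      using sum_representation_eq[OF F(2), of y ?F] F fin by auto
    have "v $ a = 0" if "a < nh" for a
    proof -
      have "co a y = (\<Sum>b<nh. v $ b * (if a = b then 1 else 0))"
        unfolding y_def using that nh_le by (simp add: co_simps co_u)
      then show ?thesis using \<open>y = 0\<close> that by (simp add: co_simps if_distrib cong: if_cong)
    qed
    then have "v = 0\<^sub>v nh" using v(1) by (intro eq_vecI) auto
    then show False using v(2) by simp
  qed
  then show ?thesis
    using det_transpose[OF dmat_carrier(2)] eval_\<delta>[OF \<xi>(1)] by (intro exI[of _ C]) metis
qed

text \<open>Where some \<open>\<delta> C\<close> is nonzero the stabilizer, which contains the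
  gradient, lies in \<open>\<h>\<close>. Other points are joined by a line to a regular point: a
  suitable \<open>\<delta> C\<close> is a nonzero polynomial on that line, so the components of the
  gradient outside \<open>\<h>\<close> vanish on all of it.\<close>

lemma grad_center_h:
  assumes f: "f \<in> poisson_center" and \<xi>: "\<xi> \<in> dual"
  shows "grad \<xi> f \<in> \<h>"
proof -
  obtain \<xi>0 where \<xi>0: "\<xi>0 \<in> dual_reg" using dual_reg_nonempty by blast
  obtain C where C: "eval_at \<xi>0 (\<delta> C) \<noteq> 0" using reg_\<delta>_nonzero[OF \<xi>0] by blast
  have \<xi>0d: "\<xi>0 \<in> dual" using \<xi>0 by (simp add: dual_reg_def)
  define \<eta> where "\<eta> x = \<xi>0 x - \<xi> x" for x
  have \<eta>: "\<eta> \<in> dual" unfolding \<eta>_def by (rule dual_closed(5)[OF \<xi>0d \<xi>])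
  have ld: "(\<lambda>x. \<xi> x + t * \<eta> x) \<in> dual" for t by (intro dual_closed \<xi> \<eta>)
  define P where "P = line_poly \<xi> \<eta> (\<delta> C)"
  have "poly P 1 \<noteq> 0" using C by (simp add: P_def poly_line_poly \<eta>_def)
  then have P: "P \<noteq> 0" by auto
  have "co a (grad \<xi> f) = 0" if a: "a \<in> {nh..<dimension}" for a
  proof -
    obtain R where R: "\<And>t. poly R t = co a (grad (\<lambda>x. \<xi> x + t * \<eta> x) f)"
      using grad_shift_poly[OF co_dual] by blast
    have "poly (P * R) t = 0" for t
    proof (cases "poly P t = 0")
      case False
      let ?\<zeta> = "\<lambda>x. \<xi> x + t * \<eta> x"
      have "grad ?\<zeta> f \<in> stabilizer ?\<zeta>" by (rule grad_center[OF f ld])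
      then have "grad ?\<zeta> f \<in> \<h>"
        using False by (intro nondeg_perp[OF ld, of t C]) (auto simp: stabilizer_def P_def poly_line_poly)
      then show ?thesis using h_iff a R by auto
    qed simp
    then have "P * R = 0" by (simp only: poly_all_0_iff_0[symmetric]) blast
    then have "R = 0" using P by simp
    then show ?thesis using R[of 0] by simp
  qed
  then show ?thesis using h_iff by blast
qed

text \<open>In characteristic zero this is the symmetric algebra of \<open>\<h>\<close>, described
  by gradients since the fixed basis need not be adapted to \<open>\<h>\<close>.\<close>

definition h_functions :: "('g, 'k) mpoly set" where
  "h_functions = {f \<in> sym_algebra. \<forall>\<xi> \<in> dual. grad \<xi> f \<in> \<h>}"

lemma sym_eq_0:
  assumes "f \<in> sym_algebra" "\<And>\<xi>. \<xi> \<in> dual \<Longrightarrow> eval_at \<xi> f = 0"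
  shows "f = 0"
proof (rule mpoly_eq_0_if_vanishing[OF finite_Basis])
  show "f \<in> polys Basis" using assms(1) by (simp add: sym_algebra_def)
  fix a :: "'g \<Rightarrow> 'k"
  obtain \<xi> where \<xi>: "\<xi> \<in> dual" "\<forall>b \<in> Basis. \<xi> b = a b" using dual_extend by blast
  have "eval_at a f = eval_at \<xi> f"
    by (rule eval_in_cong_polys[of _ Basis]) (use assms(1) \<xi> in \<open>auto simp: sym_algebra_def\<close>)
  then show "eval_at a f = 0" using assms(2) \<xi> by simp
qed

lemma h_functions_pcs: "poisson_commutative_subalgebra h_functions"
  unfolding poisson_commutative_subalgebra_def
proof (intro conjI ballI)
  show "subalgebra h_functions"
    unfolding Defs.subalgebra_def h_functions_def sym_algebra_def
    using subspace_0[OF subspace_h]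
    by (auto simp: grad_mult intro!: subspace_add[OF subspace_h] subspace_scale[OF subspace_h])
  show "h_functions \<subseteq> sym_algebra" by (auto simp: h_functions_def)
  fix f g assume fg: "f \<in> h_functions" "g \<in> h_functions"
  show "poisson f g = 0"
  proof (rule sym_eq_0)
    show "poisson f g \<in> sym_algebra" using fg by (intro poisson_sym) (auto simp: h_functions_def)
    fix \<xi> assume "\<xi> \<in> dual"
    then show "eval_at \<xi> (poisson f g) = 0"
      using fg by (auto simp: eval_poisson h_functions_def bracket_h dualD)
  qed
qed

lemma embed_h_functions: "x \<in> \<h> \<Longrightarrow> embed x \<in> h_functions"
  by (simp add: h_functions_def)

lemma mf_subset_h_functions:
  assumes "\<xi> \<in> dual"
  shows "mishchenko_fomenko \<xi> \<subseteq> h_functions"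
  unfolding mishchenko_fomenko_def
proof (rule hull_minimal)
  show "subalgebra h_functions" using h_functions_pcs by (simp add: poisson_commutative_subalgebra_def)
  show "(\<Union>f \<in> poisson_center. shifts \<xi> f) \<subseteq> h_functions"
  proof (clarify, unfold shifts_def, clarify)
    fix f j assume f: "f \<in> poisson_center"
    let ?g = "coeff (shift_expansion \<xi> f) j"
    have "grad \<eta> ?g \<in> \<h>" if \<eta>: "\<eta> \<in> dual" for \<eta>
    proof -
      have "co a (grad \<eta> ?g) = 0" if a: "a \<in> {nh..<dimension}" for a
      proof -
        obtain R where R: "\<And>t. poly R t = co a (grad (\<lambda>x. \<eta> x + t * \<xi> x) f)"
          "\<And>j. coeff R j = co a (grad \<eta> (coeff (shift_expansion \<xi> f) j))"
          using grad_shift_poly[OF co_dual] by blast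
        have "poly R t = 0" for t
        proof -
          have "grad (\<lambda>x. \<eta> x + t * \<xi> x) f \<in> \<h>"
            by (rule grad_center_h[OF f dual_closed(2)[OF \<eta> dual_closed(3)[OF assms]]])
          then show ?thesis using a by (simp only: h_iff R(1))
        qed
        then have "R = 0" by (simp only: poly_all_0_iff_0[symmetric]) blast
        then show ?thesis using R(2)[of j] by simp
      qed
      then show ?thesis using h_iff by blast
    qed
    moreover have "?g \<in> sym_algebra"
      using shift_over[of f Basis \<xi>] f by (auto simp: poisson_center_def sym_algebra_def poly_over_def)
    ultimately show "?g \<in> h_functions" by (simp add: h_functions_def)
  qed
qed

text \<open>The gradients at the origin of the shifts of \<open>f\<close> are the coefficients of
  the gradient of \<open>f\<close> along the line through \<open>\<xi>\<close>, and all points of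
  this line except the origin have the same stabilizer as \<open>\<xi>\<close>. By the product rule
  at a single point the property passes from the shifts to the algebra they generate.\<close>

lemma grad_0_mf:
  assumes \<xi>: "\<xi> \<in> dual" and g: "g \<in> mishchenko_fomenko \<xi>"
  shows "grad (\<lambda>x. 0) g \<in> stabilizer \<xi>"
proof -
  let ?S = "{g. grad (\<lambda>x. 0) g \<in> stabilizer \<xi>}"
  note sub = subspace_stabilizer[OF \<xi>]
  have "subalgebra ?S"
    unfolding Defs.subalgebra_def using subspace_0[OF sub]
    by (auto simp: grad_mult intro!: subspace_add[OF sub] subspace_scale[OF sub])
  moreover have "(\<Union>f \<in> poisson_center. shifts \<xi> f) \<subseteq> ?S"
  proof (clarify, unfold shifts_def, clarify)
    fix f j assume f: "f \<in> poisson_center"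
    show "grad (\<lambda>x. 0) (coeff (shift_expansion \<xi> f) j) \<in> stabilizer \<xi>"
      unfolding stabilizer_def
    proof (intro CollectI allI)
      fix y
      have d: "(\<lambda>x. \<xi> (bracket x y)) \<in> dual"
        using \<xi> by (auto simp: dual_iff bracket_left.add bracket_left.scale)
      obtain R where R: "\<And>t. poly R t = \<xi> (bracket (grad (\<lambda>x. 0 + t * \<xi> x) f) y)"
        "\<And>j. coeff R j = \<xi> (bracket (grad (\<lambda>x. 0) (coeff (shift_expansion \<xi> f) j)) y)"
        using grad_shift_poly[OF d, of "\<lambda>x. 0" \<xi> f] by blast
      \<comment> \<open>The factor \<open>t\<close> turns the stabilizer condition at
        \<open>t\<close> times \<open>\<xi>\<close> into a condition on \<open>R\<close> that also
        holds at the origin.\<close>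
      have "poly ([:0, 1:] * R) t = 0" for t
      proof -
        have "t * \<xi> (bracket (grad (\<lambda>x. t * \<xi> x) f) y) = 0"
          using grad_center[OF f dual_closed(3)[OF \<xi>, of t]] unfolding stabilizer_def by blast
        then show ?thesis using R(1)[of t] by simp
      qed
      then have "[:0, 1:] * R = 0" by (simp only: poly_all_0_iff_0[symmetric]) blast
      then have "R = 0" by simp
      then show "\<xi> (bracket (grad (\<lambda>x. 0) (coeff (shift_expansion \<xi> f) j)) y) = 0" using R(2)[of j] by simp
    qed
  qed
  ultimately have "mishchenko_fomenko \<xi> \<subseteq> ?S" unfolding mishchenko_fomenko_def by (intro hull_minimal)
  then show ?thesis using g by blast
qed

text \<open>If every stabilizer were the whole algebra, every linear form would kill every bracket.
  The inequality makes the number \<open>nv\<close> of columns of the bracket matrix positive, on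
  which both halves of the theorem rest.\<close>

lemma index_less_dimension: "index < dimension"
proof (rule ccontr)
  assume "\<not> ?thesis"
  have "bracket x y = 0" for x y
  proof -
    have "\<xi> (bracket x y) = 0" if \<xi>: "\<xi> \<in> dual" for \<xi>
    proof -
      have "dimension \<le> dim (stabilizer \<xi>)" using index_le[OF \<xi>] \<open>\<not> index < dimension\<close> by simp
      then have "span (stabilizer \<xi>) = UNIV"
        by (metis dim_UNIV dim_eq_full dim_subset_UNIV le_antisym dimension_def)
      then have "stabilizer \<xi> = UNIV" using span_eq_iff subspace_stabilizer[OF \<xi>] by metis
      then show ?thesis unfolding stabilizer_def by blast
    qed
    then have "co a (bracket x y) = 0" for a using co_dual by blast
    then show ?thesis using expand_u[of "bracket x y"] by simp
  qed
  then show False using nonabelian by (simp add: abelian_def)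
qed

lemma nv_pos: "nv > 0"
  using index_less_dimension nh_eq nh_nv by simp

theorem mf_not_maximal:
  assumes "\<xi> \<in> dual_reg"
  shows "\<not> maximal_poisson_commutative_subalgebra (mishchenko_fomenko \<xi>)"
proof
  assume max: "maximal_poisson_commutative_subalgebra (mishchenko_fomenko \<xi>)"
  have \<xi>: "\<xi> \<in> dual" "dim (stabilizer \<xi>) = index" using assms by (auto simp: dual_reg_def)
  have "h_functions = mishchenko_fomenko \<xi>"
    using max h_functions_pcs mf_subset_h_functions[OF \<xi>(1)]
    by (simp add: maximal_poisson_commutative_subalgebra_def)
  then have "\<h> \<subseteq> stabilizer \<xi>"
    using embed_h_functions grad_0_mf[OF \<xi>(1)] by (metis grad_embed subsetI)
  then have "nh \<le> index" unfolding nh_def using dim_subset \<xi>(2) by metis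
  then show False using nv_pos nh_eq by simp
qed

end

section \<open>Zariski closed cones\<close>

lemma monic_division:
  assumes R: "ring_subset R" and G: "G \<in> poly_over R" "lead_coeff G = 1" and H: "H \<in> poly_over R"
  shows "\<exists>Q \<in> poly_over R. \<exists>K \<in> poly_over R. H = Q * G + K \<and> (K = 0 \<or> degree K < degree G)"
  using pseudo_division_over[OF R G(1) H] by (auto simp: G(2))

text \<open>Divisibility can be tested locally at the roots, one linear factor at a time; the
  multiplier \<open>f\<close> may vary with the root.\<close>

lemma dvd_cancel_no_common_root:
  fixes g :: "'k::alg_closed_field poly"
  assumes "g \<noteq> 0" "\<And>x. poly g x = 0 \<Longrightarrow> \<exists>f. poly f x \<noteq> 0 \<and> g dvd f * h"
  shows "g dvd h"
  using assms
proof (induction "degree g" arbitrary: g rule: less_induct)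
  case less
  show ?case
  proof (cases "degree g = 0")
    case True
    then show ?thesis using less.prems(1) by (metis degree_eq_zeroE dvd_trans is_unit_const_poly_iff
          is_unit_iff_degree one_dvd dvd_refl)
  next
    case False
    then obtain x where x: "poly g x = 0" using alg_closed_imp_poly_has_root[of g] by auto
    then obtain g' where g': "g = [:-x, 1:] * g'" by (auto simp: poly_eq_0_iff_dvd)
    have "g' \<noteq> 0" using less.prems(1) g' by auto
    then have "degree g' < degree g" unfolding g' by (subst degree_mult_eq) auto
    moreover have "\<exists>f. poly f y \<noteq> 0 \<and> g' dvd f * h" if "poly g' y = 0" for y
      using less.prems(2)[of y] that unfolding g' by (metis dvd_mult_right mult_zero_right poly_mult)
    ultimately have "g' dvd h" using less.hyps \<open>g' \<noteq> 0\<close> by blast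
    then obtain h' where h': "h = g' * h'" by blast
    obtain f where f: "poly f x \<noteq> 0" "g dvd f * h" using less.prems(2)[OF x] by blast
    then have "g' * [:-x, 1:] dvd g' * (f * h')" unfolding g' h' by (simp only: mult_ac)
    then have "[:-x, 1:] dvd f * h'" using \<open>g' \<noteq> 0\<close> by (simp only: dvd_mult_cancel_left) simp
    then have "poly h' x = 0" using f(1) by (simp add: poly_eq_0_iff_dvd[symmetric])
    then have "[:-x, 1:] dvd h'" by (simp add: poly_eq_0_iff_dvd)
    then have "[:-x, 1:] * g' dvd h' * g'" by (intro mult_dvd_mono dvd_refl)
    then show ?thesis unfolding g' h' by (simp only: mult.commute)
  qed
qed

context cp_setting
begin

definition zclosed :: "('g \<Rightarrow> 'k) set \<Rightarrow> bool" where
  "zclosed K \<longleftrightarrow> (\<exists>F \<subseteq> sym_algebra. K = {a \<in> dual. \<forall>f \<in> F. eval_at a f = 0})"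

definition cone :: "('g \<Rightarrow> 'k) set \<Rightarrow> bool" where
  "cone Z \<longleftrightarrow> (\<forall>a \<in> Z. \<forall>c. (\<lambda>x. c * a x) \<in> Z)"

text \<open>The saturation of \<open>K\<close> under translation by multiples of \<open>v\<close>.
  It stands for the projection of \<open>K\<close> along \<open>v\<close> while staying in the same
  dual space.\<close>

definition lsum :: "('g \<Rightarrow> 'k) set \<Rightarrow> ('g \<Rightarrow> 'k) \<Rightarrow> ('g \<Rightarrow> 'k) set" where
  "lsum K v = {\<lambda>x. a x + t * v x |a t. a \<in> K}"

lemma zclosed_subset_dual: "zclosed K \<Longrightarrow> K \<subseteq> dual"
  by (auto simp: zclosed_def)

lemma zclosed_Int: "zclosed K \<Longrightarrow> zclosed L \<Longrightarrow> zclosed (K \<inter> L)"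
  unfolding zclosed_def
proof (elim exE conjE)
  fix F G assume "F \<subseteq> sym_algebra" "G \<subseteq> sym_algebra" "K = {a \<in> dual. \<forall>f \<in> F. eval_at a f = 0}"
    "L = {a \<in> dual. \<forall>f \<in> G. eval_at a f = 0}"
  then show "\<exists>F \<subseteq> sym_algebra. K \<inter> L = {a \<in> dual. \<forall>f \<in> F. eval_at a f = 0}"
    by (intro exI[of _ "F \<union> G"]) auto
qed

lemma zclosed_Inter:
  assumes "\<And>K. K \<in> C \<Longrightarrow> zclosed K" "C \<noteq> {}"
  shows "zclosed (\<Inter>C)"
proof -
  define F where "F = {f \<in> sym_algebra. \<exists>K \<in> C. \<forall>a \<in> K. eval_at a f = 0}"
  have "\<Inter>C = {a \<in> dual. \<forall>f \<in> F. eval_at a f = 0}"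
  proof (intro equalityI subsetI)
    fix a assume "a \<in> \<Inter>C"
    then show "a \<in> {a \<in> dual. \<forall>f \<in> F. eval_at a f = 0}"
      using assms zclosed_subset_dual by (auto simp: F_def)
  next
    fix a assume a: "a \<in> {a \<in> dual. \<forall>f \<in> F. eval_at a f = 0}"
    show "a \<in> \<Inter>C"
    proof
      fix K assume K: "K \<in> C"
      then obtain G where G: "G \<subseteq> sym_algebra" "K = {a \<in> dual. \<forall>f \<in> G. eval_at a f = 0}"
        using assms(1)[OF K] unfolding zclosed_def by blast
      have "f \<in> F" if f: "f \<in> G" for f
      proof -
        have "\<forall>a \<in> K. eval_at a f = 0" using G(2) f by simp
        then show ?thesis using G(1) f K unfolding F_def by auto
      qed
      then show "a \<in> K" unfolding G(2) using a by simp
    qed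
  qed
  moreover have "F \<subseteq> sym_algebra" by (auto simp: F_def)
  ultimately show ?thesis unfolding zclosed_def by blast
qed

lemma mono_const_poly: "map_poly (eval_at \<eta>) (map_poly Const q) = q"
  by (intro poly_eqI) (simp add: coeff_map_poly)

lemma map_poly_Const_over: "map_poly Const q \<in> poly_over (polys Basis)"
  by (simp add: poly_over_def coeff_map_poly)

lemma infinite_nonzero_poly_eq_0:
  fixes q :: "'k poly"
  assumes "\<And>t. t \<noteq> 0 \<Longrightarrow> poly q t = 0"
  shows "q = 0"
proof -
  have "poly ([:0, 1:] * q) t = 0" for t using assms by auto
  then have "[:0, 1:] * q = 0" by (simp only: poly_all_0_iff_0[symmetric]) blast
  then show ?thesis by simp
qed

text \<open>For \<open>g\<close> homogeneous of degree \<open>D\<close> and nonzero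
  \<open>t\<close>, the value at \<open>\<eta>\<close> plus \<open>t\<close> times \<open>v\<close>
  is \<open>t ^ D\<close> times the value at \<open>v\<close> plus \<open>\<eta>\<close> divided by
  \<open>t\<close>. The shift at \<open>\<eta>\<close> is thus a reversed line polynomial based at
  \<open>v\<close>, and its leading coefficient is the constant value of \<open>g\<close> at
  \<open>v\<close>.\<close>

lemma shift_homogeneous:
  assumes g: "g \<in> sym_algebra" and v: "v \<in> dual"
    and hom: "\<And>s \<xi>. \<xi> \<in> dual \<Longrightarrow> eval_at (\<lambda>x. s * \<xi> x) g = s ^ D * eval_at \<xi> g"
    and gv: "eval_at v g \<noteq> 0"
  shows "coeff (shift_expansion v g) j = (if j = D then Const (eval_at v g) else if j < D then coeff (shift_expansion v g) j else 0)"
    and "degree (shift_expansion v g) = D"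
proof -
  have *: "eval_at \<eta> (coeff (shift_expansion v g) j) = (if j = D then eval_at v g else 0)"
    if \<eta>: "\<eta> \<in> dual" and j: "j \<ge> D" for \<eta> j
  proof -
    define q where "q = map_poly (eval_at \<eta>) (shift_expansion v g)"
    define r where "r = line_poly v \<eta> g"
    define N where "N = degree r"
    have r0: "coeff r 0 = eval_at v g"
      using poly_line_poly[of v \<eta> g 0] by (simp add: r_def poly_0_coeff_0)
    \<comment> \<open>The reversal identity with denominators cleared by \<open>t ^ N\<close>; it is
      verified at nonzero \<open>t\<close> only.\<close>
    have "monom 1 N * q - monom 1 D * reflect_poly r = 0"
    proof (rule infinite_nonzero_poly_eq_0)
      fix t :: 'k assume t: "t \<noteq> 0"
      have "poly q t = eval_at (\<lambda>x. \<eta> x + t * v x) g" by (simp add: q_def eval_shift)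
      also have "(\<lambda>x. \<eta> x + t * v x) = (\<lambda>x. t * (v x + inverse t * \<eta> x))"
        using t by (auto simp: algebra_simps)
      also have "eval_at \<dots> g = t ^ D * poly r (inverse t)"
        unfolding r_def poly_line_poly by (rule hom) (intro dual_closed v \<eta>)
      finally show "poly (monom 1 N * q - monom 1 D * reflect_poly r) t = 0"
        using t by (simp add: poly_monom poly_reflect_poly_nz N_def)
    qed
    then have "coeff (monom 1 N * q) (j + N) = coeff (monom 1 D * reflect_poly r) (j + N)" by simp
    then have "coeff q j = coeff (reflect_poly r) (j + N - D)"
      using j by (simp add: coeff_monom_mult)
    also have "\<dots> = (if j = D then eval_at v g else 0)"
      using j by (auto simp: coeff_reflect_poly N_def r0)
    finally show ?thesis by (simp add: q_def coeff_map_poly)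
  qed
  have mem: "coeff (shift_expansion v g) j \<in> sym_algebra" for j
    using shift_over[of g Basis v] g by (simp add: sym_algebra_def poly_over_def)
  have D: "coeff (shift_expansion v g) D = Const (eval_at v g)"
    using sym_eq_0[of "coeff (shift_expansion v g) D - Const (eval_at v g)"] mem[of D] *[of _ D]
    by (simp add: sym_algebra_def)
  have gt: "coeff (shift_expansion v g) j = 0" if "j > D" for j
    using sym_eq_0[OF mem[of j]] *[of _ j] that by simp
  show "coeff (shift_expansion v g) j = (if j = D then Const (eval_at v g) else if j < D then coeff (shift_expansion v g) j else 0)"
    using D gt[of j] by auto
  show "degree (shift_expansion v g) = D"
    using D gt gv by (intro antisym degree_le le_degree) auto
qed

text \<open>On a cone the homogeneous components of a vanishing polynomial vanish one by one. They
  are the coefficients of \<open>f\<close> after all variables are scaled by a parameter, and one of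
  them is nonzero at \<open>v\<close> because their sum is.\<close>

lemma homogeneous_separation:
  assumes Z: "zclosed Z" "cone Z" and v: "v \<in> dual" "v \<notin> Z"
  shows "\<exists>g D. g \<in> sym_algebra \<and> (\<forall>a \<in> Z. eval_at a g = 0) \<and> eval_at v g \<noteq> 0 \<and>
    (\<forall>s. \<forall>\<xi> \<in> dual. eval_at (\<lambda>x. s * \<xi> x) g = s ^ D * eval_at \<xi> g)"
proof -
  obtain F where F: "F \<subseteq> sym_algebra" "Z = {a \<in> dual. \<forall>f \<in> F. eval_at a f = 0}"
    using Z(1) by (auto simp: zclosed_def)
  then obtain f where f: "f \<in> sym_algebra" "eval_at v f \<noteq> 0" "\<forall>a \<in> Z. eval_at a f = 0" using v by blast
  define H where "H = eval_in (\<lambda>c. [:Const c :: ('g, 'k) mpoly:]) (\<lambda>x. [:0, Var x:]) f"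
  have H_over: "H \<in> poly_over (polys Basis)"
    unfolding H_def
  proof (rule eval_in_polys_mem[OF comm_ring_hom_pConst])
    note cl = poly_over_closed[OF ring_subset_polys[of Basis]]
    show "f \<in> polys Basis" using f(1) by (simp add: sym_algebra_def)
    show "[:Const c:] \<in> poly_over (polys Basis)" for c by (intro cl polys_Const)
    show "[:0, Var x:] \<in> poly_over (polys Basis)" if "x \<in> Basis" for x
      using that by (auto simp: poly_over_def coeff_pCons split: nat.splits)
    show "p + q \<in> poly_over (polys Basis)" "p * q \<in> poly_over (polys Basis)"
      if "p \<in> poly_over (polys Basis)" "q \<in> poly_over (polys Basis)" for p q
      by (rule cl that)+
  qed
  define L where "L \<xi> = map_poly (eval_at \<xi>) H" for \<xi>
  have L: "poly (L \<xi>) s = eval_at (\<lambda>x. s * \<xi> x) f" for \<xi> s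
    unfolding L_def H_def
    by (rule eval_in_polys_eqI[OF comm_ring_hom_compose[OF comm_ring_hom_poly_eval
        comm_ring_hom_compose[OF comm_ring_hom_map_poly[OF eval_at.comm_ring_hom_axioms]
          comm_ring_hom_eval_in[OF comm_ring_hom_pConst]]]
        eval_at.comm_ring_hom_axioms polys_UNIV])
      (auto simp: eval_in_Const[OF comm_ring_hom_pConst] eval_in_Var[OF comm_ring_hom_pConst] map_poly_pCons)
  have cL: "coeff (L \<xi>) D = eval_at \<xi> (coeff H D)" for \<xi> D by (simp add: L_def coeff_map_poly)
  have "L v \<noteq> 0" using L[of v 1] f(2) by auto
  then obtain D where D: "coeff (L v) D \<noteq> 0" by (metis leading_coeff_0_iff)
  show ?thesis
  proof (intro exI[of _ "coeff H D"] exI[of _ D] conjI ballI allI)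
    show "coeff H D \<in> sym_algebra" using H_over by (simp add: poly_over_def sym_algebra_def)
    show "eval_at v (coeff H D) \<noteq> 0" using D by (simp add: cL)
    show "eval_at a (coeff H D) = 0" if "a \<in> Z" for a
    proof -
      have "poly (L a) s = 0" for s using Z(2) that f(3) by (simp add: L cone_def)
      then have "L a = 0" by (simp only: poly_all_0_iff_0[symmetric]) blast
      then show ?thesis using cL[of a D] by simp
    qed
    show "eval_at (\<lambda>x. s * \<xi> x) (coeff H D) = s ^ D * eval_at \<xi> (coeff H D)" for s \<xi>
    proof -
      have "poly (L (\<lambda>x. s * \<xi> x)) t = poly (pcompose (L \<xi>) [:0, s:]) t" for t
        by (simp add: L poly_pcompose mult_ac)
      then have "L (\<lambda>x. s * \<xi> x) = pcompose (L \<xi>) [:0, s:]" by (simp only: poly_eq_poly_eq_iff[symmetric] fun_eq_iff) blast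
      then show ?thesis by (simp add: cL[symmetric] coeff_pcompose_linear)
    qed
  qed
qed

text \<open>A homogeneous equation of the cone that does not vanish at \<open>v\<close>, divided by
  its value there, is monic in the direction of \<open>v\<close>. This is what makes the projection
  of \<open>Z\<close> along \<open>v\<close> finite.\<close>

lemma exists_monic_equation:
  assumes Z: "zclosed Z" "cone Z" and v: "v \<in> dual" "v \<notin> Z"
  shows "\<exists>G \<in> poly_over (polys Basis). lead_coeff G = 1 \<and>
    (\<forall>\<eta> \<in> dual. \<forall>t. (\<lambda>x. \<eta> x + t * v x) \<in> Z \<longrightarrow> poly (map_poly (eval_at \<eta>) G) t = 0)"
proof -
  obtain g D where g: "g \<in> sym_algebra" "\<forall>a \<in> Z. eval_at a g = 0" "eval_at v g \<noteq> 0"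
    "\<And>s \<xi>. \<xi> \<in> dual \<Longrightarrow> eval_at (\<lambda>x. s * \<xi> x) g = s ^ D * eval_at \<xi> g"
    using homogeneous_separation[OF Z v] by blast
  note sh = shift_homogeneous[OF g(1) v(1) g(4,3)]
  define \<gamma> where "\<gamma> = eval_at v g"
  define G where "G = smult (Const (1 / \<gamma>)) (shift_expansion v g)"
  have cG: "coeff G D = 1"
    using sh(1)[of D] g(3) by (simp add: G_def \<gamma>_def Const_mult[symmetric])
  have "degree G \<le> D" using sh(2) degree_smult_le[of "Const (1 / \<gamma>)" "shift_expansion v g"] by (simp add: G_def)
  moreover have "D \<le> degree G" using cG by (intro le_degree) simp
  ultimately have "lead_coeff G = 1" using cG by simp
  moreover have "G \<in> poly_over (polys Basis)"
    unfolding G_def using shift_over[of g Basis v] g(1)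
    by (intro poly_over_closed[OF ring_subset_polys] polys_Const) (auto simp: sym_algebra_def)
  moreover have "poly (map_poly (eval_at \<eta>) G) t = 0" if "(\<lambda>x. \<eta> x + t * v x) \<in> Z" for \<eta> t
  proof -
    have "map_poly (eval_at \<eta>) G = smult (1 / \<gamma>) (map_poly (eval_at \<eta>) (shift_expansion v g))"
      by (intro poly_eqI) (simp add: G_def coeff_map_poly)
    then show ?thesis using that g(2) by (simp add: eval_shift)
  qed
  ultimately show ?thesis by blast
qed

lemma finite_line_cone:
  assumes Z: "zclosed Z" "cone Z" and v: "v \<in> dual" "v \<notin> Z" and \<eta>: "\<eta> \<in> dual"
  shows "finite {t. (\<lambda>x. \<eta> x + t * v x) \<in> Z}"
proof -
  obtain G where G: "lead_coeff G = 1"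
    "\<forall>\<eta> \<in> dual. \<forall>t. (\<lambda>x. \<eta> x + t * v x) \<in> Z \<longrightarrow> poly (map_poly (eval_at \<eta>) G) t = 0"
    using exists_monic_equation[OF Z v] by blast
  have "coeff (map_poly (eval_at \<eta>) G) (degree G) = 1" using G(1) by (simp add: coeff_map_poly)
  then have "map_poly (eval_at \<eta>) G \<noteq> 0" by auto
  then have "finite {t. poly (map_poly (eval_at \<eta>) G) t = 0}" by (rule poly_roots_finite)
  then show ?thesis by (rule finite_subset[rotated]) (use G(2) \<eta> in auto)
qed

text \<open>Elimination: \<open>G\<close> and \<open>H\<close> have a common root at \<open>\<eta>\<close> iff multiplication by \<open>H\<close> on the residues
  modulo \<open>G\<close> is singular at \<open>\<eta>\<close>; its determinant is a polynomial in \<open>\<eta>\<close> since \<open>G\<close> is monic.\<close>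

lemma zclosed_lsum:
  assumes Z: "zclosed Z" "cone Z" and v: "v \<in> dual" "v \<notin> Z" and K: "zclosed K" "K \<subseteq> Z"
  shows "zclosed (lsum K v)"
proof -
  obtain G where G: "G \<in> poly_over (polys Basis)" "lead_coeff G = 1"
    "\<forall>\<eta> \<in> dual. \<forall>t. (\<lambda>x. \<eta> x + t * v x) \<in> Z \<longrightarrow> poly (map_poly (eval_at \<eta>) G) t = 0"
    using exists_monic_equation[OF Z v] by blast
  define D where "D = degree G"
  let ?e = "\<lambda>\<eta> H. map_poly (eval_at \<eta>) H"
  note R = ring_subset_polys[of Basis]
  note cl = poly_over_closed[OF R]
  have e: "comm_ring_hom (?e \<eta>)" for \<eta> by (rule comm_ring_hom_map_poly[OF eval_at.comm_ring_hom_axioms])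
  interpret e: comm_ring_hom "?e \<eta>" for \<eta> by (rule e)
  \<comment> \<open>Quotient and remainder of \<open>monom 1 j * H\<close> by \<open>G\<close>; the
    remainders form the rows of the multiplication matrix.\<close>
  define rd where "rd j H = (SOME QK. fst QK \<in> poly_over (polys Basis) \<and> snd QK \<in> poly_over (polys Basis) \<and>
      monom 1 j * H = fst QK * G + snd QK \<and> (snd QK = 0 \<or> degree (snd QK) < D))" for j H
  have rd: "fst (rd j H) \<in> poly_over (polys Basis) \<and> snd (rd j H) \<in> poly_over (polys Basis) \<and>
      monom 1 j * H = fst (rd j H) * G + snd (rd j H) \<and> (snd (rd j H) = 0 \<or> degree (snd (rd j H)) < D)"
    if H: "H \<in> poly_over (polys Basis)" for j H
    unfolding rd_def
  proof (rule someI_ex)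
    have "monom 1 j * H \<in> poly_over (polys Basis)" by (intro cl H) simp
    from monic_division[OF R G(1,2) this] obtain Q K where "Q \<in> poly_over (polys Basis)" "K \<in> poly_over (polys Basis)"
      "monom 1 j * H = Q * G + K" "K = 0 \<or> degree K < degree G" by blast
    then show "\<exists>QK. fst QK \<in> poly_over (polys Basis) \<and> snd QK \<in> poly_over (polys Basis) \<and>
      monom 1 j * H = fst QK * G + snd QK \<and> (snd QK = 0 \<or> degree (snd QK) < D)"
      by (intro exI[of _ "(Q, K)"]) (simp add: D_def)
  qed
  define M where "M H = mat D D (\<lambda>(j, l). coeff (snd (rd j H)) l)" for H
  define E where "E = {det (M H) |H. H \<in> poly_over (polys Basis) \<and>
     (\<forall>\<eta> \<in> dual. \<forall>t. (\<lambda>x. \<eta> x + t * v x) \<in> K \<longrightarrow> poly (?e \<eta> H) t = 0)}"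
  have MC: "M H \<in> carrier_mat D D" for H by (simp add: M_def)
  have "E \<subseteq> sym_algebra"
    using rd by (auto simp: E_def sym_algebra_def M_def intro!: det_polys[OF MC[unfolded M_def]] poly_over_coeff)
  moreover have "lsum K v = {a \<in> dual. \<forall>f \<in> E. eval_at a f = 0}"
  proof (intro equalityI subsetI)
    fix \<eta> assume "\<eta> \<in> lsum K v"
    then obtain a t where a: "a \<in> K" "\<eta> = (\<lambda>x. a x + t * v x)" by (auto simp: lsum_def)
    have ad: "a \<in> dual" using a K zclosed_subset_dual by blast
    have \<eta>: "\<eta> \<in> dual" unfolding a(2) by (intro dual_closed ad v)
    define \<tau> where "\<tau> = - t"
    have aK: "(\<lambda>x. \<eta> x + \<tau> * v x) \<in> K" using a by (simp add: \<tau>_def)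
    have G0: "poly (?e \<eta> G) \<tau> = 0" using G(3) \<eta> aK K(2) by blast
    have Dpos: "D > 0"
    proof (rule ccontr)
      assume "\<not> D > 0"
      then obtain b where b: "G = [:b:]" by (metis D_def degree_eq_zeroE gr0I)
      then have "b = 1" using G(2) by simp
      then show False using G0 b by (simp add: map_poly_pCons)
    qed
    have "eval_at \<eta> (det (M H)) = 0" if H: "H \<in> poly_over (polys Basis)" "\<forall>\<eta> \<in> dual. \<forall>t. (\<lambda>x. \<eta> x + t * v x) \<in> K \<longrightarrow> poly (?e \<eta> H) t = 0" for H
    proof -
      have H0: "poly (?e \<eta> H) \<tau> = 0" using H(2) \<eta> aK by blast
      \<comment> \<open>The powers of a common root form a kernel vector of the multiplication
        matrix.\<close>
      define w where "w = vec D (\<lambda>l. \<tau> ^ l)"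
      have wc: "w \<in> carrier_vec D" by (simp add: w_def)
      have MeC: "map_mat (eval_at \<eta>) (M H) \<in> carrier_mat D D" by (simp add: M_def)
      have "map_mat (eval_at \<eta>) (M H) *\<^sub>v w = 0\<^sub>v D"
      proof (rule eq_vecI)
        fix j assume "j < dim_vec (0\<^sub>v D)"
        then have j: "j < D" by simp
        let ?K = "snd (rd j H)"
        have deg: "\<forall>l \<ge> D. coeff (?e \<eta> ?K) l = 0"
          using rd[OF H(1), of j] by (auto simp: coeff_map_poly coeff_eq_0)
        have "(map_mat (eval_at \<eta>) (M H) *\<^sub>v w) $ j = (\<Sum>l<D. coeff (?e \<eta> ?K) l * \<tau> ^ l)"
          unfolding mult_mat_vec_sum[OF MeC wc j] using j
          by (intro sum.cong) (auto simp: M_def w_def coeff_map_poly)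
        also have "\<dots> = poly (?e \<eta> ?K) \<tau>"
          using deg Dpos
          by (subst poly_as_sum_of_monoms'[symmetric, of "?e \<eta> ?K" "D - 1"])
            (auto intro!: degree_le simp: poly_sum poly_monom atMost_def lessThan_def intro!: sum.cong)
        also have "\<dots> = poly (?e \<eta> (monom 1 j * H - fst (rd j H) * G)) \<tau>"
          using rd[OF H(1), of j] by (simp add: algebra_simps)
        also have "\<dots> = 0" using G0 H0 by (simp add: e.hom_minus e.hom_mult)
        finally show "(map_mat (eval_at \<eta>) (M H) *\<^sub>v w) $ j = 0\<^sub>v D $ j" using j by simp
      qed (simp add: M_def)
      moreover have "w \<noteq> 0\<^sub>v D"
      proof
        assume "w = 0\<^sub>v D"
        from arg_cong[OF this, of "\<lambda>w. w $ 0"] show False using Dpos by (simp add: w_def)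
      qed
      ultimately have "det (map_mat (eval_at \<eta>) (M H)) = 0"
        using det_0_iff_vec_prod_zero_field[OF MeC] wc by blast
      then show ?thesis by simp
    qed
    then show "\<eta> \<in> {a \<in> dual. \<forall>f \<in> E. eval_at a f = 0}" using \<eta> unfolding E_def by blast
  next
    fix \<eta> assume \<eta>: "\<eta> \<in> {a \<in> dual. \<forall>f \<in> E. eval_at a f = 0}"
    then have \<eta>d: "\<eta> \<in> dual" by simp
    show "\<eta> \<in> lsum K v"
    proof (rule ccontr)
      assume no: "\<eta> \<notin> lsum K v"
      have noK: "(\<lambda>x. \<eta> x + t * v x) \<notin> K" for t
      proof
        assume "(\<lambda>x. \<eta> x + t * v x) \<in> K"
        then have "\<eta> \<in> lsum K v"
          unfolding lsum_def
          by (intro CollectI exI[of _ "\<lambda>x. \<eta> x + t * v x"] exI[of _ "- t"]) auto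
        then show False using no by blast
      qed
      obtain F where F: "F \<subseteq> sym_algebra" "K = {a \<in> dual. \<forall>f \<in> F. eval_at a f = 0}"
        using K(1) by (auto simp: zclosed_def)
      define g where "g = ?e \<eta> G"
      have cg: "coeff g D = 1" using G(2) by (simp add: g_def coeff_map_poly D_def)
      then have g0: "g \<noteq> 0" by auto
      have dg: "degree g = D"
        using cg map_poly_degree_leq[of "eval_at \<eta>" G] by (intro antisym le_degree) (auto simp: g_def D_def)
      define T where "T = {t. poly g t = 0}"
      have T: "finite T" unfolding T_def by (rule poly_roots_finite[OF g0])
      have "\<forall>t. \<exists>f \<in> F. eval_at (\<lambda>x. \<eta> x + t * v x) f \<noteq> 0"
        using noK F(2) dual_closed(2)[OF \<eta>d dual_closed(3)[OF v(1)]] by blast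
      then obtain f where f: "\<And>t. f t \<in> F" "\<And>t. eval_at (\<lambda>x. \<eta> x + t * v x) (f t) \<noteq> 0" by metis
      \<comment> \<open>At different roots of \<open>g\<close> different equations of
        \<open>K\<close> may be nonzero. Weighting them with Lagrange products gives one
        \<open>H\<close> that vanishes over \<open>K\<close> but at no root of
        \<open>g\<close>.\<close>
      define l where "l t = (\<Prod>s \<in> T - {t}. [:- s, 1:])" for t
      have l: "poly (l t) s = (\<Prod>r \<in> T - {t}. s - r)" for t s by (simp add: l_def poly_prod)
      define H where "H = (\<Sum>t \<in> T. shift_expansion v (f t) * map_poly Const (l t))"
      have H: "H \<in> poly_over (polys Basis)"
        unfolding H_def using F(1) f(1)
        by (intro ring_subset_sum[OF ring_subset_poly_over_set[OF R]] cl shift_over map_poly_Const_over) (auto simp: sym_algebra_def)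
      have eH: "poly (?e \<zeta> H) s = (\<Sum>t \<in> T. eval_at (\<lambda>x. \<zeta> x + s * v x) (f t) * poly (l t) s)" for \<zeta> s
        by (simp add: H_def e.hom_sum e.hom_mult poly_sum eval_shift mono_const_poly)
      have "det (M H) \<in> E"
        unfolding E_def using H eH F f(1) by (intro CollectI exI[of _ H]) auto
      then have 0: "det (map_mat (eval_at \<eta>) (M H)) = 0" using \<eta> by simp
      have MeC: "map_mat (eval_at \<eta>) (M H) \<in> carrier_mat D D" by (simp add: M_def)
      have "det (transpose_mat (map_mat (eval_at \<eta>) (M H))) = 0" using 0 det_transpose[OF MeC] by simp
      moreover have MtC: "transpose_mat (map_mat (eval_at \<eta>) (M H)) \<in> carrier_mat D D" using MeC by simp
      ultimately obtain c where c: "c \<in> carrier_vec D" "c \<noteq> 0\<^sub>v D"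
        "transpose_mat (map_mat (eval_at \<eta>) (M H)) *\<^sub>v c = 0\<^sub>v D"
        using det_0_iff_vec_prod_zero_field[OF MtC] by blast
      \<comment> \<open>A kernel vector of the transposed matrix is a polynomial of degree below
        \<open>D\<close> whose product with \<open>H\<close> is divisible by \<open>g\<close>. As
        \<open>H\<close> has no root in common with \<open>g\<close>, this polynomial must be
        zero.\<close>
      define C where "C = (\<Sum>j<D. monom (c $ j) j)"
      have K0: "(\<Sum>j<D. smult (c $ j) (?e \<eta> (snd (rd j H)))) = 0"
      proof (rule poly_eqI)
        fix l
        show "coeff (\<Sum>j<D. smult (c $ j) (?e \<eta> (snd (rd j H)))) l = coeff 0 l"
        proof (cases "l < D")
          case True
          have "(\<Sum>j<D. transpose_mat (map_mat (eval_at \<eta>) (M H)) $$ (l, j) * c $ j) = 0"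
            using mult_mat_vec_sum[OF MtC c(1) True] c(3) True by simp
          moreover have "transpose_mat (map_mat (eval_at \<eta>) (M H)) $$ (l, j) = eval_at \<eta> (coeff (snd (rd j H)) l)" if "j < D" for j
            using that True by (simp add: M_def)
          ultimately show ?thesis by (simp add: coeff_sum coeff_map_poly mult.commute)
        next
          case False
          then have "coeff (snd (rd j H)) l = 0" for j
            using rd[OF H, of j] by (auto intro: coeff_eq_0)
          then show ?thesis by (simp add: coeff_sum coeff_map_poly)
        qed
      qed
      have rdj: "monom 1 j * ?e \<eta> H = ?e \<eta> (fst (rd j H)) * g + ?e \<eta> (snd (rd j H))" for j
      proof -
        have "?e \<eta> (monom 1 j * H) = ?e \<eta> (fst (rd j H) * G + snd (rd j H))" using rd[OF H, of j] by simp
        then show ?thesis by (simp add: e.hom_mult e.hom_add g_def map_poly_monom)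
      qed
      have "C * ?e \<eta> H = (\<Sum>j<D. smult (c $ j) (monom 1 j * ?e \<eta> H))"
        by (simp add: C_def sum_distrib_right smult_monom flip: mult_smult_left)
      also have "\<dots> = (\<Sum>j<D. smult (c $ j) (?e \<eta> (fst (rd j H)))) * g + (\<Sum>j<D. smult (c $ j) (?e \<eta> (snd (rd j H))))"
        unfolding rdj by (simp add: smult_add_right sum.distrib sum_distrib_right)
      also have "\<dots> = (\<Sum>j<D. smult (c $ j) (?e \<eta> (fst (rd j H)))) * g" unfolding K0 by simp
      finally have gC: "C * ?e \<eta> H = (\<Sum>j<D. smult (c $ j) (?e \<eta> (fst (rd j H)))) * g" .
      have "g dvd C * ?e \<eta> H" unfolding gC by (rule dvd_triv_right)
      then have "g dvd ?e \<eta> H * C" by (simp only: mult.commute)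
      moreover have "poly (?e \<eta> H) x \<noteq> 0" if "poly g x = 0" for x
      proof -
        have x: "x \<in> T" using that by (simp add: T_def)
        have "poly (?e \<eta> H) x = (\<Sum>t \<in> T. if t = x then eval_at (\<lambda>y. \<eta> y + x * v y) (f x) * poly (l x) x else 0)"
          unfolding eH using x T by (intro sum.cong refl) (auto simp: l)
        also have "\<dots> = eval_at (\<lambda>y. \<eta> y + x * v y) (f x) * poly (l x) x" using x T by simp
        finally show ?thesis using f(2)[of x] T by (simp add: l)
      qed
      ultimately have "g dvd C" using dvd_cancel_no_common_root[OF g0, of C] by blast
      moreover have "coeff C j = (if j < D then c $ j else 0)" for j
        by (simp add: C_def coeff_sum coeff_monom)
      then have cC: "\<And>j. coeff C j = (if j < D then c $ j else 0)" .
      have "C = 0"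
      proof (rule ccontr)
        assume "C \<noteq> 0"
        then have "D \<le> degree C" using \<open>g dvd C\<close> dg dvd_imp_degree_le by metis
        then have "lead_coeff C = 0" using cC[of "degree C"] by simp
        then show False using \<open>C \<noteq> 0\<close> by simp
      qed
      then have "c $ j = 0" if "j < D" for j using cC[of j] that by simp
      then have "c = 0\<^sub>v D" using c(1) by (intro eq_vecI) auto
      then show False using c(2) by simp
    qed
  qed
  ultimately show ?thesis unfolding zclosed_def by blast
qed

end

section \<open>Iterated projections of cones and chains of irreducible closed sets\<close>

context cp_setting
begin

primrec lsums :: "('g \<Rightarrow> 'k) list \<Rightarrow> ('g \<Rightarrow> 'k) set \<Rightarrow> ('g \<Rightarrow> 'k) set" where
  "lsums [] K = K"
| "lsums (v # vs) K = lsum (lsums vs K) v"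

text \<open>The list is read from its end: each vector avoids the saturation of \<open>Z\<close> by
  the vectors behind it. Every single projection is then one of a closed cone along a vector outside
  it.\<close>

primrec transversal :: "('g \<Rightarrow> 'k) list \<Rightarrow> ('g \<Rightarrow> 'k) set \<Rightarrow> bool" where
  "transversal [] Z \<longleftrightarrow> True"
| "transversal (v # vs) Z \<longleftrightarrow> transversal vs Z \<and> v \<in> dual \<and> v \<notin> lsums vs Z"

lemma lsum_mono: "K \<subseteq> L \<Longrightarrow> lsum K v \<subseteq> lsum L v"
  unfolding lsum_def by blast

lemma lsums_mono: "K \<subseteq> L \<Longrightarrow> lsums vs K \<subseteq> lsums vs L"
  by (induction vs) (auto dest: subsetD[OF lsum_mono])

lemma lsum_Un: "lsum (K \<union> L) v = lsum K v \<union> lsum L v"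
  unfolding lsum_def by blast

lemma lsums_Un: "lsums vs (K \<union> L) = lsums vs K \<union> lsums vs L"
  by (induction vs) (simp_all add: lsum_Un)

lemma lsums_iff: "\<eta> \<in> lsums vs K \<longleftrightarrow> (\<exists>a \<in> K. \<eta> \<in> lsums vs {a})"
proof (induction vs arbitrary: \<eta>)
  case (Cons v vs)
  have "\<eta> \<in> lsum (lsums vs K) v \<longleftrightarrow> (\<exists>a t. a \<in> lsums vs K \<and> \<eta> = (\<lambda>x. a x + t * v x))"
    by (auto simp: lsum_def)
  also have "\<dots> \<longleftrightarrow> (\<exists>b \<in> K. \<exists>a t. a \<in> lsums vs {b} \<and> \<eta> = (\<lambda>x. a x + t * v x))"
    using Cons by blast
  also have "\<dots> \<longleftrightarrow> (\<exists>b \<in> K. \<eta> \<in> lsum (lsums vs {b}) v)"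
    by (auto simp: lsum_def)
  finally show ?case by simp
qed simp

lemma cone_lsum: "cone K \<Longrightarrow> cone (lsum K v)"
  unfolding cone_def
proof (intro ballI allI)
  fix a c assume K: "\<forall>a \<in> K. \<forall>c. (\<lambda>x. c * a x) \<in> K" and "a \<in> lsum K v"
  then obtain b t where b: "b \<in> K" "a = (\<lambda>x. b x + t * v x)" by (auto simp: lsum_def)
  then have "(\<lambda>x. c * a x) = (\<lambda>x. (c * b x) + (c * t) * v x)" by (auto simp: algebra_simps)
  moreover have "(\<lambda>x. c * b x) \<in> K" using K b by blast
  ultimately show "(\<lambda>x. c * a x) \<in> lsum K v" by (auto simp: lsum_def)
qed

lemma cone_lsums: "cone K \<Longrightarrow> cone (lsums vs K)"
  by (induction vs) (auto intro: cone_lsum)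

lemma zclosed_lsums:
  assumes Z: "zclosed Z" "cone Z"
  shows "transversal vs Z \<Longrightarrow> zclosed K \<Longrightarrow> K \<subseteq> Z \<Longrightarrow> zclosed (lsums vs K)"
proof (induction vs arbitrary: K)
  case (Cons v vs)
  have "zclosed (lsums vs Z)" using Cons.IH[of Z] Cons.prems(1) Z by simp
  moreover have "cone (lsums vs Z)" by (rule cone_lsums[OF Z(2)])
  moreover have "zclosed (lsums vs K)" using Cons by simp
  ultimately show ?case
    using Cons.prems lsums_mono[OF Cons.prems(3), of vs] by (auto intro!: zclosed_lsum[of "lsums vs Z"])
qed simp

lemma lsums_annihilated:
  "\<eta> \<in> lsums vs {a} \<Longrightarrow> (\<And>v. v \<in> set vs \<Longrightarrow> v x = 0) \<Longrightarrow> \<eta> x = a x"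
  by (induction vs arbitrary: \<eta>) (auto simp: lsum_def)

text \<open>At every stage the line through the given point meets the previous saturation, a closed
  cone missing the new vector, in finitely many points.\<close>

lemma finite_fibre:
  assumes Z: "zclosed Z" "cone Z"
  shows "transversal vs Z \<Longrightarrow> \<eta> \<in> dual \<Longrightarrow> finite {a \<in> Z. \<eta> \<in> lsums vs {a}}"
proof (induction vs arbitrary: \<eta>)
  case Nil
  have "{a \<in> Z. \<eta> \<in> lsums [] {a}} \<subseteq> {\<eta>}" by auto
  then show ?case by (rule finite_subset) simp
next
  case (Cons v vs)
  then have v: "v \<in> dual" "v \<notin> lsums vs Z" and vs: "transversal vs Z" by auto
  have cl: "zclosed (lsums vs Z)" "cone (lsums vs Z)"
    using zclosed_lsums[OF Z vs Z(1)] cone_lsums[OF Z(2)] by auto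
  define T where "T = {t. (\<lambda>x. \<eta> x + t * v x) \<in> lsums vs Z}"
  have "finite T" unfolding T_def by (rule finite_line_cone[OF cl v Cons.prems(2)])
  moreover have "finite {a \<in> Z. (\<lambda>x. \<eta> x + t * v x) \<in> lsums vs {a}}" for t
    by (rule Cons.IH[OF vs]) (intro dual_closed v Cons.prems(2))
  ultimately have "finite (\<Union>t \<in> T. {a \<in> Z. (\<lambda>x. \<eta> x + t * v x) \<in> lsums vs {a}})" by blast
  moreover have "{a \<in> Z. \<eta> \<in> lsums (v # vs) {a}} \<subseteq> (\<Union>t \<in> T. {a \<in> Z. (\<lambda>x. \<eta> x + t * v x) \<in> lsums vs {a}})"
  proof
    fix a assume "a \<in> {a \<in> Z. \<eta> \<in> lsums (v # vs) {a}}"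
    then obtain b t where b: "a \<in> Z" "b \<in> lsums vs {a}" "\<eta> = (\<lambda>x. b x + t * v x)"
      by (auto simp: lsum_def)
    then have eq: "(\<lambda>x. \<eta> x + (- t) * v x) = b" by auto
    have "b \<in> lsums vs Z" using b lsums_iff by blast
    then have "- t \<in> T" using eq by (simp add: T_def)
    moreover have "a \<in> {a \<in> Z. (\<lambda>x. \<eta> x + (- t) * v x) \<in> lsums vs {a}}" using b eq by simp
    ultimately show "a \<in> (\<Union>t \<in> T. {a \<in> Z. (\<lambda>x. \<eta> x + t * v x) \<in> lsums vs {a}})" by blast
  qed
  ultimately show ?case by (rule finite_subset[rotated])
qed

text \<open>Since the fibres over \<open>U\<close> are finite, the covering property survives intersections of chains.\<close>

lemma minimal_covering:
  assumes Z: "zclosed Z" "cone Z" "transversal vs Z" and U: "U \<subseteq> dual"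
    and K0: "zclosed K0" "K0 \<subseteq> Z" "U \<subseteq> lsums vs K0"
  shows "\<exists>K. zclosed K \<and> K \<subseteq> K0 \<and> U \<subseteq> lsums vs K \<and>
    (\<forall>K'. zclosed K' \<longrightarrow> K' \<subseteq> K \<longrightarrow> U \<subseteq> lsums vs K' \<longrightarrow> K' = K)"
proof -
  define Fam where "Fam = {K. zclosed K \<and> K \<subseteq> K0 \<and> U \<subseteq> lsums vs K}"
  \<comment> \<open>Passing to complements turns the search for a minimal closed set into one for a
    maximal element, as Zorn's lemma requires.\<close>
  define N where "N = {dual - K |K. K \<in> Fam}"
  have inv: "dual - (dual - K) = K" if "K \<in> Fam" for K
    using that zclosed_subset_dual unfolding Fam_def by blast
  have "N \<noteq> {}" using K0 by (auto simp: N_def Fam_def)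
  moreover have "\<Union>C \<in> N" if C: "C \<noteq> {}" "subset.chain N C" for C
  proof -
    define D where "D = (\<lambda>A. dual - A) ` C"
    have CN: "C \<subseteq> N" and lin: "\<And>A B. A \<in> C \<Longrightarrow> B \<in> C \<Longrightarrow> A \<subseteq> B \<or> B \<subseteq> A"
      using C(2) by (auto simp: subset.chain_def)
    have D: "D \<subseteq> Fam"
    proof
      fix K assume "K \<in> D"
      then obtain A where "A \<in> C" "K = dual - A" by (auto simp: D_def)
      moreover then obtain K' where "A = dual - K'" "K' \<in> Fam" using CN by (auto simp: N_def)
      ultimately show "K \<in> Fam" using inv by simp
    qed
    have Dlin: "K \<subseteq> L \<or> L \<subseteq> K" if "K \<in> D" "L \<in> D" for K L
      using that lin unfolding D_def by blast
    have "D \<noteq> {}" using C(1) by (simp add: D_def)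
    have "\<Inter>D \<in> Fam"
      unfolding Fam_def
    proof (intro CollectI conjI)
      show "zclosed (\<Inter>D)" using D \<open>D \<noteq> {}\<close> by (intro zclosed_Inter) (auto simp: Fam_def)
      show "\<Inter>D \<subseteq> K0" using D \<open>D \<noteq> {}\<close> by (auto simp: Fam_def)
      show "U \<subseteq> lsums vs (\<Inter>D)"
      proof
        fix \<eta> assume \<eta>: "\<eta> \<in> U"
        define S where "S K = {a \<in> K. \<eta> \<in> lsums vs {a}}" for K
        have fin: "finite (S K)" if "K \<in> D" for K
        proof (rule finite_subset)
          show "finite {a \<in> Z. \<eta> \<in> lsums vs {a}}" using finite_fibre[OF Z] \<eta> U by blast
          show "S K \<subseteq> {a \<in> Z. \<eta> \<in> lsums vs {a}}" using that D K0(2) by (auto simp: S_def Fam_def)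
        qed
        \<comment> \<open>A member of the chain with the fewest points in the fibre: every smaller
          member has the same fibre points, so they lie in the whole intersection.\<close>
        obtain K1 where K1: "K1 \<in> D" "\<And>K. K \<in> D \<Longrightarrow> card (S K1) \<le> card (S K)"
          using \<open>D \<noteq> {}\<close> arg_min_nat_lemma[of "\<lambda>K. K \<in> D" _ "\<lambda>K. card (S K)"] by blast
        have "U \<subseteq> lsums vs K1" using K1(1) D by (auto simp: Fam_def)
        then obtain a where a: "a \<in> K1" "\<eta> \<in> lsums vs {a}" using \<eta> lsums_iff by blast
        have "a \<in> K" if K: "K \<in> D" for K
        proof (cases "K1 \<subseteq> K")
          case False
          then have "K \<subseteq> K1" using Dlin K K1(1) by blast
          then have "S K \<subseteq> S K1" by (auto simp: S_def)
          then have "S K = S K1" using fin[OF K1(1)] K1(2)[OF K] by (intro card_seteq)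
          then show ?thesis using a by (auto simp: S_def)
        qed (use a in blast)
        then show "\<eta> \<in> lsums vs (\<Inter>D)" using a(2) lsums_iff by blast
      qed
    qed
    moreover have "\<Union>C = dual - \<Inter>D"
    proof -
      have "A \<subseteq> dual" if "A \<in> C" for A using that CN by (auto simp: N_def)
      then show ?thesis using C(1) unfolding D_def by blast
    qed
    ultimately show ?thesis by (auto simp: N_def)
  qed
  ultimately obtain A where A: "A \<in> N" "\<And>B. B \<in> N \<Longrightarrow> A \<subseteq> B \<Longrightarrow> B = A"
    using subset_Zorn_nonempty[of N] by metis
  then obtain K where K: "K \<in> Fam" "A = dual - K" by (auto simp: N_def)
  have "K' = K" if "zclosed K'" "K' \<subseteq> K" "U \<subseteq> lsums vs K'" for K'
  proof -
    have "K' \<in> Fam" using that K by (auto simp: Fam_def)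
    moreover then have "dual - K' = A" using K that by (intro A(2)) (auto simp: N_def)
    ultimately show ?thesis using inv K by metis
  qed
  then show ?thesis using K(1) by (intro exI[of _ K]) (auto simp: Fam_def)
qed

lemma zariski_closed_in_iff: "zclosed K \<Longrightarrow> K \<subseteq> W \<Longrightarrow> W \<subseteq> dual \<Longrightarrow> zariski_closed_in sym_algebra W K"
  unfolding zclosed_def zariski_closed_in_def by blast

lemma zclosed_if_zariski_closed_in:
  assumes "zariski_closed_in sym_algebra W K1" "K1 \<subseteq> K" "zclosed K" "K \<subseteq> W"
  shows "zclosed K1"
proof -
  obtain F where F: "F \<subseteq> sym_algebra" "K1 = {a \<in> W. \<forall>f \<in> F. eval_at a f = 0}"
    using assms(1) by (auto simp: zariski_closed_in_def)
  have "zclosed {a \<in> dual. \<forall>f \<in> F. eval_at a f = 0}" unfolding zclosed_def using F(1) by blast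
  then have "zclosed (K \<inter> {a \<in> dual. \<forall>f \<in> F. eval_at a f = 0})" by (rule zclosed_Int[OF assms(3)])
  moreover have "K \<inter> {a \<in> dual. \<forall>f \<in> F. eval_at a f = 0} = K1"
    using F assms zclosed_subset_dual[OF assms(3)] by blast
  ultimately show ?thesis by simp
qed

text \<open>If \<open>U\<close> were in neither closed set, equations of the two sets would restrict
  to nonzero polynomials with zero product on the line through two points of
  \<open>U\<close>.\<close>

lemma linear_irreducible:
  assumes U: "U \<subseteq> dual" "\<And>\<xi> \<eta> t. \<xi> \<in> U \<Longrightarrow> \<eta> \<in> U \<Longrightarrow> (\<lambda>x. \<xi> x + t * (\<eta> x - \<xi> x)) \<in> U"
    and AB: "zclosed A" "zclosed B" "U \<subseteq> A \<union> B"
  shows "U \<subseteq> A \<or> U \<subseteq> B"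
proof (rule ccontr)
  assume "\<not> ?thesis"
  then obtain \<xi> \<eta> where 1: "\<xi> \<in> U" "\<xi> \<notin> A" "\<eta> \<in> U" "\<eta> \<notin> B" by blast
  obtain f where f: "f \<in> sym_algebra" "eval_at \<xi> f \<noteq> 0" "\<forall>a \<in> A. eval_at a f = 0"
    using AB(1) 1 U(1) unfolding zclosed_def by blast
  obtain g where g: "g \<in> sym_algebra" "eval_at \<eta> g \<noteq> 0" "\<forall>a \<in> B. eval_at a g = 0"
    using AB(2) 1 U(1) unfolding zclosed_def by blast
  let ?L = "line_poly \<xi> (\<lambda>x. \<eta> x - \<xi> x)"
  have "poly (?L f * ?L g) t = 0" for t
    using U(2)[OF 1(1,3), of t] AB(3) f(3) g(3) by (auto simp: poly_line_poly)
  then have "?L f * ?L g = 0" by (simp only: poly_all_0_iff_0[symmetric]) blast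
  moreover have "poly (?L f) 0 \<noteq> 0" "poly (?L g) 1 \<noteq> 0" using f g by (simp_all add: poly_line_poly)
  ultimately show False by auto
qed

text \<open>The projection of \<open>Z\<close> along \<open>vs\<close> is finite and onto, so a
  chain of linear subspaces lifts. A minimal closed set covering a linear subspace is irreducible:
  of two closed pieces, one would already cover it. Choosing these sets from the top downwards, each
  inside the previous one, makes them nested.\<close>

lemma cone_chain:
  assumes Z: "zclosed Z" "cone Z" "transversal vs Z" "lsums vs Z = dual" and W: "Z \<subseteq> W" "W \<subseteq> dual"
  shows "enat (dimension - length vs) \<le> zariski_dim sym_algebra W"
proof -
  have vsd: "set vs \<subseteq> dual" using Z(3) by (induction vs) auto
  define G where "G = {x. \<forall>v \<in> set vs. v x = 0}"
  have "subspace G \<and> dim UNIV \<le> card (set vs) + dim G"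
    using dim_kernels_ge[of "set vs" UNIV "\<lambda>v. v"] vsd by (auto simp: G_def)
  then have dG: "dimension - length vs \<le> dim G"
    using card_length[of vs] by (auto simp: dimension_def)
  obtain E where E: "E \<subseteq> G" "independent E" "G \<subseteq> span E" "card E = dim G"
    using basis_exists by blast
  let ?F = "extend_basis E"
  have F: "E \<subseteq> ?F" "independent ?F" "span ?F = UNIV"
    using extend_basis_superset[OF E(2)] independent_extend_basis[OF E(2)] span_extend_basis[OF E(2)] by auto
  have "finite E" using E(2) finiteI_independent by auto
  define d where "d = dim G"
  obtain e where e: "bij_betw e {..<d} E"
    using ex_bij_betw_nat_finite[OF \<open>finite E\<close>] E(4) by (auto simp: d_def atLeast0LessThan)
  have eG: "e l \<in> G" if "l < d" for l using e E(1) that by (auto simp: bij_betw_def)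
  \<comment> \<open>The conditions involve only elements of \<open>G\<close>, on which all of
    \<open>vs\<close> vanish, so each \<open>U j\<close> is stable under adding multiples of these
    vectors. A covering set can therefore be cut with \<open>U j\<close> without uncovering
    \<open>U j\<close>.\<close>
  define U where "U j = {\<xi> \<in> dual. \<forall>l \<in> {j..<d}. \<xi> (e l) = 0}" for j
  have Ud: "U j \<subseteq> dual" for j by (auto simp: U_def)
  have Ulin: "(\<lambda>x. \<xi> x + t * (\<eta> x - \<xi> x)) \<in> U j" if "\<xi> \<in> U j" "\<eta> \<in> U j" for \<xi> \<eta> t j
  proof -
    have "(\<lambda>x. \<xi> x + t * (\<eta> x - \<xi> x)) \<in> dual"
      using that by (intro dual_closed) (auto simp: U_def)
    then show ?thesis using that by (auto simp: U_def)
  qed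
  have Ucl: "zclosed (U j)" for j
    unfolding zclosed_def U_def
    by (rule exI[of _ "(\<lambda>l. embed (e l)) ` {j..<d}"]) auto
  have Umono: "U j \<subseteq> U (Suc j)" for j by (auto simp: U_def)
  have Ustrict: "\<exists>\<xi> \<in> U (Suc j). \<xi> \<notin> U j" if "j < d" for j
  proof (intro bexI[of _ "\<lambda>x. representation ?F x (e j)"])
    have rd: "(\<lambda>x. representation ?F x (e j)) \<in> dual" by (rule dual_representation[OF F(2,3)])
    have r: "representation ?F (e l) (e j) = (if l = j then 1 else 0)" if "l < d" for l
    proof -
      have "e l \<in> ?F" using e F(1) that by (auto simp: bij_betw_def)
      moreover have "e l = e j \<longleftrightarrow> l = j" using e that \<open>j < d\<close> by (auto simp: bij_betw_def inj_on_def)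
      ultimately show ?thesis by (auto simp: representation_basis[OF F(2)])
    qed
    show "(\<lambda>x. representation ?F x (e j)) \<in> U (Suc j)" using rd r by (auto simp: U_def)
    show "(\<lambda>x. representation ?F x (e j)) \<notin> U j" using r that by (auto simp: U_def)
  qed
  have Usum: "lsums vs K \<subseteq> U j" if "K \<subseteq> U j" "zclosed K" "K \<subseteq> Z" for K j
  proof
    fix \<eta> assume \<eta>: "\<eta> \<in> lsums vs K"
    then obtain a where a: "a \<in> K" "\<eta> \<in> lsums vs {a}" using lsums_iff by blast
    have "\<eta> x = a x" if "x \<in> G" for x
      using lsums_annihilated[OF a(2)] that by (auto simp: G_def)
    moreover have "\<eta> \<in> dual" using \<eta> zclosed_lsums[OF Z(1-3) that(2,3)] zclosed_subset_dual by blast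
    ultimately show "\<eta> \<in> U j" using a(1) that(1) eG by (auto simp: U_def)
  qed
  have Ucut: "U j \<subseteq> lsums vs (K \<inter> U j)" if "U j \<subseteq> lsums vs K" "K \<subseteq> dual" for K j
  proof
    fix \<eta> assume \<eta>: "\<eta> \<in> U j"
    then have "\<eta> \<in> lsums vs K" using that(1) by (rule subsetD[rotated])
    then obtain a where a: "a \<in> K" "\<eta> \<in> lsums vs {a}" unfolding lsums_iff[of \<eta> vs K] by (elim bexE)
    have "\<eta> x = a x" if "x \<in> G" for x
      using lsums_annihilated[OF a(2)] that by (auto simp: G_def)
    then have "a \<in> U j" using a(1) that(2) \<eta> eG by (auto simp: U_def)
    then show "\<eta> \<in> lsums vs (K \<inter> U j)"
      unfolding lsums_iff[of \<eta> vs "K \<inter> U j"] using a by (intro bexI[of _ a]) auto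
  qed
  \<comment> \<open>\<open>n\<close> counts steps down from \<open>U d\<close>, the whole dual
    space; from \<open>n = d\<close> on, the truncated subtraction only repeats
    \<open>U 0\<close>.\<close>
  define P where "P n K \<longleftrightarrow> zclosed K \<and> K \<subseteq> Z \<inter> U (d - n) \<and> U (d - n) \<subseteq> lsums vs K \<and>
    (\<forall>K'. zclosed K' \<longrightarrow> K' \<subseteq> K \<longrightarrow> U (d - n) \<subseteq> lsums vs K' \<longrightarrow> K' = K)" for n K
  have "\<exists>f. \<forall>n. P n (f n) \<and> f (Suc n) \<subseteq> f n"
  proof (rule dependent_nat_choice)
    have "U (d - 0) = dual" by (auto simp: U_def)
    then have "U (d - 0) \<subseteq> lsums vs Z" "Z \<subseteq> U (d - 0)" using Z(4) zclosed_subset_dual[OF Z(1)] by auto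
    then show "\<exists>K. P 0 K"
      using minimal_covering[OF Z(1-3) Ud Z(1) subset_refl, of "d - 0"] unfolding P_def by (simp add: le_inf_iff) blast
  next
    fix K n assume K: "P n K"
    let ?U = "U (d - Suc n)"
    have "?U \<subseteq> U (d - n)"
    proof (cases "n < d")
      case True
      then have "d - n = Suc (d - Suc n)" by simp
      then show ?thesis using Umono by metis
    qed simp
    moreover have Kn: "zclosed K" "K \<subseteq> Z" "U (d - n) \<subseteq> lsums vs K" using K by (simp_all add: P_def)
    ultimately have "?U \<subseteq> lsums vs K" by (meson order_trans)
    then have c3: "?U \<subseteq> lsums vs (K \<inter> ?U)" by (rule Ucut[OF _ zclosed_subset_dual[OF Kn(1)]])
    have c1: "zclosed (K \<inter> ?U)" by (rule zclosed_Int[OF Kn(1) Ucl])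
    have c2: "K \<inter> ?U \<subseteq> Z" using Kn(2) by auto
    have "\<exists>K'. zclosed K' \<and> K' \<subseteq> K \<inter> ?U \<and> ?U \<subseteq> lsums vs K' \<and>
        (\<forall>K''. zclosed K'' \<longrightarrow> K'' \<subseteq> K' \<longrightarrow> ?U \<subseteq> lsums vs K'' \<longrightarrow> K'' = K')"
      by (rule minimal_covering[OF Z(1-3) Ud c1 c2 c3])
    then show "\<exists>K'. P (Suc n) K' \<and> K' \<subseteq> K"
    proof (elim exE conjE)
      fix K' assume "zclosed K'" "K' \<subseteq> K \<inter> ?U" "?U \<subseteq> lsums vs K'"
        "\<forall>K''. zclosed K'' \<longrightarrow> K'' \<subseteq> K' \<longrightarrow> ?U \<subseteq> lsums vs K'' \<longrightarrow> K'' = K'"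
      then show ?thesis using Kn(2) unfolding P_def by (intro exI[of _ K']) auto
    qed
  qed
  then obtain f where f: "\<And>n. P n (f n)" "\<And>n. f (Suc n) \<subseteq> f n" by blast
  define K where "K j = f (d - j)" for j
  have K: "zclosed (K j)" "K j \<subseteq> Z" "K j \<subseteq> U j" "U j \<subseteq> lsums vs (K j)"
    "\<And>K'. zclosed K' \<Longrightarrow> K' \<subseteq> K j \<Longrightarrow> U j \<subseteq> lsums vs K' \<Longrightarrow> K' = K j" if "j \<le> d" for j
    using f(1)[of "d - j"] that unfolding P_def K_def by auto
  have irr: "irreducible_closed_in sym_algebra W (K j)" if j: "j \<le> d" for j
    unfolding irreducible_closed_in_def
  proof (intro conjI allI impI)
    show "zariski_closed_in sym_algebra W (K j)"
      using K[OF j] W by (intro zariski_closed_in_iff) auto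
    have "(\<lambda>x. 0) \<in> U j" by (simp add: U_def)
    then have "(\<lambda>x. 0) \<in> lsums vs (K j)" using K(4)[OF j] by (rule subsetD[rotated])
    then show "K j \<noteq> {}" unfolding lsums_iff[of _ vs "K j"] by (elim bexE) auto
  next
    fix K1 K2
    assume *: "zariski_closed_in sym_algebra W K1 \<and> zariski_closed_in sym_algebra W K2 \<and> K j = K1 \<union> K2"
    have s: "K1 \<subseteq> K j" "K2 \<subseteq> K j" "K j = K1 \<union> K2" using * by auto
    have w: "K j \<subseteq> W" using K(2)[OF j] W(1) by simp
    have c1: "zclosed K1" by (rule zclosed_if_zariski_closed_in[OF conjunct1[OF *] s(1) K(1)[OF j] w])
    have c2: "zclosed K2"
      by (rule zclosed_if_zariski_closed_in[OF conjunct1[OF conjunct2[OF *]] s(2) K(1)[OF j] w])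
    have "K1 \<subseteq> Z" "K2 \<subseteq> Z" using s(1,2) K(2)[OF j] by auto
    then have "zclosed (lsums vs K1)" "zclosed (lsums vs K2)"
      using zclosed_lsums[OF Z(1-3)] c1 c2 by simp_all
    moreover have "U j \<subseteq> lsums vs K1 \<union> lsums vs K2" using K(4)[OF j] * by (simp add: lsums_Un)
    ultimately have "U j \<subseteq> lsums vs K1 \<or> U j \<subseteq> lsums vs K2"
      by (intro linear_irreducible[OF Ud Ulin])
    then show "K j = K1 \<or> K j = K2" using K(5)[OF j c1 s(1)] K(5)[OF j c2 s(2)] by (elim disjE) simp_all
  qed
  have strict: "K j \<subset> K (Suc j)" if j: "j < d" for j
  proof -
    have "d - j = Suc (d - Suc j)" using j by simp
    then have "K j \<subseteq> K (Suc j)" using f(2) by (simp add: K_def)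
    moreover have "K j \<noteq> K (Suc j)"
    proof
      assume "K j = K (Suc j)"
      then have "U (Suc j) \<subseteq> lsums vs (K j)" using K(4)[of "Suc j"] j by simp
      also have "\<dots> \<subseteq> U j" using K(1-3)[of j] j by (intro Usum) simp_all
      finally have "U (Suc j) \<subseteq> U j" .
      then show False using Ustrict[OF j] by blast
    qed
    ultimately show ?thesis by blast
  qed
  have "enat d \<le> zariski_dim sym_algebra W"
    unfolding zariski_dim_def
    by (rule SUP_upper) (use irr strict in \<open>auto intro!: exI[of _ K]\<close>)
  then show ?thesis using dG unfolding d_def by (meson enat_ord_simps(1) order_trans)
qed

end

section \<open>The degeneracy locus and the Jacobian of the Poisson center\<close>

lemma partial_deriv_commute: "partial_deriv x (partial_deriv y p) = partial_deriv y (partial_deriv x p)"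
  using polys_UNIV[of p]
  by (induction p rule: polys_induct)
    (auto simp: partial_deriv_Var partial_deriv_mult algebra_simps partial_deriv_Const[of _ 0, simplified]
      partial_deriv_Const[of _ 1, simplified])

text \<open>The differential of the determinant at \<open>Q\<close> in the direction
  \<open>R\<close>. The form by columns involves no inverse of \<open>Q\<close> and makes sense at
  singular matrices.\<close>

definition det_deriv :: "'a::comm_ring_1 mat \<Rightarrow> 'a mat \<Rightarrow> 'a" where
  "det_deriv Q R = (\<Sum>k<dim_row Q. det (replace_col Q (col R k) k))"

lemma coeff_1_mult: "coeff (p * q) 1 = coeff p 0 * coeff q 1 + coeff p 1 * coeff q 0"
  by (simp add: coeff_mult)

lemma det_deriv_coeff:
  fixes A :: "'a::comm_ring_1 poly mat"
  assumes A: "A \<in> carrier_mat n n"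
  shows "coeff (det A) 1 = det_deriv (map_mat (\<lambda>p. coeff p 0) A) (map_mat (\<lambda>p. coeff p 1) A)"
proof -
  let ?Q = "map_mat (\<lambda>p. coeff p 0) A" and ?R = "map_mat (\<lambda>p. coeff p 1) A"
  have c1: "coeff (\<Prod>i \<in> S. q i) 1 = (\<Sum>k \<in> S. \<Prod>i \<in> S. coeff (q i) (if i = k then 1 else 0))"
    if "finite S" for S :: "nat set" and q :: "nat \<Rightarrow> 'a poly"
  proof -
    have "coeff (\<Prod>i \<in> S. q i) 1 = (\<Sum>k \<in> S. \<Prod>i \<in> S. coeff (q i) (if i = k then 1 else 0)) \<and>
      coeff (\<Prod>i \<in> S. q i) 0 = (\<Prod>i \<in> S. coeff (q i) 0)"
      using that
    proof induction
      case (insert x S)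
      have p0: "coeff (p * r) 0 = coeff p 0 * coeff r 0" for p r :: "'a poly" by (simp add: coeff_mult)
      have "(\<Prod>i \<in> S. coeff (q i) (if i = x then 1 else 0)) = (\<Prod>i \<in> S. coeff (q i) 0)"
        using insert.hyps by (intro prod.cong) auto
      moreover have "(\<Sum>k \<in> S. coeff (q x) (if x = k then 1 else 0) * (\<Prod>i \<in> S. coeff (q i) (if i = k then 1 else 0)))
        = (\<Sum>k \<in> S. coeff (q x) 0 * (\<Prod>i \<in> S. coeff (q i) (if i = k then 1 else 0)))"
        using insert.hyps by (intro sum.cong) auto
      ultimately show ?case
        using insert
        by (simp add: coeff_1_mult p0 sum_distrib_left add.commute del: One_nat_def)
    qed simp
    then show ?thesis by simp
  qed
  have sg: "signof p = [:signof p :: 'a:]" for p :: "nat \<Rightarrow> nat" by (simp add: sign_def one_pCons)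
  have dA: "det A = (\<Sum>p | p permutes {0..<n}. smult (signof p) (\<Prod>i = 0..<n. A $$ (i, p i)))"
    by (subst det_def'[OF A]) (auto intro!: sum.cong prod.cong simp: sg simp del: signof_pm_one)
  have inner: "(\<Sum>k = 0..<n. \<Prod>i = 0..<n. coeff (A $$ (i, p i)) (if i = k then 1 else 0))
    = (\<Sum>k<n. \<Prod>i = 0..<n. coeff (A $$ (i, p i)) (if p i = k then 1 else 0))" if p: "p permutes {0..<n}" for p
  proof -
    have "(\<Sum>k<n. \<Prod>i = 0..<n. coeff (A $$ (i, p i)) (if p i = k then 1 else 0))
      = (\<Sum>k = 0..<n. \<Prod>i = 0..<n. coeff (A $$ (i, p i)) (if p i = p k then 1 else 0))"
      unfolding lessThan_atLeast0 by (rule sum.permute[OF p, unfolded comp_def])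
    also have "\<dots> = (\<Sum>k = 0..<n. \<Prod>i = 0..<n. coeff (A $$ (i, p i)) (if i = k then 1 else 0))"
      by (simp add: inj_eq[OF permutes_inj[OF p]])
    finally show ?thesis by simp
  qed
  have rc: "det (replace_col ?Q (col ?R k) k) = (\<Sum>p | p permutes {0..<n}. signof p *
      (\<Prod>i = 0..<n. coeff (A $$ (i, p i)) (if p i = k then 1 else 0)))" if "k < n" for k
    using A that
    by (subst det_def'[of _ n])
      (auto simp: replace_col_def permutes_in_image intro!: sum.cong prod.cong arg_cong2[where f="(*)"])
  have "coeff (det A) 1 = (\<Sum>p | p permutes {0..<n}. signof p *
      (\<Sum>k<n. \<Prod>i = 0..<n. coeff (A $$ (i, p i)) (if p i = k then 1 else 0)))"
    unfolding dA coeff_sum by (intro sum.cong refl) (simp add: c1 inner del: One_nat_def)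
  also have "\<dots> = (\<Sum>k<n. \<Sum>p | p permutes {0..<n}. signof p *
      (\<Prod>i = 0..<n. coeff (A $$ (i, p i)) (if p i = k then 1 else 0)))"
    unfolding sum_distrib_left by (rule sum.swap)
  also have "\<dots> = (\<Sum>k<n. det (replace_col ?Q (col ?R k) k))"
    by (intro sum.cong refl) (rule rc[symmetric], simp)
  finally show ?thesis using A by (simp add: det_deriv_def)
qed

lemma det_deriv_add:
  assumes Q: "Q \<in> carrier_mat n n" and R: "R \<in> carrier_mat n n" "S \<in> carrier_mat n n"
  shows "det_deriv Q (R + S) = det_deriv Q R + det_deriv Q S"
proof -
  have rc: "replace_col Q v k \<in> carrier_mat n n" for v k using Q by (auto simp: replace_col_def)
  have cf: "cofactor (replace_col Q v k) i k = cofactor Q i k" for v i k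
    unfolding cofactor_def
    by (intro arg_cong2[where f="(*)"] refl arg_cong[where f=det])
      (auto simp: mat_delete_def replace_col_def intro!: eq_matI)
  have "det (replace_col Q v k) = (\<Sum>i<n. v $ i * cofactor Q i k)" if "k < n" "v \<in> carrier_vec n" for v k
    using laplace_expansion_column[OF rc that(1), of v k] Q that by (simp add: cf) (auto simp: replace_col_def intro!: sum.cong)
  then show ?thesis
    using Q R unfolding det_deriv_def
    by (simp add: sum.distrib[symmetric] distrib_right[symmetric])
qed

text \<open>Cramer's rule in each column gives the trace formula of Jacobi.\<close>

lemma det_deriv_mult_right:
  assumes Q: "Q \<in> carrier_mat n n" and W: "W \<in> carrier_mat n n"
  shows "det_deriv Q (Q * W) = (\<Sum>k<n. W $$ (k, k)) * det Q"
proof -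
  have "det (replace_col Q (col (Q * W) k) k) = W $$ (k, k) * det Q" if "k < n" for k
  proof -
    have "col (Q * W) k = Q *\<^sub>v col W k" using Q W that by (intro eq_vecI) auto
    then show ?thesis using cramer_lemma_mat[OF Q _ that, of "col W k"] W that by simp
  qed
  then show ?thesis using Q by (simp add: det_deriv_def sum_distrib_right)
qed

lemma det_deriv_transpose:
  assumes Q: "Q \<in> carrier_mat n n" and R: "R \<in> carrier_mat n n"
  shows "det_deriv (transpose_mat Q) (transpose_mat R) = det_deriv Q R"
proof -
  let ?A = "mat n n (\<lambda>(i, j). [:Q $$ (i, j), R $$ (i, j):])"
  have "map_mat (\<lambda>p. coeff p 0) ?A = Q" "map_mat (\<lambda>p. coeff p 1) ?A = R"
    "map_mat (\<lambda>p. coeff p 0) (transpose_mat ?A) = transpose_mat Q"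
    "map_mat (\<lambda>p. coeff p 1) (transpose_mat ?A) = transpose_mat R"
    using Q R by (auto intro!: eq_matI)
  then show ?thesis
    using det_deriv_coeff[of ?A n] det_deriv_coeff[of "transpose_mat ?A" n] det_transpose[of ?A n] by simp
qed

lemma det_deriv_zero:
  assumes Q: "Q \<in> carrier_mat n n"
  shows "det_deriv Q (0\<^sub>m n n) = 0"
  using det_deriv_add[OF Q zero_carrier_mat zero_carrier_mat] by simp

lemma det_deriv_mult_left:
  assumes Q: "Q \<in> carrier_mat n n" and W: "W \<in> carrier_mat n n"
  shows "det_deriv Q (W * Q) = (\<Sum>k<n. W $$ (k, k)) * det Q"
proof -
  have "det_deriv Q (W * Q) = det_deriv (transpose_mat Q) (transpose_mat (W * Q))"
    using det_deriv_transpose[OF Q, of "W * Q"] Q W by simp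
  also have "transpose_mat (W * Q) = transpose_mat Q * transpose_mat W" by (rule transpose_mult[OF W Q])
  also have "det_deriv (transpose_mat Q) (transpose_mat Q * transpose_mat W) = (\<Sum>k<n. W $$ (k, k)) * det Q"
    using det_deriv_mult_right[of "transpose_mat Q" n "transpose_mat W"] Q W det_transpose[OF Q] by simp
  finally show ?thesis .
qed

context lie_algebra
begin

lemma line_poly_coeffs:
  assumes "q \<in> polys Basis" "\<zeta> \<in> dual"
  shows "coeff (line_poly \<xi> \<zeta> q) 0 = eval_at \<xi> q" "coeff (line_poly \<xi> \<zeta> q) 1 = \<zeta> (grad \<xi> q)"
proof -
  interpret L: comm_ring_hom "line_poly \<xi> \<zeta>" by (rule comm_ring_hom_line_poly)
  show 0: "coeff (line_poly \<xi> \<zeta> q) 0 = eval_at \<xi> q" for q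
    using poly_line_poly[of \<xi> \<zeta> q 0] by (simp add: poly_0_coeff_0)
  show "coeff (line_poly \<xi> \<zeta> q) 1 = \<zeta> (grad \<xi> q)"
    using assms(1)
  proof (induction q rule: polys_induct)
    case (Const c)
    then show ?case
      by (simp add: line_poly_def eval_in_Const[OF comm_ring_hom_const_poly] dualD[OF assms(2)])
  next
    case (Var x)
    have "grad \<xi> (Var x) = (\<Sum>b \<in> Basis. if b = x then x else 0)"
      unfolding grad_def by (intro sum.cong) (auto simp: partial_deriv_Var)
    then show ?case
      using Var finite_Basis by (simp add: line_poly_def eval_in_Var[OF comm_ring_hom_const_poly])
  next
    case (add p q)
    then show ?case by (simp add: L.hom_add dualD[OF assms(2)])
  next
    case (mult p q)
    have "coeff (u * v) 1 = coeff u 0 * coeff v 1 + coeff u 1 * coeff v 0" for u v :: "'k poly"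
      by (simp add: coeff_mult)
    then show ?case
      using mult.IH by (simp add: L.hom_mult grad_mult dualD[OF assms(2)] 0)
  qed
qed

lemma grad_sum: "grad \<xi> (sum f A) = (\<Sum>i \<in> A. grad \<xi> (f i))"
  by (induction A rule: infinite_finite_induct) (auto simp: grad_Const[of _ 0, simplified])

lemma grad_zero [simp]: "grad \<xi> 0 = 0"
  using grad_Const[of \<xi> 0] by simp

lemma poisson_embed: "poisson (embed x) f = (\<Sum>b \<in> Basis. embed (bracket x b) * partial_deriv b f)"
proof -
  interpret bl: Vector_Spaces.linear scale scale "\<lambda>y. bracket y b" for b by (rule linear_left)
  have pd: "partial_deriv a (embed x) = Const (representation Basis x a)" if "a \<in> Basis" for a
  proof -
    have "partial_deriv a (embed x) = (\<Sum>c \<in> Basis. if c = a then Const (representation Basis x a) else 0)"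
      unfolding embed_def partial_deriv_sum
      by (rule sum.cong) (auto simp: partial_deriv_mult partial_deriv_Var)
    then show ?thesis using that finite_Basis by simp
  qed
  have em: "embed (\<Sum>a \<in> A. scale (c a) (z a)) = (\<Sum>a \<in> A. Const (c a) * embed (z a))" if "finite A" for A c z
    using that
  proof induction
    case empty
    show ?case by (simp add: embed_def representation_zero)
  next
    case (insert a A)
    have "embed (x + y) = embed x + embed y" for x y
      by (simp add: embed_def representation_add[OF independent_Basis] span_Basis Const_add distrib_right sum.distrib)
    moreover have "embed (scale c x) = Const c * embed x" for c x
      by (simp add: embed_def representation_scale[OF independent_Basis] span_Basis Const_mult sum_distrib_left mult.assoc)
    ultimately show ?case using insert by simp
  qed
  have "bracket x b = (\<Sum>a \<in> Basis. scale (representation Basis x a) (bracket a b))" for b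
    by (subst sum_Basis_representation[of x, symmetric]) (simp add: bl.sum bl.scale)
  then have "embed (bracket x b) = (\<Sum>a \<in> Basis. Const (representation Basis x a) * embed (bracket a b))" for b
    using em[OF finite_Basis] by metis
  then have "(\<Sum>b \<in> Basis. embed (bracket x b) * partial_deriv b f) =
    (\<Sum>b \<in> Basis. \<Sum>a \<in> Basis. embed (bracket a b) * partial_deriv a (embed x) * partial_deriv b f)"
    by (simp add: sum_distrib_left pd mult_ac)
  then show ?thesis unfolding poisson_def by (subst sum.swap) simp
qed

end

context cp_setting
begin

interpretation bracket_right: Vector_Spaces.linear scale scale "bracket x" for x by (rule linear_right)
interpretation bracket_left: Vector_Spaces.linear scale scale "\<lambda>y. bracket y x" for x by (rule linear_left)

lemma sym_mult_eq_0:
  fixes f g :: "('g, 'k) mpoly"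
  assumes "f \<in> polys Basis" "g \<in> polys Basis" "f * g = 0" "f \<noteq> 0"
  shows "g = 0"
proof -
  obtain \<iota> :: "('g, 'k) mpoly \<Rightarrow> 'k generic_field" where \<iota>: "comm_ring_hom \<iota>"
    and inj: "\<And>p. p \<in> polys Basis \<Longrightarrow> \<iota> p = 0 \<Longrightarrow> p = 0"
    using exists_embedding[OF finite_Basis, where 'k='k] by blast
  interpret \<iota>: comm_ring_hom \<iota> by (rule \<iota>)
  have "\<iota> f * \<iota> g = 0" using assms(3) by (metis \<iota>.hom_mult \<iota>.hom_zero)
  then show ?thesis using inj assms by auto
qed

lemma poisson_embed_antisym:
  assumes "f \<in> sym_algebra" "poisson f (embed x) = 0"
  shows "poisson (embed x) f = 0"
proof (rule sym_eq_0)
  show "poisson (embed x) f \<in> sym_algebra" by (intro poisson_sym embed_sym assms)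
  fix \<xi> assume \<xi>: "\<xi> \<in> dual"
  have "\<xi> (bracket (grad \<xi> f) x) = 0" using eval_poisson[OF \<xi>, of f "embed x"] assms(2) by simp
  then show "eval_at \<xi> (poisson (embed x) f) = 0"
    unfolding eval_poisson[OF \<xi>] grad_embed by (subst bracket_antisym) (simp add: dualD[OF \<xi>])
qed

lemma center_iff:
  assumes "f \<in> sym_algebra"
  shows "f \<in> poisson_center \<longleftrightarrow> (\<forall>\<xi> \<in> dual. \<forall>y. \<xi> (bracket (grad \<xi> f) y) = 0)"
proof
  assume "f \<in> poisson_center"
  then show "\<forall>\<xi> \<in> dual. \<forall>y. \<xi> (bracket (grad \<xi> f) y) = 0"
    using grad_center by (auto simp: stabilizer_def)
next
  assume *: "\<forall>\<xi> \<in> dual. \<forall>y. \<xi> (bracket (grad \<xi> f) y) = 0"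
  have "poisson f g = 0" if g: "g \<in> sym_algebra" for g
    by (rule sym_eq_0[OF poisson_sym[OF assms g]]) (simp add: eval_poisson *)
  then show "f \<in> poisson_center" using assms by (simp add: poisson_center_def)
qed

text \<open>Differentiating the invariance of \<open>f\<close> gives the derivative of its gradient along the
  coadjoint direction of \<open>x\<close>.\<close>

lemma grad_center_coadjoint:
  assumes f: "f \<in> poisson_center" and \<xi>: "\<xi> \<in> dual" and \<phi>: "\<phi> \<in> dual"
  shows "(\<Sum>b \<in> Basis. \<xi> (bracket x b) * \<phi> (grad \<xi> (partial_deriv b f))) = - \<phi> (bracket x (grad \<xi> f))"
proof -
  have fs: "f \<in> sym_algebra" "poisson f (embed x) = 0" using f by (auto simp: poisson_center_def)
  have "0 = grad \<xi> (poisson (embed x) f)" by (simp add: poisson_embed_antisym[OF fs])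
  also have "\<dots> = (\<Sum>b \<in> Basis. scale (\<xi> (bracket x b)) (grad \<xi> (partial_deriv b f)) +
      scale (eval_at \<xi> (partial_deriv b f)) (bracket x b))"
    unfolding poisson_embed grad_sum by (simp add: grad_mult \<xi>)
  also have "\<dots> = (\<Sum>b \<in> Basis. scale (\<xi> (bracket x b)) (grad \<xi> (partial_deriv b f))) + bracket x (grad \<xi> f)"
    by (simp add: sum.distrib grad_def bracket_right.sum bracket_right.scale)
  finally have "\<phi> 0 = \<phi> ((\<Sum>b \<in> Basis. scale (\<xi> (bracket x b)) (grad \<xi> (partial_deriv b f))) + bracket x (grad \<xi> f))"
    by simp
  then show ?thesis by (simp add: dualD[OF \<phi>] eq_neg_iff_add_eq_0)
qed

lemma co_trace:
  assumes "unimodular"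
  shows "(\<Sum>a<dimension. co a (bracket x (u a))) = 0"
proof -
  let ?r = "\<lambda>v b. representation Basis v b"
  have rd: "(\<lambda>v. ?r v b) \<in> dual" for b by (rule dual_representation[OF independent_Basis span_Basis])
  have "0 = (\<Sum>b \<in> Basis. ?r (bracket x b) b)" using assms by (simp add: unimodular_def)
  also have "\<dots> = (\<Sum>b \<in> Basis. ?r (bracket x (\<Sum>a<dimension. scale (co a b) (u a))) b)"
    by (simp only: expand_u)
  also have "\<dots> = (\<Sum>b \<in> Basis. \<Sum>a<dimension. co a b * ?r (bracket x (u a)) b)"
    by (simp add: bracket_right.sum bracket_right.scale dualD[OF rd])
  also have "\<dots> = (\<Sum>a<dimension. \<Sum>b \<in> Basis. co a b * ?r (bracket x (u a)) b)" by (rule sum.swap)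
  also have "\<dots> = (\<Sum>a<dimension. co a (\<Sum>b \<in> Basis. scale (?r (bracket x (u a)) b) b))"
    by (simp add: co_simps mult.commute)
  finally show ?thesis by (simp add: sum_Basis_representation)
qed

definition degenerate :: "('g \<Rightarrow> 'k) set" where
  "degenerate = {\<xi> \<in> dual. \<forall>C. eval_at \<xi> (\<delta> C) = 0}"

lemma zclosed_degenerate: "zclosed degenerate"
  unfolding zclosed_def degenerate_def
  by (rule exI[of _ "range \<delta>"]) (use \<delta>_sym in \<open>auto simp: sym_algebra_def\<close>)

lemma \<delta>_homogeneous:
  assumes "\<xi> \<in> dual"
  shows "eval_at (\<lambda>x. s * \<xi> x) (\<delta> C) = s ^ nv * eval_at \<xi> (\<delta> C)"
proof -
  let ?D = "mat nh nh (\<lambda>(i, j). if i = j then (if j < nv then s else 1) else 0)"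
  have nvh: "nv \<le> nh" using nh_eq by simp
  have "dmat_at (\<lambda>x. s * \<xi> x) C = dmat_at \<xi> C * ?D"
  proof (rule eq_matI)
    fix i j assume "i < dim_row (dmat_at \<xi> C * ?D)" "j < dim_col (dmat_at \<xi> C * ?D)"
    then have ij: "i < nh" "j < nh" by (auto simp: dmat_at_def)
    have "(dmat_at \<xi> C * ?D) $$ (i, j) = (\<Sum>k = 0..<nh. dmat_at \<xi> C $$ (i, k) * ?D $$ (k, j))"
      using ij by (simp add: scalar_prod_def dmat_at_def)
    also have "\<dots> = (\<Sum>k = 0..<nh. if k = j then dmat_at \<xi> C $$ (i, k) * (if j < nv then s else 1) else 0)"
      using ij by (intro sum.cong) auto
    also have "\<dots> = dmat_at \<xi> C $$ (i, j) * (if j < nv then s else 1)" using ij by simp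
    finally show "dmat_at (\<lambda>x. s * \<xi> x) C $$ (i, j) = (dmat_at \<xi> C * ?D) $$ (i, j)"
      using ij by (simp add: dmat_at_def)
  qed (auto simp: dmat_at_def)
  then have "eval_at (\<lambda>x. s * \<xi> x) (\<delta> C) = det (dmat_at \<xi> C) * det ?D"
    using eval_\<delta>[of "\<lambda>x. s * \<xi> x" C] assms det_mult[of "dmat_at \<xi> C" nh ?D] by simp
  also have "det ?D = (\<Prod>i = 0..<nh. if i < nv then s else 1)"
    by (subst det_upper_triangular[of _ nh])
      (auto simp: upper_triangular_def diag_mat_def prod.list_conv_set_nth intro!: prod.cong)
  also have "\<dots> = s ^ nv"
  proof -
    have "(\<Prod>i = 0..<nh. if i < nv then s else 1) = (\<Prod>i = 0..<nv. s)"
      using nvh by (intro prod.mono_neutral_cong_right) auto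
    then show ?thesis by simp
  qed
  finally show ?thesis using eval_\<delta>[OF assms] by (simp add: mult.commute)
qed

lemma cone_degenerate: "cone degenerate"
  unfolding cone_def degenerate_def by (auto simp: \<delta>_homogeneous)

lemma degenerate_subset_sing: "degenerate \<subseteq> dual_sing"
  unfolding degenerate_def dual_sing_def using reg_\<delta>_nonzero by auto

end

lemma sum_lessThan_add: "(\<Sum>i<m + n. g i) = (\<Sum>i<m. g i) + (\<Sum>j<n. g (m + j :: nat) :: 'a::comm_monoid_add)"
  by (induction n) (simp_all add: add.assoc)

lemma index_mult_mat_sum:
  assumes "A \<in> carrier_mat n m" "B \<in> carrier_mat m l" "i < n" "j < l"
  shows "(A * B) $$ (i, j) = (\<Sum>k<m. A $$ (i, k) * B $$ (k, j))"
  using assms by (auto simp: scalar_prod_def lessThan_atLeast0 intro!: sum.cong)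

section \<open>Maximal minors of the gradients of invariants\<close>

locale cp_invariants = cp_setting scale Basis bracket \<h>
  for scale :: "'k::{alg_closed_field, field_char_0} \<Rightarrow> 'g::ab_group_add \<Rightarrow> 'g"
    and Basis :: "'g set" and bracket :: "'g \<Rightarrow> 'g \<Rightarrow> 'g" and \<h> :: "'g set" +
  fixes f :: "nat \<Rightarrow> ('g, 'k) mpoly"
  assumes f_center: "j < index \<Longrightarrow> f j \<in> poisson_center"
begin

interpretation bracket_right: Vector_Spaces.linear scale scale "bracket x" for x by (rule linear_right)
interpretation bracket_left: Vector_Spaces.linear scale scale "\<lambda>y. bracket y x" for x by (rule linear_left)

lemma nv_le_nh: "nv \<le> nh"
  using nh_eq by simp

lemma nh_b_less: "b < nv \<Longrightarrow> nh + b < dimension"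
  using nh_nv by simp

definition fco :: "nat \<Rightarrow> nat \<Rightarrow> ('g, 'k) mpoly" where
  "fco a j = (\<Sum>b \<in> Basis. Const (co a b) * partial_deriv b (f j))"

text \<open>The counterpart of \<open>\<delta> C\<close> for the gradients: if the columns of
  \<open>C\<close> are distinct unit vectors, \<open>\<epsilon> C\<close> is a maximal minor of the
  gradient matrix and \<open>\<delta> C\<close> is, up to sign, the complementary minor of the
  bracket matrix.\<close>

definition \<epsilon> :: "(nat \<Rightarrow> nat \<Rightarrow> 'k) \<Rightarrow> ('g, 'k) mpoly" where
  "\<epsilon> C = det (mat index index (\<lambda>(r, j). \<Sum>a<nh. Const (C a r) * fco a j))"

definition emat_at :: "('g \<Rightarrow> 'k) \<Rightarrow> (nat \<Rightarrow> nat \<Rightarrow> 'k) \<Rightarrow> 'k mat" where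
  "emat_at \<xi> C = mat index index (\<lambda>(r, j). \<Sum>a<nh. C a r * co a (grad \<xi> (f j)))"

lemma emat_carrier [simp]: "emat_at \<xi> C \<in> carrier_mat index index"
  by (simp add: emat_at_def)

lemma f_sym: "j < index \<Longrightarrow> f j \<in> polys Basis"
  using f_center by (auto simp: poisson_center_def sym_algebra_def)

lemma fco_sym: "j < index \<Longrightarrow> fco a j \<in> polys Basis"
  unfolding fco_def by (intro polys_sum polys_mult polys_Const partial_deriv_polys f_sym)

lemma \<epsilon>_sym: "\<epsilon> C \<in> polys Basis"
  unfolding \<epsilon>_def
  by (rule det_polys[of _ index]) (auto intro!: polys_sum polys_mult fco_sym)

lemma eval_fco: "eval_at \<xi> (fco a j) = co a (grad \<xi> (f j))"
  by (simp add: fco_def eval_at.hom_sum grad_def co_simps mult.commute)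

lemma eval_\<epsilon>: "eval_at \<xi> (\<epsilon> C) = det (emat_at \<xi> C)"
proof -
  have "map_mat (eval_at \<xi>) (mat index index (\<lambda>(r, j). \<Sum>a<nh. Const (C a r) * fco a j)) = emat_at \<xi> C"
    by (intro eq_matI) (auto simp: emat_at_def eval_at.hom_sum eval_fco)
  then show ?thesis unfolding \<epsilon>_def eval_at.hom_det[symmetric] by (rule arg_cong)
qed

lemma expand_grad: "j < index \<Longrightarrow> \<xi> \<in> dual \<Longrightarrow> (\<Sum>a<nh. scale (co a (grad \<xi> (f j))) (u a)) = grad \<xi> (f j)"
  by (rule expand_h[OF grad_center_h[OF f_center]])

lemma grad_bracket_0:
  assumes "j < index" "\<xi> \<in> dual"
  shows "(\<Sum>a<nh. \<xi> (bracket (u a) z) * co a (grad \<xi> (f j))) = 0"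
proof -
  have "\<xi> (bracket (\<Sum>a<nh. scale (co a (grad \<xi> (f j))) (u a)) z) = 0"
    using grad_center[OF f_center[OF assms(1)] assms(2)] by (simp add: expand_grad assms stabilizer_def)
  then show ?thesis
    by (simp add: bracket_left.sum bracket_left.scale dualD[OF assms(2)] mult.commute)
qed

lemma right_inverse_exists:
  assumes "det (dmat_at \<xi> C) \<noteq> 0"
  shows "\<exists>G. \<forall>b<nv. \<forall>j<nv. (\<Sum>a<nh. \<xi> (bracket (u a) (u (nh + b))) * G a j) = (if b = j then 1 else 0)"
proof -
  define A where "A = transpose_mat (dmat_at \<xi> C)"
  have A: "A \<in> carrier_mat nh nh" by (simp add: A_def)
  have dA: "det A \<noteq> 0" using assms det_transpose[OF dmat_carrier(2)] by (simp add: A_def)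
  have adj: "adj_mat A \<in> carrier_mat nh nh" "A * adj_mat A = det A \<cdot>\<^sub>m 1\<^sub>m nh" using adj_mat[OF A] by auto
  have "(\<Sum>a<nh. \<xi> (bracket (u a) (u (nh + b))) * (adj_mat A $$ (a, j) / det A)) = (if b = j then 1 else 0)"
    if "b < nv" "j < nv" for b j
  proof -
    have bj: "b < nh" "j < nh" using that nv_le_nh by auto
    have Ab: "A $$ (b, a) = \<xi> (bracket (u a) (u (nh + b)))" if "a < nh" for a
      using that bj \<open>b < nv\<close> by (simp add: A_def dmat_at_def)
    have "(\<Sum>a<nh. \<xi> (bracket (u a) (u (nh + b))) * (adj_mat A $$ (a, j) / det A))
      = (\<Sum>a<nh. A $$ (b, a) * adj_mat A $$ (a, j)) / det A"
      unfolding sum_divide_distrib by (intro sum.cong) (auto simp: Ab)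
    also have "(\<Sum>a<nh. A $$ (b, a) * adj_mat A $$ (a, j)) = (if b = j then det A else 0)"
      unfolding index_mult_mat_sum[OF A adj(1) bj, symmetric] adj(2) using bj by simp
    finally show ?thesis using dA by simp
  qed
  then show ?thesis by (intro exI[of _ "\<lambda>a j. adj_mat A $$ (a, j) / det A"]) blast
qed

text \<open>Let the matrix with blocks \<open>G\<close> and gradients be multiplied from the left by
  the transpose of \<open>dmat_at \<xi> C\<close>. The result is block triangular, with an identity
  block by the choice of \<open>G\<close> and a zero block by invariance of the \<open>f j\<close>.
  The second determinant on the left does not involve \<open>C\<close>: it is the common ratio of
  the two families of minors.\<close>

lemma bordered_det:
  assumes \<xi>: "\<xi> \<in> dual"
    and G: "\<forall>b<nv. \<forall>j<nv. (\<Sum>a<nh. \<xi> (bracket (u a) (u (nh + b))) * G a j) = (if b = j then 1 else 0)"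
  shows "det (dmat_at \<xi> C) * det (mat nh nh (\<lambda>(a, j). if j < nv then G a j else co a (grad \<xi> (f (j - nv)))))
    = det (emat_at \<xi> C)"
proof -
  let ?W = "mat nh nh (\<lambda>(a, j). if j < nv then G a j else co a (grad \<xi> (f (j - nv))))"
  let ?A = "transpose_mat (dmat_at \<xi> C)"
  let ?B = "mat index nv (\<lambda>(r, j). \<Sum>a<nh. C a r * G a j)"
  have A: "?A \<in> carrier_mat nh nh" and W: "?W \<in> carrier_mat nh nh" by simp_all
  have "?A * ?W = four_block_mat (1\<^sub>m nv) (0\<^sub>m nv index) ?B (emat_at \<xi> C)"
  proof (rule eq_matI)
    fix i j assume "i < dim_row (four_block_mat (1\<^sub>m nv) (0\<^sub>m nv index) ?B (emat_at \<xi> C))"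
      "j < dim_col (four_block_mat (1\<^sub>m nv) (0\<^sub>m nv index) ?B (emat_at \<xi> C))"
    then have ij: "i < nh" "j < nh" using nh_eq by (auto simp: emat_at_def)
    have "(?A * ?W) $$ (i, j) = (\<Sum>a<nh. ?A $$ (i, a) * ?W $$ (a, j))"
      by (rule index_mult_mat_sum[OF A W ij])
    also have "\<dots> = (\<Sum>a<nh. (if i < nv then \<xi> (bracket (u a) (u (nh + i))) else C a (i - nv)) *
        (if j < nv then G a j else co a (grad \<xi> (f (j - nv)))))"
      using ij by (intro sum.cong) (auto simp: dmat_at_def)
    finally show "(?A * ?W) $$ (i, j) = four_block_mat (1\<^sub>m nv) (0\<^sub>m nv index) ?B (emat_at \<xi> C) $$ (i, j)"
      using ij nh_eq G grad_bracket_0[OF _ \<xi>] by (auto simp: emat_at_def)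
  qed (use nh_eq in \<open>auto simp: emat_at_def dmat_at_def\<close>)
  moreover have "det (four_block_mat (1\<^sub>m nv) (0\<^sub>m nv index) ?B (emat_at \<xi> C)) = det (emat_at \<xi> C)"
    by (subst det_four_block_mat_upper_right_zero[OF one_carrier_mat refl mat_carrier emat_carrier]) simp
  ultimately have "det (?A * ?W) = det (emat_at \<xi> C)" by simp
  then show ?thesis using det_mult[OF A W] det_transpose[OF dmat_carrier(2)] by simp
qed

lemma minors_proportional:
  assumes \<xi>: "\<xi> \<in> dual"
  shows "det (emat_at \<xi> C) * det (dmat_at \<xi> C') = det (emat_at \<xi> C') * det (dmat_at \<xi> C)"
proof (cases "det (dmat_at \<xi> C) = 0 \<and> det (dmat_at \<xi> C') = 0")
  case False
  then obtain C0 where "det (dmat_at \<xi> C0) \<noteq> 0" by blast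
  then obtain G where G: "\<forall>b<nv. \<forall>j<nv. (\<Sum>a<nh. \<xi> (bracket (u a) (u (nh + b))) * G a j) = (if b = j then 1 else 0)"
    using right_inverse_exists by blast
  show ?thesis
    unfolding bordered_det[OF \<xi> G, symmetric] by (simp only: mult_ac)
qed simp

text \<open>Off the degeneracy locus \<open>\<epsilon> C / \<delta> C\<close> is regular and independent of \<open>C\<close>. A generic line in
  the direction \<open>v1\<close> avoids that locus, so the division by a suitable \<open>\<delta> C\<close>, which is monic along
  \<open>v1\<close>, leaves no remainder.\<close>

lemma minors_quotient:
  assumes v1: "v1 \<in> dual" "v1 \<notin> degenerate" and v2: "v2 \<in> dual" "v2 \<notin> lsum degenerate v1"
  shows "\<exists>p \<in> polys Basis. \<forall>C. \<epsilon> C = p * \<delta> C"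
proof -
  obtain C0 where C0: "eval_at v1 (\<delta> C0) \<noteq> 0" using v1 by (auto simp: degenerate_def)
  define g0 where "g0 = eval_at v1 (\<delta> C0)"
  have g0: "g0 \<noteq> 0" using C0 by (simp add: g0_def)
  define S where "S = shift_expansion v1 (\<delta> C0)"
  have S: "S \<in> poly_over (polys Basis)" unfolding S_def by (rule shift_over[OF \<delta>_sym])
  have hom: "eval_at (\<lambda>x. s * \<xi> x) (\<delta> C0) = s ^ nv * eval_at \<xi> (\<delta> C0)" if "\<xi> \<in> dual" for s \<xi>
    by (rule \<delta>_homogeneous[OF that])
  have \<delta>s: "\<delta> C0 \<in> sym_algebra" using \<delta>_sym by (simp add: sym_algebra_def)
  have Slc: "coeff S nv = Const g0" and Sdeg: "degree S = nv"
    using shift_homogeneous(1)[OF \<delta>s v1(1) hom C0, of nv] shift_homogeneous(2)[OF \<delta>s v1(1) hom C0]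
    by (simp_all add: S_def g0_def)
  define G where "G = smult (Const (1 / g0)) S"
  have Gn: "coeff G nv = 1" using g0 by (simp add: G_def Slc Const_mult[symmetric])
  have "degree G \<le> nv" using degree_smult_le[of "Const (1 / g0)" S] Sdeg by (simp add: G_def)
  moreover have "nv \<le> degree G" by (rule le_degree) (simp add: Gn)
  ultimately have Gdeg: "degree G = nv" by simp
  note cl = poly_over_closed[OF ring_subset_polys[of Basis]]
  have G: "G \<in> poly_over (polys Basis)" "lead_coeff G = 1"
    using Gn Gdeg by (auto simp: G_def intro!: cl(8) S)
  define H where "H = shift_expansion v1 (\<epsilon> C0)"
  have H: "H \<in> poly_over (polys Basis)" unfolding H_def by (rule shift_over[OF \<epsilon>_sym])
  obtain Q K where QK: "Q \<in> poly_over (polys Basis)" "K \<in> poly_over (polys Basis)" "H = Q * G + K"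
    "K = 0 \<or> degree K < degree G"
    using monic_division[OF ring_subset_polys G H] by blast
  have evG: "poly (map_poly (eval_at \<eta>) G) t = eval_at (\<lambda>x. \<eta> x + t * v1 x) (\<delta> C0) / g0" for \<eta> t
  proof -
    have "map_poly (eval_at \<eta>) G = smult (1 / g0) (map_poly (eval_at \<eta>) S)"
      by (intro poly_eqI) (simp add: G_def coeff_map_poly)
    then show ?thesis by (simp add: S_def eval_shift)
  qed
  have evH: "poly (map_poly (eval_at \<eta>) H) t = eval_at (\<lambda>x. \<eta> x + t * v1 x) (\<epsilon> C0)" for \<eta> t
    by (simp add: H_def eval_shift)
  have ldual: "(\<lambda>x. \<eta> x + t * v1 x) \<in> dual" if "\<eta> \<in> dual" for \<eta> t
    by (rule dual_closed(2)[OF that dual_closed(3)[OF v1(1)]])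
  have evQK: "map_poly (eval_at \<eta>) H = map_poly (eval_at \<eta>) Q * map_poly (eval_at \<eta>) G + map_poly (eval_at \<eta>) K" for \<eta>
  proof -
    interpret m: comm_ring_hom "map_poly (eval_at \<eta>)" by (rule comm_ring_hom_map_poly[OF eval_at.comm_ring_hom_axioms])
    show ?thesis by (simp add: QK(3) m.hom_add m.hom_mult)
  qed
  have K0: "map_poly (eval_at \<eta>) K = 0" if \<eta>: "\<eta> \<in> dual" "\<eta> \<notin> lsum degenerate v1" for \<eta>
  proof (rule ccontr)
    let ?m = "map_poly (eval_at \<eta>)"
    assume nz: "?m K \<noteq> 0"
    then have "K \<noteq> 0" by auto
    then have dK: "degree K < nv" using QK(4) Gdeg by simp
    have Gm: "coeff (?m G) nv = 1" by (simp add: coeff_map_poly Gn)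
    have "?m G dvd ?m H"
    proof (rule dvd_cancel_no_common_root)
      show "?m G \<noteq> 0" using Gm by auto
      fix t assume "poly (?m G) t = 0"
      let ?\<zeta> = "\<lambda>x. \<eta> x + t * v1 x"
      have "?\<zeta> \<notin> degenerate"
      proof
        assume "?\<zeta> \<in> degenerate"
        then have "(\<lambda>x. ?\<zeta> x + (- t) * v1 x) \<in> lsum degenerate v1"
          unfolding lsum_def by (intro CollectI exI[of _ ?\<zeta>] exI[of _ "- t"] conjI refl)
        then show False using \<eta>(2) by simp
      qed
      then obtain C where C: "eval_at ?\<zeta> (\<delta> C) \<noteq> 0" using ldual[OF \<eta>(1)] by (auto simp: degenerate_def)
      let ?l = "line_poly \<eta> v1"
      have "?l (\<delta> C) * ?m H = ?l (\<epsilon> C) * smult g0 (?m G)"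
      proof (rule poly_ext)
        fix s
        show "poly (?l (\<delta> C) * ?m H) s = poly (?l (\<epsilon> C) * smult g0 (?m G)) s"
          using minors_proportional[OF ldual[OF \<eta>(1), of s], of C0 C] g0
          by (simp add: poly_line_poly evH evG eval_\<delta>[OF ldual[OF \<eta>(1)]] eval_\<epsilon> mult.commute)
      qed
      then have "?m G dvd ?l (\<delta> C) * ?m H" by (simp add: dvd_smult)
      then show "\<exists>q. poly q t \<noteq> 0 \<and> ?m G dvd q * ?m H"
        using C by (intro exI[of _ "?l (\<delta> C)"]) (simp add: poly_line_poly)
    qed
    then have "?m G dvd ?m K" unfolding evQK by (simp add: dvd_add_right_iff)
    then have "degree (?m G) \<le> degree (?m K)" using nz by (rule dvd_imp_degree_le)
    moreover have "nv \<le> degree (?m G)" by (rule le_degree) (simp add: Gm)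
    moreover have "degree (?m K) \<le> degree K" by (rule map_poly_degree_leq)
    ultimately show False using dK by simp
  qed
  \<comment> \<open>The vector \<open>v2\<close> shows that the saturation of the degeneracy locus
    along \<open>v1\<close> is a proper closed set. Multiplication by an equation \<open>h\<close>
    of it disposes of the exceptional points.\<close>
  obtain F where F: "F \<subseteq> sym_algebra" "lsum degenerate v1 = {a \<in> dual. \<forall>f \<in> F. eval_at a f = 0}"
    using zclosed_lsum[OF zclosed_degenerate cone_degenerate v1 zclosed_degenerate subset_refl]
    unfolding zclosed_def by blast
  then obtain h where h: "h \<in> sym_algebra" "eval_at v2 h \<noteq> 0" "\<And>a. a \<in> lsum degenerate v1 \<Longrightarrow> eval_at a h = 0"
    using v2 by blast
  have hb: "h \<in> polys Basis" "h \<noteq> 0" using h by (auto simp: sym_algebra_def)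
  have "coeff K n = 0" for n
  proof (rule sym_mult_eq_0[OF hb(1) _ _ hb(2)])
    show Kn: "coeff K n \<in> polys Basis" using QK(2) by (simp add: poly_over_def)
    show "h * coeff K n = 0"
    proof (rule sym_eq_0)
      show "h * coeff K n \<in> sym_algebra" using hb Kn by (simp add: sym_algebra_def)
      fix \<eta> assume \<eta>: "\<eta> \<in> dual"
      show "eval_at \<eta> (h * coeff K n) = 0"
      proof (cases "\<eta> \<in> lsum degenerate v1")
        case False
        then have "coeff (map_poly (eval_at \<eta>) K) n = 0" using K0[OF \<eta>] by simp
        then show ?thesis by (simp add: coeff_map_poly)
      qed (simp add: h(3))
    qed
  qed
  then have "K = 0" by (intro poly_eqI) simp
  \<comment> \<open>At parameter 0 the shift does nothing, so the constant term of the quotient is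
    the factor sought, up to the normalization of \<open>G\<close> by \<open>g0\<close>.\<close>
  define p where "p = Const (1 / g0) * coeff Q 0"
  have p: "p \<in> polys Basis" using QK(1) by (simp add: p_def poly_over_def)
  have 0: "\<epsilon> C0 = p * \<delta> C0"
  proof -
    have "\<epsilon> C0 - p * \<delta> C0 = 0"
    proof (rule sym_eq_0)
      show "\<epsilon> C0 - p * \<delta> C0 \<in> sym_algebra" using p \<delta>_sym \<epsilon>_sym by (simp add: sym_algebra_def)
      fix \<eta> assume "\<eta> \<in> dual"
      have "eval_at \<eta> (\<epsilon> C0) = poly (map_poly (eval_at \<eta>) H) 0" by (simp add: evH)
      also have "\<dots> = poly (map_poly (eval_at \<eta>) Q) 0 * poly (map_poly (eval_at \<eta>) G) 0"
        using evQK[of \<eta>] by (simp add: \<open>K = 0\<close>)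
      also have "\<dots> = eval_at \<eta> (coeff Q 0) * (eval_at \<eta> (\<delta> C0) / g0)"
        unfolding evG by (simp add: poly_0_coeff_0 coeff_map_poly)
      finally show "eval_at \<eta> (\<epsilon> C0 - p * \<delta> C0) = 0" by (simp add: p_def)
    qed
    then show ?thesis by simp
  qed
  have "\<epsilon> C = p * \<delta> C" for C
  proof -
    have "\<epsilon> C - p * \<delta> C = 0"
    proof (rule sym_mult_eq_0[OF \<delta>_sym[of C0]])
      show "\<epsilon> C - p * \<delta> C \<in> polys Basis" using p \<delta>_sym \<epsilon>_sym by simp
      show "\<delta> C0 \<noteq> 0" using C0 by auto
      show "\<delta> C0 * (\<epsilon> C - p * \<delta> C) = 0"
      proof (rule sym_eq_0)
        show "\<delta> C0 * (\<epsilon> C - p * \<delta> C) \<in> sym_algebra" using p \<delta>_sym \<epsilon>_sym by (simp add: sym_algebra_def)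
        fix \<eta> assume \<eta>: "\<eta> \<in> dual"
        have "eval_at \<eta> (\<epsilon> C) * eval_at \<eta> (\<delta> C0) = eval_at \<eta> (\<epsilon> C0) * eval_at \<eta> (\<delta> C)"
          using minors_proportional[OF \<eta>] by (simp add: eval_\<delta>[OF \<eta>] eval_\<epsilon>)
        then show "eval_at \<eta> (\<delta> C0 * (\<epsilon> C - p * \<delta> C)) = 0"
          by (simp add: 0 right_diff_distrib mult_ac)
      qed
    qed
    then show ?thesis by simp
  qed
  then show ?thesis using p by blast
qed

end

section \<open>Invariance and constancy of the factor between the minors\<close>

context cp_invariants
begin

interpretation bracket_right: Vector_Spaces.linear scale scale "bracket x" for x by (rule linear_right)
interpretation bracket_left: Vector_Spaces.linear scale scale "\<lambda>y. bracket y x" for x by (rule linear_left)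

text \<open>Where the bracket matrix is injective, every linear form on the complement is
  represented by bracketing with an element of \<open>\<h>\<close>. Adding such elements makes the
  complement isotropic for the form given by \<open>\<xi>\<close>, which later separates the two
  diagonal blocks of \<open>ad x\<close>.\<close>

lemma complement_adjusted:
  assumes \<xi>: "\<xi> \<in> dual" and C: "det (dmat_at \<xi> C) \<noteq> 0"
  shows "\<exists>y. (\<forall>b<nv. y b \<in> \<h>) \<and>
    (\<forall>b<nv. \<forall>b'<nv. \<xi> (bracket (u (nh + b) + y b) (u (nh + b') + y b')) = 0)"
proof -
  let ?v = "\<lambda>b. u (nh + b)"
  obtain G where G: "\<forall>b<nv. \<forall>j<nv. (\<Sum>a<nh. \<xi> (bracket (u a) (?v b)) * G a j) = (if b = j then 1 else 0)"
    using right_inverse_exists[OF C] by blast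
  \<comment> \<open>Two mixed terms occur in the bracket of adjusted vectors, and each has to cancel
    half of the original value; brackets inside \<open>\<h>\<close> add nothing.\<close>
  define y where "y b = (\<Sum>a<nh. scale (\<Sum>j<nv. G a j * (- \<xi> (bracket (?v b) (?v j)) / 2)) (u a))" for b
  have yh: "y b \<in> \<h>" for b
    unfolding y_def by (intro subspace_sum subspace_scale subspace_h u_in_h) auto
  have yv: "\<xi> (bracket (y b) (?v b')) = - \<xi> (bracket (?v b) (?v b')) / 2" if "b' < nv" for b b'
  proof -
    let ?c = "\<lambda>j. - \<xi> (bracket (?v b) (?v j)) / 2"
    have "\<xi> (bracket (y b) (?v b')) = (\<Sum>a<nh. (\<Sum>j<nv. G a j * ?c j) * \<xi> (bracket (u a) (?v b')))"
      unfolding y_def bracket_left.sum bracket_left.scale dualD[OF \<xi>] ..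
    also have "\<dots> = (\<Sum>a<nh. \<Sum>j<nv. ?c j * (\<xi> (bracket (u a) (?v b')) * G a j))"
      unfolding sum_distrib_right by (intro sum.cong refl) (simp only: mult_ac)
    also have "\<dots> = (\<Sum>j<nv. ?c j * (\<Sum>a<nh. \<xi> (bracket (u a) (?v b')) * G a j))"
      unfolding sum_distrib_left by (rule sum.swap)
    also have "\<dots> = (\<Sum>j<nv. if j = b' then ?c j else 0)"
      using G that by (intro sum.cong) auto
    also have "\<dots> = ?c b'" using that by simp
    finally show ?thesis .
  qed
  have "\<xi> (bracket (?v b + y b) (?v b' + y b')) = 0" if b: "b < nv" "b' < nv" for b b'
  proof -
    have "\<xi> (bracket (?v b) (y b')) = \<xi> (bracket (?v b') (?v b)) / 2"
      by (subst bracket_antisym) (simp add: dualD[OF \<xi>] yv[OF b(1)])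
    also have "\<xi> (bracket (?v b') (?v b)) = - \<xi> (bracket (?v b) (?v b'))"
      by (subst bracket_antisym) (simp add: dualD[OF \<xi>])
    finally have "\<xi> (bracket (?v b) (y b')) = - \<xi> (bracket (?v b) (?v b')) / 2" .
    then show ?thesis
      using yv[OF b(2), of b] bracket_h[OF yh yh, of b b']
      by (simp add: bracket_left.add bracket_right.add dualD[OF \<xi>])
  qed
  then show ?thesis using yh by blast
qed

lemma coadjoint_fco:
  assumes j: "j < index" and \<xi>: "\<xi> \<in> dual"
  shows "\<xi> (bracket x (grad \<xi> (fco a j))) = - co a (bracket x (grad \<xi> (f j)))"
proof -
  have "\<xi> (bracket x (grad \<xi> (fco a j))) = (\<Sum>b \<in> Basis. co a b * \<xi> (bracket x (grad \<xi> (partial_deriv b (f j)))))"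
    by (simp add: fco_def grad_sum grad_mult bracket_right.sum bracket_right.scale dualD[OF \<xi>])
  also have "\<dots> = (\<Sum>b \<in> Basis. \<Sum>c \<in> Basis. co a b * (eval_at \<xi> (partial_deriv c (partial_deriv b (f j))) * \<xi> (bracket x c)))"
    by (simp add: grad_def bracket_right.sum bracket_right.scale dualD[OF \<xi>] sum_distrib_left)
  also have "\<dots> = (\<Sum>c \<in> Basis. \<Sum>b \<in> Basis. co a b * (eval_at \<xi> (partial_deriv c (partial_deriv b (f j))) * \<xi> (bracket x c)))"
    by (rule sum.swap)
  also have "\<dots> = (\<Sum>c \<in> Basis. \<xi> (bracket x c) * co a (grad \<xi> (partial_deriv c (f j))))"
    by (simp add: grad_def co_simps sum_distrib_left partial_deriv_commute[of _ _ "f j"] mult_ac)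
  finally show ?thesis using grad_center_coadjoint[OF f_center[OF j] \<xi> co_dual] by simp
qed

lemma fco_eq_0:
  assumes "j < index" "b < nv"
  shows "fco (nh + b) j = 0"
proof (rule sym_eq_0)
  show "fco (nh + b) j \<in> sym_algebra" using fco_sym assms by (simp add: sym_algebra_def)
  fix \<xi> assume "\<xi> \<in> dual"
  then show "eval_at \<xi> (fco (nh + b) j) = 0"
    using grad_center_h[OF f_center[OF assms(1)]] assms(2) nh_b_less
    by (auto simp: eval_fco h_iff)
qed

text \<open>Both families of minors are moved by the coadjoint direction of \<open>x\<close> in the same way, because the
  traces of the two diagonal blocks of \<open>ad x\<close> cancel.\<close>

lemma coadjoint_minors:
  assumes unimodular and \<xi>: "\<xi> \<in> dual" and C0: "det (dmat_at \<xi> C0) \<noteq> 0"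
  shows "\<exists>X. \<forall>C.
    \<xi> (bracket x (grad \<xi> (\<delta> C))) = - det_deriv (dmat_at \<xi> C)
      (mat nh nh (\<lambda>(a, j). if j < nv then 0 else \<Sum>a'<nh. X a' a * C a' (j - nv))) \<and>
    \<xi> (bracket x (grad \<xi> (\<epsilon> C))) = - det_deriv (emat_at \<xi> C) (emat_at \<xi> (\<lambda>a r. \<Sum>a'<nh. X a' a * C a' r))"
proof -
  let ?v = "\<lambda>b. u (nh + b)"
  obtain y where yh: "\<And>b. b < nv \<Longrightarrow> y b \<in> \<h>"
    and yy: "\<And>b b'. b < nv \<Longrightarrow> b' < nv \<Longrightarrow> \<xi> (bracket (?v b + y b) (?v b' + y b')) = 0"
    using complement_adjusted[OF \<xi> C0] by blast
  define w where "w b = ?v b + y b" for b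
  \<comment> \<open>Coordinates along \<open>u a\<close> after the complement vectors have been
    replaced by the isotropic \<open>w b\<close>; the coordinates along the complement do not
    change. \<open>X\<close> and \<open>Y\<close> are the diagonal blocks of \<open>ad x\<close> in
    the new basis.\<close>
  define cw where "cw a z = co a z - (\<Sum>b<nv. co (nh + b) z * co a (y b))" for a z
  define X where "X a' a = cw a' (bracket x (u a))" for a' a
  define Y where "Y b' b = co (nh + b') (bracket x (w b))" for b' b
  have cwd: "cw a \<in> dual" for a
    by (simp add: dual_iff cw_def co_simps distrib_right sum.distrib sum_distrib_left right_diff_distrib mult.assoc)
  have ww: "\<xi> (bracket (w b) (w b')) = 0" if "b < nv" "b' < nv" for b b' using yy[OF that] by (simp add: w_def)
  have aw: "bracket (u a) (w b) = bracket (u a) (?v b)" if "a < nh" "b < nv" for a b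
    using bracket_h[OF u_in_h[OF that(1)] yh[OF that(2)]] by (simp add: w_def bracket_right.add)
  have expand: "z = (\<Sum>a<nh. scale (cw a z) (u a)) + (\<Sum>b<nv. scale (co (nh + b) z) (w b))" for z
  proof -
    have "(\<Sum>a<nh. scale (cw a z) (u a)) = (\<Sum>a<nh. scale (co a z) (u a)) -
        (\<Sum>a<nh. \<Sum>b<nv. scale (co (nh + b) z) (scale (co a (y b)) (u a)))"
      by (simp add: cw_def scale_left_diff_distrib sum_subtractf scale_sum_left)
    also have "(\<Sum>a<nh. \<Sum>b<nv. scale (co (nh + b) z) (scale (co a (y b)) (u a))) =
        (\<Sum>b<nv. \<Sum>a<nh. scale (co (nh + b) z) (scale (co a (y b)) (u a)))"
      by (rule sum.swap)
    also have "\<dots> = (\<Sum>b<nv. scale (co (nh + b) z) (y b))"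
      unfolding scale_sum_right[symmetric] using expand_h[OF yh] by (intro sum.cong) auto
    finally have "(\<Sum>a<nh. scale (cw a z) (u a)) + (\<Sum>b<nv. scale (co (nh + b) z) (w b)) =
        (\<Sum>a<nh. scale (co a z) (u a)) + (\<Sum>b<nv. scale (co (nh + b) z) (?v b))"
      by (simp add: w_def scale_right_distrib sum.distrib)
    also have "\<dots> = (\<Sum>a<dimension. scale (co a z) (u a))"
      unfolding nh_nv[symmetric] sum_lessThan_add ..
    finally show ?thesis by (simp only: expand_u)
  qed
  have trace: "(\<Sum>a<nh. X a a) + (\<Sum>b<nv. Y b b) = 0"
  proof -
    have "(\<Sum>b<nv. co (nh + b) (bracket x (y b))) = (\<Sum>b<nv. \<Sum>a<nh. co a (y b) * co (nh + b) (bracket x (u a)))"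
    proof (intro sum.cong refl)
      fix b assume "b \<in> {..<nv}"
      then have "bracket x (y b) = bracket x (\<Sum>a<nh. scale (co a (y b)) (u a))" using expand_h[OF yh] by simp
      then show "co (nh + b) (bracket x (y b)) = (\<Sum>a<nh. co a (y b) * co (nh + b) (bracket x (u a)))"
        by (simp add: bracket_right.sum bracket_right.scale co_simps)
    qed
    also have "\<dots> = (\<Sum>a<nh. \<Sum>b<nv. co (nh + b) (bracket x (u a)) * co a (y b))"
      by (subst sum.swap) (simp only: mult.commute)
    finally have "(\<Sum>a<nh. X a a) + (\<Sum>b<nv. Y b b) =
        (\<Sum>a<nh. co a (bracket x (u a))) + (\<Sum>b<nv. co (nh + b) (bracket x (?v b)))"
      by (simp add: X_def Y_def cw_def w_def bracket_right.add co_simps sum.distrib sum_subtractf)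
    also have "\<dots> = (\<Sum>a<dimension. co a (bracket x (u a)))"
      unfolding nh_nv[symmetric] sum_lessThan_add ..
    finally show ?thesis using co_trace[OF assms(1)] by simp
  qed
  \<comment> \<open>The coadjoint direction of \<open>x\<close> at \<open>\<xi>\<close>; the
    derivatives wanted are first-order coefficients along it.\<close>
  define \<zeta> where "\<zeta> z = \<xi> (bracket x z)" for z
  have \<zeta>: "\<zeta> \<in> dual"
    using \<xi> unfolding \<zeta>_def by (auto simp: dual_iff bracket_right.add bracket_right.scale)
  interpret L: comm_ring_hom "line_poly \<xi> \<zeta>" by (rule comm_ring_hom_line_poly)
  have \<delta>': "\<xi> (bracket x (grad \<xi> (\<delta> C))) = - det_deriv (dmat_at \<xi> C)
      (mat nh nh (\<lambda>(a, j). if j < nv then 0 else \<Sum>a'<nh. X a' a * C a' (j - nv)))" for C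
  proof -
    let ?Q = "dmat_at \<xi> C"
    let ?N = "mat nh nh (\<lambda>(a, j). if j < nv then 0 else \<Sum>a'<nh. X a' a * C a' (j - nv))"
    let ?R = "mat nh nh (\<lambda>(a, j). if j < nv then \<zeta> (bracket (u a) (?v j)) else 0)"
    let ?X = "mat nh nh (\<lambda>(a, a'). X a' a)"
    let ?Y = "mat nh nh (\<lambda>(i, j). if i < nv \<and> j < nv then Y i j else 0)"
    have Q: "?Q \<in> carrier_mat nh nh" by simp
    then have dQ: "dim_row ?Q = nh" "dim_col ?Q = nh" by (simp_all only: carrier_matD)
    have coeffs: "coeff (line_poly \<xi> \<zeta> (embed z)) 0 = \<xi> z" "coeff (line_poly \<xi> \<zeta> (embed z)) 1 = \<zeta> z"
      "coeff (line_poly \<xi> \<zeta> (Const c)) 0 = c" "coeff (line_poly \<xi> \<zeta> (Const c)) 1 = 0" for z c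
      using line_poly_coeffs[of "embed z" \<zeta> \<xi>] line_poly_coeffs[of "Const c" \<zeta> \<xi>] embed_sym \<zeta> \<xi>
      by (simp_all add: sym_algebra_def dualD[OF \<zeta>])
    have "\<xi> (bracket x (grad \<xi> (\<delta> C))) = coeff (det (map_mat (line_poly \<xi> \<zeta>) (dmat C))) 1"
      using line_poly_coeffs(2)[OF \<delta>_sym \<zeta>, of \<xi>] by (simp add: \<delta>_def \<zeta>_def L.hom_det)
    also have "\<dots> = det_deriv ?Q ?R"
    proof -
      have "map_mat (\<lambda>p. coeff p 0) (map_mat (line_poly \<xi> \<zeta>) (dmat C)) = ?Q"
        "map_mat (\<lambda>p. coeff p 1) (map_mat (line_poly \<xi> \<zeta>) (dmat C)) = ?R"
        by (auto intro!: eq_matI simp: dmat_def dmat_at_def coeffs simp del: One_nat_def)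
      then show ?thesis using det_deriv_coeff[of "map_mat (line_poly \<xi> \<zeta>) (dmat C)" nh] by simp
    qed
    finally have 1: "\<xi> (bracket x (grad \<xi> (\<delta> C))) = det_deriv ?Q ?R" .
    \<comment> \<open>By the Jacobi identity and isotropy, moving in the coadjoint direction
      multiplies the bracket columns by one block on the left and the other on the right;
      \<open>?N\<close> is the effect of the left factor on the constant columns. The trace formulas
      then produce the sum of both traces, which is zero.\<close>
    have "?R + ?N = ?X * ?Q + ?Q * ?Y"
    proof (rule eq_matI)
      fix i j assume "i < dim_row (?X * ?Q + ?Q * ?Y)" "j < dim_col (?X * ?Q + ?Q * ?Y)"
      then have ij: "i < nh" "j < nh" by (auto simp: dmat_at_def)
      have XQ: "(?X * ?Q) $$ (i, j) = (\<Sum>a<nh. X a i * ?Q $$ (a, j))"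
        using index_mult_mat_sum[OF mat_carrier Q ij] ij by simp
      have QY: "(?Q * ?Y) $$ (i, j) = (\<Sum>b<nh. ?Q $$ (i, b) * (if b < nv \<and> j < nv then Y b j else 0))"
        using index_mult_mat_sum[OF Q mat_carrier ij] ij by simp
      show "(?R + ?N) $$ (i, j) = (?X * ?Q + ?Q * ?Y) $$ (i, j)"
      proof (cases "j < nv")
        case True
        have "bracket x (bracket (u i) (w j)) + bracket (u i) (bracket (w j) x) + bracket (w j) (bracket x (u i)) = 0"
          by (rule jacobi)
        moreover have "bracket (u i) (bracket (w j) x) = - bracket (u i) (bracket x (w j))"
          by (subst bracket_antisym[of "w j"]) (simp add: bracket_right.neg)
        moreover have "bracket (w j) (bracket x (u i)) = - bracket (bracket x (u i)) (w j)"
          by (rule bracket_antisym)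
        ultimately have "bracket x (bracket (u i) (w j)) = bracket (bracket x (u i)) (w j) + bracket (u i) (bracket x (w j))"
          by (simp add: algebra_simps)
        then have "\<zeta> (bracket (u i) (?v j)) = \<xi> (bracket (bracket x (u i)) (w j)) + \<xi> (bracket (u i) (bracket x (w j)))"
          using aw[OF ij(1) True] by (simp add: \<zeta>_def dualD[OF \<xi>])
        also have "\<xi> (bracket (bracket x (u i)) (w j)) = (\<Sum>a<nh. X a i * ?Q $$ (a, j))"
        proof -
          have "\<xi> (bracket (bracket x (u i)) (w j)) = (\<Sum>a<nh. X a i * \<xi> (bracket (u a) (w j))) +
              (\<Sum>b<nv. co (nh + b) (bracket x (u i)) * \<xi> (bracket (w b) (w j)))"
            by (subst expand[of "bracket x (u i)"])
              (simp add: bracket_left.add bracket_left.sum bracket_left.scale dualD[OF \<xi>] X_def)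
          also have "\<dots> = (\<Sum>a<nh. X a i * ?Q $$ (a, j))"
            using True ij by (simp add: ww aw dmat_at_def)
          finally show ?thesis .
        qed
        also have "\<xi> (bracket (u i) (bracket x (w j))) = (\<Sum>b<nv. ?Q $$ (i, b) * Y b j)"
        proof -
          have "\<xi> (bracket (u i) (bracket x (w j))) = (\<Sum>b<nv. \<xi> (bracket (u i) (?v b)) * Y b j)"
            by (simp add: bracket_u_h[OF u_in_h[OF ij(1)], of "bracket x (w j)"] dualD[OF \<xi>] Y_def mult.commute)
          also have "\<dots> = (\<Sum>b<nv. ?Q $$ (i, b) * Y b j)"
            using ij nv_le_nh by (intro sum.cong) (auto simp: dmat_at_def)
          finally show ?thesis .
        qed
        also have "\<dots> = (\<Sum>b<nh. ?Q $$ (i, b) * (if b < nv \<and> j < nv then Y b j else 0))"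
          using True nv_le_nh by (intro sum.mono_neutral_cong_left) auto
        finally show ?thesis using True ij XQ QY by (simp add: dQ)
      next
        case False
        then have "(?X * ?Q) $$ (i, j) = (\<Sum>a<nh. X a i * C a (j - nv))" "(?Q * ?Y) $$ (i, j) = 0"
          using XQ QY ij by (auto simp: dmat_at_def)
        then show ?thesis using False ij by (simp add: dQ)
      qed
    qed (auto simp: dmat_at_def)
    then have "det_deriv ?Q (?R + ?N) = det_deriv ?Q (?X * ?Q + ?Q * ?Y)" by (rule arg_cong)
    also have "det_deriv ?Q (?R + ?N) = det_deriv ?Q ?R + det_deriv ?Q ?N"
      by (rule det_deriv_add[OF Q mat_carrier mat_carrier])
    also have "det_deriv ?Q (?X * ?Q + ?Q * ?Y) = det_deriv ?Q (?X * ?Q) + det_deriv ?Q (?Q * ?Y)"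
      by (rule det_deriv_add[OF Q mult_carrier_mat[OF mat_carrier Q] mult_carrier_mat[OF Q mat_carrier]])
    also have "\<dots> = ((\<Sum>a<nh. X a a) + (\<Sum>k<nh. if k < nv then Y k k else 0)) * det ?Q"
      by (simp add: det_deriv_mult_left[OF Q mat_carrier] det_deriv_mult_right[OF Q mat_carrier] distrib_right)
    also have "(\<Sum>k<nh. if k < nv then Y k k else 0) = (\<Sum>b<nv. Y b b)"
      using nv_le_nh by (intro sum.mono_neutral_cong_right) auto
    finally show ?thesis using 1 trace by (simp add: eq_neg_iff_add_eq_0)
  qed
  have \<epsilon>': "\<xi> (bracket x (grad \<xi> (\<epsilon> C))) =
      - det_deriv (emat_at \<xi> C) (emat_at \<xi> (\<lambda>a r. \<Sum>a'<nh. X a' a * C a' r))" for C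
  proof -
    let ?A = "mat index index (\<lambda>(r, j). \<Sum>a<nh. Const (C a r) * fco a j)"
    let ?E = "emat_at \<xi> C" and ?N = "emat_at \<xi> (\<lambda>a r. \<Sum>a'<nh. X a' a * C a' r)"
    let ?R = "mat index index (\<lambda>(r, j). \<Sum>a<nh. C a r * \<zeta> (grad \<xi> (fco a j)))"
    have E: "?E \<in> carrier_mat index index" "?N \<in> carrier_mat index index" by simp_all
    \<comment> \<open>The bracket of \<open>x\<close> with the gradient of an invariant stays in
      \<open>\<h>\<close>, so the adjusted coordinates coincide with the original ones on
      it.\<close>
    have X: "\<zeta> (grad \<xi> (fco a j)) = - (\<Sum>a'<nh. X a a' * co a' (grad \<xi> (f j)))" if j: "j < index" for a j
    proof -
      let ?g = "grad \<xi> (f j)"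
      have gx: "bracket x ?g = (\<Sum>a'<nh. scale (co a' ?g) (bracket x (u a')))"
        by (subst expand_grad[OF j \<xi>, symmetric]) (simp add: bracket_right.sum bracket_right.scale)
      have 0: "co (nh + b) (bracket x ?g) = 0" if "b < nv" for b
        using coadjoint_fco[OF j \<xi>, of x "nh + b"] fco_eq_0[OF j that] by (simp add: bracket_right.zero dualD[OF \<xi>])
      have "cw a (bracket x ?g) = (\<Sum>a'<nh. X a a' * co a' ?g)"
        unfolding gx X_def by (simp add: dualD[OF cwd] mult.commute)
      then show ?thesis
        using coadjoint_fco[OF j \<xi>, of x a] 0 by (simp add: \<zeta>_def cw_def)
    qed
    have A: "?A $$ (r, j) \<in> polys Basis" if "r < index" "j < index" for r j
      using that by (auto intro!: polys_sum polys_mult fco_sym)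
    have "\<xi> (bracket x (grad \<xi> (\<epsilon> C))) = coeff (det (map_mat (line_poly \<xi> \<zeta>) ?A)) 1"
      using line_poly_coeffs(2)[OF \<epsilon>_sym \<zeta>, of \<xi>] by (simp add: \<epsilon>_def \<zeta>_def L.hom_det)
    also have "\<dots> = det_deriv ?E ?R"
    proof -
      have "map_mat (\<lambda>p. coeff p 0) (map_mat (line_poly \<xi> \<zeta>) ?A) = ?E"
        using line_poly_coeffs(1)[OF A \<zeta>, of _ _ \<xi>]
        by (intro eq_matI) (auto simp: emat_at_def eval_at.hom_sum eval_fco)
      moreover have "map_mat (\<lambda>p. coeff p 1) (map_mat (line_poly \<xi> \<zeta>) ?A) = ?R"
        using line_poly_coeffs(2)[OF A \<zeta>, of _ _ \<xi>]
        by (intro eq_matI) (auto simp: grad_sum grad_mult dualD[OF \<zeta>] simp del: One_nat_def)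
      ultimately show ?thesis using det_deriv_coeff[of "map_mat (line_poly \<xi> \<zeta>) ?A" index] by simp
    qed
    finally have 1: "\<xi> (bracket x (grad \<xi> (\<epsilon> C))) = det_deriv ?E ?R" .
    have "?R + ?N = 0\<^sub>m index index"
    proof (rule eq_matI)
      fix r j assume rj: "r < dim_row (0\<^sub>m index index :: 'k mat)" "j < dim_col (0\<^sub>m index index :: 'k mat)"
      have "(\<Sum>a<nh. C a r * (\<Sum>a'<nh. X a a' * co a' (grad \<xi> (f j)))) =
          (\<Sum>a'<nh. (\<Sum>a<nh. X a a' * C a r) * co a' (grad \<xi> (f j)))"
        unfolding sum_distrib_left sum_distrib_right by (subst sum.swap) (simp only: mult_ac)
      then show "(?R + ?N) $$ (r, j) = 0\<^sub>m index index $$ (r, j)"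
        using rj X by (simp add: emat_at_def sum_negf)
    qed (auto simp: emat_at_def)
    then have "det_deriv ?E ?R + det_deriv ?E ?N = 0"
      using det_deriv_add[OF E(1) mat_carrier E(2), of "\<lambda>(r, j). \<Sum>a<nh. C a r * \<zeta> (grad \<xi> (fco a j))"]
        det_deriv_zero[OF E(1)] by simp
    then show ?thesis using 1 by (simp add: eq_neg_iff_add_eq_0)
  qed
  show ?thesis using \<delta>' \<epsilon>' by blast
qed

text \<open>In the coadjoint direction both families of minors vary like under the same linear
  substitution in \<open>C\<close>. Since the identity between them can also be differentiated in
  \<open>C\<close>, these variations match without any contribution from \<open>p\<close>, whose
  derivative therefore vanishes wherever \<open>\<delta> C0\<close> does not.\<close>

lemma quotient_center:
  assumes unimodular and p: "p \<in> polys Basis" "\<And>C. \<epsilon> C = p * \<delta> C" and C0: "\<delta> C0 \<noteq> 0"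
  shows "p \<in> poisson_center"
proof -
  have ps: "p \<in> sym_algebra" using p by (simp add: sym_algebra_def)
  \<comment> \<open>The identity between the minors, valid for all constant matrices, is
    differentiated at \<open>C\<close> in the direction \<open>H\<close>.\<close>
  have lin: "det_deriv (emat_at \<xi> C) (emat_at \<xi> H) = eval_at \<xi> p *
      det_deriv (dmat_at \<xi> C) (mat nh nh (\<lambda>(a, j). if j < nv then 0 else H a (j - nv)))"
    if \<xi>: "\<xi> \<in> dual" for \<xi> C H
  proof -
    let ?E = "mat index index (\<lambda>(r, j). [:emat_at \<xi> C $$ (r, j), emat_at \<xi> H $$ (r, j):])"
    let ?N = "mat nh nh (\<lambda>(a, j). if j < nv then 0 else H a (j - nv))"
    let ?D = "mat nh nh (\<lambda>(a, j). [:dmat_at \<xi> C $$ (a, j), ?N $$ (a, j):])"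
    have "det ?E = smult (eval_at \<xi> p) (det ?D)"
    proof (rule poly_ext)
      fix t :: 'k
      interpret ev: comm_ring_hom "\<lambda>q. poly q t" by (rule comm_ring_hom_poly_eval)
      let ?C = "\<lambda>a r. C a r + t * H a r"
      have "map_mat (\<lambda>q. poly q t) ?E = emat_at \<xi> ?C"
        by (intro eq_matI) (auto simp: emat_at_def distrib_right sum.distrib sum_distrib_left mult.assoc)
      moreover have "map_mat (\<lambda>q. poly q t) ?D = dmat_at \<xi> ?C"
        by (intro eq_matI) (auto simp: dmat_at_def)
      moreover have "det (emat_at \<xi> ?C) = eval_at \<xi> p * det (dmat_at \<xi> ?C)"
        using arg_cong[OF p(2)[of ?C], of "eval_at \<xi>"] by (simp add: eval_\<epsilon> eval_\<delta>[OF \<xi>])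
      ultimately show "poly (det ?E) t = poly (smult (eval_at \<xi> p) (det ?D)) t"
        by (simp add: ev.hom_det[symmetric])
    qed
    then have "coeff (det ?E) 1 = eval_at \<xi> p * coeff (det ?D) 1" by simp
    moreover have "map_mat (\<lambda>p. coeff p 0) ?E = emat_at \<xi> C" "map_mat (\<lambda>p. coeff p 1) ?E = emat_at \<xi> H"
      "map_mat (\<lambda>p. coeff p 0) ?D = dmat_at \<xi> C" "map_mat (\<lambda>p. coeff p 1) ?D = ?N"
      by (auto intro!: eq_matI simp: emat_at_def dmat_at_def)
    ultimately show ?thesis using det_deriv_coeff[of ?E index] det_deriv_coeff[of ?D nh] by simp
  qed
  have "poisson p (embed x) = 0" for x
  proof (rule sym_mult_eq_0[OF \<delta>_sym _ _ C0])
    show pe: "poisson p (embed x) \<in> polys Basis" using poisson_sym[OF ps embed_sym] by (simp add: sym_algebra_def)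
    show "\<delta> C0 * poisson p (embed x) = 0"
    proof (rule sym_eq_0)
      show "\<delta> C0 * poisson p (embed x) \<in> sym_algebra" using pe \<delta>_sym by (simp add: sym_algebra_def)
      fix \<xi> assume \<xi>: "\<xi> \<in> dual"
      show "eval_at \<xi> (\<delta> C0 * poisson p (embed x)) = 0"
      proof (cases "eval_at \<xi> (\<delta> C0) = 0")
        case False
        then have "det (dmat_at \<xi> C0) \<noteq> 0" by (simp add: eval_\<delta>[OF \<xi>])
        then obtain X where X: "\<And>C. \<xi> (bracket x (grad \<xi> (\<delta> C))) = - det_deriv (dmat_at \<xi> C)
            (mat nh nh (\<lambda>(a, j). if j < nv then 0 else \<Sum>a'<nh. X a' a * C a' (j - nv)))"
          "\<And>C. \<xi> (bracket x (grad \<xi> (\<epsilon> C))) = - det_deriv (emat_at \<xi> C) (emat_at \<xi> (\<lambda>a r. \<Sum>a'<nh. X a' a * C a' r))"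
          using coadjoint_minors[OF assms(1) \<xi>, of C0 x] by blast
        have "\<xi> (bracket x (grad \<xi> (\<epsilon> C0))) = eval_at \<xi> p * \<xi> (bracket x (grad \<xi> (\<delta> C0)))"
          unfolding X lin[OF \<xi>] by simp
        moreover have "\<xi> (bracket x (grad \<xi> (\<epsilon> C0))) = eval_at \<xi> p * \<xi> (bracket x (grad \<xi> (\<delta> C0))) +
            eval_at \<xi> (\<delta> C0) * \<xi> (bracket x (grad \<xi> p))"
          unfolding p(2) by (simp add: grad_mult bracket_right.add bracket_right.scale dualD[OF \<xi>])
        ultimately have "\<xi> (bracket x (grad \<xi> p)) = 0" using False by simp
        moreover have "\<xi> (bracket (grad \<xi> p) x) = - \<xi> (bracket x (grad \<xi> p))"
          by (subst bracket_antisym) (simp add: dualD[OF \<xi>])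
        ultimately show ?thesis by (simp add: eval_poisson[OF \<xi>])
      qed simp
    qed
  qed
  then have "\<xi> (bracket (grad \<xi> p) x) = 0" if "\<xi> \<in> dual" for \<xi> x
    using eval_poisson[OF that, of p "embed x"] by simp
  then show ?thesis unfolding center_iff[OF ps] by blast
qed

lemma partial_deriv_f:
  assumes j: "j < index" and b: "b \<in> Basis"
  shows "partial_deriv b (f j) = (\<Sum>a<nh. Const (representation Basis (u a) b) * fco a j)"
proof -
  have "partial_deriv b (f j) - (\<Sum>a<nh. Const (representation Basis (u a) b) * fco a j) = 0"
  proof (rule sym_eq_0)
    show "partial_deriv b (f j) - (\<Sum>a<nh. Const (representation Basis (u a) b) * fco a j) \<in> sym_algebra"
      unfolding sym_algebra_def
      by (intro polys_minus polys_sum polys_mult polys_Const partial_deriv_polys f_sym fco_sym j)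
    fix \<xi> assume \<xi>: "\<xi> \<in> dual"
    have rd: "(\<lambda>v. representation Basis v b) \<in> dual" by (rule dual_representation[OF independent_Basis span_Basis])
    have "(\<Sum>a<nh. representation Basis (u a) b * co a (grad \<xi> (f j))) = representation Basis (grad \<xi> (f j)) b"
      by (subst (2) expand_grad[OF j \<xi>, symmetric]) (simp add: dualD[OF rd] mult.commute)
    also have "\<dots> = (\<Sum>c \<in> Basis. if c = b then eval_at \<xi> (partial_deriv b (f j)) else 0)"
      unfolding grad_def dualD[OF rd]
      by (intro sum.cong) (auto simp: representation_basis[OF independent_Basis])
    also have "\<dots> = eval_at \<xi> (partial_deriv b (f j))" using b finite_Basis by simp
    finally show "eval_at \<xi> (partial_deriv b (f j) - (\<Sum>a<nh. Const (representation Basis (u a) b) * fco a j)) = 0"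
      by (simp add: eval_at.hom_sum eval_fco)
  qed
  then show ?thesis by simp
qed

lemma minors_constant_quotient:
  assumes unimodular
    and ind: "\<And>P. P \<in> polys {..<index} \<Longrightarrow> eval_in Const f P = 0 \<Longrightarrow> P = 0"
    and gen: "poisson_center = eval_in Const f ` polys {..<index}"
    and v1: "v1 \<in> dual" "v1 \<notin> degenerate" and v2: "v2 \<in> dual" "v2 \<notin> lsum degenerate v1"
  shows "\<exists>c. c \<noteq> 0 \<and> (\<forall>C. \<epsilon> C = Const c * \<delta> C)"
proof -
  obtain p where p: "p \<in> polys Basis" "\<And>C. \<epsilon> C = p * \<delta> C" using minors_quotient[OF v1 v2] by blast
  obtain C0 where "eval_at v1 (\<delta> C0) \<noteq> 0" using v1 by (auto simp: degenerate_def)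
  then have "\<delta> C0 \<noteq> 0" by auto
  have pc: "p \<in> poisson_center" by (rule quotient_center[OF assms(1) p \<open>\<delta> C0 \<noteq> 0\<close>])
  then obtain P where P: "P \<in> polys {..<index}" "p = eval_in Const f P" using gen by blast
  \<comment> \<open>Partial derivatives in the fixed basis are constant combinations of coordinates
    along \<open>\<h>\<close>, so every Jacobian minor is of the form
    \<open>\<epsilon> C\<close>.\<close>
  have minor: "det (mat index index (\<lambda>(r, j). partial_deriv (\<beta> r) (f j))) = p * \<delta> (\<lambda>a r. representation Basis (u a) (\<beta> r))"
    if "\<beta> \<in> {0..<index} \<rightarrow>\<^sub>E Basis" for \<beta>
  proof -
    have "mat index index (\<lambda>(r, j). partial_deriv (\<beta> r) (f j)) =
        mat index index (\<lambda>(r, j). \<Sum>a<nh. Const (representation Basis (u a) (\<beta> r)) * fco a j)"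
      using that by (intro eq_matI) (auto simp: PiE_iff intro!: partial_deriv_f)
    then show ?thesis by (simp only: \<epsilon>_def[symmetric] p(2))
  qed
  have fB: "f j \<in> polys Basis" if "j < index" for j by (rule f_sym[OF that])
  have p0: "p \<noteq> 0"
    using jacobian_minor_nonzero[OF finite_Basis fB ind] minor by force
  \<comment> \<open>For invariant \<open>p\<close>, bracketing with \<open>p * s\<close> is
    \<open>p\<close> times bracketing with \<open>s\<close>, so invariants are closed under
    division.\<close>
  have closed: "s \<in> poisson_center" if s: "s \<in> polys Basis" "p * s \<in> poisson_center" for s
  proof -
    have ss: "s \<in> sym_algebra" "p * s \<in> sym_algebra" "p \<in> sym_algebra"
      using s p by (simp_all add: sym_algebra_def)
    have "poisson s (embed x) = 0" for x
    proof (rule sym_mult_eq_0[OF p(1) _ _ p0])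
      show e: "poisson s (embed x) \<in> polys Basis"
        using poisson_sym[OF ss(1) embed_sym] by (simp add: sym_algebra_def)
      show "p * poisson s (embed x) = 0"
      proof (rule sym_eq_0)
        show "p * poisson s (embed x) \<in> sym_algebra" using e p by (simp add: sym_algebra_def)
        fix \<xi> assume \<xi>: "\<xi> \<in> dual"
        have "\<xi> (bracket (grad \<xi> (p * s)) x) = 0" "\<xi> (bracket (grad \<xi> p) x) = 0"
          using s(2) pc \<xi> by (auto simp: center_iff ss)
        then show "eval_at \<xi> (p * poisson s (embed x)) = 0"
          by (simp add: eval_poisson[OF \<xi>] grad_mult bracket_left.add bracket_left.scale dualD[OF \<xi>])
      qed
    qed
    then have "\<xi> (bracket (grad \<xi> s) x) = 0" if "\<xi> \<in> dual" for \<xi> x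
      using eval_poisson[OF that, of s "embed x"] by simp
    then show ?thesis unfolding center_iff[OF ss(1)] by blast
  qed
  have "\<exists>c. P = Const c"
  proof (rule jacobian_minors_common_factor[OF finite_Basis fB ind P])
    show "s \<in> eval_in Const f ` polys {..<index}" if "s \<in> polys Basis" "p * s \<in> eval_in Const f ` polys {..<index}" for s
      using closed that by (simp add: gen)
    show "p dvd det (mat index index (\<lambda>(r, j). partial_deriv (\<beta> r) (f j)))" if "\<beta> \<in> {0..<index} \<rightarrow>\<^sub>E Basis" for \<beta>
      using minor[OF that] by simp
  qed (use p0 in auto)
  then obtain c where "P = Const c" by blast
  then have pc: "p = Const c" using P(2) by (simp add: eval_in_Const[OF comm_ring_hom_Const])
  show ?thesis using p0 p(2) pc by (intro exI[of _ c]) auto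
qed

end

section \<open>Exactness of a two-step complex\<close>

text \<open>The elements annihilating the homology of \<open>R\<^sup>i \<rightarrow> R\<^sup>n \<rightarrow> R\<^sup>m\<close> at the two right-hand places.\<close>

definition annihilator ::
  "nat \<Rightarrow> nat \<Rightarrow> nat \<Rightarrow> (nat \<Rightarrow> nat \<Rightarrow> 'r::comm_ring_1) \<Rightarrow> (nat \<Rightarrow> nat \<Rightarrow> 'r) \<Rightarrow> 'r set" where
  "annihilator i n m A F = {r.
     (\<forall>u. \<exists>w. \<forall>b<m. r * u b = (\<Sum>a<n. A b a * w a)) \<and>
     (\<forall>v. (\<forall>b<m. (\<Sum>a<n. A b a * v a) = 0) \<longrightarrow> (\<exists>w. \<forall>a<n. r * v a = (\<Sum>j<i. F a j * w j)))}"

lemma annihilator_zero: "0 \<in> annihilator i n m A F"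
  unfolding annihilator_def by (auto intro!: exI[of _ "\<lambda>_. 0"])

lemma annihilator_mult:
  assumes "r \<in> annihilator i n m A F"
  shows "s * r \<in> annihilator i n m A F"
  unfolding annihilator_def
proof (intro CollectI conjI allI impI)
  fix u
  obtain w where w: "\<forall>b<m. r * u b = (\<Sum>a<n. A b a * w a)" using assms unfolding annihilator_def by blast
  show "\<exists>w. \<forall>b<m. s * r * u b = (\<Sum>a<n. A b a * w a)"
    by (intro exI[of _ "\<lambda>a. s * w a"]) (simp add: w mult.assoc sum_distrib_left mult.left_commute)
next
  fix v assume "\<forall>b<m. (\<Sum>a<n. A b a * v a) = 0"
  then obtain w where w: "\<forall>a<n. r * v a = (\<Sum>j<i. F a j * w j)" using assms unfolding annihilator_def by blast
  show "\<exists>w. \<forall>a<n. s * r * v a = (\<Sum>j<i. F a j * w j)"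
    by (intro exI[of _ "\<lambda>j. s * w j"]) (simp add: w mult.assoc sum_distrib_left mult.left_commute)
qed

lemma annihilator_add:
  assumes "r \<in> annihilator i n m A F" "s \<in> annihilator i n m A F"
  shows "r + s \<in> annihilator i n m A F"
  unfolding annihilator_def
proof (intro CollectI conjI allI impI)
  fix u
  obtain w w' where w: "\<forall>b<m. r * u b = (\<Sum>a<n. A b a * w a)" "\<forall>b<m. s * u b = (\<Sum>a<n. A b a * w' a)"
    using assms unfolding annihilator_def by blast
  show "\<exists>w. \<forall>b<m. (r + s) * u b = (\<Sum>a<n. A b a * w a)"
    by (intro exI[of _ "\<lambda>a. w a + w' a"]) (simp add: w distrib_right distrib_left sum.distrib)
next
  fix v assume v: "\<forall>b<m. (\<Sum>a<n. A b a * v a) = 0"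
  obtain w where w: "\<forall>a<n. r * v a = (\<Sum>j<i. F a j * w j)" using assms(1) v unfolding annihilator_def by blast
  obtain w' where w': "\<forall>a<n. s * v a = (\<Sum>j<i. F a j * w' j)" using assms(2) v unfolding annihilator_def by blast
  show "\<exists>w. \<forall>a<n. (r + s) * v a = (\<Sum>j<i. F a j * w j)"
    by (intro exI[of _ "\<lambda>j. w j + w' j"]) (simp add: w w' distrib_right distrib_left sum.distrib)
qed

lemma mult_mat_vec_eq_0D:
  fixes Q :: "'r::idom mat"
  assumes Q: "Q \<in> carrier_mat n n" "det Q \<noteq> 0" and x: "\<And>r. r < n \<Longrightarrow> (\<Sum>a<n. Q $$ (r, a) * x a) = 0" and a: "a < n"
  shows "x a = 0"
proof -
  have "Q *\<^sub>v vec n x = 0\<^sub>v n"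
  proof (rule eq_vecI)
    fix r assume "r < dim_vec (0\<^sub>v n)"
    then have "r < n" by simp
    then have "(Q *\<^sub>v vec n x) $ r = (\<Sum>a<n. Q $$ (r, a) * vec n x $ a)"
      by (rule mult_mat_vec_sum[OF Q(1) vec_carrier])
    then show "(Q *\<^sub>v vec n x) $ r = 0\<^sub>v n $ r" using x[OF \<open>r < n\<close>] \<open>r < n\<close> by simp
  qed (use Q in auto)
  then have "vec n x = 0\<^sub>v n" using det_0_iff_vec_prod_zero[OF Q(1)] Q(2) vec_carrier[of n x] by blast
  then show ?thesis using a by (metis index_vec index_zero_vec(1))
qed

lemma adj_mat_solve:
  fixes Q :: "'r::idom mat"
  assumes Q: "Q \<in> carrier_mat n n"
  shows "\<exists>w. \<forall>r<n. (\<Sum>a<n. Q $$ (r, a) * w a) = det Q * z r"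
proof -
  note adj = adj_mat[OF Q]
  define w where "w a = (\<Sum>k<n. adj_mat Q $$ (a, k) * z k)" for a
  have "(\<Sum>a<n. Q $$ (r, a) * w a) = det Q * z r" if r: "r < n" for r
  proof -
    have "(\<Sum>a<n. Q $$ (r, a) * w a) = (\<Sum>a<n. \<Sum>k<n. Q $$ (r, a) * adj_mat Q $$ (a, k) * z k)"
      by (simp add: w_def sum_distrib_left mult.assoc)
    also have "\<dots> = (\<Sum>k<n. (\<Sum>a<n. Q $$ (r, a) * adj_mat Q $$ (a, k)) * z k)"
      by (subst sum.swap) (simp add: sum_distrib_right)
    also have "\<dots> = (\<Sum>k<n. if k = r then det Q * z k else 0)"
    proof (intro sum.cong refl)
      fix k assume k: "k \<in> {..<n}"
      have "(\<Sum>a<n. Q $$ (r, a) * adj_mat Q $$ (a, k)) = (Q * adj_mat Q) $$ (r, k)"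
        by (rule index_mult_mat_sum[OF Q adj(1) r, symmetric]) (use k in simp)
      then show "(\<Sum>a<n. Q $$ (r, a) * adj_mat Q $$ (a, k)) * z k = (if k = r then det Q * z k else 0)"
        using r k unfolding adj(2) by simp
    qed
    also have "\<dots> = det Q * z r" using r by simp
    finally show ?thesis .
  qed
  then show ?thesis by blast
qed

text \<open>The adjugate of \<open>Q\<close> lifts \<open>det Q * u\<close> through \<open>A\<close>
  once \<open>u\<close> is extended by zeros. For \<open>v\<close> in the kernel of
  \<open>A\<close>, the adjugate of \<open>E\<close> supplies a combination of the columns of
  \<open>F\<close> that agrees with \<open>det E * v\<close> on the rows of \<open>C\<close>; on the
  rows of \<open>A\<close> both vanish, so they are equal because \<open>Q\<close> is nonsingular.
  The unit \<open>c\<close> exchanges \<open>det E\<close> for \<open>det Q\<close>.\<close>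

lemma minor_annihilates:
  fixes A F C :: "nat \<Rightarrow> nat \<Rightarrow> 'r::idom" and m i :: nat
  defines "Q \<equiv> mat (m + i) (m + i) (\<lambda>(r, a). if r < m then A r a else C (r - m) a)"
    and "E \<equiv> mat i i (\<lambda>(r, j). \<Sum>a<m + i. C r a * F a j)"
  assumes AF: "\<And>b j. b < m \<Longrightarrow> j < i \<Longrightarrow> (\<Sum>a<m + i. A b a * F a j) = 0"
    and c: "det E = c * det Q" "c' * c = 1"
  shows "det Q \<in> annihilator i (m + i) m A F"
proof (cases "det Q = 0")
  case False
  have Q: "Q \<in> carrier_mat (m + i) (m + i)" and E: "E \<in> carrier_mat i i" by (simp_all add: Q_def E_def)
  show ?thesis
    unfolding annihilator_def
  proof (intro CollectI conjI allI impI)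
    fix u
    obtain w where w: "\<forall>r<m + i. (\<Sum>a<m + i. Q $$ (r, a) * w a) = det Q * (if r < m then u r else 0)"
      using adj_mat_solve[OF Q, of "\<lambda>r. if r < m then u r else 0"] by (elim exE)
    have "det Q * u b = (\<Sum>a<m + i. A b a * w a)" if "b < m" for b
    proof -
      have "(\<Sum>a<m + i. Q $$ (b, a) * w a) = det Q * u b" using w that by simp
      moreover have "(\<Sum>a<m + i. Q $$ (b, a) * w a) = (\<Sum>a<m + i. A b a * w a)"
        using that by (intro sum.cong) (auto simp: Q_def)
      ultimately show ?thesis by simp
    qed
    then show "\<exists>w. \<forall>b<m. det Q * u b = (\<Sum>a<m + i. A b a * w a)" by blast
  next
    fix v assume v: "\<forall>b<m. (\<Sum>a<m + i. A b a * v a) = 0"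
    obtain w where w: "\<forall>r<i. (\<Sum>j<i. E $$ (r, j) * w j) = det E * (\<Sum>a<m + i. C r a * v a)"
      using adj_mat_solve[OF E, of "\<lambda>r. \<Sum>a<m + i. C r a * v a"] by (elim exE)
    have "(\<Sum>j<i. F a j * w j) - det E * v a = 0" if a: "a < m + i" for a
    proof (rule mult_mat_vec_eq_0D[OF Q False _ a])
      fix r assume r: "r < m + i"
      have swap: "(\<Sum>a<m + i. B a * ((\<Sum>j<i. F a j * w j) - det E * v a)) =
          (\<Sum>j<i. (\<Sum>a<m + i. B a * F a j) * w j) - det E * (\<Sum>a<m + i. B a * v a)" for B
      proof -
        have "(\<Sum>a<m + i. B a * (\<Sum>j<i. F a j * w j)) = (\<Sum>j<i. (\<Sum>a<m + i. B a * F a j) * w j)"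
          unfolding sum_distrib_left sum_distrib_right by (subst sum.swap) (simp only: mult.assoc)
        then show ?thesis by (simp add: right_diff_distrib sum_subtractf sum_distrib_left mult.left_commute)
      qed
      show "(\<Sum>a<m + i. Q $$ (r, a) * ((\<Sum>j<i. F a j * w j) - det E * v a)) = 0"
      proof (cases "r < m")
        case True
        then have "(\<Sum>a<m + i. Q $$ (r, a) * ((\<Sum>j<i. F a j * w j) - det E * v a)) =
            (\<Sum>a<m + i. A r a * ((\<Sum>j<i. F a j * w j) - det E * v a))"
          by (intro sum.cong) (auto simp: Q_def)
        then show ?thesis unfolding swap using True v AF by simp
      next
        case False
        then have "(\<Sum>a<m + i. Q $$ (r, a) * ((\<Sum>j<i. F a j * w j) - det E * v a)) =
            (\<Sum>a<m + i. C (r - m) a * ((\<Sum>j<i. F a j * w j) - det E * v a))"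
          using r by (intro sum.cong) (auto simp: Q_def)
        also have "\<dots> = (\<Sum>j<i. E $$ (r - m, j) * w j) - det E * (\<Sum>a<m + i. C (r - m) a * v a)"
          unfolding swap using False r by (simp add: E_def)
        finally show ?thesis using w False r by simp
      qed
    qed
    then have Fw: "(\<Sum>j<i. F a j * w j) = c * det Q * v a" if "a < m + i" for a using that c(1) by simp
    then have "det Q * v a = (\<Sum>j<i. F a j * (c' * w j))" if "a < m + i" for a
    proof -
      have "(\<Sum>j<i. F a j * (c' * w j)) = c' * (\<Sum>j<i. F a j * w j)"
        by (simp add: sum_distrib_left mult.left_commute)
      also have "\<dots> = (c' * c) * (det Q * v a)" using Fw[OF that] by (simp add: mult_ac)
      finally show ?thesis using c(2) by simp
    qed
    then show "\<exists>w. \<forall>a<m + i. det Q * v a = (\<Sum>j<i. F a j * w j)"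
      by (intro exI[of _ "\<lambda>j. c' * w j"] allI impI)
  qed
qed (simp add: annihilator_zero)

text \<open>A diagram chase with the Koszul relations of \<open>r1, r2, r3\<close>: a module that has a free resolution of
  length two and is annihilated by a regular sequence of length three is zero.\<close>

lemma koszul_surjective:
  fixes A F :: "nat \<Rightarrow> nat \<Rightarrow> 'r::idom"
  assumes AF: "\<And>b j. b < m \<Longrightarrow> j < i \<Longrightarrow> (\<Sum>a<n. A b a * F a j) = 0"
    and inj: "\<And>w. (\<And>a. a < n \<Longrightarrow> (\<Sum>j<i. F a j * w j) = 0) \<Longrightarrow> \<forall>j<i. w j = 0"
    and r: "r1 \<in> annihilator i n m A F" "r2 \<in> annihilator i n m A F" "r3 \<in> annihilator i n m A F" "r1 \<noteq> 0"
    and reg2: "\<And>u v. r1 * u = r2 * v \<Longrightarrow> r1 dvd v"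
    and reg3: "\<And>u v w. r1 * u + r2 * v + r3 * w = 0 \<Longrightarrow> \<exists>s t. w = r1 * s + r2 * t"
  shows "\<exists>w. \<forall>b<m. u b = (\<Sum>a<n. A b a * w a)"
proof -
  have im: "\<exists>w. \<forall>b<m. s * u b = (\<Sum>a<n. A b a * w a)" if "s \<in> annihilator i n m A F" for s u
    using that unfolding annihilator_def by blast
  have linA: "(\<Sum>a<n. A b a * (s * x a - t * y a)) = s * (\<Sum>a<n. A b a * x a) - t * (\<Sum>a<n. A b a * y a)" for b s t x y
    by (simp add: right_diff_distrib sum_subtractf sum_distrib_left mult.left_commute)
  have linF: "(\<Sum>j<i. F a j * (s * x j - t * y j)) = s * (\<Sum>j<i. F a j * x j) - t * (\<Sum>j<i. F a j * y j)" for a s t x y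
    by (simp add: right_diff_distrib sum_subtractf sum_distrib_left mult.left_commute)
  \<comment> \<open>Exactness at the middle term uses \<open>r1\<close> and \<open>r2\<close>: the
    lifts of \<open>r1 * v\<close> and \<open>r2 * v\<close> are proportional by injectivity of
    \<open>F\<close>, and regularity makes the first divisible by \<open>r1\<close>.\<close>
  have exact: "\<exists>w. \<forall>a<n. v a = (\<Sum>j<i. F a j * w j)" if v: "\<forall>b<m. (\<Sum>a<n. A b a * v a) = 0" for v
  proof -
    obtain w1 w2 where w: "\<forall>a<n. r1 * v a = (\<Sum>j<i. F a j * w1 j)" "\<forall>a<n. r2 * v a = (\<Sum>j<i. F a j * w2 j)"
      using r(1,2) v unfolding annihilator_def by blast
    have "\<forall>j<i. r1 * w2 j - r2 * w1 j = 0"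
    proof (rule inj)
      fix a assume a: "a < n"
      have "r1 * (r2 * v a) - r2 * (r1 * v a) = 0" by (simp only: mult.left_commute[of r2 r1] diff_self)
      then show "(\<Sum>j<i. F a j * (r1 * w2 j - r2 * w1 j)) = 0"
        unfolding linF using w a by simp
    qed
    then have "\<forall>j<i. \<exists>w. w1 j = r1 * w" using reg2 by (auto simp: dvd_def)
    then obtain w where w': "\<forall>j<i. w1 j = r1 * w j" by metis
    have "v a = (\<Sum>j<i. F a j * w j)" if "a < n" for a
    proof -
      have "r1 * v a = (\<Sum>j<i. F a j * (r1 * w j))" using w(1) that w' by simp
      also have "\<dots> = r1 * (\<Sum>j<i. F a j * w j)" by (simp add: sum_distrib_left mult.left_commute)
      finally show ?thesis using r(4) by simp
    qed
    then show ?thesis by blast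
  qed
  obtain w1 where w1: "\<forall>b<m. r1 * u b = (\<Sum>a<n. A b a * w1 a)" using im[OF r(1), of u] by (elim exE)
  obtain w2 where w2: "\<forall>b<m. r2 * u b = (\<Sum>a<n. A b a * w2 a)" using im[OF r(2), of u] by (elim exE)
  obtain w3 where w3: "\<forall>b<m. r3 * u b = (\<Sum>a<n. A b a * w3 a)" using im[OF r(3), of u] by (elim exE)
  \<comment> \<open>Cross multiples of two lifts differ by an element of the kernel of
    \<open>A\<close>, which comes from \<open>F\<close> by exactness.\<close>
  have "\<exists>x. \<forall>a<n. s * y a - t * z a = (\<Sum>j<i. F a j * x j)"
    if "\<forall>b<m. t * u b = (\<Sum>a<n. A b a * y a)" "\<forall>b<m. s * u b = (\<Sum>a<n. A b a * z a)" for s t y z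
  proof (rule exact, intro allI impI)
    fix b assume b: "b < m"
    have "s * (t * u b) - t * (s * u b) = 0" by (simp only: mult.left_commute[of t s] diff_self)
    then show "(\<Sum>a<n. A b a * (s * y a - t * z a)) = 0"
      unfolding linA using that b by simp
  qed
  note kos = this
  obtain x12 where x12: "\<forall>a<n. r1 * w2 a - r2 * w1 a = (\<Sum>j<i. F a j * x12 j)"
    using kos[OF w2 w1] by (elim exE)
  obtain x13 where x13: "\<forall>a<n. r1 * w3 a - r3 * w1 a = (\<Sum>j<i. F a j * x13 j)"
    using kos[OF w3 w1] by (elim exE)
  obtain x23 where x23: "\<forall>a<n. r2 * w3 a - r3 * w2 a = (\<Sum>j<i. F a j * x23 j)"
    using kos[OF w3 w2] by (elim exE)
  \<comment> \<open>The cyclic sum of the three differences cancels identically; by injectivity of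
    \<open>F\<close> it cancels already among the preimages. Regularity then writes
    \<open>x12\<close> as a combination of \<open>r1\<close> and \<open>r2\<close>.\<close>
  have "\<forall>j<i. r1 * x23 j + r2 * (- x13 j) + r3 * x12 j = 0"
  proof (rule inj)
    fix a assume a: "a < n"
    have "(\<Sum>j<i. F a j * (r1 * x23 j + r2 * (- x13 j) + r3 * x12 j)) =
        r1 * (\<Sum>j<i. F a j * x23 j) - r2 * (\<Sum>j<i. F a j * x13 j) + r3 * (\<Sum>j<i. F a j * x12 j)"
      by (simp add: distrib_left right_diff_distrib sum.distrib sum_subtractf sum_distrib_left mult.left_commute)
    also have "\<dots> = r1 * (r2 * w3 a - r3 * w2 a) - r2 * (r1 * w3 a - r3 * w1 a) + r3 * (r1 * w2 a - r2 * w1 a)"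
      using a x12 x13 x23 by simp
    also have "\<dots> = 0" by (simp add: algebra_simps)
    finally show "(\<Sum>j<i. F a j * (r1 * x23 j + r2 * (- x13 j) + r3 * x12 j)) = 0" .
  qed
  then have "\<forall>j<i. \<exists>s t. x12 j = r1 * s + r2 * t" using reg3 by blast
  then obtain s t where st: "\<forall>j<i. x12 j = r1 * s j + r2 * t j" by metis
  define Fs where "Fs x a = (\<Sum>j<i. F a j * x j)" for x a
  \<comment> \<open>Corrected by an image of \<open>F\<close>, which \<open>A\<close> kills, the
    lift of \<open>r1 * u\<close> becomes divisible by \<open>r1\<close>; the quotient lifts
    \<open>u\<close>.\<close>
  have "r1 * (w2 a - Fs s a) = r2 * (w1 a + Fs t a)" if "a < n" for a
  proof -
    have "r1 * w2 a - r2 * w1 a = (\<Sum>j<i. F a j * (r1 * s j + r2 * t j))" using x12 st that by simp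
    also have "\<dots> = r1 * Fs s a + r2 * Fs t a"
      by (simp add: Fs_def distrib_left sum.distrib sum_distrib_left mult.left_commute)
    finally show ?thesis by (simp add: algebra_simps)
  qed
  then have "\<forall>a<n. \<exists>w. w1 a + Fs t a = r1 * w" using reg2 by (metis dvdE)
  then obtain w0 where w0: "\<forall>a<n. w1 a + Fs t a = r1 * w0 a" by metis
  have "u b = (\<Sum>a<n. A b a * w0 a)" if b: "b < m" for b
  proof -
    have "(\<Sum>a<n. A b a * Fs t a) = (\<Sum>j<i. (\<Sum>a<n. A b a * F a j) * t j)"
      unfolding Fs_def sum_distrib_left sum_distrib_right by (subst sum.swap) (simp only: mult.assoc)
    also have "\<dots> = 0" using AF b by simp
    finally have "r1 * u b = (\<Sum>a<n. A b a * (w1 a + Fs t a))" using w1 b by (simp add: distrib_left sum.distrib)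
    also have "\<dots> = r1 * (\<Sum>a<n. A b a * w0 a)" using w0 by (simp add: sum_distrib_left mult.left_commute)
    finally show ?thesis using r(4) by simp
  qed
  then show ?thesis by blast
qed

section \<open>Powers of the variables as a regular sequence\<close>

lemma monom_mult_poly_shift: "monom 1 N dvd p \<Longrightarrow> monom 1 N * poly_shift N p = (p :: 'a::idom poly)"
  by (intro poly_eqI) (auto simp: monom_1_dvd_iff' coeff_monom_mult coeff_poly_shift)

lemma monom_regular2:
  fixes s :: "'a::idom"
  assumes "s \<noteq> 0" "monom 1 N * u = [:s:] * v"
  shows "monom 1 N dvd v"
  unfolding monom_1_dvd_iff'
proof (intro allI impI)
  fix k assume "k < N"
  then have "s * coeff v k = 0" using arg_cong[OF assms(2), of "\<lambda>p. coeff p k"] by (simp add: coeff_monom_mult)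
  then show "coeff v k = 0" using assms(1) by simp
qed

text \<open>Below degree \<open>N\<close> in the outer variable the relation has two terms only, so
  these coefficients of \<open>w\<close> are divisible by the power of the middle variable;
  everything else is absorbed by the power of the outer one.\<close>

lemma monom_regular3:
  fixes t :: "'a::idom"
  assumes t: "t \<noteq> 0" and eq: "monom 1 N * u + [:monom 1 N:] * v + [:[:t:]:] * w = 0"
  shows "\<exists>p q. w = monom 1 N * p + [:monom 1 N:] * q"
proof -
  define q where "q = map_poly (poly_shift N) w"
  have "monom 1 N dvd w - [:monom 1 N:] * q"
    unfolding monom_1_dvd_iff'
  proof (intro allI impI)
    fix n assume n: "n < N"
    have "monom 1 N * coeff v n + [:t:] * coeff w n = 0"
      using arg_cong[OF eq, of "\<lambda>p. coeff p n"] n by (simp add: coeff_monom_mult)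
    then have "[:t:] * coeff w n = - (monom 1 N * coeff v n)" by (rule add_eq_0_iff[THEN iffD1])
    then have "monom 1 N * (- coeff v n) = [:t:] * coeff w n" by (simp only: mult_minus_right)
    then have "monom 1 N dvd coeff w n" by (rule monom_regular2[OF t])
    then show "coeff (w - [:monom 1 N:] * q) n = 0"
      by (simp add: q_def coeff_map_poly monom_mult_poly_shift)
  qed
  then obtain p where "w - [:monom 1 N:] * q = monom 1 N * p" by (elim dvdE)
  then show ?thesis by (intro exI[of _ p] exI[of _ q]) (simp add: algebra_simps)
qed

section \<open>Restriction to a three-dimensional linear space\<close>

context cp_invariants
begin

text \<open>The last vector with a nonzero coefficient would lie in the saturation of the cone by
  the earlier ones, against transversality. The coefficients are therefore excluded in the order
  \<open>c\<close>, \<open>b\<close>, \<open>a\<close>.\<close>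

lemma degenerate_plane_section:
  assumes tr: "transversal [v3, v2, v1] degenerate" and \<zeta>: "(\<lambda>x. a * v1 x + b * v2 x + c * v3 x) \<in> degenerate"
  shows "a = 0 \<and> b = 0 \<and> c = 0"
proof -
  let ?\<zeta> = "\<lambda>x. a * v1 x + b * v2 x + c * v3 x"
  have v: "v1 \<notin> degenerate" "v2 \<notin> lsum degenerate v1" "v3 \<notin> lsum (lsum degenerate v1) v2"
    using tr by auto
  have sc: "(\<lambda>x. s * ?\<zeta> x) \<in> degenerate" for s by (rule cone_degenerate[unfolded cone_def, rule_format, OF \<zeta>])
  have l: "(\<lambda>x. p x + t * w x) \<in> lsum L w" if "p \<in> L" for p t w L
    unfolding lsum_def using that by (intro CollectI exI[of _ p] exI[of _ t] conjI refl)
  have "c = 0"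
  proof (rule ccontr)
    assume c: "c \<noteq> 0"
    have "(\<lambda>x. ((1 / c) * ?\<zeta> x + (- a / c) * v1 x) + (- b / c) * v2 x) \<in> lsum (lsum degenerate v1) v2"
      by (intro l sc)
    moreover have "(\<lambda>x. ((1 / c) * ?\<zeta> x + (- a / c) * v1 x) + (- b / c) * v2 x) = v3"
      using c by (intro ext) (simp add: field_simps)
    ultimately show False using v(3) by simp
  qed
  moreover have "b = 0"
  proof (rule ccontr)
    assume b: "b \<noteq> 0"
    have "(\<lambda>x. (1 / b) * ?\<zeta> x + (- a / b) * v1 x) \<in> lsum degenerate v1" by (intro l sc)
    moreover have "(\<lambda>x. (1 / b) * ?\<zeta> x + (- a / b) * v1 x) = v2"
      using b \<open>c = 0\<close> by (intro ext) (simp add: field_simps)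
    ultimately show False using v(2) by simp
  qed
  moreover have "a = 0"
  proof (rule ccontr)
    assume a: "a \<noteq> 0"
    have "(\<lambda>x. (1 / a) * ?\<zeta> x) = v1"
      using a \<open>b = 0\<close> \<open>c = 0\<close> by (intro ext) simp
    then show False using v(1) sc[of "1 / a"] by simp
  qed
  ultimately show ?thesis by simp
qed

theorem no_transversal_triple:
  assumes unimodular
    and ind: "\<And>P. P \<in> polys {..<index} \<Longrightarrow> eval_in Const f P = 0 \<Longrightarrow> P = 0"
    and gen: "poisson_center = eval_in Const f ` polys {..<index}"
    and tr: "transversal [v3, v2, v1] degenerate"
  shows False
proof -
  have v: "v1 \<in> dual" "v1 \<notin> degenerate" "v2 \<in> dual" "v2 \<notin> lsum degenerate v1" using tr by auto
  obtain c where c: "c \<noteq> 0" "\<And>C. \<epsilon> C = Const c * \<delta> C"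
    using minors_constant_quotient[OF assms(1) ind gen v] by blast
  define K :: "'k \<Rightarrow> 'k poly poly poly" where "K c = [:[:[:c:]:]:]" for c
  \<comment> \<open>Coordinates on the span of the three vectors. \<open>Z\<close> is the outermost
    variable, and the powers of \<open>Z\<close>, \<open>Y\<close>, \<open>X\<close> serve in this
    order as the regular sequence.\<close>
  define X Y Z :: "'k poly poly poly" where "X = [:[:[:0, 1:]:]:]" and "Y = [:[:0, 1:]:]" and "Z = [:0, 1:]"
  have K: "comm_ring_hom K" by unfold_locales (simp_all add: K_def one_pCons)
  interpret K: comm_ring_hom K by (rule K)
  \<comment> \<open>Restriction of polynomial functions to the span of the three vectors.\<close>
  define \<Lambda> where "\<Lambda> = eval_in K (\<lambda>b. K (v1 b) * X + K (v2 b) * Y + K (v3 b) * Z)"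
  have \<Lambda>: "comm_ring_hom \<Lambda>" unfolding \<Lambda>_def by (rule comm_ring_hom_eval_in[OF K])
  interpret \<Lambda>: comm_ring_hom \<Lambda> by (rule \<Lambda>)
  have \<Lambda>C [simp]: "\<Lambda> (Const a) = K a" for a by (simp add: \<Lambda>_def eval_in_Const[OF K])
  have \<Lambda>V: "\<Lambda> (Var b) = K (v1 b) * X + K (v2 b) * Y + K (v3 b) * Z" for b by (simp add: \<Lambda>_def eval_in_Var[OF K])
  have eval_\<Lambda>: "h (\<Lambda> q) = eval_at (\<lambda>x. h X * v1 x + h Y * v2 x + h Z * v3 x) q"
    if h: "comm_ring_hom h" "\<And>a. h (K a) = a" for h q
  proof -
    interpret h: comm_ring_hom h by (rule h)
    show ?thesis
      by (rule eval_in_polys_eqI[OF comm_ring_hom_compose[OF h(1) \<Lambda>] eval_at.comm_ring_hom_axioms polys_UNIV])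
        (simp_all add: h(2) \<Lambda>V h.hom_add h.hom_mult mult.commute)
  qed
  \<comment> \<open>Evaluation at \<open>t\<close> times \<open>v1\<close>: the origin for
    \<open>t = 0\<close>, a point off the degeneracy locus for \<open>t = 1\<close>.\<close>
  define ev where "ev t r = poly (poly (poly r 0) 0) t" for t :: 'k and r :: "'k poly poly poly"
  have ev: "comm_ring_hom (ev t)" for t
    unfolding ev_def
    by (rule comm_ring_hom_compose[OF comm_ring_hom_poly_eval comm_ring_hom_compose[OF comm_ring_hom_poly_eval comm_ring_hom_poly_eval]])
  have evK: "ev t (K a) = a" and evXYZ: "ev t X = t" "ev t Y = 0" "ev t Z = 0" for t a
    by (simp_all add: ev_def K_def X_def Y_def Z_def)
  define A where "A b a = \<Lambda> (embed (bracket (u a) (u (nh + b))))" for b a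
  define F where "F a j = \<Lambda> (fco a j)" for a j
  let ?I = "annihilator index nh nv A F"
  have AF: "(\<Sum>a<nh. A b a * F a j) = 0" if "b < nv" "j < index" for b j
  proof -
    have "(\<Sum>a<nh. embed (bracket (u a) (u (nh + b))) * fco a j) = 0"
    proof (rule sym_eq_0)
      show "(\<Sum>a<nh. embed (bracket (u a) (u (nh + b))) * fco a j) \<in> sym_algebra"
        unfolding sym_algebra_def
        by (intro polys_sum polys_mult fco_sym that embed_sym[unfolded sym_algebra_def])
      fix \<xi> assume "\<xi> \<in> dual"
      then show "eval_at \<xi> (\<Sum>a<nh. embed (bracket (u a) (u (nh + b))) * fco a j) = 0"
        using grad_bracket_0[OF that(2)] by (simp add: eval_at.hom_sum eval_fco)
    qed
    then have "\<Lambda> (\<Sum>a<nh. embed (bracket (u a) (u (nh + b))) * fco a j) = 0" by simp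
    then show ?thesis by (simp add: A_def F_def \<Lambda>.hom_sum \<Lambda>.hom_mult)
  qed
  have E_det: "det (mat index index (\<lambda>(r, j). \<Sum>a<nh. K (C a r) * F a j)) = \<Lambda> (\<epsilon> C)" for C
  proof -
    have "map_mat \<Lambda> (mat index index (\<lambda>(r, j). \<Sum>a<nh. Const (C a r) * fco a j)) =
        mat index index (\<lambda>(r, j). \<Sum>a<nh. K (C a r) * F a j)"
      by (intro eq_matI) (auto simp: F_def \<Lambda>.hom_sum \<Lambda>.hom_mult)
    then show ?thesis unfolding \<epsilon>_def \<Lambda>.hom_det[symmetric] by simp
  qed
  have \<delta>I: "\<Lambda> (\<delta> C) \<in> ?I" for C
  proof -
    let ?Q = "mat nh nh (\<lambda>(r, a). if r < nv then A r a else K (C a (r - nv)))"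
    have "?Q = transpose_mat (map_mat \<Lambda> (dmat C))"
      by (intro eq_matI) (auto simp: dmat_def A_def)
    then have Q: "det ?Q = \<Lambda> (\<delta> C)"
      using det_transpose[of "map_mat \<Lambda> (dmat C)" nh] by (simp add: \<delta>_def \<Lambda>.hom_det)
    have "K (1 / c) * K c = 1" using c(1) by (simp add: K.hom_mult[symmetric])
    moreover have "\<Lambda> (\<epsilon> C) = K c * \<Lambda> (\<delta> C)" unfolding c(2) by (simp add: \<Lambda>.hom_mult)
    ultimately show ?thesis
      using minor_annihilates[of nv index A F "\<lambda>r a. K (C a r)" "K c" "K (1 / c)"] AF
      unfolding nh_eq[symmetric] Q E_det by simp
  qed
  \<comment> \<open>A Nullstellensatz argument: a prime ideal over the annihilator that avoids the
    powers of \<open>l\<close> would yield a point of the degeneracy locus in the span with nonzero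
    coordinate \<open>l\<close>, but the span meets the locus in the origin only.\<close>
  have power: "\<exists>N. l ^ N \<in> ?I" if l: "l \<in> {X, Y, Z}" for l
  proof (rule ccontr)
    assume no: "\<not> ?thesis"
    have disj: "?I \<inter> range (\<lambda>n. l ^ n) = {}" using no by auto
    have m1: "1 \<in> range (\<lambda>n. l ^ n)" by (rule range_eqI[of _ _ 0]) simp
    have m2: "p * q \<in> range (\<lambda>n. l ^ n)" if "p \<in> range (\<lambda>n. l ^ n)" "q \<in> range (\<lambda>n. l ^ n)" for p q
      using that by (auto simp: power_add[symmetric])
    obtain J where J: "prime_ideal_set J" "?I \<subseteq> J" "J \<inter> range (\<lambda>n. l ^ n) = {}"
      using exists_prime_ideal_avoiding[of ?I "range (\<lambda>n. l ^ n)", OF annihilator_zero annihilator_add annihilator_mult m1 m2 disj]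
      by blast
    have "l \<in> range (\<lambda>n. l ^ n)" by (rule range_eqI[of _ _ 1]) simp
    then have lJ: "l \<notin> J" using J(3) by blast
    have A0: "ring_subset (range K)"
      unfolding ring_subset_def by (auto simp: K.hom_minus[symmetric] K.hom_mult[symmetric] intro: range_eqI[of _ _ 1])
    have AJ: "range K \<inter> J \<subseteq> {0}"
    proof
      fix r assume "r \<in> range K \<inter> J"
      then obtain a where a: "r = K a" "r \<in> J" by blast
      have "a = 0"
      proof (rule ccontr)
        assume "a \<noteq> 0"
        then have "K (1 / a) * r = 1" by (simp add: a(1) K.hom_mult[symmetric])
        moreover have "K (1 / a) * r \<in> J" using J(1) a(2) by (simp add: prime_ideal_set_def)
        ultimately show False using J(1) by (simp add: prime_ideal_set_def)
      qed
      then show "r \<in> {0}" by (simp add: a)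
    qed
    interpret ev0: comm_ring_hom "ev 0" by (rule ev)
    have h0: "hom_on (range K) (ev 0)" by (simp add: hom_on_def ev0.hom_add ev0.hom_mult)
    have inj: "r = 0" if "r \<in> range K" "ev 0 r = 0" for r using that by (auto simp: evK)
    have fin: "finite {X, Y, Z}" by simp
    obtain A' and \<theta> :: "'k poly poly poly \<Rightarrow> 'k" where A': "ring_subset A'" "range K \<subseteq> A'" "{X, Y, Z} \<subseteq> A'"
      "hom_on A' \<theta>" "\<forall>a \<in> A' \<inter> J. \<theta> a = 0" "\<forall>a \<in> range K. \<theta> a = ev 0 a" "l \<in> A' \<longrightarrow> \<theta> l \<noteq> 0"
      by (rule hom_extend_injective[OF fin A0 J(1) AJ h0 inj lJ])
    note h = hom_onD[OF A'(1,4)] and cl = ring_subsetD[OF A'(1)]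
    let ?\<zeta> = "\<lambda>x. \<theta> X * v1 x + \<theta> Y * v2 x + \<theta> Z * v3 x"
    have KA: "K a \<in> A'" "\<theta> (K a) = a" for a using A'(2,6) by (auto simp: evK)
    have XA: "X \<in> A'" "Y \<in> A'" "Z \<in> A'" using A'(3) by auto
    have \<theta>\<Lambda>: "\<Lambda> q \<in> A' \<and> \<theta> (\<Lambda> q) = eval_at ?\<zeta> q" for q
      using polys_UNIV[of q]
    proof (induction q rule: polys_induct)
      case (Var b)
      then show ?case by (simp add: \<Lambda>V h cl KA XA mult.commute)
    qed (simp_all add: KA h cl \<Lambda>.hom_add \<Lambda>.hom_mult)
    have "?\<zeta> \<in> dual" using tr by (intro dual_closed) auto
    moreover have "eval_at ?\<zeta> (\<delta> C) = 0" for C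
      using \<theta>\<Lambda>[of "\<delta> C"] A'(5) \<delta>I[of C] J(2) by auto
    ultimately have "?\<zeta> \<in> degenerate" by (simp add: degenerate_def)
    then have "\<theta> X = 0 \<and> \<theta> Y = 0 \<and> \<theta> Z = 0" by (rule degenerate_plane_section[OF tr])
    then show False using A'(7) XA l by auto
  qed
  obtain N1 N2 N3 where N: "X ^ N1 \<in> ?I" "Y ^ N2 \<in> ?I" "Z ^ N3 \<in> ?I"
    using power[of X] power[of Y] power[of Z] by auto
  define N where "N = N1 + N2 + N3"
  have "X ^ N \<in> ?I" "Y ^ N \<in> ?I" "Z ^ N \<in> ?I"
    using annihilator_mult[OF N(1), of "X ^ (N2 + N3)"] annihilator_mult[OF N(2), of "Y ^ (N1 + N3)"]
      annihilator_mult[OF N(3), of "Z ^ (N1 + N2)"]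
    by (simp_all add: N_def power_add mult_ac)
  then have r: "[:[:monom 1 N:]:] \<in> ?I" "[:monom 1 N:] \<in> ?I" "monom 1 N \<in> ?I"
    by (simp_all add: X_def Y_def Z_def poly_const_pow monom_altdef)
  obtain C0 where C0: "eval_at v1 (\<delta> C0) \<noteq> 0" using v by (auto simp: degenerate_def)
  have inj: "\<forall>j<index. w j = 0" if w: "\<And>a. a < nh \<Longrightarrow> (\<Sum>j<index. F a j * w j) = 0" for w
  proof (intro allI impI)
    let ?E = "mat index index (\<lambda>(r, j). \<Sum>a<nh. K (C0 a r) * F a j)"
    have "ev 1 (\<Lambda> (\<delta> C0)) \<noteq> 0" using C0 by (simp add: eval_\<Lambda>[OF ev evK] evXYZ)
    then have "\<Lambda> (\<delta> C0) \<noteq> 0" by (auto simp: ev_def)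
    moreover have "K c \<noteq> 0" using c(1) by (simp add: K_def)
    ultimately have dE: "det ?E \<noteq> 0" unfolding E_det c(2) by (simp add: \<Lambda>.hom_mult)
    fix j assume j: "j < index"
    show "w j = 0"
    proof (rule mult_mat_vec_eq_0D[OF mat_carrier dE _ j])
      fix r assume "r < index"
      then have "(\<Sum>j<index. ?E $$ (r, j) * w j) = (\<Sum>j<index. \<Sum>a<nh. K (C0 a r) * (F a j * w j))"
        by (simp add: sum_distrib_right mult.assoc)
      also have "\<dots> = (\<Sum>a<nh. K (C0 a r) * (\<Sum>j<index. F a j * w j))"
        by (subst sum.swap) (simp add: sum_distrib_left)
      finally show "(\<Sum>j<index. ?E $$ (r, j) * w j) = 0" using w by simp
    qed
  qed
  have N0: "(monom 1 N :: 'k poly) \<noteq> 0" "(monom 1 N :: 'k poly poly) \<noteq> 0" "(monom 1 N :: 'k poly poly poly) \<noteq> 0"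
    by simp_all
  \<comment> \<open>A single unit vector, available because \<open>nv\<close> is positive, refutes
    surjectivity: the entries of \<open>A\<close> are linear forms and vanish at the origin.\<close>
  have "\<exists>w. \<forall>b<nv. (if b = 0 then 1 else 0) = (\<Sum>a<nh. A b a * w a)"
    by (rule koszul_surjective[OF AF inj r(3,2,1) N0(3) monom_regular2[OF N0(2)] monom_regular3[OF N0(1)]])
  then obtain w where "(\<Sum>a<nh. A 0 a * w a) = 1" using nv_pos by (elim exE) (metis (full_types))
  then have "ev 0 (\<Sum>a<nh. A 0 a * w a) = ev 0 1" by simp
  moreover have "ev 0 (A 0 a) = 0" for a
    by (simp add: A_def eval_\<Lambda>[OF ev evK] evXYZ)
  moreover have "ev 0 (\<Sum>a<nh. A 0 a * w a) = (\<Sum>a<nh. ev 0 (A 0 a) * ev 0 (w a))"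
  proof -
    interpret ev0: comm_ring_hom "ev 0" by (rule ev)
    show ?thesis by (simp add: ev0.hom_sum ev0.hom_mult)
  qed
  ultimately show False by (simp add: ev_def)
qed

end

section \<open>Generators of the Poisson center\<close>

lemma subalgebra_hull_eq: "subalgebra hull F = eval_in Const (\<lambda>f. f) ` polys F"
proof (rule equalityI)
  note C = comm_ring_hom_Const
  let ?S = "eval_in Const (\<lambda>f. f) ` polys F"
  show "subalgebra hull F \<subseteq> ?S"
  proof (rule hull_minimal)
    show "F \<subseteq> ?S" by (auto simp: eval_in_Var[OF C] intro!: image_eqI[of _ _ "Var _"])
    show "subalgebra ?S"
      unfolding Defs.subalgebra_def
    proof (intro conjI allI ballI)
      show "Const c \<in> ?S" for c by (rule image_eqI[of _ _ "Const c"]) (simp_all add: eval_in_Const[OF C])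
      fix p q assume "p \<in> ?S" "q \<in> ?S"
      then obtain P Q where PQ: "P \<in> polys F" "Q \<in> polys F" "p = eval_in Const (\<lambda>f. f) P" "q = eval_in Const (\<lambda>f. f) Q"
        by blast
      show "p + q \<in> ?S" by (rule image_eqI[of _ _ "P + Q"]) (simp_all add: PQ eval_in_add[OF C])
      show "p * q \<in> ?S" by (rule image_eqI[of _ _ "P * Q"]) (simp_all add: PQ eval_in_mult[OF C])
    qed
  qed
  have "subalgebra (subalgebra hull F)"
    by (rule hull_in) (auto simp: Defs.subalgebra_def)
  then show "?S \<subseteq> subalgebra hull F"
    by (auto simp: Defs.subalgebra_def hull_inc intro!: eval_in_polys_mem[OF C])
qed

lemma alg_independent_subset: "alg_independent F \<Longrightarrow> G \<subseteq> F \<Longrightarrow> alg_independent G"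
  unfolding alg_independent_def using polys_mono by blast

text \<open>Polynomials whose variables are named by the elements of \<open>F\<close> are matched
  with polynomials in numbered variables, as the Jacobian arguments index rows and columns by
  numbers.\<close>

lemma enumerate_generators:
  fixes f :: "nat \<Rightarrow> ('x, 'k::comm_ring_1) mpoly"
  assumes f: "bij_betw f {..<i} F"
  shows "eval_in Const f ` polys {..<i} = eval_in Const (\<lambda>f. f) ` polys F"
    and "alg_independent F \<Longrightarrow> P \<in> polys {..<i} \<Longrightarrow> eval_in Const f P = 0 \<Longrightarrow> P = 0"
proof -
  let ?C = "Const :: 'k \<Rightarrow> ('x, 'k) mpoly"
  note C = comm_ring_hom_Const
  define g where "g = inv_into {..<i} f"
  have gf: "g (f j) = j" if "j < i" for j
    using f that unfolding g_def by (simp add: bij_betw_def inv_into_f_f)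
  have fg: "f (g y) = y" "g y < i" if "y \<in> F" for y
    using f that unfolding g_def by (auto simp: bij_betw_def f_inv_into_f intro: inv_into_into[of _ f "{..<i}", simplified])
  have fF: "f j \<in> F" if "j < i" for j using f that by (auto simp: bij_betw_def)
  define \<sigma> where "\<sigma> = eval_in (Const :: 'k \<Rightarrow> (('x, 'k) mpoly, 'k) mpoly) (\<lambda>j. Var (f j))"
  define \<rho> where "\<rho> = eval_in (Const :: 'k \<Rightarrow> (nat, 'k) mpoly) (\<lambda>y. Var (g y))"
  have hom: "comm_ring_hom \<sigma>" "comm_ring_hom \<rho>" unfolding \<sigma>_def \<rho>_def by (rule comm_ring_hom_eval_in[OF C])+
  have \<sigma>: "\<sigma> Q \<in> polys F" "eval_in ?C (\<lambda>f. f) (\<sigma> Q) = eval_in ?C f Q" "\<rho> (\<sigma> Q) = Q" if Q: "Q \<in> polys {..<i}" for Q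
  proof -
    show "\<sigma> Q \<in> polys F" unfolding \<sigma>_def by (rule eval_in_polys_mem[OF C Q]) (auto simp: fF)
    show "eval_in ?C (\<lambda>f. f) (\<sigma> Q) = eval_in ?C f Q"
      by (rule eval_in_polys_eqI[OF comm_ring_hom_compose[OF comm_ring_hom_eval_in[OF C] hom(1)] comm_ring_hom_eval_in[OF C] Q])
        (simp_all add: \<sigma>_def eval_in_Const[OF C] eval_in_Var[OF C])
    show "\<rho> (\<sigma> Q) = Q"
      by (rule eval_in_polys_eqI[OF comm_ring_hom_compose[OF hom(2,1)] comm_ring_hom_id Q])
        (simp_all add: \<sigma>_def \<rho>_def eval_in_Const[OF C] eval_in_Var[OF C] gf)
  qed
  have \<rho>: "\<rho> P \<in> polys {..<i}" "eval_in ?C f (\<rho> P) = eval_in ?C (\<lambda>f. f) P" if P: "P \<in> polys F" for P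
  proof -
    show "\<rho> P \<in> polys {..<i}" unfolding \<rho>_def by (rule eval_in_polys_mem[OF C P]) (auto simp: fg)
    show "eval_in ?C f (\<rho> P) = eval_in ?C (\<lambda>f. f) P"
      by (rule eval_in_polys_eqI[OF comm_ring_hom_compose[OF comm_ring_hom_eval_in[OF C] hom(2)] comm_ring_hom_eval_in[OF C] P])
        (simp_all add: \<rho>_def eval_in_Const[OF C] eval_in_Var[OF C] fg)
  qed
  show "eval_in ?C f ` polys {..<i} = eval_in ?C (\<lambda>f. f) ` polys F"
  proof (intro equalityI subsetI)
    fix p assume "p \<in> eval_in ?C f ` polys {..<i}"
    then obtain Q where "Q \<in> polys {..<i}" "p = eval_in ?C f Q" by blast
    then show "p \<in> eval_in ?C (\<lambda>f. f) ` polys F" using \<sigma>(1,2) by (intro image_eqI[of _ _ "\<sigma> Q"]) simp_all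
  next
    fix p assume "p \<in> eval_in ?C (\<lambda>f. f) ` polys F"
    then obtain P where "P \<in> polys F" "p = eval_in ?C (\<lambda>f. f) P" by blast
    then show "p \<in> eval_in ?C f ` polys {..<i}" using \<rho> by (intro image_eqI[of _ _ "\<rho> P"]) simp_all
  qed
  show "P = 0" if "alg_independent F" "P \<in> polys {..<i}" "eval_in Const f P = 0"
  proof -
    interpret \<rho>: comm_ring_hom \<rho> by (rule hom(2))
    have "\<sigma> P = 0" using that \<sigma>(1,2)[OF that(2)] by (simp add: alg_independent_def)
    then show ?thesis using \<sigma>(3)[OF that(2)] by simp
  qed
qed

text \<open>By the chain rule the Jacobian matrix of \<open>G\<close> factors through the gradients of the elements of \<open>F\<close>.\<close>

lemma card_alg_independent_le:
  fixes F G :: "('x, 'k::field_char_0) mpoly set"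
  assumes B: "finite B" "G \<subseteq> polys B" and F: "finite F" "G \<subseteq> subalgebra hull F" and G: "finite G" "alg_independent G"
  shows "card G \<le> card F"
proof (rule ccontr)
  assume less: "\<not> card G \<le> card F"
  note C = comm_ring_hom_Const
  obtain g where g: "bij_betw g {..<card G} G"
    using ex_bij_betw_nat_finite[OF G(1)] by (auto simp: atLeast0LessThan)
  have gG: "g j \<in> G" if "j < card G" for j using g that by (auto simp: bij_betw_def)
  have "\<exists>P. \<forall>j<card G. P j \<in> polys F \<and> g j = eval_in Const (\<lambda>f. f) (P j)"
  proof (rule choice[THEN exE])
    show "\<forall>j. \<exists>P. j < card G \<longrightarrow> P \<in> polys F \<and> g j = eval_in Const (\<lambda>f. f) P"
      using gG F(2) unfolding subalgebra_hull_eq by blast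
  qed blast
  then obtain P where P: "\<And>j. j < card G \<Longrightarrow> P j \<in> polys F" "\<And>j. j < card G \<Longrightarrow> g j = eval_in Const (\<lambda>f. f) (P j)"
    by blast
  have gB: "g j \<in> polys B" if "j < card G" for j using gG[OF that] B(2) by blast
  obtain \<beta> where \<beta>: "det (mat (card G) (card G) (\<lambda>(r, j). partial_deriv (\<beta> r) (g j))) \<noteq> 0"
    using jacobian_minor_nonzero[OF B(1), of "card G" g, OF gB enumerate_generators(2)[OF g G(2)]] by blast
  have U: "ring_subset (UNIV :: ('x, 'k) mpoly set)" by (simp add: ring_subset_def)
  have D: "derivation_on UNIV (partial_deriv b)" for b :: 'x
    by (simp add: derivation_on_def partial_deriv_mult)
  let ?H = "\<lambda>f j. eval_in Const (\<lambda>f. f) (partial_deriv f (P j))"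
  have "mat (card G) (card G) (\<lambda>(r, j). partial_deriv (\<beta> r) (g j)) =
      mat (card G) (card G) (\<lambda>(r, j). \<Sum>f \<in> F. partial_deriv (\<beta> r) f * ?H f j)"
    by (intro eq_matI) (simp_all add: P(2) derivation_eval_in[OF C U D _ _ _ F(1) P(1)] mult.commute)
  then have "det (mat (card G) (card G) (\<lambda>(r, j). partial_deriv (\<beta> r) (g j))) =
      (\<Sum>\<gamma> \<in> {0..<card G} \<rightarrow>\<^sub>E F. (\<Prod>r = 0..<card G. partial_deriv (\<beta> r) (\<gamma> r)) *
        det (mat (card G) (card G) (\<lambda>(r, j). ?H (\<gamma> r) j)))"
    by (simp only: det_sum_prod_expand[OF F(1)])
  also have "\<dots> = 0"
  proof (rule sum.neutral, rule ballI)
    fix \<gamma> assume \<gamma>: "\<gamma> \<in> {0..<card G} \<rightarrow>\<^sub>E F"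
    have "\<not> inj_on \<gamma> {0..<card G}"
    proof
      assume "inj_on \<gamma> {0..<card G}"
      moreover have "\<gamma> ` {0..<card G} \<subseteq> F" using \<gamma> by (auto simp: PiE_iff)
      ultimately have "card {0..<card G} \<le> card F" using F(1) by (rule card_inj_on_le)
      then show False using less by simp
    qed
    then obtain r s where rs: "r < card G" "s < card G" "r \<noteq> s" "\<gamma> r = \<gamma> s" by (auto simp: inj_on_def)
    have "det (mat (card G) (card G) (\<lambda>(r, j). ?H (\<gamma> r) j)) = 0"
      by (rule det_identical_rows[OF mat_carrier rs(3,1,2)]) (use rs in \<open>auto intro!: eq_vecI\<close>)
    then show "(\<Prod>r = 0..<card G. partial_deriv (\<beta> r) (\<gamma> r)) * det (mat (card G) (card G) (\<lambda>(r, j). ?H (\<gamma> r) j)) = 0"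
      by simp
  qed
  finally show False using \<beta> by simp
qed

text \<open>The transcendence degree bounds the size of finite independent subsets by
  \<open>i\<close>, which makes the generating set finite. Conversely no independent subset has more
  elements than the generating set, so there are exactly \<open>i\<close> generators.\<close>

lemma polynomial_algebra_generators:
  fixes A :: "('x, 'k::field_char_0) mpoly set"
  assumes B: "finite B" "A \<subseteq> polys B" and A: "polynomial_algebra A" "trdeg A = enat i"
  shows "\<exists>f :: nat \<Rightarrow> ('x, 'k) mpoly. A = eval_in Const f ` polys {..<i} \<and> (\<forall>j<i. f j \<in> A) \<and>
    (\<forall>P \<in> polys {..<i}. eval_in Const f P = 0 \<longrightarrow> P = 0)"
proof -
  obtain F where F: "alg_independent F" "subalgebra hull F = A" using A(1) by (auto simp: polynomial_algebra_def)
  have FA: "F \<subseteq> A" unfolding F(2)[symmetric] by (rule hull_subset)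
  have le: "card G \<le> i" if G: "G \<subseteq> A" "finite G" "alg_independent G" for G
  proof -
    have "enat (card G) \<le> trdeg A" unfolding trdeg_def by (rule SUP_upper) (use G in simp)
    then show ?thesis by (simp add: A(2))
  qed
  have "finite F"
  proof (rule ccontr)
    assume "infinite F"
    then obtain G where "G \<subseteq> F" "card G = Suc i" "finite G" using infinite_arbitrarily_large by blast
    then show False using le[of G] alg_independent_subset[OF F(1)] FA by auto
  qed
  have "trdeg A \<le> enat (card F)"
    unfolding trdeg_def
  proof (rule SUP_least)
    fix G assume "G \<in> {G. G \<subseteq> A \<and> finite G \<and> alg_independent G}"
    then show "enat (card G) \<le> enat (card F)"
      using card_alg_independent_le[OF B(1) _ \<open>finite F\<close>, of G] B(2) F(2) by auto
  qed
  then have "card F = i" using le[OF FA \<open>finite F\<close> F(1)] A(2) by simp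
  then obtain f where f: "bij_betw f {..<i} F"
    using ex_bij_betw_nat_finite[OF \<open>finite F\<close>] by (auto simp: atLeast0LessThan)
  show ?thesis
    using enumerate_generators[OF f] F FA f
    by (intro exI[of _ f]) (auto simp: subalgebra_hull_eq bij_betw_def)
qed

section \<open>The codimension of the singular set\<close>

context cp_setting
begin

lemma codim_sing_le_2:
  assumes "unimodular" "coregular" "trdeg poisson_center = enat index"
  shows "dual_codim dual_sing \<le> 2"
proof -
  have pB: "poisson_center \<subseteq> polys Basis" by (auto simp: poisson_center_def sym_algebra_def)
  obtain f where f: "poisson_center = eval_in Const f ` polys {..<index}" "\<forall>j<index. f j \<in> poisson_center"
    "\<forall>P \<in> polys {..<index}. eval_in Const f P = 0 \<longrightarrow> P = 0"
    using polynomial_algebra_generators[OF finite_Basis pB] assms(2,3) by (auto simp: coregular_def)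
  interpret cp_invariants scale Basis bracket \<h> f by unfold_locales (use f(2) in blast)
  note no = no_transversal_triple[OF assms(1) _ f(1)]
  note Z = zclosed_degenerate cone_degenerate
  have sub: "lsums vs degenerate \<subseteq> dual" if "transversal vs degenerate" for vs
    by (rule zclosed_subset_dual[OF zclosed_lsums[OF Z that Z(1) subset_refl]])
  have ext: "lsums vs degenerate = dual \<or> (\<exists>v. transversal (v # vs) degenerate)"
    if "transversal vs degenerate" for vs
    using sub[OF that] that by auto
  \<comment> \<open>Vectors are chosen greedily until the saturation is the whole dual space; a
    third choice would produce the excluded triple.\<close>
  have "\<exists>vs. length vs \<le> 2 \<and> transversal vs degenerate \<and> lsums vs degenerate = dual"
  proof (rule ccontr)
    assume none: "\<not> ?thesis"
    have step: "\<exists>v. transversal (v # vs) degenerate" if "transversal vs degenerate" "length vs \<le> 2" for vs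
      using ext[OF that(1)] none that by blast
    have "transversal [] degenerate" by simp
    then obtain v1 where 1: "transversal [v1] degenerate" using step[of "[]"] by auto
    then obtain v2 where 2: "transversal [v2, v1] degenerate" using step[of "[v1]"] by auto
    then obtain v3 where "transversal [v3, v2, v1] degenerate" using step[of "[v2, v1]"] by auto
    then show False using no f(3) by blast
  qed
  then obtain vs where vs: "length vs \<le> 2" "transversal vs degenerate" "lsums vs degenerate = dual" by blast
  have "dual_sing \<subseteq> dual" by (auto simp: dual_sing_def)
  then have "enat (dimension - length vs) \<le> zariski_dim sym_algebra dual_sing"
    by (rule cone_chain[OF Z vs(2,3) degenerate_subset_sing])
  moreover have "enat (dimension - 2) \<le> enat (dimension - length vs)" using vs(1) by simp
  ultimately have "enat (dimension - 2) \<le> zariski_dim sym_algebra dual_sing" by (rule order_trans[rotated])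
  then have "enat dimension - zariski_dim sym_algebra dual_sing \<le> 2"
    by (cases "zariski_dim sym_algebra dual_sing") (auto simp: numeral_eq_enat)
  \<comment> \<open>The singular set is nonempty, which rules out the infinite codimension that the
    empty set has by convention.\<close>
  moreover have "(\<lambda>x. 0) \<in> degenerate"
    using \<delta>_homogeneous[of "\<lambda>x. 0" 0] nv_pos by (auto simp: degenerate_def zero_power)
  ultimately show ?thesis using degenerate_subset_sing by (auto simp: dual_codim_def)
qed

end

theorem theorem26:
  fixes scale :: "'k::{alg_closed_field, field_char_0} \<Rightarrow> 'g::ab_group_add \<Rightarrow> 'g"
    and Basis :: "'g set"
    and bracket :: "'g \<Rightarrow> 'g \<Rightarrow> 'g"
    and \<h> :: "'g set"
  assumes "lie_algebra scale Basis bracket"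
    and "\<not> lie_algebra.abelian bracket"
    and "lie_algebra.unimodular scale Basis bracket"
    and "lie_algebra.coregular scale Basis bracket"
    and "trdeg (lie_algebra.poisson_center scale Basis bracket)
           = enat (lie_algebra.index scale bracket)"
    and "lie_algebra.commutative_polarization scale Basis bracket \<h>"
  shows "(\<forall>\<xi> \<in> lie_algebra.dual_reg scale bracket.
            \<not> lie_algebra.maximal_poisson_commutative_subalgebra scale Basis bracket
                (lie_algebra.mishchenko_fomenko scale Basis bracket \<xi>))
         \<and> (lie_algebra.algebraic scale bracket \<longrightarrow>
              lie_algebra.dual_codim Basis (lie_algebra.dual_sing scale bracket) \<le> 2)"
proof -
  interpret cp_setting scale Basis bracket \<h>
    using assms(1,2,6) by (simp add: cp_setting_def cp_setting_axioms_def)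
  show ?thesis using mf_not_maximal codim_sing_le_2[OF assms(3-5)] by blast
qed

end
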